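(* Let $p>2$ be a prime, let $\ell\neq p$ be a prime number, and let $x,y$ be integers such that $x+y\,\zeta$ is a pseudo-unit of $K=\mathbb{Q}(\zeta)$ (i.e. $(x+y\,\zeta)$ is the $p$-th power of an ideal of $K$ prime to $\mathfrak p$). Then: (i) $\displaystyle\Big(\frac{\zeta^{x}\,y+\zeta^{-y}\,x}{\ell}\Big)_{p}=1$. (ii) If $\ell\mid y$, $p\nmid y$, and $(x,y,z)$ is a solution of Fermat's equation (nonzero pairwise relatively prime integers with $x^p+y^p+z^p=0$), then $\ell^{\,p-1}\equiv 1\pmod{p^2}$.
   Context: $\zeta$ is a primitive $p$-th root of unity and $\mathfrak p=(1-\zeta)\mathbb{Z}[\zeta]$ is the unique prime of $K$ above $p$. $\big(\frac{\bullet}{\bullet}\big)_p$ is the $p$-th power residue symbol in $K$, with values in $\langle\zeta\rangle$: for a prime ideal $\mathfrak l\ne\mathfrak p$ of $K$ unramified in $K(\sqrt[p]{\alpha})/K$, $\big(\frac{\alpha}{\mathfrak l}\big)_p$ is the root of unity $\zeta^j$ by which the Frobenius of $\mathfrak l$ multiplies $\sqrt[p]{\alpha}$ (if $\mathfrak l\nmid\alpha$ this is the $\zeta^j$ with $\zeta^j\equiv\alpha^{(\mathrm{N}\mathfrak l-1)/p}\bmod\mathfrak l$), and $\big(\frac{\alpha}{\ell}\big)_p=\prod_{\mathfrak l\mid\ell}\big(\frac{\alpha}{\mathfrak l}\big)_p$. *)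

theory Defs
  imports
    Complex_Main
    "HOL-Computational_Algebra.Computational_Algebra"
    "HOL-Number_Theory.Cong"
    "HOL-Algebra.Algebraic_Closure_Type"
    "HOL-Algebra.Generated_Fields"
    "HOL-Algebra.Ideal_Product"
    "HOL-Algebra.QuotRing"
begin

hide_const (open) Divisibility.prime

text \<open>
  Number fields are subfields of the complex numbers, represented by their carrier sets.
\<close>

abbreviation complex_ring :: "complex ring" where
  "complex_ring \<equiv> ring_of_type_algebra"

definition primitive_root_of_unity :: "nat \<Rightarrow> complex \<Rightarrow> bool" where
  "primitive_root_of_unity n \<zeta> \<longleftrightarrow>
     n > 0 \<and> \<zeta> ^ n = 1 \<and> (\<forall>k. 0 < k \<and> k < n \<longrightarrow> \<zeta> ^ k \<noteq> 1)"

text \<open>The least subfield containing \<open>\<zeta>\<close>; it contains the rationals automatically.\<close>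

definition cyclotomic_field :: "complex \<Rightarrow> complex set" where
  "cyclotomic_field \<zeta> = generate_field complex_ring {\<zeta>}"

definition ring_of_integers :: "complex set \<Rightarrow> complex ring" where
  "ring_of_integers F = complex_ring\<lparr>carrier := {z \<in> F. algebraic_int z}\<rparr>"

definition galois_group :: "complex set \<Rightarrow> complex set \<Rightarrow> (complex \<Rightarrow> complex) set" where
  "galois_group F L =
     {\<sigma> \<in> ring_iso (complex_ring\<lparr>carrier := L\<rparr>) (complex_ring\<lparr>carrier := L\<rparr>).
        \<forall>z\<in>F. \<sigma> z = z}"

text \<open>
  A prime \<open>\<ll>\<close> of the base field is unramified in \<open>L\<close> if no square of a prime ideal divides its
  extension to \<open>L\<close>. Residue fields are finite, so separability of the residue extensions need
  not be required.
\<close>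

definition unramified_in :: "complex set \<Rightarrow> complex set \<Rightarrow> bool" where
  "unramified_in L \<ll> \<longleftrightarrow>
     \<not> (\<exists>P J. primeideal P (ring_of_integers L) \<and> ideal J (ring_of_integers L) \<and>
            Idl\<^bsub>ring_of_integers L\<^esub> \<ll> =
              P \<cdot>\<^bsub>ring_of_integers L\<^esub> P \<cdot>\<^bsub>ring_of_integers L\<^esub> J)"

text \<open>
  The Frobenius of \<open>\<ll>\<close> in an abelian extension \<open>L\<close> of \<open>F\<close>: a single automorphism which
  is the Frobenius at every prime \<open>P\<close> of \<open>L\<close> above \<open>\<ll>\<close>.
\<close>

definition is_frobenius ::
  "complex set \<Rightarrow> complex set \<Rightarrow> complex set \<Rightarrow> (complex \<Rightarrow> complex) \<Rightarrow> bool" where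
  "is_frobenius F L \<ll> \<sigma> \<longleftrightarrow>
     \<sigma> \<in> galois_group F L \<and>
     (\<forall>P. primeideal P (ring_of_integers L) \<and> P \<inter> F = \<ll> \<longrightarrow>
        (\<forall>z \<in> carrier (ring_of_integers L).
           \<sigma> z - z ^ card (carrier (ring_of_integers F Quot \<ll>)) \<in> P))"

text \<open>
  The \<open>p\<close>-th power residue symbol of \<open>\<alpha>\<close> at a prime ideal \<open>\<ll>\<close> of \<open>\<rat>(\<zeta>)\<close>; the value does
  not depend on the choice of the \<open>p\<close>-th root \<open>\<beta>\<close> of \<open>\<alpha>\<close>. It is meaningful only if
  \<open>\<alpha> \<noteq> 0\<close> and \<open>\<ll>\<close> is unramified in \<open>\<rat>(\<zeta>, \<beta>)\<close>, and unspecified otherwise. \<open>\<alpha>\<close> need not be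
  prime to \<open>\<ll>\<close>.
\<close>

definition power_residue_symbol ::
  "nat \<Rightarrow> complex \<Rightarrow> complex \<Rightarrow> complex set \<Rightarrow> complex" where
  "power_residue_symbol p \<zeta> \<alpha> \<ll> =
     (THE s. s \<in> range (\<lambda>j::nat. \<zeta> ^ j) \<and>
        (\<exists>\<beta> \<sigma>. \<beta> ^ p = \<alpha> \<and>
           unramified_in (generate_field complex_ring {\<zeta>, \<beta>}) \<ll> \<and>
           is_frobenius (cyclotomic_field \<zeta>) (generate_field complex_ring {\<zeta>, \<beta>}) \<ll> \<sigma> \<and>
           \<sigma> \<beta> = s * \<beta>))"

definition power_residue_symbol_nat ::
  "nat \<Rightarrow> complex \<Rightarrow> complex \<Rightarrow> nat \<Rightarrow> complex" where
  "power_residue_symbol_nat p \<zeta> \<alpha> l =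
     (\<Prod>\<ll> | primeideal \<ll> (ring_of_integers (cyclotomic_field \<zeta>)) \<and> of_nat l \<in> \<ll>.
        power_residue_symbol p \<zeta> \<alpha> \<ll>)"

text \<open>
  For \<open>\<alpha>\<close> in \<open>\<int>[\<zeta>]\<close>: the principal ideal of \<open>\<alpha>\<close> is the \<open>p\<close>-th power of an ideal \<open>I\<close> which
  is comaximal with \<open>(1 - \<zeta>)\<close>.
\<close>

definition pseudo_unit :: "nat \<Rightarrow> complex \<Rightarrow> complex \<Rightarrow> bool" where
  "pseudo_unit p \<zeta> \<alpha> \<longleftrightarrow>
     (let R = ring_of_integers (cyclotomic_field \<zeta>) in
        \<exists>I. ideal I R \<and>
            I <+>\<^bsub>R\<^esub> (PIdl\<^bsub>R\<^esub> (1 - \<zeta>)) = carrier R \<and>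
            PIdl\<^bsub>R\<^esub> \<alpha> = I [^]\<^bsub>ideals_set R\<^esub> p)"

end

theory Submission
  imports Defs "Jordan_Normal_Form.Char_Poly" "HOL-Number_Theory.Residues"
    "HOL-Number_Theory.Pocklington" "HOL-Algebra.Sylow"
begin

text \<open>
  Write \<open>x + y \<zeta> = d\<^sup>p \<beta>\<close> with coprime coordinates; the norm of \<open>\<beta>\<close> is then a \<open>p\<close>-th power, and up
  to \<open>p\<close>-th powers \<open>\<zeta>\<^sup>x y + \<zeta>\<^sup>-\<^sup>y x\<close> is a conjugate of \<open>\<beta>\<close> times a power of \<open>\<zeta>\<close>, chosen so that the
  product is primary. By Stickelberger's relation, obtained here from Jacobi sums, each product of its
  conjugates over the indices \<open>t < p\<close> with \<open>t + (b t mod p) > p\<close> (where \<open>0 < b < p - 1\<close>) is a \<open>p\<close>-th power.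
  Taking residue symbols at all primes above \<open>l\<close>, which the Galois group permutes, gives
  \<open>S\<^sup>e = 1\<close> for the symbol \<open>S\<close> at \<open>l\<close>, with \<open>e\<close> the sum of the inverses of these \<open>t\<close> modulo \<open>p\<close>;
  summing over all \<open>b\<close> gives the exponent \<open>-1\<close> modulo \<open>p\<close>, so \<open>S = 1\<close>. If \<open>l\<close> divides \<open>y\<close>, the symbol
  reduces to that of \<open>\<zeta>\<close> to an exponent prime to \<open>p\<close>, because the symbol of the integer \<open>x\<close> is Galois
  invariant, hence trivial; so \<open>p\<^sup>2\<close> divides \<open>N - 1\<close> for the norm \<open>N\<close> of a prime above \<open>l\<close>.
\<close>

subsection \<open>Sums and products of algebraic integers\<close>

text \<open>No ideal is ever factored. If a prime \<open>q\<close> divides the norm of a form with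
  coprime coordinates \<open>x\<close>, \<open>y\<close>, then \<open>- x / y\<close> is a
  nontrivial \<open>p\<close>-th root of unity \<open>r\<close> modulo the power of \<open>q\<close>
  in question. So \<open>q\<close> is 1 modulo \<open>p\<close>, Jacobi sums over prime fields
  suffice, and divisibility in Z[\<zeta>] by powers of \<open>q\<close> can be tested by
  substituting the powers of the integer \<open>r\<close> for \<zeta>. A single \<open>b\<close>
  would not do: its exponent is ((b+1)^p - b^p - 1)/p modulo \<open>p\<close>, for b = 1 twice the
  Fermat quotient of 2, which may vanish. Over all \<open>b\<close> these numbers telescope to -1.
  The symbol is defined through Frobenius, also at primes dividing the argument. Multiplying by the
  \<open>p\<close>-th power of an element of the base field moves the argument away from such a
  prime \<open>Q\<close> without changing the Kummer extension. The integers of that extension are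
  not determined; it is enough that \<open>p a\<close> times each of them is a polynomial in the
  root \<open>b\<close> over Z[\<zeta>], because \<open>p a\<close> is prime to
  \<open>Q\<close>.\<close>

definition int_span :: "'a::field_char_0 set \<Rightarrow> 'a set" where
  "int_span S = {z. \<exists>c::'a \<Rightarrow> int. z = (\<Sum>t\<in>S. of_int (c t) * t)}"

text \<open>The elements of \<open>S\<close> form an eigenvector of an integer matrix for the
  eigenvalue \<open>z\<close>, nonzero because of \<open>s0\<close>. So \<open>z\<close> is a root
  of a characteristic polynomial, which is monic with integer coefficients.\<close>

lemma algebraic_int_of_int_span:
  fixes z :: "'a::field_char_0"
  assumes fin: "finite S" and nz: "s0 \<in> S" "s0 \<noteq> 0"
    and cl: "\<And>s. s \<in> S \<Longrightarrow> z * s \<in> int_span S"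
  shows "algebraic_int z"
proof -
  obtain xs where xs: "set xs = S" "distinct xs" using fin finite_distinct_list by blast
  define n where "n = length xs"
  have "\<forall>s\<in>S. \<exists>c::'a \<Rightarrow> int. z * s = (\<Sum>t\<in>S. of_int (c t) * t)"
    using cl unfolding int_span_def by auto
  then obtain c :: "'a \<Rightarrow> 'a \<Rightarrow> int" where c: "\<And>s. s \<in> S \<Longrightarrow> z * s = (\<Sum>t\<in>S. of_int (c s t) * t)"
    by metis
  define A where "A = mat n n (\<lambda>(i,j). c (xs ! i) (xs ! j))"
  define v where "v = vec n (\<lambda>i. xs ! i)"
  have A: "A \<in> carrier_mat n n" by (simp add: A_def)
  let ?B = "map_mat of_int A :: 'a mat"
  have sumS: "(\<Sum>t\<in>S. f t) = (\<Sum>j<n. f (xs ! j))" for f :: "'a \<Rightarrow> 'a"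
  proof -
    have "bij_betw (\<lambda>j. xs ! j) {..<n} S"
      using xs bij_betw_nth[of xs "{..<n}" S] by (auto simp: n_def)
    then show ?thesis by (rule sum.reindex_bij_betw[symmetric])
  qed
  have ev: "eigenvector ?B v z"
    unfolding eigenvector_def
  proof (intro conjI)
    show "v \<in> carrier_vec (dim_row ?B)" using A by (auto simp: v_def)
    obtain i where i: "i < n" "xs ! i = s0" using nz xs by (auto simp: n_def in_set_conv_nth)
    show "v \<noteq> 0\<^sub>v (dim_row ?B)"
    proof
      assume "v = 0\<^sub>v (dim_row ?B)"
      then have "v $ i = 0" using i A by auto
      then show False using i nz by (simp add: v_def)
    qed
    show "?B *\<^sub>v v = z \<cdot>\<^sub>v v"
    proof (rule eq_vecI)
      fix i assume "i < dim_vec (z \<cdot>\<^sub>v v)"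
      then have i: "i < n" by (simp add: v_def)
      then have mem: "xs ! i \<in> S" using xs by (auto simp: n_def)
      have "(?B *\<^sub>v v) $ i = (\<Sum>j<n. of_int (c (xs ! i) (xs ! j)) * (xs ! j))"
        using i by (simp add: A_def v_def scalar_prod_def atLeast0LessThan)
      also have "\<dots> = z * (xs ! i)" using c[OF mem] sumS by simp
      finally show "(?B *\<^sub>v v) $ i = (z \<cdot>\<^sub>v v) $ i" using i by (simp add: v_def)
    qed (auto simp: A_def v_def)
  qed
  have "poly (char_poly ?B) z = 0"
    using eigenvalue_root_char_poly[of ?B n z] A ev by (auto simp: eigenvalue_def)
  moreover have char_eq: "char_poly ?B = (map_poly of_int (char_poly A) :: 'a poly)"
    by (rule of_int_hom.char_poly_hom[OF A])
  ultimately have "poly (map_poly of_int (char_poly A)) z = 0"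
    using char_eq by simp
  moreover have "lead_coeff (char_poly A) = 1"
    using degree_monic_char_poly[OF A] by simp
  ultimately show ?thesis unfolding algebraic_int_altdef_ipoly by blast
qed

lemma int_span_base: "finite S \<Longrightarrow> s \<in> S \<Longrightarrow> s \<in> int_span S"
  unfolding int_span_def
  by (auto intro!: exI[of _ "\<lambda>t. if t = s then 1 else 0"] simp: if_distrib if_distribR sum.delta cong: if_cong)

lemma int_span_add: "a \<in> int_span S \<Longrightarrow> b \<in> int_span S \<Longrightarrow> a + b \<in> int_span S"
  unfolding int_span_def
proof safe
  fix c d :: "'a \<Rightarrow> int"
  show "\<exists>e. (\<Sum>t\<in>S. of_int (c t) * t) + (\<Sum>t\<in>S. of_int (d t) * t) = (\<Sum>t\<in>S. of_int (e t) * t)"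
    by (rule exI[of _ "\<lambda>t. c t + d t"]) (simp add: sum.distrib algebra_simps)
qed

lemma int_span_scale: "a \<in> int_span S \<Longrightarrow> of_int k * a \<in> int_span S"
  unfolding int_span_def
proof safe
  fix c :: "'a \<Rightarrow> int"
  show "\<exists>e. of_int k * (\<Sum>t\<in>S. of_int (c t) * t) = (\<Sum>t\<in>S. of_int (e t) * t)"
    by (rule exI[of _ "\<lambda>t. k * c t"]) (simp add: sum_distrib_left algebra_simps)
qed

lemma int_span_0: "0 \<in> int_span S"
  unfolding int_span_def by (auto intro!: exI[of _ "\<lambda>_. 0"])

lemma int_span_sum: "(\<And>i. i \<in> I \<Longrightarrow> f i \<in> int_span S) \<Longrightarrow> sum f I \<in> int_span S"
  by (induction I rule: infinite_finite_induct) (auto intro: int_span_add int_span_0)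

lemma algebraic_int_relation:
  fixes x :: "'a::field_char_0"
  assumes "algebraic_int x"
  obtains m c where "m > 0" "x ^ m = (\<Sum>i<m. of_int (c i) * x ^ i)"
proof -
  obtain f :: "int poly" where f: "poly (map_poly of_int f) x = 0" "lead_coeff f = 1"
    using assms algebraic_int_altdef_ipoly by blast
  define m where "m = degree f"
  have d: "degree (map_poly of_int f :: 'a poly) = m" by (simp add: m_def)
  have "poly (map_poly of_int f) x = (\<Sum>i\<le>m. of_int (coeff f i) * x ^ i)"
    unfolding poly_altdef d by (simp add: coeff_map_poly)
  also have "\<dots> = (\<Sum>i<m. of_int (coeff f i) * x ^ i) + x ^ m"
    using f(2) by (simp add: lessThan_Suc_atMost[symmetric] m_def)
  finally have e: "x ^ m = (\<Sum>i<m. of_int (- coeff f i) * x ^ i)"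
    using f(1) by (simp add: sum_negf eq_neg_iff_add_eq_0 add.commute)
  have "m > 0"
  proof (rule ccontr)
    assume "\<not> m > 0"
    then show False using e by simp
  qed
  then show ?thesis using e that[of m "\<lambda>i. - coeff f i"] by blast
qed

text \<open>The monomials \<open>x ^ i * y ^ j\<close> below the degrees of two monic relations span
  a finitely generated group that multiplication by \<open>x\<close> and by \<open>y\<close> maps
  into itself.\<close>

lemma algebraic_int_add_mult:
  fixes x y :: "'a::field_char_0"
  assumes "algebraic_int x" "algebraic_int y"
  shows "algebraic_int (x + y)" "algebraic_int (x * y)"
proof -
  obtain m c where m: "m > 0" "x ^ m = (\<Sum>i<m. of_int (c i) * x ^ i)"
    by (rule algebraic_int_relation[OF assms(1)])
  obtain n d where n: "n > 0" "y ^ n = (\<Sum>i<n. of_int (d i) * y ^ i)"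
    by (rule algebraic_int_relation[OF assms(2)])
  define S where "S = (\<lambda>(i,j). x ^ i * y ^ j) ` ({..<m} \<times> {..<n})"
  have fin: "finite S" by (simp add: S_def)
  have one: "1 \<in> S" unfolding S_def using m n by (intro image_eqI[of _ _ "(0,0)"]) auto
  have base: "x ^ i * y ^ j \<in> int_span S" if "i < m" "j < n" for i j
    using that by (intro int_span_base[OF fin]) (auto simp: S_def)
  have xS: "x * (x ^ i * y ^ j) \<in> int_span S" if "i < m" "j < n" for i j
  proof (cases "Suc i < m")
    case True
    then show ?thesis using base[of "Suc i" j] that by (simp add: mult_ac)
  next
    case False
    then have "Suc i = m" using that by simp
    then have "x * (x ^ i * y ^ j) = x ^ m * y ^ j" by (auto simp: mult_ac)
    also have "\<dots> = (\<Sum>i<m. of_int (c i) * (x ^ i * y ^ j))"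
      by (simp only: m(2) sum_distrib_right mult.assoc)
    also have "\<dots> \<in> int_span S" using that by (intro int_span_sum int_span_scale base) auto
    finally show ?thesis .
  qed
  have yS: "y * (x ^ i * y ^ j) \<in> int_span S" if "i < m" "j < n" for i j
  proof (cases "Suc j < n")
    case True
    then show ?thesis using base[of i "Suc j"] that by (simp add: mult_ac)
  next
    case False
    then have "Suc j = n" using that by simp
    then have "y * (x ^ i * y ^ j) = y ^ n * x ^ i" by (auto simp: mult_ac)
    also have "\<dots> = (\<Sum>j<n. of_int (d j) * (x ^ i * y ^ j))"
      unfolding n(2) by (simp add: sum_distrib_left sum_distrib_right mult_ac)
    also have "\<dots> \<in> int_span S" using that by (intro int_span_sum int_span_scale base) auto
    finally show ?thesis .
  qed
  have mul: "x * s \<in> int_span S" if "s \<in> int_span S" for s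
  proof -
    from that obtain c :: "'a \<Rightarrow> int" where "s = (\<Sum>t\<in>S. of_int (c t) * t)" unfolding int_span_def by auto
    then have "x * s = (\<Sum>t\<in>S. of_int (c t) * (x * t))" by (simp add: sum_distrib_left mult_ac)
    also have "\<dots> \<in> int_span S"
      by (intro int_span_sum int_span_scale) (auto simp: S_def xS[unfolded S_def])
    finally show ?thesis .
  qed
  have yS': "y * s \<in> int_span S" if "s \<in> S" for s using that yS by (auto simp: S_def)
  have xS': "x * s \<in> int_span S" if "s \<in> S" for s using that xS by (auto simp: S_def)
  show "algebraic_int (x + y)"
    by (rule algebraic_int_of_int_span[OF fin one]) (auto simp: distrib_right intro!: int_span_add xS' yS')
  show "algebraic_int (x * y)"
    by (rule algebraic_int_of_int_span[OF fin one]) (auto simp: mult.assoc intro!: mul yS')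
qed

lemmas algebraic_int_add = algebraic_int_add_mult(1)
lemmas algebraic_int_mult = algebraic_int_add_mult(2)

lemma algebraic_int_of_int [simp]: "algebraic_int (of_int k)"
  by (rule int_imp_algebraic_int) auto

lemma algebraic_int_of_nat [simp]: "algebraic_int (of_nat k)"
  by (rule int_imp_algebraic_int) auto

lemma algebraic_int_1 [simp]: "algebraic_int 1"
  by (rule int_imp_algebraic_int) auto

lemma algebraic_int_diff:
  fixes x y :: "'a::field_char_0"
  shows "algebraic_int x \<Longrightarrow> algebraic_int y \<Longrightarrow> algebraic_int (x - y)"
  using algebraic_int_add[of x "- y"] by auto

lemma algebraic_int_power:
  fixes x :: "'a::field_char_0"
  shows "algebraic_int x \<Longrightarrow> algebraic_int (x ^ n)"
  by (induction n) (auto intro: algebraic_int_mult)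

lemma algebraic_int_sum:
  fixes f :: "'b \<Rightarrow> 'a::field_char_0"
  shows "(\<And>i. i \<in> I \<Longrightarrow> algebraic_int (f i)) \<Longrightarrow> algebraic_int (sum f I)"
  by (induction I rule: infinite_finite_induct) (auto intro: algebraic_int_add)

lemma algebraic_int_poly:
  fixes x :: "'a::field_char_0"
  shows "algebraic_int x \<Longrightarrow> algebraic_int (poly (map_poly of_int f) x)"
  unfolding poly_altdef
  by (intro algebraic_int_sum algebraic_int_mult algebraic_int_power) (auto simp: coeff_map_poly)

subsection \<open>The ring \<open>\<int>[\<zeta>]\<close> and its Galois action\<close>

abbreviation ieval :: "int poly \<Rightarrow> complex \<Rightarrow> complex" where
  "ieval f \<equiv> poly (of_int_poly f)"

lemma ieval_simps:
  "ieval (f + g) z = ieval f z + ieval g z"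
  "ieval (f - g) z = ieval f z - ieval g z"
  "ieval (- f) z = - ieval f z"
  "ieval (f * g) z = ieval f z * ieval g z"
  "ieval (f ^ n) z = ieval f z ^ n"
  "ieval (smult k f) z = of_int k * ieval f z"
  "ieval (monom k n) z = of_int k * z ^ n"
  "ieval (sum F S) z = (\<Sum>i\<in>S. ieval (F i) z)"
  "ieval (prod F S) z = (\<Prod>i\<in>S. ieval (F i) z)"
  "ieval (pCons k f) z = of_int k + z * ieval f z"
  by (auto simp: of_int_poly_hom.hom_add of_int_poly_hom.hom_minus of_int_poly_hom.hom_uminus
      of_int_poly_hom.hom_mult of_int_poly_hom.hom_power of_int_poly_hom.hom_sum of_int_poly_hom.hom_prod
      of_int_hom.map_poly_hom_smult poly_monom poly_sum poly_prod of_int_hom.map_poly_pCons_hom)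

lemma ieval_sum_coeff: "degree f < n \<Longrightarrow> ieval f z = (\<Sum>i<n. of_int (coeff f i) * z ^ i)"
proof -
  assume "degree f < n"
  then have "(\<Sum>i\<le>degree f. of_int (coeff f i) * z ^ i) = (\<Sum>i<n. of_int (coeff f i) * z ^ i)"
    by (intro sum.mono_neutral_left) (auto simp: coeff_eq_0)
  then show ?thesis by (simp add: poly_altdef)
qed

lemma cnj_ieval: "cnj (ieval f z) = ieval f (cnj z)"
  by (induction f) (auto simp: ieval_simps)

lemma ieval_pcompose: "ieval (pcompose f g) z = ieval f (ieval g z)"
  by (simp add: of_int_hom.map_poly_pcompose poly_pcompose)

locale cyclo =
  fixes p :: nat and \<zeta> :: complex
  assumes p_prime: "prime p" and p_gt2: "p > 2" and zeta_p: "\<zeta> ^ p = 1" and zeta_ne_1: "\<zeta> \<noteq> 1"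
begin

lemma p_pos: "p > 0" "p \<noteq> 0" using p_gt2 by auto

lemma zeta_ne_0: "\<zeta> \<noteq> 0"
proof
  assume "\<zeta> = 0"
  then have "\<zeta> ^ p = 0" using p_gt2 by (simp add: zero_power)
  then show False using zeta_p by simp
qed

lemma zeta_pow_mod: "\<zeta> ^ (k mod p) = \<zeta> ^ k"
proof -
  have "\<zeta> ^ k = \<zeta> ^ (p * (k div p) + k mod p)" by simp
  also have "\<dots> = \<zeta> ^ (k mod p)" by (simp only: power_add power_mult zeta_p power_one mult_1)
  finally show ?thesis by simp
qed

lemma zeta_pow_cong: "[i = j] (mod p) \<Longrightarrow> \<zeta> ^ i = \<zeta> ^ j"
  by (metis zeta_pow_mod cong_def)

lemma zeta_pow_p [simp]: "(\<zeta> ^ k) ^ p = 1"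
  by (subst power_mult [symmetric], subst mult.commute, simp add: power_mult zeta_p)

lemma coprime_p: "\<not> p dvd k \<Longrightarrow> coprime k p"
  by (rule coprime_commute[THEN iffD1, OF prime_imp_coprime[OF p_prime]])

lemma ex_inverse: "\<not> p dvd k \<Longrightarrow> \<exists>k'. [k * k' = 1] (mod p)"
  using cong_solve_coprime_nat[OF coprime_p, of k] by simp

lemma zeta_pow_1_iff: "\<zeta> ^ k = 1 \<longleftrightarrow> p dvd k"
proof
  show "p dvd k \<Longrightarrow> \<zeta> ^ k = 1" by (auto simp: power_mult zeta_p)
  assume a: "\<zeta> ^ k = 1"
  show "p dvd k"
  proof (rule ccontr)
    assume "\<not> p dvd k"
    then obtain k' where "[k * k' = 1] (mod p)" using ex_inverse by blast
    then have "\<zeta> ^ (k * k') = \<zeta> ^ 1" by (rule zeta_pow_cong)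
    then show False using a zeta_ne_1 by (simp add: power_mult)
  qed
qed

lemma zeta_pow_eq_iff: "\<zeta> ^ i = \<zeta> ^ j \<longleftrightarrow> [i = j] (mod p)"
proof -
  have *: "\<zeta> ^ i = \<zeta> ^ j \<longleftrightarrow> [i = j] (mod p)" if "i \<le> j" for i j
  proof -
    have "\<zeta> ^ j = \<zeta> ^ i * \<zeta> ^ (j - i)" using that by (simp flip: power_add)
    then have "\<zeta> ^ i = \<zeta> ^ j \<longleftrightarrow> \<zeta> ^ (j - i) = 1" using zeta_ne_0 by auto
    also have "\<dots> \<longleftrightarrow> [i = j] (mod p)"
      unfolding zeta_pow_1_iff using that by (metis cong_altdef_nat cong_sym)
    finally show ?thesis .
  qed
  show ?thesis using *[of i j] *[of j i] by (cases "i \<le> j") (auto simp: cong_sym_eq)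
qed

lemma inj_zeta_pow: "inj_on (\<lambda>k. \<zeta> ^ k) {..<p}"
  by (rule inj_onI) (auto simp: zeta_pow_eq_iff cong_def)

lemma cyclo_power: "\<not> p dvd t \<Longrightarrow> cyclo p (\<zeta> ^ t)"
  by unfold_locales (use p_prime p_gt2 zeta_pow_1_iff in auto)

lemma norm_zeta: "norm \<zeta> = 1"
proof -
  have "norm \<zeta> ^ p = 1" using zeta_p by (simp flip: norm_power)
  then show ?thesis using p_pos power_eq_imp_eq_base[of "norm \<zeta>" p 1] by simp
qed

lemma cnj_zeta_mult: "cnj \<zeta> * \<zeta> = 1"
  using norm_zeta by (metis complex_norm_square mult.commute of_real_1 power_one)

lemma cnj_zeta: "cnj \<zeta> = \<zeta> ^ (p - 1)"
proof -
  have "\<zeta> ^ (p - 1) * \<zeta> = 1" using zeta_p p_pos by (metis power_minus_mult)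
  then show ?thesis using cnj_zeta_mult zeta_ne_0 by (metis mult_cancel_right)
qed

lemma prod_linear_poly: "(\<Prod>k<p. [:- (\<zeta> ^ k), 1:]) = monom 1 p - 1"
proof (rule poly_eqI_degree_lead_coeff[of _ p _ "(\<lambda>k. \<zeta> ^ k) ` {..<p}"])
  show "coeff (\<Prod>k<p. [:- (\<zeta> ^ k), 1:]) p = coeff (monom 1 p - 1) p"
  proof -
    have d: "degree (\<Prod>k<p. [:- (\<zeta> ^ k), 1:]) = p"
      by (subst degree_prod_eq_sum_degree) auto
    have "lead_coeff (\<Prod>k<p. [:- (\<zeta> ^ k), 1:]) = 1" by (simp add: lead_coeff_prod)
    then show ?thesis using p_pos by (simp add: d)
  qed
  show "p \<le> card ((\<lambda>k. \<zeta> ^ k) ` {..<p})" using card_image[OF inj_zeta_pow] by simp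
  show "degree (\<Prod>k<p. [:- (\<zeta> ^ k), 1:]) \<le> p"
    by (subst degree_prod_eq_sum_degree) auto
  show "degree (monom 1 p - 1 :: complex poly) \<le> p"
    by (rule degree_diff_le) (auto simp: degree_monom_le)
  fix z assume "z \<in> (\<lambda>k. \<zeta> ^ k) ` {..<p}"
  then show "poly (\<Prod>k<p. [:- (\<zeta> ^ k), 1:]) z = poly (monom 1 p - 1) z"
    by (auto simp: poly_prod poly_monom prod_zero_iff)
qed

lemma prod_diff: "(\<Prod>k<p. z - \<zeta> ^ k * w) = z ^ p - w ^ p"
proof (cases "w = 0")
  case True
  then show ?thesis using p_pos by simp
next
  case False
  have "(\<Prod>k<p. z / w - \<zeta> ^ k) = (z / w) ^ p - 1"
    using arg_cong[OF prod_linear_poly, of "\<lambda>f. poly f (z / w)"] by (simp add: poly_prod poly_monom)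
  then have "w ^ p * (\<Prod>k<p. z / w - \<zeta> ^ k) = z ^ p - w ^ p"
    using False by (simp add: field_simps)
  moreover have "w ^ p * (\<Prod>k<p. z / w - \<zeta> ^ k) = (\<Prod>k<p. w * (z / w - \<zeta> ^ k))"
    by (simp add: prod.distrib)
  moreover have "\<dots> = (\<Prod>k<p. z - \<zeta> ^ k * w)"
    using False by (intro prod.cong) (auto simp: field_simps)
  ultimately show ?thesis by simp
qed

lemma prod_linear_poly': "(\<Prod>k\<in>{1..<p}. [:- (\<zeta> ^ k), 1:]) = (\<Sum>i<p. monom 1 i)"
proof -
  have s: "{..<p} = insert 0 {1..<p}" using p_pos by auto
  have "[:- 1, 1:] * (\<Prod>k\<in>{1..<p}. [:- (\<zeta> ^ k), 1:]) = (monom 1 p - 1 :: complex poly)"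
    using prod_linear_poly unfolding s by simp
  also have "monom 1 p - 1 = (monom 1 1 - 1) * (\<Sum>i<p. monom 1 i :: complex poly)"
    using power_diff_1_eq[of "monom 1 1 :: complex poly" p] by (simp add: monom_power)
  also have "monom 1 1 - 1 = ([:- 1, 1:] :: complex poly)" by (simp add: monom_altdef one_pCons)
  finally show ?thesis by (subst (asm) mult_left_cancel) simp_all
qed

lemma prod_one_diff: "(\<Prod>k\<in>{1..<p}. z - \<zeta> ^ k) = (\<Sum>i<p. z ^ i)"
  using arg_cong[OF prod_linear_poly', of "\<lambda>f. poly f z"] by (simp add: poly_prod poly_sum poly_monom)

lemma p_eq_prod: "of_nat p = (\<Prod>k\<in>{1..<p}. 1 - \<zeta> ^ k)"
  using prod_one_diff[of 1] by simp

lemma odd_p: "odd p" using p_prime p_gt2 prime_odd_nat by blast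

text \<open>The left side is the norm of \<open>x + y \<zeta>\<close>. For \<open>y\<close> nonzero
  this is 1 + X + ... + X^(p-1) at X = - x / y, homogenised; the factor (-1)^(p-1) disappears
  because \<open>p\<close> is odd.\<close>

lemma norm_form: "(\<Prod>k\<in>{1..<p}. x + y * \<zeta> ^ k) = (\<Sum>i<p. (- x) ^ i * y ^ (p - 1 - i))"
proof (cases "y = 0")
  case True
  have "(\<Sum>i<p. (- x) ^ i * y ^ (p - 1 - i)) = (\<Sum>i\<in>{p - 1}. (- x) ^ i * y ^ (p - 1 - i))"
    using True p_pos by (intro sum.mono_neutral_right) auto
  also have "\<dots> = x ^ (p - 1)" using odd_p by simp
  finally show ?thesis using True by simp
next
  case False
  have "(\<Prod>k\<in>{1..<p}. x + y * \<zeta> ^ k) = (\<Prod>k\<in>{1..<p}. (- y) * ((- x / y) - \<zeta> ^ k))"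
    using False by (intro prod.cong) (auto simp: field_simps)
  also have "\<dots> = (- y) ^ (p - 1) * (\<Sum>i<p. (- x / y) ^ i)"
    by (simp only: prod.distrib prod_one_diff prod_constant card_atLeastLessThan)
  also have "\<dots> = (\<Sum>i<p. y ^ (p - 1) * (- x / y) ^ i)"
    using odd_p by (simp add: sum_distrib_left)
  also have "\<dots> = (\<Sum>i<p. (- x) ^ i * y ^ (p - 1 - i))"
  proof (rule sum.cong)
    fix i assume "i \<in> {..<p}"
    then have "y ^ (p - 1) = y ^ (p - 1 - i) * y ^ i" by (simp flip: power_add)
    moreover have "y ^ i * (- x / y) ^ i = (- x) ^ i"
      using False by (simp flip: power_mult_distrib)
    ultimately show "y ^ (p - 1) * (- x / y) ^ i = (- x) ^ i * y ^ (p - 1 - i)"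
      by (simp only: mult.assoc mult.commute[of "(- x) ^ i"])
  qed simp
  finally show ?thesis .
qed

lemma sum_zeta_pow: "(\<Sum>k<p. \<zeta> ^ (k * j)) = (if p dvd j then of_nat p else 0)"
proof (cases "p dvd j")
  case True
  then have "\<zeta> ^ (k * j) = 1" for k using zeta_pow_1_iff by simp
  then show ?thesis using True by simp
next
  case False
  then have "\<zeta> ^ j \<noteq> 1" using zeta_pow_1_iff by simp
  moreover have "(\<zeta> ^ j - 1) * (\<Sum>k<p. (\<zeta> ^ j) ^ k) = 0"
    using power_diff_1_eq[of "\<zeta> ^ j" p] by simp
  ultimately show ?thesis using False by (simp flip: power_mult add: mult.commute)
qed

definition Zz :: "complex set" where "Zz = range (\<lambda>f. ieval f \<zeta>)"

lemma Zz_ieval [simp]: "ieval f \<zeta> \<in> Zz" by (auto simp: Zz_def)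

lemma Zz_add: "a \<in> Zz \<Longrightarrow> b \<in> Zz \<Longrightarrow> a + b \<in> Zz"
  unfolding Zz_def by safe (metis ieval_simps(1) rangeI)
lemma Zz_diff: "a \<in> Zz \<Longrightarrow> b \<in> Zz \<Longrightarrow> a - b \<in> Zz"
  unfolding Zz_def by safe (metis ieval_simps(2) rangeI)
lemma Zz_mult: "a \<in> Zz \<Longrightarrow> b \<in> Zz \<Longrightarrow> a * b \<in> Zz"
  unfolding Zz_def by safe (metis ieval_simps(4) rangeI)
lemma Zz_of_int [simp]: "of_int k \<in> Zz"
  using Zz_ieval[of "[:k:]"] by (simp add: ieval_simps)
lemma Zz_of_nat [simp]: "of_nat k \<in> Zz"
  using Zz_of_int[of "int k"] by simp
lemma Zz_0 [simp]: "0 \<in> Zz" and Zz_1 [simp]: "1 \<in> Zz"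
  using Zz_of_int[of 0] Zz_of_int[of 1] by auto
lemma Zz_uminus: "a \<in> Zz \<Longrightarrow> - a \<in> Zz"
  using Zz_diff[of 0 a] by simp
lemma Zz_zeta: "\<zeta> \<in> Zz"
  using Zz_ieval[of "monom 1 1"] by (simp add: ieval_simps poly_monom)
lemma Zz_power: "a \<in> Zz \<Longrightarrow> a ^ n \<in> Zz"
  by (induction n) (auto intro: Zz_mult)
lemma Zz_sum: "(\<And>i. i \<in> I \<Longrightarrow> f i \<in> Zz) \<Longrightarrow> sum f I \<in> Zz"
  by (induction I rule: infinite_finite_induct) (auto intro: Zz_add)
lemma Zz_prod: "(\<And>i. i \<in> I \<Longrightarrow> f i \<in> Zz) \<Longrightarrow> prod f I \<in> Zz"
  by (induction I rule: infinite_finite_induct) (auto intro: Zz_mult)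
lemma Zz_zeta_pow [simp]: "\<zeta> ^ k \<in> Zz" by (intro Zz_power Zz_zeta)

lemmas Zz_intros = Zz_add Zz_diff Zz_mult Zz_uminus Zz_power Zz_sum Zz_prod Zz_zeta

lemma Zz_ieval_at: "a \<in> Zz \<Longrightarrow> ieval f a \<in> Zz"
  by (induction f) (auto simp: ieval_simps intro: Zz_intros)

lemma algebraic_int_zeta: "algebraic_int \<zeta>"
  using algebraic_int_root[of 1 "monom 1 p" \<zeta>] zeta_p p_pos
  by (auto simp: poly_monom degree_monom_eq coeff_monom)

lemma Zz_algebraic_int: "a \<in> Zz \<Longrightarrow> algebraic_int a"
  unfolding Zz_def using algebraic_int_poly algebraic_int_zeta by blast

lemma Zz_cnj: "a \<in> Zz \<Longrightarrow> cnj a \<in> Zz"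
proof -
  assume "a \<in> Zz"
  then obtain f where "a = ieval f \<zeta>" by (auto simp: Zz_def)
  then have "cnj a = ieval f (\<zeta> ^ (p - 1))" by (simp add: cnj_ieval cnj_zeta)
  then show ?thesis using Zz_ieval_at[OF Zz_zeta_pow] by simp
qed

lemma p_lambda_pow: "\<exists>U\<in>Zz. of_nat p = (1 - \<zeta>) ^ (p - 1) * U"
proof
  let ?U = "\<Prod>k\<in>{1..<p}. \<Sum>i<k. \<zeta> ^ i"
  show "?U \<in> Zz" by (intro Zz_intros)
  have "of_nat p = (\<Prod>k\<in>{1..<p}. (1 - \<zeta>) * (\<Sum>i<k. \<zeta> ^ i))"
    unfolding p_eq_prod by (intro prod.cong) (auto simp: one_diff_power_eq)
  then show "of_nat p = (1 - \<zeta>) ^ (p - 1) * ?U" by (simp add: prod.distrib)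
qed

text \<open>Together with \<open>p_lambda_pow\<close>: \<open>p\<close> and (1 - \<zeta>)^(p-1)
  divide each other. Here \<zeta> is a power of each \<zeta>^k, so 1 - \<zeta> is 1 - \<zeta>^k
  times a geometric sum.\<close>

lemma lambda_pow_p: "\<exists>V\<in>Zz. (1 - \<zeta>) ^ (p - 1) = of_nat p * V"
proof -
  have "\<exists>v\<in>Zz. 1 - \<zeta> = (1 - \<zeta> ^ k) * v" if "k \<in> {1..<p}" for k
  proof -
    have "\<not> p dvd k" using that by (auto dest: nat_dvd_not_less)
    then obtain k' where "[k * k' = 1] (mod p)" using ex_inverse by blast
    then have "\<zeta> ^ (k * k') = \<zeta> ^ 1" by (rule zeta_pow_cong)
    then have "1 - \<zeta> = 1 - (\<zeta> ^ k) ^ k'" by (simp add: power_mult)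
    then show ?thesis
      by (intro bexI[of _ "\<Sum>i<k'. (\<zeta> ^ k) ^ i"]) (auto simp: one_diff_power_eq intro!: Zz_intros)
  qed
  then obtain v where v: "\<And>k. k \<in> {1..<p} \<Longrightarrow> v k \<in> Zz" "\<And>k. k \<in> {1..<p} \<Longrightarrow> 1 - \<zeta> = (1 - \<zeta> ^ k) * v k"
    by metis
  have "(1 - \<zeta>) ^ (p - 1) = (\<Prod>k\<in>{1..<p}. 1 - \<zeta>)" by simp
  also have "\<dots> = (\<Prod>k\<in>{1..<p}. (1 - \<zeta> ^ k) * v k)" using v by (intro prod.cong) auto
  also have "\<dots> = of_nat p * prod v {1..<p}" by (simp add: prod.distrib p_eq_prod)
  finally show ?thesis using v(1) by (intro bexI[of _ "prod v {1..<p}"]) (auto intro: Zz_intros)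
qed

text \<open>The power with exponent p - 1 turns the factor 1 - \<zeta> into \<open>p\<close>, and a
  rational algebraic integer is an integer. The cofactor \<open>w\<close> may be any algebraic
  integer, since the integers of the field are not yet known to be Z[\<zeta>].\<close>

lemma p_dvd_of_lambda:
  assumes "of_int k = (1 - \<zeta>) * w" "algebraic_int w"
  shows "int p dvd k"
proof -
  obtain V where V: "V \<in> Zz" "(1 - \<zeta>) ^ (p - 1) = of_nat p * V" using lambda_pow_p by blast
  have "of_int (k ^ (p - 1)) = (of_nat p * V) * w ^ (p - 1)"
    using assms(1) V(2) by (simp add: power_mult_distrib)
  then have eq: "of_int (k ^ (p - 1)) / of_nat p = V * w ^ (p - 1)"
    using p_pos by (simp add: field_simps)
  have "algebraic_int (V * w ^ (p - 1))"
    using Zz_algebraic_int[OF V(1)] assms(2) by (intro algebraic_int_mult algebraic_int_power)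
  moreover have "of_int (k ^ (p - 1)) / (of_nat p :: complex) \<in> \<rat>" by (intro Rats_divide) auto
  ultimately have "of_int (k ^ (p - 1)) / (of_nat p :: complex) \<in> \<int>"
    using rational_algebraic_int_is_int eq by metis
  then obtain m where "of_int (k ^ (p - 1)) / (of_nat p :: complex) = of_int m" by (auto elim: Ints_cases)
  then have "(of_int (k ^ (p - 1)) :: complex) = of_int (int p * m)" using p_pos by (simp add: field_simps)
  then have "k ^ (p - 1) = int p * m" by (simp only: of_int_eq_iff)
  then have "int p dvd k ^ (p - 1)" by simp
  then show ?thesis using p_prime prime_dvd_power by (metis prime_nat_int_transfer)
qed

text \<open>The Eisenstein argument: expand \<open>f\<close> in powers of
  \<open>L = 1 - \<zeta>\<close>. As \<open>p\<close> is a multiple of \<open>L ^ (p - 1)\<close>,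
  the lowest coefficient not yet known to be divisible by \<open>p\<close> is a multiple of
  \<open>L\<close>, hence of \<open>p\<close>.\<close>

lemma p_dvd_coeffs:
  assumes deg: "degree f < p - 1" and f: "ieval f \<zeta> = of_nat p * w" and w: "algebraic_int w"
  shows "\<exists>h. f = smult (int p) h"
proof -
  define g where "g = pcompose f [:1, -1:]"
  define L where "L = 1 - \<zeta>"
  have L0: "L \<noteq> 0" using zeta_ne_1 by (simp add: L_def)
  have Lalg: "algebraic_int L" unfolding L_def by (intro Zz_algebraic_int Zz_intros) auto
  have fg: "f = pcompose g [:1, -1:]"
    unfolding g_def by (simp flip: pcompose_assoc add: pcompose_pCons)
  have "degree g \<le> degree f * 1" unfolding g_def by (rule order.trans[OF degree_pcompose_le]) simp
  then have dg: "degree g < p - 1" using deg by simp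
  have "ieval g L = ieval f \<zeta>" unfolding g_def ieval_pcompose by (simp add: ieval_simps L_def)
  then have gw: "(\<Sum>i<p - 1. of_int (coeff g i) * L ^ i) = of_nat p * w"
    using ieval_sum_coeff[OF dg] f by simp
  obtain U where U: "U \<in> Zz" "of_nat p = L ^ (p - 1) * U" using p_lambda_pow L_def by blast
  have "int p dvd coeff g j" for j
  proof (induction j rule: less_induct)
    case (less j)
    show ?case
    proof (cases "j < p - 1")
      case False
      then show ?thesis using dg by (simp add: coeff_eq_0)
    next
      case True
      have "\<forall>i<j. \<exists>c. coeff g i = int p * c" using less by (auto simp: dvd_def)
      then obtain c where c: "\<And>i. i < j \<Longrightarrow> coeff g i = int p * c i" by metis
      define w1 where "w1 = (\<Sum>i<j. of_int (c i) * L ^ i)"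
      define s where "s = (\<Sum>i\<in>{j+1..<p - 1}. of_int (coeff g i) * L ^ (i - j - 1))"
      have w1: "algebraic_int w1" unfolding w1_def
        by (intro algebraic_int_sum algebraic_int_mult algebraic_int_power Lalg) auto
      have s: "algebraic_int s" unfolding s_def
        by (intro algebraic_int_sum algebraic_int_mult algebraic_int_power Lalg) auto
      have "{..<p - 1} = {..<j} \<union> insert j {j+1..<p - 1}" using True by auto
      then have "(\<Sum>i<p - 1. of_int (coeff g i) * L ^ i) =
          (\<Sum>i\<in>{..<j} \<union> insert j {j+1..<p - 1}. of_int (coeff g i) * L ^ i)" by simp
      also have "\<dots> = (\<Sum>i<j. of_int (coeff g i) * L ^ i) +
          (of_int (coeff g j) * L ^ j + (\<Sum>i\<in>{j+1..<p - 1}. of_int (coeff g i) * L ^ i))"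
        by (subst sum.union_disjoint) auto
      also have "(\<Sum>i<j. of_int (coeff g i) * L ^ i) = of_nat p * w1"
        unfolding w1_def sum_distrib_left by (intro sum.cong) (auto simp: c)
      also have "(\<Sum>i\<in>{j+1..<p - 1}. of_int (coeff g i) * L ^ i) = L ^ j * (L * s)"
        unfolding s_def sum_distrib_left
      proof (intro sum.cong)
        fix i assume "i \<in> {j+1..<p - 1}"
        then have "i = j + (1 + (i - j - 1))" by auto
        then have "L ^ i = L ^ j * (L ^ 1 * L ^ (i - j - 1))" by (metis power_add)
        then show "of_int (coeff g i) * L ^ i = L ^ j * (L * (of_int (coeff g i) * L ^ (i - j - 1)))"
          by simp
      qed simp
      finally have "of_nat p * w = of_nat p * w1 + (of_int (coeff g j) * L ^ j + L ^ j * (L * s))"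
        using gw by simp
      moreover have "L ^ (p - 1) = L ^ j * (L * L ^ (p - 2 - j))"
      proof -
        have "p - 1 = j + Suc (p - 2 - j)" using True p_gt2 by linarith
        then show ?thesis by (simp only: power_add power_Suc)
      qed
      ultimately have "L ^ j * of_int (coeff g j) = L ^ j * (L * (L ^ (p - 2 - j) * U * (w - w1) - s))"
        using U(2) by (simp add: algebra_simps)
      then have "of_int (coeff g j) = L * (L ^ (p - 2 - j) * U * (w - w1) - s)"
        using L0 by simp
      moreover have "algebraic_int (L ^ (p - 2 - j) * U * (w - w1) - s)"
        by (intro algebraic_int_diff algebraic_int_mult algebraic_int_power Lalg w w1 s Zz_algebraic_int U)
      ultimately show ?thesis unfolding L_def by (rule p_dvd_of_lambda)
    qed
  qed
  then have "[:int p:] dvd g" by (simp add: const_poly_dvd_iff)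
  then obtain h where "g = smult (int p) h" by (auto elim!: dvdE)
  then have "f = smult (int p) (pcompose h [:1, -1:])" using fg by (simp add: pcompose_smult)
  then show ?thesis by blast
qed

text \<open>Linear independence of the powers of \<zeta> below p - 1. The primitive part of a
  nontrivial relation would be divisible by \<open>p\<close> according to
  \<open>p_dvd_coeffs\<close> with cofactor 0.\<close>

lemma ieval_eq_0:
  assumes deg: "degree f < p - 1" and f: "ieval f \<zeta> = 0"
  shows "f = 0"
proof (rule ccontr)
  assume nz: "f \<noteq> 0"
  define h where "h = primitive_part f"
  have fh: "f = smult (content f) h" by (simp add: h_def)
  have c0: "content f \<noteq> 0" using nz by simp
  have "ieval f \<zeta> = of_int (content f) * ieval h \<zeta>" by (subst fh) (simp add: ieval_simps)
  then have "ieval h \<zeta> = of_nat p * 0" using f c0 by simp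
  moreover have "degree h < p - 1" using deg by (simp add: h_def)
  ultimately obtain k where k: "h = smult (int p) k" using p_dvd_coeffs algebraic_int_0 by blast
  have "content h = 1" using nz by (simp add: h_def)
  then have "int p * content k = 1 \<or> - int p * content k = 1" using k
    by (auto simp: content_smult abs_if normalize_int_def)
  then have "int p dvd 1" by (metis dvd_triv_left minus_dvd_iff)
  then show False using p_gt2 by simp
qed

definition Phi :: "int poly" where "Phi = (\<Sum>i<p. monom 1 i)"

lemma ieval_Phi: "ieval Phi \<zeta> = 0"
  using sum_zeta_pow[of 1] p_gt2 by (simp add: Phi_def ieval_simps poly_monom)

lemma degree_Phi: "degree Phi = p - 1" and lead_Phi: "lead_coeff Phi = 1"
proof -
  have c: "coeff Phi k = (if k < p then 1 else 0)" for k
    by (simp add: Phi_def coeff_sum coeff_monom)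
  then have "degree Phi \<le> p - 1" by (intro degree_le) auto
  moreover have "p - 1 \<le> degree Phi" using c p_pos by (intro le_degree) auto
  ultimately show "degree Phi = p - 1" by simp
  then show "lead_coeff Phi = 1" using c p_pos by simp
qed

lemma reduce_poly: "\<exists>q r. f = Phi * q + r \<and> degree r < p - 1"
proof -
  obtain q r where qr: "pseudo_divmod f Phi = (q, r)" by fastforce
  have nz: "Phi \<noteq> 0" using lead_Phi by force
  have "f = Phi * q + r" using pseudo_divmod(1)[OF nz qr] by (simp add: lead_Phi)
  moreover have "degree r < p - 1"
    using pseudo_divmod(2)[OF nz qr] degree_Phi p_gt2 by auto
  ultimately show ?thesis by blast
qed

lemma Zz_repr: "a \<in> Zz \<Longrightarrow> \<exists>f. degree f < p - 1 \<and> a = ieval f \<zeta>"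
proof -
  assume "a \<in> Zz"
  then obtain f where f: "a = ieval f \<zeta>" by (auto simp: Zz_def)
  obtain q r where "f = Phi * q + r" "degree r < p - 1" using reduce_poly by blast
  then show ?thesis using f by (auto simp: ieval_simps ieval_Phi intro!: exI[of _ r])
qed

text \<open>Every integer relation of \<zeta> is a multiple of \<open>Phi\<close>, which also
  vanishes at the other primitive roots. This is what makes the Galois action well defined.\<close>

lemma ieval_zeta_pow_eq_0:
  assumes "ieval f \<zeta> = 0" "\<not> p dvd t"
  shows "ieval f (\<zeta> ^ t) = 0"
proof -
  interpret c: cyclo p "\<zeta> ^ t" by (rule cyclo_power[OF assms(2)])
  obtain q r where qr: "f = Phi * q + r" "degree r < p - 1" using reduce_poly by blast
  then have "ieval r \<zeta> = 0" using assms(1) by (simp add: ieval_simps ieval_Phi)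
  then have "r = 0" using qr(2) ieval_eq_0 by blast
  then show ?thesis using qr c.ieval_Phi by (simp add: ieval_simps Phi_def c.Phi_def)
qed

end

text \<open>The lowest nonzero coefficient of the relation, moved to the other side, is a nonzero
  integer multiple of 1 divisible by \<open>w\<close>. This is the source of all inverses
  below.\<close>

lemma ieval_invertible:
  assumes "f \<noteq> 0" "ieval f w = 0" "w \<noteq> 0"
  shows "\<exists>h c. c \<noteq> 0 \<and> w * ieval h w = of_int c"
  using assms
proof (induction f)
  case (pCons a g)
  show ?case
  proof (cases "a = 0")
    case True
    then show ?thesis using pCons by (auto simp: ieval_simps)
  next
    case False
    then have "w * ieval g w = of_int (- a)"
      using pCons.prems(2) by (simp add: ieval_simps eq_neg_iff_add_eq_0 add.commute)
    then show ?thesis using False by (intro exI[of _ g] exI[of _ "- a"]) simp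
  qed
qed simp

context cyclo
begin

lemma sum_zeta_pow_units: "(\<Sum>t\<in>{1..<p}. \<zeta> ^ (t * j)) = (if p dvd j then of_nat p else 0) - 1"
proof -
  have "{..<p} = insert 0 {1..<p}" using p_pos by auto
  then have "(\<Sum>t<p. \<zeta> ^ (t * j)) = 1 + (\<Sum>t\<in>{1..<p}. \<zeta> ^ (t * j))" by simp
  then show ?thesis using sum_zeta_pow[of j] by (simp add: algebra_simps)
qed

text \<open>Complex conjugation is written as passing to \<zeta>^(p-1), so that both factors are
  polynomials in roots of unity and relations can be transported to other conjugates.\<close>

lemma parseval:
  fixes a :: "nat \<Rightarrow> int"
  shows "(\<Sum>t<p. (\<Sum>i<p. of_int (a i) * (\<zeta> ^ t) ^ i) * (\<Sum>i<p. of_int (a i) * ((\<zeta> ^ (p - 1)) ^ t) ^ i))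
    = of_nat p * of_int (\<Sum>i<p. (a i)\<^sup>2)"
proof -
  have iff: "p dvd i + (p - 1) * j \<longleftrightarrow> i = j" if "i < p" "j < p" for i j
  proof -
    have "int (i + (p - 1) * j) = (int i - int j) + int p * int j"
    proof -
      have "int (p - 1) = int p - 1" using p_pos by simp
      then show ?thesis by (simp only: of_nat_add of_nat_mult) (simp add: algebra_simps)
    qed
    then have "int p dvd int (i + (p - 1) * j) \<longleftrightarrow> int p dvd int i - int j"
      by (simp only: dvd_add_left_iff[OF dvd_triv_left])
    also have "\<dots> \<longleftrightarrow> i = j"
      using that zdvd_imp_le[of "int p" "int i - int j"] zdvd_imp_le[of "int p" "int j - int i"]
      by (cases i j rule: linorder_cases) (auto simp: dvd_diff_commute)
    finally show ?thesis by (simp only: int_dvd_int_iff)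
  qed
  have "(\<Sum>t<p. (\<Sum>i<p. of_int (a i) * (\<zeta> ^ t) ^ i) * (\<Sum>i<p. of_int (a i) * ((\<zeta> ^ (p - 1)) ^ t) ^ i))
    = (\<Sum>t<p. \<Sum>i<p. \<Sum>j<p. of_int (a i * a j) * \<zeta> ^ (t * (i + (p - 1) * j)))"
    unfolding sum_product
    by (intro sum.cong refl) (simp add: power_add distrib_left mult_ac flip: power_mult)
  also have "\<dots> = (\<Sum>i<p. \<Sum>t<p. \<Sum>j<p. of_int (a i * a j) * \<zeta> ^ (t * (i + (p - 1) * j)))"
    by (rule sum.swap)
  also have "\<dots> = (\<Sum>i<p. \<Sum>j<p. \<Sum>t<p. of_int (a i * a j) * \<zeta> ^ (t * (i + (p - 1) * j)))"
    by (intro sum.cong refl sum.swap)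
  also have "\<dots> = (\<Sum>i<p. \<Sum>j<p. of_int (a i * a j) * (if i = j then of_nat p else 0))"
  proof (intro sum.cong refl)
    fix i j assume "i \<in> {..<p}" "j \<in> {..<p}"
    then show "(\<Sum>t<p. of_int (a i * a j) * \<zeta> ^ (t * (i + (p - 1) * j))) =
        of_int (a i * a j) * (if i = j then of_nat p else 0)"
      using iff[of i j] by (simp only: sum_distrib_left[symmetric] sum_zeta_pow lessThan_iff)
  qed
  also have "\<dots> = (\<Sum>i<p. of_int (a i * a i) * of_nat p)"
    by (intro sum.cong refl) (simp add: if_distrib sum.delta cong: if_cong)
  finally show ?thesis by (simp add: sum_distrib_left power2_eq_square mult_ac)
qed

text \<open>Shifting all coefficients by a constant does not change an element of \<open>\<int>[\<zeta>]\<close>; by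
  Parseval the coefficient sum is \<open>\<plusminus>1\<close> modulo \<open>p\<close>, and shifting it to \<open>\<plusminus>1\<close> makes the sum of
  the squared coefficients equal to \<open>1\<close>.\<close>

lemma norm_1_root_of_unity:
  assumes e: "\<epsilon> \<in> Zz" and n: "\<epsilon> * cnj \<epsilon> = 1"
  shows "\<exists>s i. s \<in> {1, -1} \<and> \<epsilon> = of_int s * \<zeta> ^ i"
proof -
  obtain f where f: "degree f < p - 1" "\<epsilon> = ieval f \<zeta>" using Zz_repr[OF e] by blast
  define a where "a = (\<lambda>c i. coeff f i + c)"
  have a0: "(\<Sum>i<p. of_int (a c i) * \<omega> ^ i) = ieval f \<omega>" if "(\<Sum>i<p. \<omega> ^ i) = 0" for \<omega> c
    using f(1) that ieval_sum_coeff[of f p \<omega>]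
    by (simp add: a_def distrib_right sum.distrib flip: sum_distrib_left)
  have pow0: "(\<Sum>i<p. (\<zeta> ^ t) ^ i) = 0" if "\<not> p dvd t" for t
    using sum_zeta_pow[of t] that by (simp flip: power_mult add: mult.commute)
  have one: "ieval f (\<zeta> ^ t) * ieval f ((\<zeta> ^ (p - 1)) ^ t) = 1" if "\<not> p dvd t" for t
  proof -
    \<comment> \<open>The equation saying that \<epsilon> has absolute value 1 is a polynomial
      relation for \<zeta>, so every conjugate of \<epsilon> has absolute value 1 too.\<close>
    define g where "g = f * pcompose f (monom 1 (p - 1)) - 1"
    have "ieval g \<zeta> = 0" using n f(2)
      by (simp add: g_def ieval_simps ieval_pcompose cnj_ieval cnj_zeta poly_monom)
    then have "ieval g (\<zeta> ^ t) = 0" using that by (rule ieval_zeta_pow_eq_0)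
    then show ?thesis
      by (simp add: g_def ieval_simps ieval_pcompose poly_monom mult.commute flip: power_mult)
  qed
  \<comment> \<open>In Parseval's sum the index 0 contributes the square of the coefficient sum and
    each of the p - 1 other indices contributes 1.\<close>
  have P: "(\<Sum>i<p. a c i)\<^sup>2 + (int p - 1) = int p * (\<Sum>i<p. (a c i)\<^sup>2)" for c
  proof -
    have s: "{..<p} = insert 0 {1..<p}" using p_pos by auto
    have nd: "\<not> p dvd t" if "t \<in> {1..<p}" for t using that by (auto dest: nat_dvd_not_less)
    have nd': "\<not> p dvd (p - 1) * t" if "t \<in> {1..<p}" for t
      using that nd p_prime p_gt2 by (auto simp: prime_dvd_mult_iff dest: nat_dvd_not_less)
    let ?F = "\<lambda>t. (\<Sum>i<p. of_int (a c i) * (\<zeta> ^ t) ^ i) * (\<Sum>i<p. of_int (a c i) * ((\<zeta> ^ (p - 1)) ^ t) ^ i)"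
    have "(\<Sum>t<p. ?F t) = ?F 0 + (\<Sum>t\<in>{1..<p}. ?F t)"
      by (subst s) simp
    also have "(\<Sum>t\<in>{1..<p}. ?F t) = (\<Sum>t\<in>{1..<p}. 1)"
    proof (intro sum.cong refl)
      fix t assume t: "t \<in> {1..<p}"
      have "?F t = ieval f (\<zeta> ^ t) * ieval f ((\<zeta> ^ (p - 1)) ^ t)"
        using a0[OF pow0[OF nd[OF t]], of c] a0[OF pow0[OF nd'[OF t]], of c] by (simp add: power_mult)
      then show "?F t = 1" using one[OF nd[OF t]] by simp
    qed
    also have "?F 0 = of_int ((\<Sum>i<p. a c i)\<^sup>2)" by (simp add: power2_eq_square)
    finally have "complex_of_int (int p * (\<Sum>i<p. (a c i)\<^sup>2)) = of_int ((\<Sum>i<p. a c i)\<^sup>2 + (int p - 1))"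
      using parseval[of "a c"] p_pos by (simp add: of_nat_diff)
    then show ?thesis by (simp only: of_int_eq_iff)
  qed
  define S where "S = (\<Sum>i<p. a 0 i)"
  have Sc: "(\<Sum>i<p. a c i) = S + int p * c" for c
    by (simp add: S_def a_def sum.distrib)
  have "int p dvd (S - 1) * (S + 1)"
  proof -
    have "(S - 1) * (S + 1) = int p * ((\<Sum>i<p. (a 0 i)\<^sup>2) - 1)"
      using P[of 0] by (simp add: S_def algebra_simps power2_eq_square)
    then show ?thesis by simp
  qed
  then have "int p dvd S - 1 \<or> int p dvd S + 1"
    using p_prime by (simp add: prime_dvd_mult_iff)
  then obtain k r where "S = r + int p * k" "r \<in> {1, -1}"
  proof (elim disjE dvdE)
    fix k assume "S - 1 = int p * k"
    then show ?thesis using that[of 1 k] by simp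
  next
    fix k assume "S + 1 = int p * k"
    then show ?thesis using that[of "-1" k] by simp
  qed
  then have "(\<Sum>i<p. a (- k) i)\<^sup>2 = 1" using Sc[of "- k"] by auto
  then have "int p * (\<Sum>i<p. (a (- k) i)\<^sup>2) = int p * 1" using P[of "- k"] by simp
  then have sq: "(\<Sum>i<p. (a (- k) i)\<^sup>2) = 1" using p_pos by simp
  obtain i where i: "i < p" "a (- k) i \<noteq> 0"
  proof (rule ccontr)
    assume "\<not> thesis"
    then have "a (- k) i = 0" if "i < p" for i using that \<open>\<And>i. i < p \<Longrightarrow> a (- k) i \<noteq> 0 \<Longrightarrow> thesis\<close> by blast
    then show False using sq by simp
  qed
  have "(\<Sum>j<p. (a (- k) j)\<^sup>2) = (a (- k) i)\<^sup>2 + (\<Sum>j\<in>{..<p} - {i}. (a (- k) j)\<^sup>2)"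
    using i by (intro sum.remove) auto
  moreover have "(\<Sum>j\<in>{..<p} - {i}. (a (- k) j)\<^sup>2) \<ge> 0" by (intro sum_nonneg) auto
  moreover have "(a (- k) i)\<^sup>2 > 0" using i by simp
  ultimately have i1: "(a (- k) i)\<^sup>2 = 1" and z: "(\<Sum>j\<in>{..<p} - {i}. (a (- k) j)\<^sup>2) = 0"
    using sq by linarith+
  have z': "a (- k) j = 0" if "j < p" "j \<noteq> i" for j
    using z that by (subst (asm) sum_nonneg_eq_0_iff) auto
  have "\<epsilon> = (\<Sum>j<p. of_int (a (- k) j) * \<zeta> ^ j)"
    using a0[of \<zeta> "- k"] pow0[of 1] p_gt2 f(2) by simp
  also have "\<dots> = (\<Sum>j\<in>{i}. of_int (a (- k) j) * \<zeta> ^ j)"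
    using i z' by (intro sum.mono_neutral_right) auto
  finally have "\<epsilon> = of_int (a (- k) i) * \<zeta> ^ i" by simp
  moreover have "a (- k) i \<in> {1, -1}" using i1 power2_eq_1_iff by auto
  ultimately show ?thesis by blast
qed

section \<open>The field Q(\<zeta>), its automorphisms and its ring of integers\<close>

definition QK :: "complex set" where
  "QK = {z. \<exists>n::nat. n > 0 \<and> of_nat n * z \<in> Zz}"

lemma QK_Zz: "z \<in> Zz \<Longrightarrow> z \<in> QK"
  unfolding QK_def by (auto intro!: exI[of _ 1])

lemma QK_repr: "z \<in> QK \<Longrightarrow> \<exists>n f. n > 0 \<and> degree f < p - 1 \<and> of_nat n * z = ieval f \<zeta>"
  unfolding QK_def using Zz_repr by blast

lemma QK_add: "a \<in> QK \<Longrightarrow> b \<in> QK \<Longrightarrow> a + b \<in> QK"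
proof -
  assume "a \<in> QK" "b \<in> QK"
  then obtain m n where "m > 0" "of_nat m * a \<in> Zz" "n > 0" "of_nat n * b \<in> Zz" by (auto simp: QK_def)
  moreover have "of_nat (m * n) * (a + b) = of_nat n * (of_nat m * a) + of_nat m * (of_nat n * b)"
    by (simp add: algebra_simps)
  ultimately show ?thesis unfolding QK_def
    by (intro CollectI exI[of _ "m * n"] conjI) (auto intro!: Zz_add Zz_mult)
qed

lemma QK_mult: "a \<in> QK \<Longrightarrow> b \<in> QK \<Longrightarrow> a * b \<in> QK"
proof -
  assume "a \<in> QK" "b \<in> QK"
  then obtain m n where "m > 0" "of_nat m * a \<in> Zz" "n > 0" "of_nat n * b \<in> Zz" by (auto simp: QK_def)
  moreover have e: "of_nat (m * n) * (a * b) = (of_nat m * a) * (of_nat n * b)"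
    by (simp add: algebra_simps)
  ultimately have "m * n > 0" "of_nat (m * n) * (a * b) \<in> Zz" unfolding e by (simp_all add: Zz_mult)
  then show ?thesis unfolding QK_def by blast
qed

lemma QK_uminus: "a \<in> QK \<Longrightarrow> - a \<in> QK"
  using QK_mult[of "-1" a] QK_Zz[of "-1"] Zz_of_int[of "-1"] by simp

lemma QK_diff: "a \<in> QK \<Longrightarrow> b \<in> QK \<Longrightarrow> a - b \<in> QK"
  using QK_add[of a "- b"] QK_uminus[of b] by simp

lemma QK_power: "a \<in> QK \<Longrightarrow> a ^ n \<in> QK"
  by (induction n) (auto intro: QK_mult QK_Zz)

lemma QK_sum: "(\<And>i. i \<in> I \<Longrightarrow> f i \<in> QK) \<Longrightarrow> sum f I \<in> QK"
  by (induction I rule: infinite_finite_induct) (auto intro: QK_add QK_Zz)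

lemma QK_prod: "(\<And>i. i \<in> I \<Longrightarrow> f i \<in> QK) \<Longrightarrow> prod f I \<in> QK"
  by (induction I rule: infinite_finite_induct) (auto intro: QK_mult QK_Zz)

lemma QK_inverse: "a \<in> QK \<Longrightarrow> inverse a \<in> QK"
proof (cases "a = 0")
  case False
  assume "a \<in> QK"
  then obtain n where n: "n > 0" "of_nat n * a \<in> Zz" by (auto simp: QK_def)
  define w where "w = of_nat n * a"
  have w0: "w \<noteq> 0" using False n by (simp add: w_def)
  have wz: "w \<in> Zz" using n(2) by (simp add: w_def)
  obtain g where "ieval g w = 0" "lead_coeff g = 1"
    using Zz_algebraic_int[OF wz] algebraic_int_altdef_ipoly by blast
  then obtain h c where c: "c \<noteq> 0" "w * ieval h w = of_int c"
    using ieval_invertible[of g w] w0 by fastforce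
  have "of_int c * inverse a = of_nat n * ieval h w"
    using False unfolding c(2)[symmetric] by (simp add: w_def field_simps)
  then have "of_int \<bar>c\<bar> * inverse a = of_int (sgn c) * (of_nat n * ieval h w)"
    by (simp add: abs_sgn mult.assoc)
  then have "of_nat (nat \<bar>c\<bar>) * inverse a = of_int (sgn c) * (of_nat n * ieval h w)" by simp
  also have "\<dots> \<in> Zz" using Zz_ieval_at[OF wz] by (intro Zz_intros) auto
  finally show ?thesis unfolding QK_def using c(1) by (intro CollectI exI[of _ "nat \<bar>c\<bar>"]) auto
qed (auto intro: QK_Zz)

lemma QK_divide: "a \<in> QK \<Longrightarrow> b \<in> QK \<Longrightarrow> a / b \<in> QK"
  by (simp add: divide_inverse QK_mult QK_inverse)

definition sg_repr :: "complex \<Rightarrow> nat \<times> int poly" where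
  "sg_repr z = (SOME x. fst x > 0 \<and> of_nat (fst x) * z = ieval (snd x) \<zeta>)"

text \<open>The automorphism sending \<zeta> to \<zeta>^t, meaningful for \<open>t\<close> prime to
  \<open>p\<close>. It uses a chosen numerator and denominator; \<open>sg_eq\<close> removes the
  dependence on this choice.\<close>

definition sg :: "nat \<Rightarrow> complex \<Rightarrow> complex" where
  "sg t z = ieval (snd (sg_repr z)) (\<zeta> ^ t) / of_nat (fst (sg_repr z))"

lemma sg_eq:
  assumes "n > 0" "of_nat n * z = ieval f \<zeta>" and t: "\<not> p dvd t"
  shows "sg t z = ieval f (\<zeta> ^ t) / of_nat n"
proof -
  define m g where "m = fst (sg_repr z)" and "g = snd (sg_repr z)"
  have "fst (sg_repr z) > 0 \<and> of_nat (fst (sg_repr z)) * z = ieval (snd (sg_repr z)) \<zeta>"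
    unfolding sg_repr_def
    using someI[of "\<lambda>x. fst x > 0 \<and> of_nat (fst x) * z = ieval (snd x) \<zeta>" "(n, f)"] assms
    by (simp only: fst_conv snd_conv simp_thms)
  then have m: "m > 0" "of_nat m * z = ieval g \<zeta>" by (simp_all add: m_def g_def)
  have "ieval (smult (int m) f - smult (int n) g) \<zeta> = 0"
    unfolding ieval_simps assms(2)[symmetric] m(2)[symmetric] by simp
  then have "ieval (smult (int m) f - smult (int n) g) (\<zeta> ^ t) = 0" using t by (rule ieval_zeta_pow_eq_0)
  then have "of_nat m * ieval f (\<zeta> ^ t) = of_nat n * ieval g (\<zeta> ^ t)" by (simp add: ieval_simps)
  then show ?thesis using assms(1) m(1) by (simp add: sg_def flip: m_def g_def) (simp add: field_simps)
qed

lemma sg_ieval: "\<not> p dvd t \<Longrightarrow> sg t (ieval f \<zeta>) = ieval f (\<zeta> ^ t)"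
  using sg_eq[of 1 "ieval f \<zeta>" f t] by simp

lemma sg_add:
  assumes "a \<in> QK" "b \<in> QK" and t: "\<not> p dvd t"
  shows "sg t (a + b) = sg t a + sg t b"
proof -
  obtain m f where m: "m > 0" "of_nat m * a = ieval f \<zeta>" using QK_repr assms by blast
  obtain n g where n: "n > 0" "of_nat n * b = ieval g \<zeta>" using QK_repr assms by blast
  have "of_nat (m * n) * (a + b) = ieval (smult (int n) f + smult (int m) g) \<zeta>"
    unfolding ieval_simps m(2)[symmetric] n(2)[symmetric] by (simp add: algebra_simps)
  then have "sg t (a + b) = ieval (smult (int n) f + smult (int m) g) (\<zeta> ^ t) / of_nat (m * n)"
    using m(1) n(1) t by (intro sg_eq) auto
  then show ?thesis unfolding sg_eq[OF m t] sg_eq[OF n t] using m(1) n(1)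
    by (simp add: ieval_simps add_divide_distrib)
qed

lemma sg_mult:
  assumes "a \<in> QK" "b \<in> QK" and t: "\<not> p dvd t"
  shows "sg t (a * b) = sg t a * sg t b"
proof -
  obtain m f where m: "m > 0" "of_nat m * a = ieval f \<zeta>" using QK_repr assms by blast
  obtain n g where n: "n > 0" "of_nat n * b = ieval g \<zeta>" using QK_repr assms by blast
  have "of_nat (m * n) * (a * b) = ieval (f * g) \<zeta>"
    unfolding ieval_simps m(2)[symmetric] n(2)[symmetric] by (simp add: algebra_simps)
  then have "sg t (a * b) = ieval (f * g) (\<zeta> ^ t) / of_nat (m * n)"
    using m(1) n(1) t by (intro sg_eq) auto
  then show ?thesis using sg_eq[OF m t] sg_eq[OF n t] by (simp add: ieval_simps)
qed

lemma sg_of_int: "\<not> p dvd t \<Longrightarrow> sg t (of_int k) = of_int k"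
  using sg_ieval[of t "[:k:]"] by (simp add: ieval_simps)

lemma sg_of_nat: "\<not> p dvd t \<Longrightarrow> sg t (of_nat k) = of_nat k"
  using sg_of_int[of t "int k"] by simp

lemma sg_0: "\<not> p dvd t \<Longrightarrow> sg t 0 = 0" and sg_1: "\<not> p dvd t \<Longrightarrow> sg t 1 = 1"
  using sg_of_int[of t 0] sg_of_int[of t 1] by auto

lemma sg_uminus: "a \<in> QK \<Longrightarrow> \<not> p dvd t \<Longrightarrow> sg t (- a) = - sg t a"
  using sg_add[of a "- a" t] QK_uminus[of a] sg_0[of t] by (simp add: add_eq_0_iff)

lemma sg_diff: "a \<in> QK \<Longrightarrow> b \<in> QK \<Longrightarrow> \<not> p dvd t \<Longrightarrow> sg t (a - b) = sg t a - sg t b"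
  using sg_add[of a "- b" t] QK_uminus[of b] sg_uminus[of b t] by simp

lemma sg_power: "a \<in> QK \<Longrightarrow> \<not> p dvd t \<Longrightarrow> sg t (a ^ n) = sg t a ^ n"
  by (induction n) (auto simp: sg_1 sg_mult QK_power)

lemma sg_prod: "\<not> p dvd t \<Longrightarrow> (\<And>i. i \<in> I \<Longrightarrow> f i \<in> QK) \<Longrightarrow> sg t (prod f I) = (\<Prod>i\<in>I. sg t (f i))"
  by (induction I rule: infinite_finite_induct) (auto simp: sg_1 sg_mult QK_prod)

lemma sg_zeta_pow: "\<not> p dvd t \<Longrightarrow> sg t (\<zeta> ^ k) = \<zeta> ^ (t * k)"
  using sg_ieval[of t "monom 1 k"] by (simp add: ieval_simps poly_monom power_mult)

lemma sg_Zz: "a \<in> Zz \<Longrightarrow> \<not> p dvd t \<Longrightarrow> sg t a \<in> Zz"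
proof -
  assume "a \<in> Zz" and t: "\<not> p dvd t"
  then obtain f where "a = ieval f \<zeta>" by (auto simp: Zz_def)
  then show ?thesis using sg_ieval[OF t] Zz_ieval_at[OF Zz_zeta_pow] by simp
qed

lemma sg_QK: "a \<in> QK \<Longrightarrow> \<not> p dvd t \<Longrightarrow> sg t a \<in> QK"
proof -
  assume a: "a \<in> QK" and t: "\<not> p dvd t"
  obtain m f where m: "m > 0" "of_nat m * a = ieval f \<zeta>" using QK_repr a by blast
  then show ?thesis unfolding sg_eq[OF m t] QK_def
    using Zz_ieval_at[OF Zz_zeta_pow] by (intro CollectI exI[of _ m]) auto
qed

lemma sg_cong: "[s = t] (mod p) \<Longrightarrow> sg s z = sg t z"
  unfolding sg_def using zeta_pow_cong[of s t] by simp

lemma sg_one_index: "a \<in> QK \<Longrightarrow> sg 1 a = a"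
proof -
  assume a: "a \<in> QK"
  obtain m f where m: "m > 0" "of_nat m * a = ieval f \<zeta>" using QK_repr a by blast
  have "\<not> p dvd 1" using p_gt2 by simp
  then have "sg 1 a = ieval f \<zeta> / of_nat m" using sg_eq[OF m, of 1] by simp
  then show ?thesis using m(1) unfolding m(2)[symmetric] by simp
qed

lemma sg_sg:
  assumes a: "a \<in> QK" and "\<not> p dvd s" "\<not> p dvd t"
  shows "sg s (sg t a) = sg (s * t) a"
proof -
  obtain m f where m: "m > 0" "of_nat m * a = ieval f \<zeta>" using QK_repr a by blast
  have st: "\<not> p dvd s * t" using assms p_prime by (simp add: prime_dvd_mult_iff)
  have "of_nat m * sg t a = ieval (pcompose f (monom 1 t)) \<zeta>"
    using m(1) sg_eq[OF m assms(3)] by (simp add: ieval_pcompose ieval_simps poly_monom)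
  then have "sg s (sg t a) = ieval (pcompose f (monom 1 t)) (\<zeta> ^ s) / of_nat m"
    using m(1) assms by (intro sg_eq)
  then show ?thesis using sg_eq[OF m st] by (simp add: ieval_pcompose ieval_simps poly_monom power_mult)
qed

lemma cong_1_not_dvd:
  assumes "[s * t = 1] (mod p)"
  shows "\<not> p dvd s" "\<not> p dvd t"
proof -
  have "\<not> p dvd s * t"
  proof
    assume "p dvd s * t"
    then have "p dvd 1" using assms cong_dvd_iff by blast
    then show False using p_gt2 by simp
  qed
  then show "\<not> p dvd s" "\<not> p dvd t" by auto
qed

lemma sg_inverse_index: "a \<in> QK \<Longrightarrow> [s * t = 1] (mod p) \<Longrightarrow> sg s (sg t a) = a"
proof -
  assume a: "a \<in> QK" and c: "[s * t = 1] (mod p)"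
  show ?thesis using cong_1_not_dvd[OF c] sg_sg[OF a] sg_cong[OF c] sg_one_index[OF a] by simp
qed

lemma sg_eq_0_iff: "a \<in> QK \<Longrightarrow> \<not> p dvd t \<Longrightarrow> sg t a = 0 \<longleftrightarrow> a = 0"
proof
  assume a: "a \<in> QK" "\<not> p dvd t" and z: "sg t a = 0"
  obtain s where "[t * s = 1] (mod p)" using ex_inverse a(2) by blast
  then have s: "[s * t = 1] (mod p)" by (simp add: mult.commute)
  have "\<not> p dvd s" using cong_1_not_dvd[OF s] by simp
  then show "a = 0" using sg_inverse_index[OF a(1) s] z sg_0 by simp
qed (auto simp: sg_0)

lemma sg_algebraic_int:
  assumes a: "a \<in> QK" "algebraic_int a" and t: "\<not> p dvd t"
  shows "algebraic_int (sg t a)"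
proof -
  obtain h :: "int poly" where h: "ieval h a = 0" "lead_coeff h = 1"
    using a(2) algebraic_int_altdef_ipoly by blast
  have "sg t (ieval g a) = ieval g (sg t a) \<and> ieval g a \<in> QK" for g
    by (induction g) (auto simp: ieval_simps sg_0[OF t] sg_add sg_mult sg_of_int a t QK_add QK_mult QK_Zz)
  then have "ieval h (sg t a) = 0" using h(1) sg_0[OF t] by metis
  then show ?thesis using h(2) algebraic_int_altdef_ipoly by blast
qed

lemma unit_index: "t \<in> {1..<p} \<Longrightarrow> \<not> p dvd t"
  by (auto dest: nat_dvd_not_less)

lemma rational_algebraic_int_dvd:
  fixes z :: complex
  assumes "algebraic_int z" "of_nat n * z = of_int k" "n > 0"
  shows "int n dvd k"
proof -
  have e: "z = of_int k / of_nat n" using assms by (simp add: field_simps)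
  have "z \<in> \<rat>" unfolding e by (intro Rats_divide) auto
  then have "z \<in> \<int>" using assms(1) rational_algebraic_int_is_int by blast
  then obtain m where "z = of_int m" by (auto elim: Ints_cases)
  then have "complex_of_int (int n * m) = of_int k" using assms(2) by simp
  then show ?thesis by (simp only: of_int_eq_iff) auto
qed

text \<open>With n z = f(\<zeta>), the trace of \<zeta>^(-k) z is \<open>p\<close> times the k-th
  coefficient of \<open>f\<close> minus the sum of all coefficients, divided by \<open>n\<close>,
  and it is an integer. Subtracting the case k = p - 1, where the coefficient is 0, shows that
  \<open>n\<close> divides p f. So p z lies in Z[\<zeta>], and \<open>p_dvd_coeffs\<close> removes
  the factor \<open>p\<close>.\<close>

theorem QK_algebraic_int:
  assumes z: "z \<in> QK" "algebraic_int z"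
  shows "z \<in> Zz"
proof -
  obtain n f where n: "n > 0" "degree f < p - 1" "of_nat n * z = ieval f \<zeta>" using QK_repr z by blast
  have tr: "\<exists>m::complex. of_nat n * m = of_int (int p * coeff f k - (\<Sum>j<p. coeff f j)) \<and> algebraic_int m" if k: "k < p" for k
  proof (intro exI conjI)
    let ?T = "\<Sum>t\<in>{1..<p}. \<zeta> ^ (t * (p - k)) * sg t z"
    have "of_nat n * ?T = (\<Sum>t\<in>{1..<p}. \<zeta> ^ (t * (p - k)) * ieval f (\<zeta> ^ t))"
      unfolding sum_distrib_left using n sg_eq[OF n(1,3) unit_index] by (intro sum.cong) auto
    also have "\<dots> = (\<Sum>t\<in>{1..<p}. \<Sum>j<p. of_int (coeff f j) * \<zeta> ^ (t * (p - k + j)))"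
      using n(2) ieval_sum_coeff[of f p]
      by (intro sum.cong) (auto simp: sum_distrib_left power_add distrib_left mult_ac simp flip: power_mult)
    also have "\<dots> = (\<Sum>j<p. of_int (coeff f j) * (\<Sum>t\<in>{1..<p}. \<zeta> ^ (t * (p - k + j))))"
      by (subst sum.swap) (simp add: sum_distrib_left)
    also have "\<dots> = (\<Sum>j<p. of_int (coeff f j) * ((if j = k then of_nat p else 0) - 1))"
    proof (intro sum.cong refl)
      fix j assume j: "j \<in> {..<p}"
      have "p dvd p - k + j \<longleftrightarrow> j = k"
      proof
        assume "p dvd p - k + j"
        then obtain q where q: "p - k + j = p * q" by (auto elim: dvdE)
        have "0 < p - k + j" "p - k + j < p * 2" using k j by auto
        then have "0 < p * q" "p * q < p * 2" by (simp_all only: q)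
        then have "q = 1" by auto
        then show "j = k" using q k by auto
      qed (use k in auto)
      then show "of_int (coeff f j) * (\<Sum>t\<in>{1..<p}. \<zeta> ^ (t * (p - k + j))) =
        of_int (coeff f j) * ((if j = k then of_nat p else 0) - 1)"
        unfolding sum_zeta_pow_units by simp
    qed
    also have "\<dots> = of_int (int p * coeff f k - (\<Sum>j<p. coeff f j))"
    proof -
      have "(\<Sum>j<p. of_int (coeff f j) * (if j = k then of_nat p else 0)) =
          (\<Sum>j<p. if j = k then of_int (coeff f j) * of_nat p else (0 :: complex))"
        by (intro sum.cong) auto
      also have "\<dots> = of_int (coeff f k) * of_nat p" using k by simp
      finally show ?thesis by (simp add: right_diff_distrib sum_subtractf)
    qed
    finally show "of_nat n * ?T = of_int (int p * coeff f k - (\<Sum>j<p. coeff f j))" .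
    show "algebraic_int ?T"
      by (intro algebraic_int_sum algebraic_int_mult algebraic_int_power algebraic_int_zeta
          sg_algebraic_int z unit_index) auto
  qed
  have dv: "int n dvd int p * coeff f k" for k
  proof (cases "k < p")
    case True
    obtain m :: complex where m: "of_nat n * m = of_int (int p * coeff f k - (\<Sum>j<p. coeff f j))" "algebraic_int m"
      using tr[OF True] by blast
    obtain m' :: complex where m': "of_nat n * m' = of_int (int p * coeff f (p - 1) - (\<Sum>j<p. coeff f j))" "algebraic_int m'"
      using tr[of "p - 1"] p_pos by auto
    have "of_nat n * (m - m') = of_int (int p * coeff f k)"
      using m(1) m'(1) n(2) by (simp add: right_diff_distrib coeff_eq_0)
    then show ?thesis
      using rational_algebraic_int_dvd[OF algebraic_int_diff[OF m(2) m'(2)]] n(1) by blast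
  next
    case False
    then show ?thesis using n(2) by (simp add: coeff_eq_0)
  qed
  then have "[:int n:] dvd smult (int p) f" by (simp add: const_poly_dvd_iff)
  then obtain g where g: "smult (int p) f = smult (int n) g" by (auto elim!: dvdE)
  have dg: "degree g < p - 1"
    using arg_cong[OF g, of degree] n(1,2) p_pos by simp
  have "of_nat n * (of_nat p * z) = of_nat n * ieval g \<zeta>"
  proof -
    have "of_nat p * ieval f \<zeta> = of_nat n * ieval g \<zeta>"
      using arg_cong[OF g, of "\<lambda>f. ieval f \<zeta>"] by (simp add: ieval_simps)
    then show ?thesis unfolding n(3)[symmetric] by (simp only: mult.left_commute)
  qed
  then have "ieval g \<zeta> = of_nat p * z" using n(1) by simp
  then obtain h where "g = smult (int p) h" using p_dvd_coeffs[OF dg _ z(2)] by blast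
  then have "z = ieval h \<zeta>" using \<open>ieval g \<zeta> = of_nat p * z\<close> p_pos by (simp add: ieval_simps)
  then show ?thesis by simp
qed

lemma QK_algebraic_int_iff: "{z \<in> QK. algebraic_int z} = Zz"
  using QK_algebraic_int QK_Zz Zz_algebraic_int by blast

definition Nm :: "complex \<Rightarrow> complex" where
  "Nm z = (\<Prod>t\<in>{1..<p}. sg t z)"

lemma unit_perm:
  assumes "\<not> p dvd s"
  shows "bij_betw (\<lambda>t. s * t mod p) {1..<p} {1..<p}"
proof -
  have inj: "inj_on (\<lambda>t. s * t mod p) {1..<p}"
  proof (rule inj_onI)
    fix t u assume tu: "t \<in> {1..<p}" "u \<in> {1..<p}" "s * t mod p = s * u mod p"
    then have "[s * t = s * u] (mod p)" by (simp add: cong_def)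
    then have "[t = u] (mod p)" using coprime_p[OF assms] by (simp add: cong_mult_lcancel_nat)
    then show "t = u" using tu by (simp add: cong_def)
  qed
  have "(\<lambda>t. s * t mod p) ` {1..<p} \<subseteq> {1..<p}"
  proof safe
    fix t assume t: "t \<in> {1..<p}"
    then have "\<not> p dvd s * t" using assms p_prime unit_index[OF t] by (simp add: prime_dvd_mult_iff)
    then have "s * t mod p \<noteq> 0" by (simp add: dvd_eq_mod_eq_0)
    then show "s * t mod p \<in> {1..<p}" using p_pos by simp
  qed
  then show ?thesis using inj by (simp add: bij_betw_def endo_inj_surj)
qed

text \<open>The norm is Galois invariant, so p - 1 times it equals its own trace, which is an
  integer; a rational algebraic integer is an integer.\<close>

lemma Nm_int:
  assumes "z \<in> Zz"
  shows "\<exists>k. Nm z = of_int k"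
proof -
  have zq: "z \<in> QK" using assms by (rule QK_Zz)
  have N: "Nm z \<in> Zz" unfolding Nm_def using sg_Zz[OF assms unit_index] by (intro Zz_prod)
  obtain f where f: "degree f < p - 1" "Nm z = ieval f \<zeta>" using Zz_repr[OF N] by blast
  have inv: "sg s (Nm z) = Nm z" if s: "\<not> p dvd s" for s
  proof -
    have "sg s (Nm z) = (\<Prod>t\<in>{1..<p}. sg s (sg t z))"
      unfolding Nm_def using sg_QK[OF zq unit_index] s by (intro sg_prod)
    also have "\<dots> = (\<Prod>t\<in>{1..<p}. sg (s * t mod p) z)"
    proof (intro prod.cong refl)
      fix t assume "t \<in> {1..<p}"
      then have "sg s (sg t z) = sg (s * t) z" by (intro sg_sg zq s unit_index)
      also have "\<dots> = sg (s * t mod p) z" by (intro sg_cong) (simp add: cong_def)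
      finally show "sg s (sg t z) = sg (s * t mod p) z" .
    qed
    also have "\<dots> = Nm z" unfolding Nm_def by (rule prod.reindex_bij_betw[OF unit_perm[OF s]])
    finally show ?thesis .
  qed
  have "of_nat (p - 1) * Nm z = (\<Sum>t\<in>{1..<p}. sg t (Nm z))" using inv[OF unit_index] by simp
  also have "\<dots> = (\<Sum>t\<in>{1..<p}. \<Sum>j<p. of_int (coeff f j) * \<zeta> ^ (t * j))"
  proof (intro sum.cong refl)
    fix t assume t: "t \<in> {1..<p}"
    show "sg t (Nm z) = (\<Sum>j<p. of_int (coeff f j) * \<zeta> ^ (t * j))"
      unfolding f(2) sg_ieval[OF unit_index[OF t]] power_mult using f(1) by (intro ieval_sum_coeff) simp
  qed
  also have "\<dots> = (\<Sum>j<p. of_int (coeff f j) * (\<Sum>t\<in>{1..<p}. \<zeta> ^ (t * j)))"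
    by (subst sum.swap) (simp add: sum_distrib_left)
  also have "\<dots> = of_int (\<Sum>j<p. coeff f j * ((if p dvd j then int p else 0) - 1))"
    unfolding sum_zeta_pow_units of_int_sum by (intro sum.cong) auto
  finally have e: "of_nat (p - 1) * Nm z = of_int (\<Sum>j<p. coeff f j * ((if p dvd j then int p else 0) - 1))" .
  then obtain m where "(\<Sum>j<p. coeff f j * ((if p dvd j then int p else 0) - 1)) = int (p - 1) * m"
    using rational_algebraic_int_dvd[OF Zz_algebraic_int[OF N] e] p_gt2 by (auto elim: dvdE)
  then have "of_nat (p - 1) * Nm z = of_nat (p - 1) * of_int m" using e by simp
  then show ?thesis using p_gt2 by (intro exI[of _ m]) auto
qed

lemma Nm_factor:
  assumes "z \<in> Zz"
  shows "\<exists>w\<in>Zz. Nm z = z * w"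
proof -
  have "{1..<p} = insert 1 {2..<p}" using p_gt2 by auto
  then have "Nm z = sg 1 z * (\<Prod>t\<in>{2..<p}. sg t z)" by (simp add: Nm_def)
  moreover have "(\<Prod>t\<in>{2..<p}. sg t z) \<in> Zz" by (intro Zz_prod sg_Zz assms unit_index) auto
  ultimately show ?thesis using sg_one_index[OF QK_Zz[OF assms]] by metis
qed

end

subsection \<open>Jacobi sums\<close>

lemma sum_mod_affine:
  fixes f :: "int \<Rightarrow> complex"
  assumes q: "q > 0" and per: "\<And>a. f (a mod q) = f a" and k: "coprime k q"
  shows "(\<Sum>x\<in>{0..<q}. f (k * x + e)) = (\<Sum>x\<in>{0..<q}. f x)"
proof -
  have inj: "inj_on (\<lambda>x. (k * x + e) mod q) {0..<q}"
  proof (rule inj_onI)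
    fix x y assume xy: "x \<in> {0..<q}" "y \<in> {0..<q}" "(k * x + e) mod q = (k * y + e) mod q"
    then have "[k * x + e = k * y + e] (mod q)" by (simp add: cong_def)
    then have "[k * x = k * y] (mod q)" by (simp add: cong_add_rcancel)
    then have "[x = y] (mod q)" using k by (simp add: cong_mult_lcancel)
    then show "x = y" using xy by (simp add: cong_def)
  qed
  have "(\<lambda>x. (k * x + e) mod q) ` {0..<q} \<subseteq> {0..<q}" using q by auto
  then have "bij_betw (\<lambda>x. (k * x + e) mod q) {0..<q} {0..<q}"
    using inj by (simp add: bij_betw_def endo_inj_surj)
  then have "(\<Sum>x\<in>{0..<q}. f ((k * x + e) mod q)) = (\<Sum>x\<in>{0..<q}. f x)"
    by (rule sum.reindex_bij_betw)
  then show ?thesis by (simp only: per)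
qed

text \<open>Multiplicative characters modulo \<open>q\<close>, extended by 0. The trivial character
  is included; where nontriviality matters it is expressed by a vanishing sum.\<close>

definition mchar :: "nat \<Rightarrow> (int \<Rightarrow> complex) \<Rightarrow> bool" where
  "mchar q \<chi> \<longleftrightarrow> (\<forall>a. \<chi> (a mod int q) = \<chi> a) \<and> (\<forall>a b. \<chi> (a * b) = \<chi> a * \<chi> b) \<and>
     (\<forall>a. int q dvd a \<longrightarrow> \<chi> a = 0) \<and> (\<forall>a. \<not> int q dvd a \<longrightarrow> \<chi> a * cnj (\<chi> a) = 1)"

lemma mchar_one: "mchar q \<chi> \<Longrightarrow> prime q \<Longrightarrow> \<chi> 1 = 1"
proof -
  assume c: "mchar q \<chi>" and q: "prime q"
  have "\<not> int q dvd 1" using q prime_gt_1_nat[OF q] by simp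
  then have n: "\<chi> 1 * cnj (\<chi> 1) = 1" using c by (simp add: mchar_def)
  then have "\<chi> 1 \<noteq> 0" by auto
  moreover have "\<chi> (1 * 1) = \<chi> 1 * \<chi> 1" using c unfolding mchar_def by blast
  ultimately show ?thesis by simp
qed

lemma mchar_cong: "mchar q \<chi> \<Longrightarrow> [a = b] (mod int q) \<Longrightarrow> \<chi> a = \<chi> b"
  unfolding mchar_def cong_def by metis

lemma mchar_cnj:
  assumes c: "mchar q \<chi>" and q: "prime q" and e: "[a * b = 1] (mod int q)"
  shows "cnj (\<chi> a) = \<chi> b"
proof -
  have ab: "\<chi> a * \<chi> b = 1"
    using mchar_cong[OF c e] mchar_one[OF c q] c by (simp add: mchar_def)
  have "\<not> int q dvd a"
  proof
    assume "int q dvd a"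
    then have "\<chi> a = 0" using c by (simp add: mchar_def)
    then show False using ab by simp
  qed
  then have n: "\<chi> a * cnj (\<chi> a) = 1" using c by (simp add: mchar_def)
  then have "\<chi> a * cnj (\<chi> a) = \<chi> a * \<chi> b" using ab by simp
  moreover have "\<chi> a \<noteq> 0" using ab by auto
  ultimately show ?thesis by simp
qed

lemma sum_mod_inverse:
  fixes f :: "int \<Rightarrow> complex"
  assumes q: "prime q"
  shows "\<exists>g. (\<forall>e\<in>{1..<int q}. [e * g e = 1] (mod int q)) \<and>
    (\<forall>h::int \<Rightarrow> complex. (\<Sum>e\<in>{1..<int q}. h (g e)) = (\<Sum>e\<in>{1..<int q}. h e))"
proof -
  have ex: "\<exists>w\<in>{1..<int q}. [e * w = 1] (mod int q)" if e: "e \<in> {1..<int q}" for e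
  proof -
    have "\<not> int q dvd e" using e by (auto dest: zdvd_imp_le)
    then have "coprime e (int q)" using q by (metis coprime_commute prime_imp_coprime prime_nat_int_transfer)
    then obtain w where w: "[e * w = 1] (mod int q)" using cong_solve_coprime_int by blast
    then have c: "[e * (w mod int q) = 1] (mod int q)" by (simp add: cong_def mod_simps)
    have "w mod int q \<noteq> 0"
    proof
      assume "w mod int q = 0"
      then have "[0 = 1] (mod int q)" using c by simp
      then show False using prime_gt_1_nat[OF q] by (simp add: cong_def)
    qed
    moreover have "0 \<le> w mod int q" "w mod int q < int q" using prime_gt_0_nat[OF q] by auto
    ultimately have "w mod int q \<in> {1..<int q}" by auto
    then show ?thesis using c by blast
  qed
  then obtain g where g: "\<And>e. e \<in> {1..<int q} \<Longrightarrow> g e \<in> {1..<int q} \<and> [e * g e = 1] (mod int q)"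
    by metis
  have "inj_on g {1..<int q}"
  proof (rule inj_onI)
    fix x y assume xy: "x \<in> {1..<int q}" "y \<in> {1..<int q}" "g x = g y"
    have "[x = x * (y * g y)] (mod int q)"
      using cong_mult[OF cong_refl[of x] g[THEN conjunct2, OF xy(2)]] by (simp add: cong_sym_eq)
    also have "x * (y * g y) = y * (x * g x)" using xy(3) by simp
    also have "[y * (x * g x) = y] (mod int q)"
      using cong_mult[OF cong_refl[of y] g[THEN conjunct2, OF xy(1)]] by simp
    finally show "x = y" using xy by (simp add: cong_def)
  qed
  moreover have "g ` {1..<int q} \<subseteq> {1..<int q}" using g by blast
  ultimately have b: "bij_betw g {1..<int q} {1..<int q}" by (simp add: bij_betw_def endo_inj_surj)
  show ?thesis using g sum.reindex_bij_betw[OF b] by blast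
qed

text \<open>A direct computation without Gauss sums: substituting \<open>a = u c\<close> in the
  double sum for \<open>J * cnj J\<close> leaves an inner sum over \<open>c\<close> that depends on
  \<open>u\<close> only. Nontriviality of \<chi>, \<psi> and their product enters through the three
  vanishing sums.\<close>

lemma jacobi_sum_norm:
  assumes q: "prime q" and c1: "mchar q \<chi>" and c2: "mchar q \<psi>"
    and s2: "(\<Sum>a\<in>{0..<int q}. \<psi> a) = 0" and s1: "(\<Sum>a\<in>{0..<int q}. \<chi> a) = 0"
    and s12: "(\<Sum>a\<in>{0..<int q}. \<chi> a * \<psi> a) = 0"
  defines "J \<equiv> \<Sum>a\<in>{0..<int q}. \<chi> a * \<psi> (1 - a)"
  shows "J * cnj J = of_nat q"
proof -
  let ?F = "{0..<int q}"
  have q1: "int q > 1" using prime_gt_1_nat[OF q] by simp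
  have split0: "?F = insert 0 {1..<int q}" using q1 by auto
  have per1: "\<chi> (a mod int q) = \<chi> a" and per2: "\<psi> (a mod int q) = \<psi> a" for a
    using c1 c2 by (auto simp: mchar_def)
  have mul1: "\<chi> (a * b) = \<chi> a * \<chi> b" and mul2: "\<psi> (a * b) = \<psi> a * \<psi> b" for a b
    using c1 c2 by (auto simp: mchar_def)
  have z1: "\<chi> 0 = 0" and z2: "\<psi> 0 = 0" using c1 c2 by (auto simp: mchar_def)
  have cop: "coprime a (int q)" if "\<not> int q dvd a" for a
    using that q by (metis coprime_commute prime_imp_coprime prime_nat_int_transfer)
  have nd: "\<not> int q dvd a" if "a \<in> {1..<int q}" for a using that by (auto dest: zdvd_imp_le)
  define S where "S = (\<lambda>u. \<Sum>c\<in>?F. \<psi> (1 - u * c) * cnj (\<psi> (1 - c)))"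
  have Sval: "S u = (if u = 1 then of_nat q - 1 else - \<psi> u)" if u: "u \<in> ?F" for u
  proof -
    obtain g where g: "\<And>e. e \<in> {1..<int q} \<Longrightarrow> [e * g e = 1] (mod int q)"
      "\<And>h::int \<Rightarrow> complex. (\<Sum>e\<in>{1..<int q}. h (g e)) = (\<Sum>e\<in>{1..<int q}. h e)"
      using sum_mod_inverse[OF q] by blast
    \<comment> \<open>With e = 1 - c and w the inverse of e, the quotient (1 - u c) / (1 - c) equals
      (1 - u) w + u. The sum over \<open>c\<close> becomes one over nonzero \<open>w\<close>; the
      missing term w = 0 is \<open>\<psi> u\<close>.\<close>
    define h where "h = (\<lambda>w. \<psi> ((1 - u) * w + u))"
    define f where "f = (\<lambda>c. \<psi> (1 - u * c) * cnj (\<psi> (1 - c)))"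
    have pf: "f (a mod int q) = f a" for a
    proof -
      have "[1 - u * (a mod int q) = 1 - u * a] (mod int q)"
        by (intro cong_diff cong_mult cong_refl) (simp add: cong_def)
      then have "\<psi> (1 - u * (a mod int q)) = \<psi> (1 - u * a)"
        by (rule mchar_cong[OF c2])
      moreover have "\<psi> (1 - a mod int q) = \<psi> (1 - a)"
        by (rule mchar_cong[OF c2]) (simp add: cong_def mod_simps)
      ultimately show ?thesis by (simp add: f_def)
    qed
    have "S u = (\<Sum>c\<in>?F. f c)" by (simp add: S_def f_def)
    also have "\<dots> = (\<Sum>e\<in>?F. f (-1 * e + 1))"
      by (rule sum_mod_affine[symmetric]) (use q1 pf in auto)
    also have "\<dots> = (\<Sum>e\<in>{1..<int q}. f (-1 * e + 1))"
      unfolding split0 by (simp add: f_def z2)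
    also have "\<dots> = (\<Sum>e\<in>{1..<int q}. h (g e))"
    proof (rule sum.cong[OF refl])
      fix e assume e: "e \<in> {1..<int q}"
      have "f (-1 * e + 1) = \<psi> (1 - u + u * e) * cnj (\<psi> e)"
        by (simp add: f_def algebra_simps)
      also have "cnj (\<psi> e) = \<psi> (g e)" by (rule mchar_cnj[OF c2 q g(1)[OF e]])
      also have "\<psi> (1 - u + u * e) * \<psi> (g e) = \<psi> ((1 - u + u * e) * g e)" by (simp only: mul2)
      also have "\<dots> = \<psi> ((1 - u) * g e + u)"
      proof (rule mchar_cong[OF c2])
        have "[(1 - u) * g e + u * (e * g e) = (1 - u) * g e + u * 1] (mod int q)"
          by (intro cong_add cong_mult cong_refl g(1) e)
        then show "[(1 - u + u * e) * g e = (1 - u) * g e + u] (mod int q)"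
          by (simp add: algebra_simps)
      qed
      finally show "f (-1 * e + 1) = h (g e)" by (simp add: h_def)
    qed
    also have "\<dots> = (\<Sum>w\<in>{1..<int q}. h w)" by (rule g(2))
    also have "\<dots> = (\<Sum>w\<in>?F. h w) - \<psi> u" unfolding split0 by (simp add: h_def)
    also have "(\<Sum>w\<in>?F. h w) = (if u = 1 then of_nat q else 0)"
    proof (cases "u = 1")
      case True
      then show ?thesis by (simp add: h_def mchar_one[OF c2 q])
    next
      case False
      have "\<not> int q dvd 1 - u"
      proof
        assume d: "int q dvd 1 - u"
        have "\<bar>1 - u\<bar> < int q" "1 - u \<noteq> 0" using u False q1 by auto
        then show False using d zdvd_imp_le[of "int q" "\<bar>1 - u\<bar>"] by simp
      qed
      then have "(\<Sum>w\<in>?F. h w) = (\<Sum>w\<in>?F. \<psi> w)"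
        unfolding h_def using cop per2 q1 by (intro sum_mod_affine) auto
      then show ?thesis using s2 False by simp
    qed
    finally show ?thesis by (auto simp: mchar_one[OF c2 q])
  qed
  have inner: "(\<Sum>a\<in>?F. \<chi> a * \<psi> (1 - a)) * (cnj (\<chi> c) * cnj (\<psi> (1 - c))) =
      (\<Sum>u\<in>?F. \<chi> u * (\<psi> (1 - u * c) * cnj (\<psi> (1 - c))))" if c: "c \<in> {1..<int q}" for c
  proof -
    have e1: "(\<Sum>a\<in>?F. \<chi> a * \<psi> (1 - a)) = (\<Sum>u\<in>?F. \<chi> (c * u + 0) * \<psi> (1 - (c * u + 0)))"
    proof (rule sum_mod_affine[symmetric])
      show "coprime c (int q)" using cop nd c by blast
      show "\<chi> (a mod int q) * \<psi> (1 - a mod int q) = \<chi> a * \<psi> (1 - a)" for a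
      proof -
        have "\<psi> (1 - a mod int q) = \<psi> (1 - a)"
          by (rule mchar_cong[OF c2]) (simp add: cong_def mod_simps)
        then show ?thesis by (simp add: per1)
      qed
    qed (use q1 in auto)
    have nc: "\<chi> c * cnj (\<chi> c) = 1" using c1 nd[OF c] by (simp add: mchar_def)
    have e2: "\<chi> (c * u + 0) * \<psi> (1 - (c * u + 0)) * (cnj (\<chi> c) * cnj (\<psi> (1 - c))) =
        \<chi> u * (\<psi> (1 - u * c) * cnj (\<psi> (1 - c)))" for u
    proof -
      have cu: "c * u + 0 = u * c" by simp
      have "\<chi> (u * c) * \<psi> (1 - u * c) * (cnj (\<chi> c) * cnj (\<psi> (1 - c))) =
          (\<chi> c * cnj (\<chi> c)) * (\<chi> u * (\<psi> (1 - u * c) * cnj (\<psi> (1 - c))))"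
        unfolding mul1 by (simp only: mult_ac)
      then show ?thesis unfolding cu using nc by simp
    qed
    show ?thesis unfolding e1 sum_distrib_right by (intro sum.cong refl e2)
  qed
  have "J * cnj J = J * (\<Sum>c\<in>?F. cnj (\<chi> c) * cnj (\<psi> (1 - c)))" by (simp add: J_def cnj_sum)
  also have "\<dots> = J * (\<Sum>c\<in>{1..<int q}. cnj (\<chi> c) * cnj (\<psi> (1 - c)))" unfolding split0 by (simp add: z1)
  also have "\<dots> = (\<Sum>c\<in>{1..<int q}. \<Sum>u\<in>?F. \<chi> u * (\<psi> (1 - u * c) * cnj (\<psi> (1 - c))))"
    unfolding sum_distrib_left by (intro sum.cong refl) (use inner in \<open>simp add: J_def\<close>)
  also have "\<dots> = (\<Sum>u\<in>?F. \<Sum>c\<in>{1..<int q}. \<chi> u * (\<psi> (1 - u * c) * cnj (\<psi> (1 - c))))"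
    by (rule sum.swap)
  also have "\<dots> = (\<Sum>u\<in>?F. \<chi> u * (S u - 1))"
  proof (intro sum.cong refl)
    fix u
    \<comment> \<open>The index c = 0 belongs to \<open>S u\<close> but not to the inner sum, since
      \<open>\<chi> 0 = 0\<close>; its term is 1.\<close>
    have "S u = 1 + (\<Sum>c\<in>{1..<int q}. \<psi> (1 - u * c) * cnj (\<psi> (1 - c)))"
      unfolding S_def split0 by (simp add: mchar_one[OF c2 q])
    then show "(\<Sum>c\<in>{1..<int q}. \<chi> u * (\<psi> (1 - u * c) * cnj (\<psi> (1 - c)))) = \<chi> u * (S u - 1)"
      by (simp add: sum_distrib_left)
  qed
  also have "\<dots> = (\<Sum>u\<in>?F. \<chi> u * S u)" using s1 by (simp add: right_diff_distrib sum_subtractf)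
  also have "\<dots> = (of_nat q - 1) + (\<Sum>u\<in>?F - {1}. \<chi> u * S u)"
    using q1 Sval[of 1] by (subst sum.remove[of _ 1]) (simp_all add: mchar_one[OF c1 q])
  also have "(\<Sum>u\<in>?F - {1}. \<chi> u * S u) = - (\<Sum>u\<in>?F - {1}. \<chi> u * \<psi> u)"
    unfolding sum_negf[symmetric] by (intro sum.cong) (auto simp: Sval)
  also have "(\<Sum>u\<in>?F - {1}. \<chi> u * \<psi> u) = - 1"
  proof -
    have "(\<Sum>u\<in>?F. \<chi> u * \<psi> u) = 1 + (\<Sum>u\<in>?F - {1}. \<chi> u * \<psi> u)"
      using q1 by (subst sum.remove[of _ 1]) (simp_all add: mchar_one[OF c1 q] mchar_one[OF c2 q])
    then show ?thesis using s12 by (simp add: eq_neg_iff_add_eq_0 add.commute)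
  qed
  finally show ?thesis by simp
qed

text \<open>Summing (a+1)^(k+1) - a^(k+1) telescopes to a multiple of \<open>q\<close>; its binomial
  expansion expresses k + 1 times the k-th power sum by lower ones, and k + 1 < q is
  invertible.\<close>

lemma power_sum_mod_prime:
  assumes q: "prime q" and k: "k < q - 1"
  shows "int q dvd (\<Sum>a<q. int a ^ k)"
  using k
proof (induction k rule: less_induct)
  case (less k)
  have "(int a + 1) ^ Suc k - int a ^ Suc k = (\<Sum>i\<le>k. of_nat (Suc k choose i) * int a ^ i)" for a
    by (subst binomial_ring) (simp add: lessThan_Suc_atMost[symmetric])
  then have "(\<Sum>a<q. (int a + 1) ^ Suc k - int a ^ Suc k) = (\<Sum>a<q. \<Sum>i\<le>k. of_nat (Suc k choose i) * int a ^ i)"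
    by simp
  moreover have "(\<Sum>a<q. (int a + 1) ^ Suc k - int a ^ Suc k) = int q ^ Suc k"
    using sum_lessThan_telescope[of "\<lambda>a. int a ^ Suc k" q] by (simp add: add.commute)
  ultimately have "int q ^ Suc k = (\<Sum>i\<le>k. of_nat (Suc k choose i) * (\<Sum>a<q. int a ^ i))"
    by (subst (asm) sum.swap) (simp add: sum_distrib_left)
  also have "\<dots> = (\<Sum>i<k. of_nat (Suc k choose i) * (\<Sum>a<q. int a ^ i)) + int (Suc k) * (\<Sum>a<q. int a ^ k)"
    by (simp add: lessThan_Suc_atMost[symmetric])
  finally have "int (Suc k) * (\<Sum>a<q. int a ^ k) =
      int q ^ Suc k - (\<Sum>i<k. of_nat (Suc k choose i) * (\<Sum>a<q. int a ^ i))" by simp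
  moreover have "int q dvd int q ^ Suc k - (\<Sum>i<k. of_nat (Suc k choose i) * (\<Sum>a<q. int a ^ i))"
  proof (rule dvd_diff)
    show "int q dvd (\<Sum>i<k. of_nat (Suc k choose i) * (\<Sum>a<q. int a ^ i))"
      by (rule dvd_sum, rule dvd_mult, rule less.IH) (use less.prems in auto)
  qed simp
  ultimately have d: "int q dvd int (Suc k) * (\<Sum>a<q. int a ^ k)" by simp
  have "\<not> q dvd Suc k" using less.prems by (auto dest: dvd_imp_le)
  then have "\<not> int q dvd int (Suc k)" using int_dvd_int_iff by blast
  moreover have "prime (int q)" using q by simp
  ultimately show ?case using d prime_dvd_mult_iff by blast
qed

lemma poly_sum_mod_prime:
  fixes P :: "int poly"
  assumes q: "prime q" and d: "degree P < q - 1"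
  shows "int q dvd (\<Sum>a\<in>{0..<int q}. poly P a)"
proof -
  have "(\<Sum>a\<in>{0..<int q}. poly P a) = (\<Sum>a<q. poly P (int a))"
  proof -
    have "{0..<int q} = int ` {..<q}" using image_int_atLeastLessThan[of 0 q] by (simp add: atLeast0LessThan)
    then show ?thesis by (simp add: sum.reindex)
  qed
  also have "\<dots> = (\<Sum>a<q. \<Sum>i\<le>degree P. coeff P i * int a ^ i)" by (simp add: poly_altdef)
  also have "\<dots> = (\<Sum>i\<le>degree P. coeff P i * (\<Sum>a<q. int a ^ i))"
    by (subst sum.swap) (simp add: sum_distrib_left)
  also have "int q dvd \<dots>" by (rule dvd_sum, rule dvd_mult, rule power_sum_mod_prime[OF q]) (use d in auto)
  finally show ?thesis .
qed

lemma fermat_theorem_int: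
  assumes q: "prime q" and a: "\<not> int q dvd a"
  shows "[a ^ (q - 1) = 1] (mod int q)"
proof -
  define c where "c = nat (a mod int q)"
  have c: "int c = a mod int q" using prime_gt_0_nat[OF q] by (simp add: c_def)
  have "\<not> q dvd c"
  proof
    assume "q dvd c"
    then have "int q dvd a mod int q" using c int_dvd_int_iff[of q c] by simp
    then show False using a by (simp add: dvd_mod_iff)
  qed
  then have "[c ^ (q - 1) = 1] (mod q)" using fermat_theorem q by blast
  then have "[int (c ^ (q - 1)) = int 1] (mod int q)" by (simp only: cong_int_iff)
  then have "[(a mod int q) ^ (q - 1) = 1] (mod int q)" using c by simp
  moreover have "[(a mod int q) ^ (q - 1) = a ^ (q - 1)] (mod int q)" by (intro cong_pow) (simp add: cong_def)
  ultimately show ?thesis using cong_sym cong_trans by blast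
qed

lemma mchar_power:
  assumes c: "mchar q \<chi>" and b: "b > 0"
  shows "mchar q (\<lambda>a. \<chi> a ^ b)"
proof -
  have "\<chi> a ^ b * cnj (\<chi> a ^ b) = 1" if "\<not> int q dvd a" for a
  proof -
    have "\<chi> a * cnj (\<chi> a) = 1" using that c by (simp add: mchar_def)
    then show ?thesis by (simp only: power_mult_distrib[symmetric] complex_cnj_power power_one)
  qed
  then show ?thesis using c b by (simp add: mchar_def power_mult_distrib)
qed

context cyclo
begin

text \<open>With m = (q-1)/p the power a^m is a \<open>p\<close>-th root of unity modulo
  \<open>q\<close>, hence some r^(ind a); sending \<open>r\<close> to \<zeta> yields the
  \<open>p\<close>-th power residue character. It is nontrivial because X^m = 1 has at most
  \<open>m\<close> roots.\<close>

lemma residue_character: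
  assumes q: "prime q" and r: "[r ^ p = 1] (mod q)" "\<not> [r = 1] (mod q)" and m: "q - 1 = p * m"
  shows "\<exists>ind. (\<forall>a. \<not> int q dvd a \<longrightarrow> [int r ^ ind a = a ^ m] (mod int q)) \<and>
    mchar q (\<lambda>a. if int q dvd a then 0 else \<zeta> ^ ind a) \<and>
    (\<forall>k. \<not> p dvd k \<longrightarrow> (\<Sum>a\<in>{0..<int q}. (if int q dvd a then 0 else \<zeta> ^ ind a) ^ k) = 0)"
proof -
  have q1: "q > 1" using prime_gt_1_nat[OF q] .
  have ndr: "\<not> q dvd r"
  proof
    assume "q dvd r"
    then have "q dvd r ^ p" using p_pos by (meson dvd_power dvd_trans)
    then have "q dvd 1" using r(1) cong_dvd_iff by blast
    then show False using q1 by simp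
  qed
  then have cop: "coprime q r" using q prime_imp_coprime by blast
  have "ord q r dvd p" using r(1) ord_divides by blast
  moreover have "ord q r \<noteq> 1" using r(2) ord_works[of r q] by auto
  ultimately have ordp: "ord q r = p" using p_prime prime_nat_iff by blast
  have rpow: "[r ^ i = r ^ j] (mod q) \<longleftrightarrow> [i = j] (mod p)" for i j
    using order_divides_expdiff[OF cop] ordp by simp
  have rpow_int: "[int r ^ i = int r ^ j] (mod int q) \<longleftrightarrow> [i = j] (mod p)" for i j
    using rpow[of i j] cong_int_iff[of "r ^ i" "r ^ j" q] by simp
  have m0: "m > 0" using m q1 by (cases m) auto
  \<comment> \<open>The \<open>p\<close> distinct powers of \<open>r\<close> already exhaust the
    \<open>p\<close>-th roots of unity modulo \<open>q\<close>, of which there are at most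
    \<open>p\<close>.\<close>
  let ?A = "{x\<in>{..<q}. [x ^ p = 1] (mod q)}"
  let ?B = "(\<lambda>j. r ^ j mod q) ` {..<p}"
  have cA: "card ?A \<le> p" by (rule roots_mod_prime_bound[OF q]) (use p_pos in simp)
  have "inj_on (\<lambda>j. r ^ j mod q) {..<p}"
    using rpow by (intro inj_onI) (auto simp: cong_def)
  then have cB: "card ?B = p" by (simp add: card_image)
  have "[(r ^ j mod q) ^ p = 1] (mod q)" for j
  proof -
    have "[(r ^ j mod q) ^ p = (r ^ j) ^ p] (mod q)" by (intro cong_pow) (simp add: cong_def)
    also have "(r ^ j) ^ p = (r ^ p) ^ j" by (metis power_mult mult.commute)
    also have "[(r ^ p) ^ j = 1 ^ j] (mod q)" by (intro cong_pow r)
    finally show ?thesis by simp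
  qed
  then have sub: "?B \<subseteq> ?A" using q1 by auto
  have BA: "?B = ?A" by (rule card_seteq[OF _ sub]) (use cA cB in auto)
  have "\<exists>j. [int r ^ j = a ^ m] (mod int q)" if a: "\<not> int q dvd a" for a
  proof -
    define x where "x = nat (a ^ m mod int q)"
    have x: "int x = a ^ m mod int q" using q1 by (simp add: x_def)
    have "[int x ^ p = (a ^ m) ^ p] (mod int q)" unfolding x by (intro cong_pow) (simp add: cong_def)
    also have "(a ^ m) ^ p = a ^ (q - 1)" by (simp only: m mult.commute[of p m] power_mult)
    also have "[a ^ (q - 1) = 1] (mod int q)" by (rule fermat_theorem_int[OF q a])
    finally have "[int (x ^ p) = int 1] (mod int q)" by simp
    then have "[x ^ p = 1] (mod q)" by (simp only: cong_int_iff)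
    moreover have "int x < int q" unfolding x using q1 by simp
    ultimately have "x \<in> ?B" unfolding BA by simp
    then obtain j where "x = r ^ j mod q" by auto
    then have "[r ^ j = x] (mod q)" by (simp add: cong_def)
    then have "[int (r ^ j) = int x] (mod int q)" by (simp only: cong_int_iff)
    moreover have "[int x = a ^ m] (mod int q)" unfolding x by (simp add: cong_def)
    ultimately have "[int (r ^ j) = a ^ m] (mod int q)" using cong_trans by blast
    then show ?thesis by auto
  qed
  then obtain ind where ind: "\<And>a. \<not> int q dvd a \<Longrightarrow> [int r ^ ind a = a ^ m] (mod int q)" by metis
  define \<chi> where "\<chi> = (\<lambda>a. if int q dvd a then 0 else \<zeta> ^ ind a)"
  have chi_eq: "\<chi> a = \<zeta> ^ j" if "\<not> int q dvd a" "[int r ^ j = a ^ m] (mod int q)" for a j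
  proof -
    have "[int r ^ ind a = int r ^ j] (mod int q)" using ind[OF that(1)] that(2) cong_sym cong_trans by blast
    then show ?thesis using that(1) zeta_pow_cong rpow_int by (auto simp: \<chi>_def)
  qed
  have pq: "prime (int q)" using q by simp
  have char: "mchar q \<chi>"
    unfolding mchar_def
  proof (intro conjI allI impI)
    fix a b
    show "\<chi> (a mod int q) = \<chi> a"
    proof (cases "int q dvd a")
      case False
      have "[(a mod int q) ^ m = a ^ m] (mod int q)" by (intro cong_pow) (simp add: cong_def)
      then have "[int r ^ ind a = (a mod int q) ^ m] (mod int q)"
        using ind[OF False] cong_sym cong_trans by blast
      then have "\<chi> (a mod int q) = \<zeta> ^ ind a" using False by (intro chi_eq) (simp_all add: dvd_mod_iff)
      then show ?thesis using False by (simp add: \<chi>_def)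
    qed (simp add: \<chi>_def dvd_mod_iff)
    show "\<chi> (a * b) = \<chi> a * \<chi> b"
    proof (cases "int q dvd a \<or> int q dvd b")
      case False
      then have "\<not> int q dvd a * b" using prime_dvd_mult_iff[OF pq] by blast
      moreover have "[int r ^ (ind a + ind b) = (a * b) ^ m] (mod int q)"
        unfolding power_add power_mult_distrib using False by (intro cong_mult ind) auto
      ultimately have "\<chi> (a * b) = \<zeta> ^ (ind a + ind b)" by (rule chi_eq)
      then show ?thesis using False by (simp add: \<chi>_def power_add)
    qed (auto simp: \<chi>_def)
    show "int q dvd a \<Longrightarrow> \<chi> a = 0" by (simp add: \<chi>_def)
    have "\<zeta> ^ k * cnj (\<zeta> ^ k) = 1" for k
      using cnj_zeta_mult by (simp add: mult.commute flip: power_mult_distrib)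
    then show "\<not> int q dvd a \<Longrightarrow> \<chi> a * cnj (\<chi> a) = 1" by (simp only: \<chi>_def if_False)
  qed
  have "\<exists>a0. \<not> int q dvd a0 \<and> \<chi> a0 \<noteq> 1"
  proof (rule ccontr)
    assume "\<not> ?thesis"
    then have all1: "\<And>a. \<not> int q dvd a \<Longrightarrow> \<chi> a = 1" by blast
    have "{1..<q} \<subseteq> {x\<in>{..<q}. [x ^ m = 1] (mod q)}"
    proof safe
      fix x assume x: "x \<in> {1..<q}"
      then have nd: "\<not> int q dvd int x" by (auto dest: zdvd_imp_le)
      have "\<zeta> ^ ind (int x) = \<zeta> ^ 0" using all1[OF nd] nd by (simp add: \<chi>_def)
      then have "[int r ^ ind (int x) = int r ^ 0] (mod int q)" using zeta_pow_eq_iff rpow_int by blast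
      then have "[int (x ^ m) = int 1] (mod int q)" using ind[OF nd] cong_sym cong_trans by force
      then show "[x ^ m = 1] (mod q)" by (simp only: cong_int_iff)
      show "x < q" using x by simp
    qed
    then have "card {1..<q} \<le> card {x\<in>{..<q}. [x ^ m = 1] (mod q)}" by (intro card_mono) auto
    also have "\<dots> \<le> m" by (rule roots_mod_prime_bound[OF q m0])
    finally have "p * m \<le> 1 * m" using m by simp
    then show False using m0 p_gt2 by simp
  qed
  then obtain a0 where a0: "\<not> int q dvd a0" "\<chi> a0 \<noteq> 1" by blast
  have sum0: "(\<Sum>a\<in>{0..<int q}. \<chi> a ^ k) = 0" if k: "\<not> p dvd k" for k
  proof -
    have "\<chi> a0 ^ k \<noteq> 1"
    proof
      assume "\<chi> a0 ^ k = 1"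
      then have "\<zeta> ^ (ind a0 * k) = 1" using a0(1) by (simp add: \<chi>_def power_mult)
      then have "p dvd ind a0" using k p_prime by (simp add: zeta_pow_1_iff prime_dvd_mult_iff)
      then show False using a0 zeta_pow_1_iff by (simp add: \<chi>_def)
    qed
    moreover have "(\<Sum>a\<in>{0..<int q}. \<chi> a ^ k) = (\<Sum>a\<in>{0..<int q}. \<chi> (a0 * a + 0) ^ k)"
    proof (rule sum_mod_affine[symmetric])
      show "coprime a0 (int q)" using a0(1) pq by (metis coprime_commute prime_imp_coprime)
      show "\<chi> (a mod int q) ^ k = \<chi> a ^ k" for a using char by (simp add: mchar_def)
    qed (use q1 in simp)
    moreover have "\<dots> = \<chi> a0 ^ k * (\<Sum>a\<in>{0..<int q}. \<chi> a ^ k)"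
      using char by (simp add: mchar_def power_mult_distrib sum_distrib_left)
    ultimately show ?thesis by simp
  qed
  show ?thesis using ind char sum0 unfolding \<chi>_def by blast
qed

text \<open>The Jacobi sum of \<chi> and \<chi>^b, kept as a polynomial \<open>F\<close> so that r^s
  can be substituted for \<zeta>. The substitution turns \<open>\<chi> a\<close> into a^(m s) modulo
  \<open>q\<close>, and the sum becomes that of a polynomial in \<open>a\<close> of degree m (s + (b
  s mod p)). If this is below q - 1 = m p, the sum vanishes modulo \<open>q\<close>.\<close>

lemma jacobi_poly:
  assumes q: "prime q" and r: "[r ^ p = 1] (mod q)" "\<not> [r = 1] (mod q)" and b: "1 \<le> b" "b \<le> p - 2"
  shows "\<exists>F. ieval F \<zeta> * cnj (ieval F \<zeta>) = of_nat q \<and>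
    (\<forall>s\<in>{1..<p}. s + b * s mod p < p \<longrightarrow> int q dvd poly F (int r ^ s))"
proof -
  have q1: "q > 1" using prime_gt_1_nat[OF q] .
  have ndr: "\<not> q dvd r"
  proof
    assume "q dvd r"
    then have "q dvd r ^ p" using p_pos by (meson dvd_power dvd_trans)
    then have "q dvd 1" using r(1) cong_dvd_iff by blast
    then show False using q1 by simp
  qed
  have "ord q r dvd p" using r(1) ord_divides by blast
  moreover have "ord q r \<noteq> 1" using r(2) ord_works[of r q] by auto
  ultimately have ordp: "ord q r = p" using p_prime prime_nat_iff by blast
  have "[r ^ (q - 1) = 1] (mod q)" by (rule fermat_theorem[OF q ndr])
  then have "p dvd q - 1" using ord_divides ordp by blast
  then obtain m where m: "q - 1 = p * m" by (auto elim: dvdE)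
  have m0: "m > 0" using m q1 by (cases m) auto
  obtain ind where ind: "\<And>a. \<not> int q dvd a \<Longrightarrow> [int r ^ ind a = a ^ m] (mod int q)"
    and char: "mchar q (\<lambda>a. if int q dvd a then 0 else \<zeta> ^ ind a)"
    and sum0: "\<And>k. \<not> p dvd k \<Longrightarrow> (\<Sum>a\<in>{0..<int q}. (if int q dvd a then 0 else \<zeta> ^ ind a) ^ k) = 0"
    using residue_character[OF q r m] by blast
  define \<chi> where "\<chi> = (\<lambda>a. if int q dvd a then 0 else \<zeta> ^ ind a)"
  define J where "J = (\<Sum>a\<in>{0..<int q}. \<chi> a * \<chi> (1 - a) ^ b)"
  have nb: "\<not> p dvd 1" "\<not> p dvd b" "\<not> p dvd Suc b" using b p_gt2 by (auto dest!: dvd_imp_le)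
  have JJ: "J * cnj J = of_nat q"
    unfolding J_def
  proof (rule jacobi_sum_norm[OF q])
    show "mchar q \<chi>" using char by (simp add: \<chi>_def)
    then show "mchar q (\<lambda>a. \<chi> a ^ b)" using b by (intro mchar_power) auto
    show "(\<Sum>a\<in>{0..<int q}. \<chi> a ^ b) = 0" using sum0[OF nb(2)] by (simp add: \<chi>_def)
    show "(\<Sum>a\<in>{0..<int q}. \<chi> a) = 0" using sum0[OF nb(1)] by (simp add: \<chi>_def)
    show "(\<Sum>a\<in>{0..<int q}. \<chi> a * \<chi> a ^ b) = 0" using sum0[OF nb(3)] by (simp add: \<chi>_def)
  qed
  define F :: "int poly" where "F = (\<Sum>a\<in>{2..<int q}. monom 1 (ind a + b * ind (1 - a)))"
  have nd: "\<not> int q dvd a" "\<not> int q dvd 1 - a" if "a \<in> {2..<int q}" for a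
  proof -
    show "\<not> int q dvd a" using that by (auto dest: zdvd_imp_le)
    have "\<not> int q dvd a - 1" using that by (auto dest: zdvd_imp_le)
    then show "\<not> int q dvd 1 - a" by (simp add: dvd_diff_commute)
  qed
  have split: "a = 0 \<or> a = 1" if "a \<in> {0..<int q} - {2..<int q}" for a using that by auto
  \<comment> \<open>The terms a = 0 and a = 1 vanish; dropping them leaves only powers of \<zeta>,
    which is what \<open>F\<close> encodes.\<close>
  have "J = (\<Sum>a\<in>{2..<int q}. \<chi> a * \<chi> (1 - a) ^ b)"
    unfolding J_def
  proof (intro sum.mono_neutral_right ballI)
    fix a assume "a \<in> {0..<int q} - {2..<int q}"
    then have "a = 0 \<or> a = 1" by (rule split)
    then show "\<chi> a * \<chi> (1 - a) ^ b = 0" using b by (auto simp: \<chi>_def)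
  qed auto
  also have "\<dots> = ieval F \<zeta>"
    unfolding F_def ieval_simps
    by (intro sum.cong) (auto simp: \<chi>_def nd power_add power_mult mult.commute[of b])
  finally have JF: "J = ieval F \<zeta>" .
  have "int q dvd poly F (int r ^ s)" if s: "s \<in> {1..<p}" "s + b * s mod p < p" for s
  proof -
    define c where "c = b * s mod p"
    have "\<not> p dvd b * s" using nb unit_index[OF s(1)] p_prime by (simp add: prime_dvd_mult_iff)
    then have c0: "c > 0" by (simp add: c_def dvd_eq_mod_eq_0)
    define P :: "int poly" where "P = [:0, 1:] ^ (m * s) * [:1, -1:] ^ (m * c)"
    have "degree P \<le> m * s + m * c"
      unfolding P_def by (intro order.trans[OF degree_mult_le] add_mono order.trans[OF degree_power_le]) auto
    also have "\<dots> < m * p" using s m0 by (simp add: c_def flip: distrib_left)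
    finally have "degree P < q - 1" using m by (simp add: mult.commute)
    then have P: "int q dvd (\<Sum>a\<in>{0..<int q}. poly P a)" by (rule poly_sum_mod_prime[OF q])
    have "(\<Sum>a\<in>{0..<int q}. poly P a) = (\<Sum>a\<in>{2..<int q}. poly P a)"
    proof (intro sum.mono_neutral_right ballI)
      fix a assume "a \<in> {0..<int q} - {2..<int q}"
      then have "a = 0 \<or> a = 1" by (rule split)
      then show "poly P a = 0" using s c0 m0 by (auto simp: P_def)
    qed auto
    then have P2: "[(\<Sum>a\<in>{2..<int q}. poly P a) = 0] (mod int q)" using P by (simp add: cong_0_iff)
    have "[poly F (int r ^ s) = (\<Sum>a\<in>{2..<int q}. poly P a)] (mod int q)"
      unfolding F_def poly_sum
    proof (intro cong_sum)
      fix a assume a: "a \<in> {2..<int q}"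
      have "[(int r ^ ind a) ^ s = (a ^ m) ^ s] (mod int q)" by (intro cong_pow ind nd a)
      \<comment> \<open>Fermat's theorem allows the exponent b s to be reduced modulo
        \<open>p\<close>; only then is the degree small enough.\<close>
      moreover have "[(int r ^ ind (1 - a)) ^ (b * s) = (1 - a) ^ (m * c)] (mod int q)"
      proof -
        have "[(int r ^ ind (1 - a)) ^ (b * s) = ((1 - a) ^ m) ^ (b * s)] (mod int q)"
          by (intro cong_pow ind nd a)
        also have "((1 - a) ^ m) ^ (b * s) = ((1 - a) ^ m) ^ (p * (b * s div p) + c)" by (simp add: c_def)
        also have "\<dots> = ((1 - a) ^ (q - 1)) ^ (b * s div p) * (1 - a) ^ (m * c)"
        proof -
          have "q - 1 = m * p" using m by simp
          then show ?thesis by (simp only: power_add power_mult)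
        qed
        also have "[((1 - a) ^ (q - 1)) ^ (b * s div p) * (1 - a) ^ (m * c)
            = 1 ^ (b * s div p) * (1 - a) ^ (m * c)] (mod int q)"
          by (intro cong_mult cong_pow cong_refl fermat_theorem_int q nd a)
        finally show ?thesis by simp
      qed
      ultimately have "[(int r ^ ind a) ^ s * (int r ^ ind (1 - a)) ^ (b * s) =
          (a ^ m) ^ s * (1 - a) ^ (m * c)] (mod int q)" by (rule cong_mult)
      moreover have "(int r ^ ind a) ^ s * (int r ^ ind (1 - a)) ^ (b * s) =
          poly (monom 1 (ind a + b * ind (1 - a))) (int r ^ s)"
        unfolding poly_monom power_add power_mult[symmetric] by (simp add: mult_ac)
      moreover have "(a ^ m) ^ s * (1 - a) ^ (m * c) = poly P a" by (simp add: P_def power_mult)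
      ultimately show "[poly (monom 1 (ind a + b * ind (1 - a))) (int r ^ s) = poly P a] (mod int q)" by simp
    qed
    then show ?thesis using P2 cong_trans cong_0_iff by blast
  qed
  then show ?thesis using JJ JF by blast
qed

end

subsection \<open>Stickelberger's relation for norm forms\<close>

definition inv_mod :: "nat \<Rightarrow> nat \<Rightarrow> nat" where
  "inv_mod p t = (SOME t'. [t * t' = 1] (mod p))"

text \<open>For admissible \<open>b\<close> these are the units \<open>t\<close> where the integral
  part of (b+1) t / p exceeds that of b t / p by one, that is, the support of a Stickelberger
  element.\<close>

definition stick_set :: "nat \<Rightarrow> nat \<Rightarrow> nat set" where
  "stick_set p b = {t\<in>{1..<p}. p < t + b * t mod p}"

context cyclo
begin

lemma inv_mod: "\<not> p dvd t \<Longrightarrow> [t * inv_mod p t = 1] (mod p)"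
  unfolding inv_mod_def by (rule someI_ex) (rule ex_inverse)

lemma inv_mod_unit: "\<not> p dvd t \<Longrightarrow> \<not> p dvd inv_mod p t"
  using cong_1_not_dvd inv_mod by blast

lemma bij_inv_mod: "bij_betw (\<lambda>t. inv_mod p t mod p) {1..<p} {1..<p}"
proof -
  have "inj_on (\<lambda>t. inv_mod p t mod p) {1..<p}"
  proof (rule inj_onI)
    fix t u assume tu: "t \<in> {1..<p}" "u \<in> {1..<p}" "inv_mod p t mod p = inv_mod p u mod p"
    have e: "[inv_mod p t = inv_mod p u] (mod p)" using tu(3) by (simp add: cong_def)
    have "[t * 1 = t * (u * inv_mod p u)] (mod p)"
      by (intro cong_mult cong_refl cong_sym[OF inv_mod] unit_index tu)
    also have "[t * (u * inv_mod p u) = t * (u * inv_mod p t)] (mod p)"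
      by (intro cong_mult cong_refl cong_sym[OF e])
    also have "t * (u * inv_mod p t) = u * (t * inv_mod p t)" by simp
    also have "[u * (t * inv_mod p t) = u * 1] (mod p)"
      by (intro cong_mult cong_refl inv_mod unit_index tu)
    finally show "t = u" using tu by (simp add: cong_def)
  qed
  moreover have "(\<lambda>t. inv_mod p t mod p) ` {1..<p} \<subseteq> {1..<p}"
  proof safe
    fix t assume "t \<in> {1..<p}"
    then have "inv_mod p t mod p \<noteq> 0" using inv_mod_unit unit_index by (simp add: dvd_eq_mod_eq_0)
    then show "inv_mod p t mod p \<in> {1..<p}" using p_pos by simp
  qed
  ultimately show ?thesis by (simp add: bij_betw_def endo_inj_surj)
qed

text \<open>Replacing \<open>t\<close> by p - t replaces b t mod p by p - (b t mod p). The two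
  residues \<open>t\<close> and b t mod p never add up to \<open>p\<close> itself, because b + 1 is
  prime to \<open>p\<close>.\<close>

lemma stick_set_compl:
  assumes b: "1 \<le> b" "b \<le> p - 2" and t: "t \<in> {1..<p}"
  shows "p - t \<in> stick_set p b \<longleftrightarrow> t \<notin> stick_set p b"
    and "t \<notin> stick_set p b \<Longrightarrow> t + b * t mod p < p"
proof -
  define c where "c = b * t mod p"
  have nt: "\<not> p dvd t" by (rule unit_index[OF t])
  have nb: "\<not> p dvd b" "\<not> p dvd Suc b" using b p_gt2 by (auto dest!: dvd_imp_le)
  have "\<not> p dvd b * t" using nt nb p_prime by (simp add: prime_dvd_mult_iff)
  then have c: "0 < c" "c < p" using p_pos by (auto simp: c_def dvd_eq_mod_eq_0)
  have ne: "t + c \<noteq> p"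
  proof
    assume "t + c = p"
    then have "(t + b * t) mod p = 0" unfolding c_def by (metis mod_add_right_eq mod_self)
    then have "p dvd Suc b * t" by (simp add: dvd_eq_mod_eq_0)
    then show False using nt nb prime_dvd_mult_iff[OF p_prime, of "Suc b" t] by blast
  qed
  have "b * (p - t) mod p = p - c"
  proof -
    have "(b * (p - t) + b * t) mod p = 0"
    proof -
      have "b * (p - t) + b * t = b * p" using t by (simp flip: distrib_left)
      then show ?thesis by simp
    qed
    then have "(b * (p - t) mod p + c) mod p = 0" by (simp add: c_def mod_add_eq)
    then obtain k where k: "b * (p - t) mod p + c = p * k" by auto
    have "b * (p - t) mod p < p" using p_pos by simp
    then have "0 < b * (p - t) mod p + c" "b * (p - t) mod p + c < p * 2" using c by linarith+
    then have "0 < p * k" "p * k < p * 2" by (simp_all only: k)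
    then have "k = 1" by auto
    then show ?thesis using k by simp
  qed
  then have "p - t \<in> stick_set p b \<longleftrightarrow> p < (p - t) + (p - c)" using t by (auto simp: stick_set_def)
  also have "\<dots> \<longleftrightarrow> t + c < p" using t c by auto
  also have "\<dots> \<longleftrightarrow> t \<notin> stick_set p b" using t ne by (auto simp: stick_set_def c_def)
  finally show 1: "p - t \<in> stick_set p b \<longleftrightarrow> t \<notin> stick_set p b" .
  show "t \<notin> stick_set p b \<Longrightarrow> t + b * t mod p < p" using t ne by (auto simp: stick_set_def c_def)
qed

text \<open>The characters \<open>\<zeta> \<mapsto> r\<^sup>s\<close> for \<open>0 < s < p\<close> jointly detect divisibility by \<open>M\<close> in \<open>\<int>[\<zeta>]\<close>, by
  Fourier inversion modulo \<open>M\<close>.\<close>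

lemma dvd_all_specialisations:
  assumes zero: "\<And>d. \<not> p dvd d \<Longrightarrow> int M dvd (\<Sum>i<p. int r ^ (d * i))"
    and rp: "[int r ^ p = 1] (mod int M)" and cop: "coprime p M"
    and G: "\<And>s. s \<in> {1..<p} \<Longrightarrow> int M dvd poly G (int r ^ s)"
  shows "\<exists>w\<in>Zz. ieval G \<zeta> = of_nat M * w"
proof -
  obtain Q R where QR: "G = Phi * Q + R" "degree R < p - 1" using reduce_poly by blast
  have R: "int M dvd poly R (int r ^ s)" if s: "s \<in> {1..<p}" for s
  proof -
    have "poly Phi (int r ^ s) = (\<Sum>i<p. int r ^ (s * i))"
      by (simp add: Phi_def poly_sum poly_monom power_mult)
    then have "int M dvd poly Phi (int r ^ s) * poly Q (int r ^ s)"
      using zero[OF unit_index[OF s]] by simp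
    then show ?thesis using G[OF s] QR(1) by (simp add: dvd_add_right_iff)
  qed
  have polyR: "poly R z = (\<Sum>j<p. coeff R j * z ^ j)" for z
    unfolding poly_altdef using QR(2) by (intro sum.mono_neutral_left) (auto simp: coeff_eq_0)
  \<comment> \<open>In the Fourier sum over all \<open>s\<close> modulo \<open>M\<close>, the terms
    with \<open>s\<close> nonzero vanish by hypothesis and only s = 0, that is
    \<open>poly R 1\<close>, remains.\<close>
  have key: "[int p * coeff R k = poly R 1] (mod int M)" if k: "k < p" for k
  proof -
    have "(\<Sum>s<p. int r ^ (s * (p - k)) * poly R (int r ^ s)) =
        (\<Sum>s<p. \<Sum>j<p. coeff R j * int r ^ ((p - k + j) * s))"
      unfolding polyR sum_distrib_left
      by (intro sum.cong refl) (simp only: power_add power_mult[symmetric] distrib_right distrib_left mult_ac)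
    also have "\<dots> = (\<Sum>j<p. coeff R j * (\<Sum>s<p. int r ^ ((p - k + j) * s)))"
      by (subst sum.swap) (simp only: sum_distrib_left)
    also have "[\<dots> = (\<Sum>j<p. coeff R j * (if j = k then int p else 0))] (mod int M)"
    proof (intro cong_sum cong_mult cong_refl)
      fix j assume j: "j \<in> {..<p}"
      show "[(\<Sum>s<p. int r ^ ((p - k + j) * s)) = (if j = k then int p else 0)] (mod int M)"
      proof (cases "j = k")
        case True
        have "[(\<Sum>s<p. int r ^ ((p - k + j) * s)) = (\<Sum>s<p. 1)] (mod int M)"
        proof (rule cong_sum)
          fix s
          have "[(int r ^ p) ^ s = 1 ^ s] (mod int M)" by (intro cong_pow rp)
          then show "[int r ^ ((p - k + j) * s) = 1] (mod int M)" using True k by (simp add: power_mult)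
        qed
        then show ?thesis using True by simp
      next
        case False
        have "\<not> p dvd p - k + j"
        proof
          assume "p dvd p - k + j"
          then obtain q where q: "p - k + j = p * q" by (auto elim: dvdE)
          have "0 < p - k + j" "p - k + j < p * 2" using k j by auto
          then have "0 < p * q" "p * q < p * 2" by (simp_all only: q)
          then have "q = 1" by auto
          then show False using q k False by auto
        qed
        then show ?thesis using zero False by (simp add: cong_0_iff)
      qed
    qed
    also have "(\<Sum>j<p. coeff R j * (if j = k then int p else 0)) = (\<Sum>j<p. if j = k then coeff R j * int p else 0)"
      by (intro sum.cong) auto
    also have "\<dots> = int p * coeff R k" using k by simp
    finally have 1: "[(\<Sum>s<p. int r ^ (s * (p - k)) * poly R (int r ^ s)) = int p * coeff R k] (mod int M)" .
    have "{..<p} = insert 0 {1..<p}" using p_pos by auto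
    then have "(\<Sum>s<p. int r ^ (s * (p - k)) * poly R (int r ^ s)) =
        poly R 1 + (\<Sum>s\<in>{1..<p}. int r ^ (s * (p - k)) * poly R (int r ^ s))" by simp
    moreover have "int M dvd (\<Sum>s\<in>{1..<p}. int r ^ (s * (p - k)) * poly R (int r ^ s))"
      by (rule dvd_sum, rule dvd_mult, rule R)
    ultimately have "[(\<Sum>s<p. int r ^ (s * (p - k)) * poly R (int r ^ s)) = poly R 1] (mod int M)"
      by (simp add: cong_iff_dvd_diff)
    then show ?thesis using 1 cong_sym cong_trans by blast
  qed
  \<comment> \<open>The coefficient with index p - 1 is 0 by the degree bound, and by
    \<open>key\<close> the value at 1 is \<open>p\<close> times it modulo \<open>M\<close>.\<close>
  have R1: "int M dvd poly R 1"
  proof -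
    have "coeff R (p - 1) = 0" using QR(2) by (simp add: coeff_eq_0)
    then have "[0 = poly R 1] (mod int M)" using key[of "p - 1"] p_pos by simp
    then show ?thesis using cong_0_iff cong_sym by blast
  qed
  have "int M dvd coeff R k" for k
  proof (cases "k < p")
    case True
    then have "int M dvd int p * coeff R k" using key[OF True] R1 cong_dvd_iff by blast
    moreover have "coprime (int M) (int p)" using cop by (simp add: coprime_commute)
    ultimately show ?thesis by (simp add: coprime_dvd_mult_right_iff)
  next
    case False
    then show ?thesis using QR(2) by (simp add: coeff_eq_0)
  qed
  then have "[:int M:] dvd R" by (simp add: const_poly_dvd_iff)
  then obtain R' where "R = smult (int M) R'" by (auto elim!: dvdE)
  then have "ieval G \<zeta> = of_nat M * ieval R' \<zeta>"
    using QR(1) by (simp add: ieval_simps ieval_Phi)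
  then show ?thesis by (intro bexI[of _ "ieval R' \<zeta>"]) auto
qed

lemma norm_form_int:
  "(\<Prod>k\<in>{1..<p}. of_int x + of_int y * \<zeta> ^ k) = of_int (\<Sum>i<p. (- x) ^ i * y ^ (p - 1 - i))"
  unfolding norm_form by simp

text \<open>By Fermat, (x + y) N = x^p + y^p is x + y modulo \<open>p\<close>, and x + y can be
  cancelled.\<close>

lemma norm_form_mod_p:
  assumes "\<not> int p dvd x + y"
  shows "[(\<Sum>i<p. (- x) ^ i * y ^ (p - 1 - i)) = 1] (mod int p)"
proof -
  let ?N = "\<Sum>i<p. (- x) ^ i * y ^ (p - 1 - i)"
  have "(- x) ^ p - y ^ p = (- x - y) * (\<Sum>i<p. y ^ (p - Suc i) * (- x) ^ i)" by (rule power_diff_sumr2)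
  then have "(x + y) * ?N = x ^ p + y ^ p" using odd_p by (simp add: mult.commute algebra_simps)
  moreover have "[z ^ p = z] (mod int p)" for z
  proof (cases "int p dvd z")
    case True
    then have "int p dvd z ^ p" using p_pos by (meson dvd_power dvd_trans)
    then show ?thesis using True by (simp add: cong_iff_dvd_diff)
  next
    case False
    have "[z * z ^ (p - 1) = z * 1] (mod int p)"
      by (intro cong_mult cong_refl fermat_theorem_int p_prime False)
    then show ?thesis using p_pos by (simp add: power_eq_if)
  qed
  ultimately have "[(x + y) * ?N = (x + y) * 1] (mod int p)" by (simp add: cong_add)
  moreover have "coprime (x + y) (int p)"
    using assms p_prime by (metis coprime_commute prime_imp_coprime prime_nat_int_transfer)
  ultimately show ?thesis using cong_mult_lcancel by blast
qed

text \<open>Take r = - x / y; a common divisor of \<open>q\<close> and \<open>y\<close> would divide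
  \<open>x\<close> too. As \<open>q\<close> differs from \<open>p\<close>, \<open>r\<close> is not 1
  modulo \<open>q\<close>, so r^d - 1 is invertible for \<open>d\<close> prime to \<open>p\<close>
  and can be cancelled from r^(d p) - 1. The last clause feeds
  \<open>dvd_all_specialisations\<close>.\<close>

lemma root_mod_norm_divisor:
  assumes q: "prime q" "q \<noteq> p" and m: "m > 0" and xy: "coprime x y"
    and d: "int (q ^ m) dvd (\<Sum>i<p. (- x) ^ i * y ^ (p - 1 - i))"
  shows "\<exists>r. [int r * y = - x] (mod int (q ^ m)) \<and> [r ^ p = 1] (mod q ^ m) \<and> \<not> [r = 1] (mod q) \<and>
    (\<forall>d. \<not> p dvd d \<longrightarrow> int (q ^ m) dvd (\<Sum>i<p. int r ^ (d * i)))"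
proof -
  let ?N = "\<Sum>i<p. (- x) ^ i * y ^ (p - 1 - i)"
  define M where "M = q ^ m"
  have qM: "q dvd M" using m by (simp add: M_def)
  have pq: "prime (int q)" using q by simp
  have M0: "M > 0" using prime_gt_0_nat[OF q(1)] by (simp add: M_def)
  have "\<not> int q dvd y"
  proof
    assume y: "int q dvd y"
    have "?N = (- x) ^ (p - 1) + (\<Sum>i<p - 1. (- x) ^ i * y ^ (p - 1 - i))"
      using sum.lessThan_Suc[of "\<lambda>i. (- x) ^ i * y ^ (p - 1 - i)" "p - 1"] p_pos by simp
    moreover have "int q dvd (\<Sum>i<p - 1. (- x) ^ i * y ^ (p - 1 - i))"
    proof (rule dvd_sum, rule dvd_mult)
      fix i assume "i \<in> {..<p - 1}"
      then have "p - 1 - i > 0" by simp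
      then show "int q dvd y ^ (p - 1 - i)" using y by (meson dvd_power dvd_trans)
    qed
    moreover have "int q dvd ?N" using qM d dvd_trans int_dvd_int_iff unfolding M_def by blast
    ultimately have "int q dvd (- x) ^ (p - 1)" by (simp add: dvd_add_left_iff)
    then have "int q dvd - x" using prime_dvd_power[OF pq] by blast
    then have "int q dvd x" by simp
    then have "int q dvd 1" using y xy by (meson coprime_common_divisor one_dvd dvd_trans)
    then show False using prime_gt_1_nat[OF q(1)] by simp
  qed
  then have "coprime y (int q)" using prime_imp_coprime[OF pq] by (simp add: coprime_commute)
  then have cy: "coprime y (int M)" by (simp add: M_def)
  then obtain y' where y': "[y * y' = 1] (mod int M)" using cong_solve_coprime_int by blast
  define r where "r = nat ((- x * y') mod int M)"
  have r: "int r = (- x * y') mod int M" using M0 by (simp add: r_def)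
  have ry: "[int r * y = - x] (mod int M)"
  proof -
    have "[int r * y = (- x * y') * y] (mod int M)" unfolding r by (intro cong_mult cong_refl) (simp add: cong_def)
    also have "(- x * y') * y = - x * (y * y')" by simp
    also have "[- x * (y * y') = - x * 1] (mod int M)" by (intro cong_mult cong_refl y')
    finally show ?thesis by simp
  qed
  have sum1: "int M dvd (\<Sum>i<p. int r ^ i)"
  proof -
    have "y ^ (p - 1) * (\<Sum>i<p. int r ^ i) = (\<Sum>i<p. (int r * y) ^ i * y ^ (p - 1 - i))"
      unfolding sum_distrib_left
    proof (intro sum.cong refl)
      fix i assume "i \<in> {..<p}"
      then have "y ^ (p - 1) = y ^ i * y ^ (p - 1 - i)" by (simp flip: power_add)
      then show "y ^ (p - 1) * int r ^ i = (int r * y) ^ i * y ^ (p - 1 - i)"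
        by (simp only: power_mult_distrib mult_ac)
    qed
    also have "[\<dots> = ?N] (mod int M)" by (intro cong_sum cong_mult cong_refl cong_pow ry)
    finally have "int M dvd y ^ (p - 1) * (\<Sum>i<p. int r ^ i)" using d cong_dvd_iff unfolding M_def by blast
    moreover have "coprime (int M) (y ^ (p - 1))" using cy by (simp add: coprime_commute)
    ultimately show ?thesis using coprime_dvd_mult_right_iff by blast
  qed
  have rp: "[int r ^ p = 1] (mod int M)"
  proof -
    have "int r ^ p - 1 = (int r - 1) * (\<Sum>i<p. int r ^ i)" by (rule power_diff_1_eq)
    then show ?thesis using sum1 by (simp add: cong_iff_dvd_diff)
  qed
  have nr1: "\<not> [int r = 1] (mod int q)"
  proof
    assume a: "[int r = 1] (mod int q)"
    have "[(\<Sum>i<p. int r ^ i) = (\<Sum>i<p. 1 ^ i)] (mod int q)" by (intro cong_sum cong_pow a)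
    moreover have "int q dvd (\<Sum>i<p. int r ^ i)" using sum1 qM dvd_trans int_dvd_int_iff by blast
    ultimately have "int q dvd int p" using cong_dvd_iff by fastforce
    then have "q dvd p" by simp
    then show False using q p_prime primes_dvd_imp_eq by blast
  qed
  have zero: "int M dvd (\<Sum>i<p. int r ^ (d * i))" if d: "\<not> p dvd d" for d
  proof -
    have "\<not> int q dvd int r ^ d - 1"
    proof
      assume "int q dvd int r ^ d - 1"
      then have a: "[int r ^ d = 1] (mod int q)" by (simp add: cong_iff_dvd_diff)
      obtain d' where d': "[d * d' = 1] (mod p)" using ex_inverse[OF d] by blast
      have rpq: "[int r ^ p = 1] (mod int q)" using rp cong_dvd_modulus qM int_dvd_int_iff by blast
      have red: "[int r ^ k = int r ^ (k mod p)] (mod int q)" for k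
      proof -
        have "int r ^ k = (int r ^ p) ^ (k div p) * int r ^ (k mod p)" by (simp flip: power_mult power_add)
        also have "[\<dots> = 1 ^ (k div p) * int r ^ (k mod p)] (mod int q)"
          by (intro cong_mult cong_pow cong_refl rpq)
        finally show ?thesis by simp
      qed
      have "d * d' mod p = 1 mod p" using d' by (simp add: cong_def)
      then have "[int r ^ (d * d') = int r ^ 1] (mod int q)" using red[of "d * d'"] red[of 1] cong_sym cong_trans by metis
      moreover have "[int r ^ (d * d') = 1] (mod int q)"
        using cong_pow[OF a, of d'] by (simp add: power_mult)
      ultimately show False using nr1 cong_sym cong_trans by (metis power_one_right)
    qed
    then have "coprime (int M) (int r ^ d - 1)" using prime_imp_coprime[OF pq] by (simp add: M_def)
    moreover have "(int r ^ d - 1) * (\<Sum>i<p. int r ^ (d * i)) = (int r ^ p) ^ d - 1"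
      using power_diff_1_eq[of "int r ^ d" p] by (simp add: mult.commute flip: power_mult)
    moreover have "int M dvd (int r ^ p) ^ d - 1"
      using cong_pow[OF rp, of d] by (simp add: cong_iff_dvd_diff)
    ultimately show ?thesis using coprime_dvd_mult_right_iff by metis
  qed
  have "[int (r ^ p) = int 1] (mod int M)" using rp by simp
  then have "[r ^ p = 1] (mod M)" by (simp only: cong_int_iff)
  moreover have "\<not> [r = 1] (mod q)" using nr1 cong_int_iff[of r 1 q] by simp
  ultimately show ?thesis using ry zero unfolding M_def by blast
qed

lemma Zz_dvd_coprime_prod:
  assumes "finite S" "\<And>q. q \<in> S \<Longrightarrow> \<exists>w\<in>Zz. z = of_nat (f q) * w"
    "\<And>q q'. q \<in> S \<Longrightarrow> q' \<in> S \<Longrightarrow> q \<noteq> q' \<Longrightarrow> coprime (f q) (f q')" "z \<in> Zz"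
  shows "\<exists>w\<in>Zz. z = of_nat (\<Prod>q\<in>S. f q) * w"
  using assms
proof (induction S rule: finite_induct)
  case (insert q S)
  obtain w1 where w1: "w1 \<in> Zz" "z = of_nat (f q) * w1" using insert.prems(1)[of q] by auto
  obtain w2 where w2: "w2 \<in> Zz" "z = of_nat (\<Prod>q\<in>S. f q) * w2"
    using insert.IH insert.prems by blast
  have "coprime (f q) (\<Prod>q\<in>S. f q)"
  proof (rule prod_coprime_right)
    fix i assume "i \<in> S"
    then show "coprime (f q) (f i)" using insert.hyps(2) insert.prems(2)[of q i] by auto
  qed
  then have "gcd (int (f q)) (int (\<Prod>q\<in>S. f q)) = 1" by (simp only: coprime_int_iff flip: coprime_iff_gcd_eq_1)
  then obtain u v where "u * int (f q) + v * int (\<Prod>q\<in>S. f q) = 1" by (metis bezout_int)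
  then have uv: "of_int u * of_nat (f q) + of_int v * of_nat (\<Prod>q\<in>S. f q) = (1 :: complex)"
    by (metis (mono_tags, lifting) of_int_1 of_int_add of_int_mult of_int_of_nat_eq)
  have "z = (of_int u * of_nat (f q) + of_int v * of_nat (\<Prod>q\<in>S. f q)) * z" using uv by simp
  also have "\<dots> = of_int u * of_nat (f q) * z + of_int v * of_nat (\<Prod>q\<in>S. f q) * z" by (rule distrib_right)
  also have "\<dots> = of_int u * of_nat (f q) * (of_nat (\<Prod>q\<in>S. f q) * w2) + of_int v * of_nat (\<Prod>q\<in>S. f q) * (of_nat (f q) * w1)"
    using w1(2) w2(2) by metis
  also have "\<dots> = of_nat (f q * (\<Prod>q\<in>S. f q)) * (of_int u * w2 + of_int v * w1)"
    by (simp add: algebra_simps)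
  finally have "z = of_nat (\<Prod>q\<in>insert q S. f q) * (of_int u * w2 + of_int v * w1)"
    using insert.hyps by simp
  moreover have "of_int u * w2 + of_int v * w1 \<in> Zz" using w1 w2 by (intro Zz_intros) auto
  ultimately show ?case by blast
qed auto

text \<open>Let \<open>g\<close> be the product of one Jacobi sum for each prime factor of
  \<open>n\<close>, with multiplicity. Then n^p divides A g^p, since at each substitution either a
  factor of \<open>A\<close> or the Jacobi sum vanishes. As g times its conjugate is
  \<open>n\<close>, \<open>A\<close> is \<open>w\<close> times the \<open>p\<close>-th power of the
  conjugate of \<open>g\<close>. Comparing absolute values, \<open>w\<close> has absolute value 1
  and is a root of unity up to sign.\<close>

theorem stickelberger_norm_form:
  assumes xy: "coprime x y" and pxy: "\<not> int p dvd x + y"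
    and N: "(\<Sum>i<p. (- x) ^ i * y ^ (p - 1 - i)) = int n ^ p" and n: "n > 0"
    and b: "1 \<le> b" "b \<le> p - 2"
  shows "\<exists>\<gamma>\<in>Zz. \<exists>i s. s \<in> {1, -1} \<and>
    (\<Prod>t\<in>stick_set p b. of_int x + of_int y * \<zeta> ^ inv_mod p t) = of_int s * \<zeta> ^ i * \<gamma> ^ p"
proof -
  define T where "T = stick_set p b"
  define A where "A = (\<Prod>t\<in>T. of_int x + of_int y * \<zeta> ^ inv_mod p t)"
  define GA :: "int poly" where "GA = (\<Prod>t\<in>T. [:x:] + monom y (inv_mod p t))"
  have AG: "A = ieval GA \<zeta>" by (simp add: A_def GA_def ieval_simps poly_monom)
  have AZ: "A \<in> Zz" unfolding AG by simp
  have finT: "finite T" and subT: "T \<subseteq> {1..<p}" by (auto simp: T_def stick_set_def)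
  define e where "e = (\<lambda>q. multiplicity q n)"
  have fac: "n = (\<Prod>q\<in>prime_factors n. q ^ e q)"
    using n by (simp add: e_def prod_prime_factors)
  have step: "\<exists>F. ieval F \<zeta> * cnj (ieval F \<zeta>) = of_nat q \<and>
      (\<exists>w\<in>Zz. A * ieval F \<zeta> ^ (p * e q) = of_nat (q ^ (p * e q)) * w)" if q: "q \<in> prime_factors n" for q
  proof -
    have qp: "prime q" using q by auto
    have e0: "e q > 0" using q n by (simp add: e_def prime_factors_multiplicity)
    have "q ^ e q dvd n" by (simp add: e_def multiplicity_dvd)
    then have "(q ^ e q) ^ p dvd n ^ p" by (rule dvd_power_same)
    then have "q ^ (p * e q) dvd n ^ p" by (metis power_mult mult.commute)
    then have "int (q ^ (p * e q)) dvd int (n ^ p)" by (simp only: int_dvd_int_iff)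
    then have dvdN: "int (q ^ (p * e q)) dvd (\<Sum>i<p. (- x) ^ i * y ^ (p - 1 - i))" using N by simp
    have "q \<noteq> p"
    proof
      assume "q = p"
      then have "int p dvd int n" using q by auto
      then have "int p dvd int n ^ p" using p_pos by (meson dvd_power dvd_trans)
      then have "int p dvd 1" using norm_form_mod_p[OF pxy] N cong_dvd_iff by metis
      then show False using p_gt2 by simp
    qed
    have m0: "p * e q > 0" using e0 p_pos by simp
    obtain r where r: "[int r * y = - x] (mod int (q ^ (p * e q)))" "[r ^ p = 1] (mod q ^ (p * e q))"
      "\<not> [r = 1] (mod q)" "\<And>d. \<not> p dvd d \<Longrightarrow> int (q ^ (p * e q)) dvd (\<Sum>i<p. int r ^ (d * i))"
      using root_mod_norm_divisor[OF qp \<open>q \<noteq> p\<close> m0 xy dvdN] by blast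
    have qM: "q dvd q ^ (p * e q)" using m0 by simp
    have rq: "[r ^ p = 1] (mod q)" using r(2) qM cong_dvd_modulus_nat by blast
    obtain F where F: "ieval F \<zeta> * cnj (ieval F \<zeta>) = of_nat q"
      "\<And>s. s \<in> {1..<p} \<Longrightarrow> s + b * s mod p < p \<Longrightarrow> int q dvd poly F (int r ^ s)"
      using jacobi_poly[OF qp rq r(3) b] by blast
    have rpM: "[int r ^ p = 1] (mod int (q ^ (p * e q)))"
      using r(2) cong_int_iff[of "r ^ p" 1 "q ^ (p * e q)"] by simp
    have "\<exists>w\<in>Zz. ieval (GA * F ^ (p * e q)) \<zeta> = of_nat (q ^ (p * e q)) * w"
    proof (rule dvd_all_specialisations[OF r(4) rpM])
      show "coprime p (q ^ (p * e q))"
        using primes_coprime[OF p_prime qp] \<open>q \<noteq> p\<close> by simp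
      fix s assume s: "s \<in> {1..<p}"
      show "int (q ^ (p * e q)) dvd poly (GA * F ^ (p * e q)) (int r ^ s)"
      proof (cases "s \<in> T")
        case True
        \<comment> \<open>For \<open>s\<close> in \<open>T\<close> the factor of \<open>A\<close>
          with t = s becomes x + y r under the substitution, and \<open>r\<close> was chosen as - x
          / y. It vanishes modulo the full power of \<open>q\<close>.\<close>
        have c1: "[s * inv_mod p s = 1] (mod p)" by (intro inv_mod unit_index s)
        then have mod1: "s * inv_mod p s mod p = 1" using p_gt2 by (simp add: cong_def)
        have "s * inv_mod p s = p * (s * inv_mod p s div p) + 1"
          using mod1 by (metis mult_div_mod_eq)
        then have "int r ^ (s * inv_mod p s) = (int r ^ p) ^ (s * inv_mod p s div p) * int r"
          by (metis power_add power_mult power_one_right)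
        moreover have "[(int r ^ p) ^ (s * inv_mod p s div p) * int r = 1 ^ (s * inv_mod p s div p) * int r] (mod int (q ^ (p * e q)))"
          by (intro cong_mult cong_pow cong_refl rpM)
        ultimately have rs: "[int r ^ (s * inv_mod p s) = int r] (mod int (q ^ (p * e q)))" by simp
        have "[x + y * int r ^ (s * inv_mod p s) = x + y * int r] (mod int (q ^ (p * e q)))"
          by (intro cong_add cong_mult cong_refl rs)
        moreover have "[x + y * int r = x + - x] (mod int (q ^ (p * e q)))"
          using r(1) by (intro cong_add cong_refl) (simp add: mult.commute)
        ultimately have "[x + y * int r ^ (s * inv_mod p s) = 0] (mod int (q ^ (p * e q)))"
          using cong_trans by fastforce
        then have "int (q ^ (p * e q)) dvd x + y * int r ^ (s * inv_mod p s)" by (simp only: cong_0_iff)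
        moreover have "x + y * int r ^ (s * inv_mod p s) dvd poly GA (int r ^ s)"
        proof -
          have "poly GA (int r ^ s) = (\<Prod>t\<in>T. x + y * int r ^ (s * inv_mod p t))"
            by (simp add: GA_def poly_prod poly_monom power_mult)
          then show ?thesis using dvd_prodI[OF finT True, of "\<lambda>t. x + y * int r ^ (s * inv_mod p t)"] by simp
        qed
        ultimately have "int (q ^ (p * e q)) dvd poly GA (int r ^ s)" by (rule dvd_trans)
        then show ?thesis by simp
      next
        case False
        \<comment> \<open>Outside \<open>T\<close> the Jacobi sum is divisible by \<open>q\<close>
          once only; the exponent p e supplies the full power.\<close>
        then have "int q dvd poly F (int r ^ s)"
          using F(2)[OF s] stick_set_compl(2)[OF b s] by (simp add: T_def)
        then have "int q ^ (p * e q) dvd poly F (int r ^ s) ^ (p * e q)" by (rule dvd_power_same)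
        then show ?thesis by simp
      qed
    qed
    then show ?thesis using F(1) by (auto simp: AG ieval_simps)
  qed
  then obtain F where F: "\<And>q. q \<in> prime_factors n \<Longrightarrow> ieval (F q) \<zeta> * cnj (ieval (F q) \<zeta>) = of_nat q"
    "\<And>q. q \<in> prime_factors n \<Longrightarrow> \<exists>w\<in>Zz. A * ieval (F q) \<zeta> ^ (p * e q) = of_nat (q ^ (p * e q)) * w"
    by metis
  define g where "g = (\<Prod>q\<in>prime_factors n. ieval (F q) \<zeta> ^ e q)"
  have gZ: "g \<in> Zz" unfolding g_def by (intro Zz_prod Zz_power Zz_ieval)
  have gg: "g * cnj g = of_nat n"
  proof -
    have "g * cnj g = (\<Prod>q\<in>prime_factors n. (ieval (F q) \<zeta> * cnj (ieval (F q) \<zeta>)) ^ e q)"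
      by (simp add: g_def cnj_prod prod.distrib power_mult_distrib)
    also have "\<dots> = (\<Prod>q\<in>prime_factors n. of_nat q ^ e q)" by (intro prod.cong) (auto simp: F(1))
    also have "\<dots> = of_nat n" by (subst (2) fac) simp
    finally show ?thesis .
  qed
  have "\<exists>w\<in>Zz. A * g ^ p = of_nat (\<Prod>q\<in>prime_factors n. q ^ (p * e q)) * w"
  proof (rule Zz_dvd_coprime_prod)
    fix q assume q: "q \<in> prime_factors n"
    have "g ^ p = (\<Prod>q\<in>prime_factors n. ieval (F q) \<zeta> ^ (p * e q))"
      unfolding g_def prod_power_distrib by (intro prod.cong refl) (simp only: power_mult[symmetric] mult.commute)
    also have "\<dots> = ieval (F q) \<zeta> ^ (p * e q) * (\<Prod>q'\<in>prime_factors n - {q}. ieval (F q') \<zeta> ^ (p * e q'))"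
      using q by (intro prod.remove) auto
    finally have gp: "A * g ^ p = (A * ieval (F q) \<zeta> ^ (p * e q)) * (\<Prod>q'\<in>prime_factors n - {q}. ieval (F q') \<zeta> ^ (p * e q'))"
      by simp
    obtain w where w: "w \<in> Zz" "A * ieval (F q) \<zeta> ^ (p * e q) = of_nat (q ^ (p * e q)) * w" using F(2)[OF q] by blast
    show "\<exists>w\<in>Zz. A * g ^ p = of_nat (q ^ (p * e q)) * w"
    proof
      show "A * g ^ p = of_nat (q ^ (p * e q)) * (w * (\<Prod>q'\<in>prime_factors n - {q}. ieval (F q') \<zeta> ^ (p * e q')))"
        unfolding gp w(2) by (rule mult.assoc)
      show "w * (\<Prod>q'\<in>prime_factors n - {q}. ieval (F q') \<zeta> ^ (p * e q')) \<in> Zz"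
        by (intro Zz_mult w Zz_prod Zz_power Zz_ieval)
    qed
  next
    fix q q' assume "q \<in> prime_factors n" "q' \<in> prime_factors n" "q \<noteq> q'"
    then have "coprime q q'" using primes_coprime by blast
    then show "coprime (q ^ (p * e q)) (q' ^ (p * e q'))" by simp
  qed (auto intro: Zz_mult Zz_power AZ gZ)
  moreover have "(\<Prod>q\<in>prime_factors n. q ^ (p * e q)) = n ^ p"
  proof -
    have "n ^ p = (\<Prod>q\<in>prime_factors n. q ^ e q) ^ p" using fac by simp
    also have "\<dots> = (\<Prod>q\<in>prime_factors n. q ^ (p * e q))"
      unfolding prod_power_distrib by (intro prod.cong refl) (simp only: power_mult[symmetric] mult.commute)
    finally show ?thesis by simp
  qed
  ultimately obtain w where w: "w \<in> Zz" "A * g ^ p = of_nat (n ^ p) * w" by auto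
  define \<gamma> where "\<gamma> = cnj g"
  have \<gamma>Z: "\<gamma> \<in> Zz" unfolding \<gamma>_def by (rule Zz_cnj[OF gZ])
  have gp: "g ^ p * \<gamma> ^ p = of_nat (n ^ p)"
    unfolding \<gamma>_def by (simp only: power_mult_distrib[symmetric] gg of_nat_power)
  have n0: "of_nat (n ^ p) \<noteq> (0 :: complex)" using n by simp
  have "of_nat (n ^ p) * A = of_nat (n ^ p) * (w * \<gamma> ^ p)"
  proof -
    have "of_nat (n ^ p) * A = (A * g ^ p) * \<gamma> ^ p" by (simp only: gp[symmetric] mult_ac)
    then show ?thesis by (simp only: w(2) mult.assoc)
  qed
  then have A: "A = w * \<gamma> ^ p" by (rule mult_left_cancel[OF n0, THEN iffD1])
  \<comment> \<open>Conjugation carries the factor with index \<open>t\<close> to the one with index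
    p - t, which lies outside \<open>T\<close>. So \<open>A\<close> times its conjugate is the full
    norm.\<close>
  have AA: "A * cnj A = of_nat (n ^ p)"
  proof -
    define h where "h = (\<lambda>t. of_int x + of_int y * \<zeta> ^ inv_mod p t)"
    have hc: "cnj (h t) = h (p - t)" if t: "t \<in> {1..<p}" for t
    proof -
      have t': "p - t \<in> {1..<p}" using t by auto
      have "[t * ((p - 1) * inv_mod p t) = t * inv_mod p (p - t)] (mod p)"
      proof -
        have i1: "[int t * int (inv_mod p t) = 1] (mod int p)"
          using inv_mod[OF unit_index[OF t]] cong_int_iff[of "t * inv_mod p t" 1 p] by simp
        have i2: "[int (p - t) * int (inv_mod p (p - t)) = 1] (mod int p)"
          using inv_mod[OF unit_index[OF t']] cong_int_iff[of "(p - t) * inv_mod p (p - t)" 1 p] by simp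
        have pt: "int (p - t) = int p - int t" using t by auto
        have p1: "int (p - 1) = int p - 1" using p_pos by simp
        have d1: "int p dvd int t * int (inv_mod p t) - 1" using i1 by (simp only: cong_iff_dvd_diff)
        have d2: "int p dvd int (p - t) * int (inv_mod p (p - t)) - 1" using i2 by (simp only: cong_iff_dvd_diff)
        have "int p dvd int p * (int t * int (inv_mod p t)) - (int t * int (inv_mod p t) - 1)
            + (int (p - t) * int (inv_mod p (p - t)) - 1) - int p * int (inv_mod p (p - t))"
          by (rule dvd_diff[OF dvd_add[OF dvd_diff[OF dvd_triv_left d1] d2] dvd_triv_left])
        moreover have "int p * (int t * int (inv_mod p t)) - (int t * int (inv_mod p t) - 1)
            + (int (p - t) * int (inv_mod p (p - t)) - 1) - int p * int (inv_mod p (p - t))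
          = int (t * ((p - 1) * inv_mod p t)) - int (t * inv_mod p (p - t))"
          unfolding of_nat_mult pt p1 by (simp add: algebra_simps)
        ultimately have "[int (t * ((p - 1) * inv_mod p t)) = int (t * inv_mod p (p - t))] (mod int p)"
          by (simp only: cong_iff_dvd_diff)
        then show ?thesis by (simp only: cong_int_iff)
      qed
      then have "[(p - 1) * inv_mod p t = inv_mod p (p - t)] (mod p)"
        using coprime_p[OF unit_index[OF t]] cong_mult_lcancel_nat by blast
      then have "\<zeta> ^ ((p - 1) * inv_mod p t) = \<zeta> ^ inv_mod p (p - t)" by (rule zeta_pow_cong)
      then show ?thesis by (simp add: h_def cnj_zeta power_mult)
    qed
    have inj: "inj_on (\<lambda>t. p - t) T" 
    proof (rule inj_onI)
      fix t u assume "t \<in> T" "u \<in> T" and e: "p - t = p - u"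
      then have "t < p" "u < p" using subT by auto
      then show "t = u" using e by linarith
    qed
    have img: "(\<lambda>t. p - t) ` T = {1..<p} - T"
    proof
      show "(\<lambda>t. p - t) ` T \<subseteq> {1..<p} - T"
      proof safe
        fix t assume "t \<in> T"
        then have t: "t \<in> {1..<p}" using subT by blast
        then have t': "p - t \<in> {1..<p}" by auto
        then show "p - t \<in> {1..<p}" .
        assume "p - t \<in> T"
        then show False using stick_set_compl(1)[OF b t] \<open>t \<in> T\<close> by (simp add: T_def)
      qed
      show "{1..<p} - T \<subseteq> (\<lambda>t. p - t) ` T"
      proof
        fix t assume "t \<in> {1..<p} - T"
        then have t: "t \<in> {1..<p}" "t \<notin> T" by auto
        then have "p - t \<in> T" using stick_set_compl(1)[OF b t(1)] by (simp add: T_def)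
        moreover have "t = p - (p - t)" using t by auto
        ultimately show "t \<in> (\<lambda>t. p - t) ` T" by blast
      qed
    qed
    have "cnj A = (\<Prod>t\<in>T. cnj (h t))" by (simp add: A_def h_def cnj_prod)
    also have "\<dots> = (\<Prod>t\<in>T. h (p - t))" using hc subT by (intro prod.cong) auto
    also have "\<dots> = prod h ((\<lambda>t. p - t) ` T)" using inj by (simp add: prod.reindex)
    also have "\<dots> = prod h ({1..<p} - T)" by (simp only: img)
    finally have "A * cnj A = prod h T * prod h ({1..<p} - T)" by (simp add: A_def h_def)
    also have "\<dots> = prod h {1..<p}" using subT by (subst mult.commute) (rule prod.subset_diff[symmetric], auto)
    also have "\<dots> = (\<Prod>t\<in>{1..<p}. of_int x + of_int y * \<zeta> ^ (inv_mod p t mod p))"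
      by (simp add: h_def zeta_pow_mod)
    also have "\<dots> = (\<Prod>k\<in>{1..<p}. of_int x + of_int y * \<zeta> ^ k)"
      by (rule prod.reindex_bij_betw[OF bij_inv_mod])
    finally show ?thesis unfolding norm_form_int N by simp
  qed
  have "w * cnj w = 1"
  proof -
    have "of_nat (n ^ p) * 1 = A * cnj A" by (simp only: AA mult_1_right)
    also have "\<dots> = (w * cnj w) * (\<gamma> ^ p * cnj (\<gamma> ^ p))" unfolding A by simp
    also have "cnj (\<gamma> ^ p) = g ^ p" by (simp add: \<gamma>_def)
    also have "\<gamma> ^ p * g ^ p = of_nat (n ^ p)" using gp by (simp only: mult.commute)
    also have "w * cnj w * of_nat (n ^ p) = of_nat (n ^ p) * (w * cnj w)" by (rule mult.commute)
    finally show ?thesis by (rule mult_left_cancel[OF n0, THEN iffD1, symmetric])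
  qed
  then obtain s i where "s \<in> {1, -1}" "w = of_int s * \<zeta> ^ i" using norm_1_root_of_unity[OF w(1)] by blast
  then show ?thesis using A \<gamma>Z unfolding A_def T_def by blast
qed

end

section \<open>Ideals and prime ideals of subrings of the complex numbers\<close>

definition is_idl :: "complex set \<Rightarrow> complex set \<Rightarrow> bool" where
  "is_idl R I \<longleftrightarrow> I \<subseteq> R \<and> 0 \<in> I \<and> (\<forall>a\<in>I. \<forall>b\<in>I. a + b \<in> I) \<and> (\<forall>r\<in>R. \<forall>a\<in>I. r * a \<in> I)"

definition is_prm :: "complex set \<Rightarrow> complex set \<Rightarrow> bool" where
  "is_prm R P \<longleftrightarrow> is_idl R P \<and> 1 \<notin> P \<and> (\<forall>a\<in>R. \<forall>b\<in>R. a * b \<in> P \<longrightarrow> a \<in> P \<or> b \<in> P)"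

definition is_sub :: "complex set \<Rightarrow> bool" where
  "is_sub R \<longleftrightarrow> 0 \<in> R \<and> 1 \<in> R \<and> (\<forall>a\<in>R. - a \<in> R) \<and> (\<forall>a\<in>R. \<forall>b\<in>R. a + b \<in> R \<and> a * b \<in> R)"

lemma is_idl_add: "is_idl R I \<Longrightarrow> a \<in> I \<Longrightarrow> b \<in> I \<Longrightarrow> a + b \<in> I"
  and is_idl_mult: "is_idl R I \<Longrightarrow> r \<in> R \<Longrightarrow> a \<in> I \<Longrightarrow> r * a \<in> I"
  and is_idl_zero: "is_idl R I \<Longrightarrow> 0 \<in> I"
  and is_idl_sub: "is_idl R I \<Longrightarrow> a \<in> I \<Longrightarrow> a \<in> R"
  by (auto simp: is_idl_def)

lemma is_idl_mult_right: "is_idl R I \<Longrightarrow> r \<in> R \<Longrightarrow> a \<in> I \<Longrightarrow> a * r \<in> I"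
  using is_idl_mult[of R I r a] by (simp add: mult.commute)

lemma is_idl_sum: "is_idl R I \<Longrightarrow> (\<And>i. i \<in> S \<Longrightarrow> f i \<in> I) \<Longrightarrow> sum f S \<in> I"
  by (induction S rule: infinite_finite_induct) (auto simp: is_idl_zero intro: is_idl_add)

lemma is_sub_neg1: "is_sub R \<Longrightarrow> -1 \<in> R"
  by (auto simp: is_sub_def)

lemma is_idl_uminus: "is_sub R \<Longrightarrow> is_idl R I \<Longrightarrow> a \<in> I \<Longrightarrow> - a \<in> I"
  using is_idl_mult[of R I "-1" a] is_sub_neg1 by simp

lemma is_idl_diff: "is_sub R \<Longrightarrow> is_idl R I \<Longrightarrow> a \<in> I \<Longrightarrow> b \<in> I \<Longrightarrow> a - b \<in> I"
  using is_idl_add[of R I a "- b"] is_idl_uminus by simp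

lemma is_prm_idl: "is_prm R P \<Longrightarrow> is_idl R P"
  and is_prm_one: "is_prm R P \<Longrightarrow> 1 \<notin> P"
  and is_prm_mult: "is_prm R P \<Longrightarrow> a \<in> R \<Longrightarrow> b \<in> R \<Longrightarrow> a * b \<in> P \<Longrightarrow> a \<in> P \<or> b \<in> P"
  by (auto simp: is_prm_def)

lemma is_sub_power: "is_sub R \<Longrightarrow> a \<in> R \<Longrightarrow> a ^ n \<in> R"
  by (induction n) (auto simp: is_sub_def)

lemma is_sub_sum: "is_sub R \<Longrightarrow> (\<And>i. i \<in> S \<Longrightarrow> f i \<in> R) \<Longrightarrow> sum f S \<in> R"
  by (induction S rule: infinite_finite_induct) (auto simp: is_sub_def)

lemma is_sub_prod: "is_sub R \<Longrightarrow> (\<And>i. i \<in> S \<Longrightarrow> f i \<in> R) \<Longrightarrow> prod f S \<in> R"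
  by (induction S rule: infinite_finite_induct) (auto simp: is_sub_def)

lemma is_prm_prod:
  assumes "is_sub R" "is_prm R P" "finite S" "\<And>i. i \<in> S \<Longrightarrow> f i \<in> R" "prod f S \<in> P"
  shows "\<exists>i\<in>S. f i \<in> P"
  using assms(3-5)
proof (induction S rule: finite_induct)
  case empty
  then show ?case using is_prm_one[OF assms(2)] by simp
next
  case (insert i S)
  have "prod f S \<in> R" using insert.prems by (intro is_sub_prod assms(1)) auto
  then show ?case using insert is_prm_mult[OF assms(2), of "f i" "prod f S"] by auto
qed

text \<open>An ideal maximal among those containing \<open>I\<close> but not 1 exists by Zorn's
  lemma and is prime.\<close>

lemma ex_is_prm:
  assumes R: "is_sub R" and I: "is_idl R I" "1 \<notin> I"
  shows "\<exists>P. is_prm R P \<and> I \<subseteq> P"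
proof -
  let ?A = "{J. is_idl R J \<and> I \<subseteq> J \<and> 1 \<notin> J}"
  have "\<exists>M\<in>?A. \<forall>W\<in>?A. M \<subseteq> W \<longrightarrow> W = M"
  proof (rule subset_Zorn_nonempty)
    show "?A \<noteq> {}" using I by blast
    fix C assume C: "C \<noteq> {}" "subset.chain ?A C"
    then have CA: "C \<subseteq> ?A" and tot: "\<And>W V. W \<in> C \<Longrightarrow> V \<in> C \<Longrightarrow> W \<subseteq> V \<or> V \<subseteq> W"
      by (auto simp: subset.chain_def subset_chain_def)
    have "is_idl R (\<Union> C)"
      unfolding is_idl_def
    proof (intro conjI ballI)
      show "\<Union> C \<subseteq> R" using CA by (auto simp: is_idl_def)
      show "0 \<in> \<Union> C" using CA C(1) by (auto simp: is_idl_def)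
      fix a b assume "a \<in> \<Union> C" "b \<in> \<Union> C"
      then obtain W V where WV: "W \<in> C" "a \<in> W" "V \<in> C" "b \<in> V" by blast
      have iW: "is_idl R W" "is_idl R V" using WV CA by auto
      have "a + b \<in> W \<or> a + b \<in> V"
        using tot[OF WV(1,3)] is_idl_add[OF iW(1), of a b] is_idl_add[OF iW(2), of a b] WV by blast
      then show "a + b \<in> \<Union> C" using WV by blast
    next
      fix r a assume r: "r \<in> R" and "a \<in> \<Union> C"
      then obtain W where W: "W \<in> C" "a \<in> W" by blast
      then have "is_idl R W" using CA by auto
      then have "r * a \<in> W" using r W(2) by (rule is_idl_mult)
      then show "r * a \<in> \<Union> C" using W(1) by blast
    qed
    moreover have "I \<subseteq> \<Union> C" using C(1) CA by blast
    moreover have "1 \<notin> \<Union> C" using CA by blast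
    ultimately show "\<Union> C \<in> ?A" by blast
  qed
  then obtain M where MA: "M \<in> ?A" "\<forall>W\<in>?A. M \<subseteq> W \<longrightarrow> W = M" by (rule bexE)
  from MA(1) have M: "is_idl R M" "I \<subseteq> M" "1 \<notin> M" by simp_all
  have mx: "W = M" if "is_idl R W" "1 \<notin> W" "M \<subseteq> W" for W
  proof -
    have "W \<in> ?A" by (intro CollectI conjI that order.trans[OF M(2)])
    from bspec[OF MA(2) this] show ?thesis using that(3) by (rule mp)
  qed
  have "a \<in> M \<or> b \<in> M" if ab: "a \<in> R" "b \<in> R" "a * b \<in> M" for a b
  proof (rule ccontr)
    assume n: "\<not> (a \<in> M \<or> b \<in> M)"
    define W where "W = {m + a * r | m r. m \<in> M \<and> r \<in> R}"
    have "is_idl R W"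
      unfolding is_idl_def
    proof (intro conjI ballI)
      show "W \<subseteq> R"
      proof
        fix u assume "u \<in> W"
        then obtain m r where "u = m + a * r" "m \<in> M" "r \<in> R" by (auto simp: W_def)
        then show "u \<in> R" using is_idl_sub[OF M(1), of m] R ab(1) by (simp add: is_sub_def)
      qed
      show "0 \<in> W" unfolding W_def using M(1) R by (auto simp: is_idl_def is_sub_def intro!: exI[of _ 0])
      fix u v assume "u \<in> W" "v \<in> W"
      then obtain m r m' r' where "u = m + a * r" "v = m' + a * r'" "m \<in> M" "m' \<in> M" "r \<in> R" "r' \<in> R"
        by (auto simp: W_def)
      moreover from this have "m + m' \<in> M" "r + r' \<in> R" using M(1) R by (auto simp: is_idl_def is_sub_def)
      moreover have "(m + a * r) + (m' + a * r') = (m + m') + a * (r + r')" by (simp add: algebra_simps)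
      ultimately show "u + v \<in> W" unfolding W_def by blast
    next
      fix s u assume s: "s \<in> R" and "u \<in> W"
      then obtain m r where "u = m + a * r" "m \<in> M" "r \<in> R" by (auto simp: W_def)
      then have "s * u = s * m + a * (s * r)" "s * m \<in> M" "s * r \<in> R"
        using M(1) R s by (auto simp: is_idl_def is_sub_def algebra_simps)
      then show "s * u \<in> W" unfolding W_def by blast
    qed
    moreover have MW: "M \<subseteq> W"
    proof
      fix m assume "m \<in> M"
      then show "m \<in> W"
        unfolding W_def using R by (intro CollectI exI[of _ m] exI[of _ 0]) (auto simp: is_sub_def)
    qed
    moreover have aW: "a \<in> W"
      unfolding W_def using R is_idl_zero[OF M(1)]
      by (intro CollectI exI[of _ 0] exI[of _ 1]) (auto simp: is_sub_def)
    ultimately have "1 \<in> W" using mx[of W] n by blast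
    then obtain m r where mr: "1 = m + a * r" "m \<in> M" "r \<in> R" by (auto simp: W_def)
    have "b = b * 1" by simp
    also have "\<dots> = b * m + r * (a * b)" unfolding mr(1) by (simp add: algebra_simps)
    also have "\<dots> \<in> M" using M(1) mr ab by (auto simp: is_idl_def)
    finally show False using n by blast
  qed
  then have "is_prm R M" using M unfolding is_prm_def by blast
  then show ?thesis using M by blast
qed

lemma is_sub_of_nat: "is_sub R \<Longrightarrow> of_nat n \<in> R"
  by (induction n) (auto simp: is_sub_def)

lemma frobenius_sub:
  assumes S: "is_sub S" and l: "prime l" and ab: "a \<in> S" "b \<in> S"
  shows "\<exists>w\<in>S. (a + b) ^ l - (a ^ l + b ^ l) = of_nat l * w"
proof
  let ?w = "\<Sum>i\<in>{1..<l}. of_nat ((l choose i) div l) * a ^ i * b ^ (l - i)"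
  have l0: "l > 0" using prime_gt_0_nat[OF l] .
  have c: "l choose i = l * ((l choose i) div l)" if "i \<in> {1..<l}" for i
    using dvd_choose_prime[of i l] l that by simp
  have "(a + b) ^ l = (\<Sum>i\<le>l. of_nat (l choose i) * a ^ i * b ^ (l - i))" by (rule binomial_ring)
  also have "{..l} = insert 0 (insert l {1..<l})" using l0 by auto
  also have "(\<Sum>i\<in>insert 0 (insert l {1..<l}). of_nat (l choose i) * a ^ i * b ^ (l - i)) =
      b ^ l + (a ^ l + (\<Sum>i\<in>{1..<l}. of_nat (l choose i) * a ^ i * b ^ (l - i)))"
    using l0 by (subst sum.insert; simp)
  also have "(\<Sum>i\<in>{1..<l}. of_nat (l choose i) * a ^ i * b ^ (l - i)) = of_nat l * ?w"
    unfolding sum_distrib_left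
  proof (intro sum.cong refl)
    fix i assume i: "i \<in> {1..<l}"
    have "(of_nat (l choose i) :: complex) = of_nat l * of_nat ((l choose i) div l)"
      by (subst c[OF i]) (rule of_nat_mult)
    then show "of_nat (l choose i) * a ^ i * b ^ (l - i) = of_nat l * (of_nat ((l choose i) div l) * a ^ i * b ^ (l - i))"
      by (simp only: mult.assoc)
  qed
  finally show "(a + b) ^ l - (a ^ l + b ^ l) = of_nat l * ?w" by simp
  have mul: "x * y \<in> S" if "x \<in> S" "y \<in> S" for x y using S that by (simp add: is_sub_def)
  show "?w \<in> S" by (intro is_sub_sum[OF S] mul is_sub_power[OF S] is_sub_of_nat[OF S] ab)
qed

section \<open>Congruences and Frobenius powers in Z[\<zeta>]\<close>

context cyclo
begin

lemma is_sub_Zz: "is_sub Zz"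
  unfolding is_sub_def by (auto intro: Zz_intros)

definition zcong :: "complex \<Rightarrow> complex \<Rightarrow> complex \<Rightarrow> bool" where
  "zcong m a b \<longleftrightarrow> (\<exists>w\<in>Zz. a - b = m * w)"

lemma zcong_refl [simp]: "zcong m a a"
  unfolding zcong_def by (intro bexI[of _ 0]) auto

lemma zcong_sym: "zcong m a b \<Longrightarrow> zcong m b a"
proof -
  assume "zcong m a b"
  then obtain w where w: "w \<in> Zz" "a - b = m * w" by (auto simp: zcong_def)
  have "b - a = - (a - b)" by simp
  then have "b - a = m * (- w)" using w(2) by simp
  then show ?thesis using Zz_uminus[OF w(1)] unfolding zcong_def by blast
qed

lemma zcong_add: "zcong m a b \<Longrightarrow> zcong m c d \<Longrightarrow> zcong m (a + c) (b + d)"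
proof -
  assume "zcong m a b" "zcong m c d"
  then obtain w v where w: "w \<in> Zz" "v \<in> Zz" "a - b = m * w" "c - d = m * v" by (auto simp: zcong_def)
  have "(a + c) - (b + d) = (a - b) + (c - d)" by simp
  then have "(a + c) - (b + d) = m * (w + v)" using w by (simp add: distrib_left)
  then show ?thesis using w unfolding zcong_def by (blast intro: Zz_add)
qed

lemma zcong_trans: "zcong m a b \<Longrightarrow> zcong m b c \<Longrightarrow> zcong m a c"
  using zcong_add[of m a b b c] unfolding zcong_def by simp

lemma zcong_mult_const: "zcong m a b \<Longrightarrow> c \<in> Zz \<Longrightarrow> zcong m (c * a) (c * b)"
proof -
  assume "zcong m a b" and c: "c \<in> Zz"
  then obtain w where w: "w \<in> Zz" "a - b = m * w" by (auto simp: zcong_def)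
  have "c * a - c * b = c * (a - b)" by (simp add: right_diff_distrib)
  then have "c * a - c * b = m * (c * w)" using w by simp
  then show ?thesis using w c unfolding zcong_def by (blast intro: Zz_mult)
qed

lemma zcong_mult: "zcong m a b \<Longrightarrow> zcong m c d \<Longrightarrow> b \<in> Zz \<Longrightarrow> c \<in> Zz \<Longrightarrow> zcong m (a * c) (b * d)"
  using zcong_mult_const[of m a b c] zcong_mult_const[of m c d b] zcong_trans[of m "a * c" "b * c" "b * d"]
  by (simp add: mult.commute)

lemma zcong_power: "zcong m a b \<Longrightarrow> a \<in> Zz \<Longrightarrow> b \<in> Zz \<Longrightarrow> zcong m (a ^ n) (b ^ n)"
proof (induction n)
  case (Suc n)
  then have "zcong m (a * a ^ n) (b * b ^ n)" by (intro zcong_mult) (auto intro: Zz_power)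
  then show ?case by simp
qed simp

lemma zcong_prod:
  "(\<And>i. i \<in> S \<Longrightarrow> zcong m (f i) (g i)) \<Longrightarrow> (\<And>i. i \<in> S \<Longrightarrow> f i \<in> Zz) \<Longrightarrow> (\<And>i. i \<in> S \<Longrightarrow> g i \<in> Zz) \<Longrightarrow>
    zcong m (prod f S) (prod g S)"
  by (induction S rule: infinite_finite_induct) (auto intro!: zcong_mult Zz_prod)

lemma zcong_mod_trans: "zcong (m * c) a b \<Longrightarrow> c \<in> Zz \<Longrightarrow> zcong m a b"
  unfolding zcong_def by (metis mult.assoc Zz_mult)

lemma frobenius_add:
  assumes l: "prime l" and ab: "a \<in> Zz" "b \<in> Zz"
  shows "zcong (of_nat l) ((a + b) ^ l) (a ^ l + b ^ l)"
  unfolding zcong_def using frobenius_sub[OF is_sub_Zz l ab] .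

lemma frobenius_add_pow:
  assumes l: "prime l" and ab: "a \<in> Zz" "b \<in> Zz"
  shows "zcong (of_nat l) ((a + b) ^ (l ^ k)) (a ^ (l ^ k) + b ^ (l ^ k))"
proof (induction k)
  case (Suc k)
  have "zcong (of_nat l) (((a + b) ^ (l ^ k)) ^ l) ((a ^ (l ^ k) + b ^ (l ^ k)) ^ l)"
    using Suc ab by (intro zcong_power) (auto intro: Zz_intros)
  moreover have "zcong (of_nat l) ((a ^ (l ^ k) + b ^ (l ^ k)) ^ l) ((a ^ (l ^ k)) ^ l + (b ^ (l ^ k)) ^ l)"
    using ab by (intro frobenius_add l Zz_power)
  moreover have "(z ^ (l ^ k)) ^ l = z ^ (l ^ Suc k)" for z :: complex
    by (metis power_Suc2 power_mult)
  ultimately show ?case using zcong_trans by metis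
qed simp

text \<open>Raising to a power of \<open>l\<close> is additive modulo \<open>l\<close> and fixes
  integers by Fermat, so it acts like the substitution of a power of \<zeta> for \<zeta>.\<close>

lemma frobenius_ieval:
  assumes l: "prime l"
  shows "zcong (of_nat l) (ieval f \<zeta> ^ (l ^ k)) (ieval f (\<zeta> ^ (l ^ k)))"
proof (induction f)
  case 0
  have "l ^ k > 0" using prime_gt_0_nat[OF l] by simp
  then show ?case by (simp add: zero_power)
next
  case (pCons a f)
  have "zcong (of_nat l) (of_int a ^ (l ^ k)) (of_int a)"
  proof -
    have "[a ^ l = a] (mod int l)"
    proof (cases "int l dvd a")
      case True
      then have "int l dvd a ^ l" using prime_gt_0_nat[OF l] by (meson dvd_power dvd_trans)
      then show ?thesis using True by (simp add: cong_iff_dvd_diff)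
    next
      case False
      have "[a * a ^ (l - 1) = a * 1] (mod int l)"
        by (intro cong_mult cong_refl fermat_theorem_int l False)
      then show ?thesis using prime_gt_0_nat[OF l] by (simp add: power_eq_if)
    qed
    then have "[a ^ (l ^ k) = a] (mod int l)"
    proof (induction k)
      case (Suc k)
      have "a ^ (l ^ Suc k) = (a ^ (l ^ k)) ^ l" by (metis power_Suc2 power_mult)
      also have "[\<dots> = a ^ l] (mod int l)" using Suc by (intro cong_pow) auto
      also have "[a ^ l = a] (mod int l)" by (rule Suc.prems)
      finally show ?case .
    qed simp
    then obtain c where "a ^ (l ^ k) - a = int l * c" by (auto simp: cong_iff_dvd_diff)
    then have "complex_of_int (a ^ (l ^ k) - a) = of_int (int l * c)" by simp
    then have "of_int a ^ (l ^ k) - of_int a = of_nat l * complex_of_int c" by simp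
    then show ?thesis unfolding zcong_def by (intro bexI[of _ "of_int c"]) auto
  qed
  moreover have "zcong (of_nat l) ((\<zeta> * ieval f \<zeta>) ^ (l ^ k)) (\<zeta> ^ (l ^ k) * ieval f (\<zeta> ^ (l ^ k)))"
    unfolding power_mult_distrib using pCons by (intro zcong_mult_const) auto
  ultimately have "zcong (of_nat l) (of_int a ^ (l ^ k) + (\<zeta> * ieval f \<zeta>) ^ (l ^ k))
      (of_int a + \<zeta> ^ (l ^ k) * ieval f (\<zeta> ^ (l ^ k)))" by (rule zcong_add)
  moreover have "zcong (of_nat l) ((of_int a + \<zeta> * ieval f \<zeta>) ^ (l ^ k))
      (of_int a ^ (l ^ k) + (\<zeta> * ieval f \<zeta>) ^ (l ^ k))"
    by (intro frobenius_add_pow l Zz_mult Zz_zeta) auto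
  ultimately show ?case unfolding ieval_simps by (rule zcong_trans[rotated])
qed

text \<open>This replaces the structure theory of Z[\<zeta>]/l: it yields the Fermat congruence at
  every prime above \<open>l\<close>, hence maximality and the size of the residue fields.\<close>

lemma frobenius_fixed:
  assumes l: "prime l" "[l ^ k = 1] (mod p)" and z: "z \<in> Zz"
  shows "zcong (of_nat l) (z ^ (l ^ k)) z"
proof -
  obtain f where f: "z = ieval f \<zeta>" using z by (auto simp: Zz_def)
  have "\<zeta> ^ (l ^ k) = \<zeta>" using zeta_pow_cong[OF l(2)] by simp
  then show ?thesis using frobenius_ieval[OF l(1), of f k] f by simp
qed

lemma p_lambda2: "\<exists>U\<in>Zz. of_nat p = (1 - \<zeta>)\<^sup>2 * U"
proof -
  obtain U where U: "U \<in> Zz" "of_nat p = (1 - \<zeta>) ^ (p - 1) * U" using p_lambda_pow by blast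
  have "p - 1 = 2 + (p - 3)" using p_gt2 by simp
  then have "of_nat p = (1 - \<zeta>)\<^sup>2 * ((1 - \<zeta>) ^ (p - 3) * U)"
    using U(2) by (metis mult.assoc power_add)
  then show ?thesis using U(1) by (blast intro: Zz_intros Zz_1)
qed

lemma zcong_lambda2_of_dvd: "int p dvd k \<Longrightarrow> zcong ((1 - \<zeta>)\<^sup>2) (of_int k * (w :: complex)) 0" if "w \<in> Zz"
proof -
  assume "int p dvd k"
  then obtain m where m: "k = int p * m" by (auto elim: dvdE)
  obtain U where U: "U \<in> Zz" "of_nat p = (1 - \<zeta>)\<^sup>2 * U" using p_lambda2 by blast
  have "of_int k * w - 0 = of_nat p * (of_int m * w)" using m by simp
  also have "\<dots> = (1 - \<zeta>)\<^sup>2 * (U * (of_int m * w))" unfolding U(2) by (rule mult.assoc)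
  finally show ?thesis unfolding zcong_def using U(1) that by (blast intro: Zz_intros Zz_of_int)
qed

lemma zeta_pow_lambda2: "zcong ((1 - \<zeta>)\<^sup>2) (\<zeta> ^ k) (1 - of_nat k * (1 - \<zeta>))"
proof (induction k)
  case (Suc k)
  have L: "1 - \<zeta> \<in> Zz" by (intro Zz_intros) auto
  have "zcong ((1 - \<zeta>)\<^sup>2) (\<zeta> * \<zeta> ^ k) (\<zeta> * (1 - of_nat k * (1 - \<zeta>)))"
    using Suc by (rule zcong_mult_const) (rule Zz_zeta)
  moreover have "zcong ((1 - \<zeta>)\<^sup>2) (\<zeta> * (1 - of_nat k * (1 - \<zeta>))) (1 - of_nat (Suc k) * (1 - \<zeta>))"
  proof -
    have "\<zeta> * (1 - of_nat k * (1 - \<zeta>)) - (1 - of_nat (Suc k) * (1 - \<zeta>)) = (1 - \<zeta>)\<^sup>2 * of_nat k"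
      by (simp add: power2_eq_square algebra_simps)
    then show ?thesis unfolding zcong_def by (intro bexI[of _ "of_nat k"]) auto
  qed
  ultimately show ?case using zcong_trans by simp
qed simp

text \<open>The exponent \<open>w\<close> makes the twisted norm form congruent to a rational integer modulo
  \<open>(1 - \<zeta>)\<^sup>2\<close>; this removes the root of unity left open by the factorisation.\<close>

theorem stickelberger_primary:
  assumes xy: "coprime x y" and pxy: "\<not> int p dvd x + y"
    and N: "(\<Sum>i<p. (- x) ^ i * y ^ (p - 1 - i)) = int n ^ p" and n: "n > 0"
    and b: "1 \<le> b" "b \<le> p - 2"
    and u: "\<not> p dvd u" and w: "int p dvd int w * (x + y) + int u * y"
  shows "\<exists>\<gamma>\<in>Zz. (\<Prod>t\<in>stick_set p b. \<zeta> ^ (w * inv_mod p t) * (of_int x + of_int y * \<zeta> ^ (u * inv_mod p t))) = \<gamma> ^ p"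
proof -
  \<comment> \<open>The factorisation is applied with \<zeta>^u as the chosen primitive
    root.\<close>
  interpret c: cyclo p "\<zeta> ^ u" by (rule cyclo_power[OF u])
  have cZ: "c.Zz \<subseteq> Zz" using Zz_ieval_at[OF Zz_zeta_pow] by (auto simp: c.Zz_def)
  obtain \<gamma> i s where g: "\<gamma> \<in> c.Zz" "s \<in> {1, -1}"
    "(\<Prod>t\<in>stick_set p b. of_int x + of_int y * (\<zeta> ^ u) ^ inv_mod p t) = of_int s * (\<zeta> ^ u) ^ i * \<gamma> ^ p"
    using c.stickelberger_norm_form[OF xy pxy N n b] by blast
  have gZ: "\<gamma> \<in> Zz" using g(1) cZ by blast
  let ?T = "stick_set p b" and ?m = "(1 - \<zeta>)\<^sup>2"
  define P where "P = (\<Prod>t\<in>?T. \<zeta> ^ (w * inv_mod p t) * (of_int x + of_int y * \<zeta> ^ (u * inv_mod p t)))"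
  define j where "j = (\<Sum>t\<in>?T. w * inv_mod p t) + u * i"
  define \<delta> where "\<delta> = of_int s * \<gamma>"
  have dZ: "\<delta> \<in> Zz" unfolding \<delta>_def using gZ by (intro Zz_intros) auto
  have sp: "of_int s ^ p = (of_int s :: complex)" using g(2) odd_p by auto
  have PP: "P = \<zeta> ^ j * \<delta> ^ p"
    unfolding P_def prod.distrib power_mult[of \<zeta> u] g(3) \<delta>_def power_mult_distrib sp j_def power_add power_sum
    by (simp only: mult_ac)
  \<comment> \<open>Modulo (1 - \<zeta>)^2 a factor is x + y minus (w (x + y) + u y) k (1 -
    \<zeta>), and the hypothesis on \<open>w\<close> makes the linear term vanish.\<close>
  have fac: "zcong ?m (\<zeta> ^ (w * k) * (of_int x + of_int y * \<zeta> ^ (u * k))) (of_int (x + y))" for k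
  proof -
    have L: "1 - \<zeta> \<in> Zz" by (intro Zz_intros) auto
    have "zcong ?m (of_int x + of_int y * \<zeta> ^ (u * k)) (of_int x + of_int y * (1 - of_nat (u * k) * (1 - \<zeta>)))"
      by (intro zcong_add zcong_refl zcong_mult_const zeta_pow_lambda2) simp
    then have "zcong ?m (\<zeta> ^ (w * k) * (of_int x + of_int y * \<zeta> ^ (u * k)))
        ((1 - of_nat (w * k) * (1 - \<zeta>)) * (of_int x + of_int y * (1 - of_nat (u * k) * (1 - \<zeta>))))"
      by (intro zcong_mult zeta_pow_lambda2) (auto intro!: Zz_intros Zz_1 Zz_of_int Zz_of_nat)
    moreover have "(1 - of_nat (w * k) * (1 - \<zeta>)) * (of_int x + of_int y * (1 - of_nat (u * k) * (1 - \<zeta>)))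
        - (of_int (x + y) - of_int (int w * (x + y) + int u * y) * (of_nat k * (1 - \<zeta>)))
      = ?m * (of_nat (w * k) * of_nat (u * k) * of_int y)"
      by (simp add: power2_eq_square algebra_simps)
    then have "zcong ?m ((1 - of_nat (w * k) * (1 - \<zeta>)) * (of_int x + of_int y * (1 - of_nat (u * k) * (1 - \<zeta>))))
        (of_int (x + y) - of_int (int w * (x + y) + int u * y) * (of_nat k * (1 - \<zeta>)))"
      unfolding zcong_def by (intro bexI) (auto intro!: Zz_mult)
    moreover have "zcong ?m (of_int (x + y) - of_int (int w * (x + y) + int u * y) * (of_nat k * (1 - \<zeta>))) (of_int (x + y))"
    proof -
      have "zcong ?m (of_int (int w * (x + y) + int u * y) * (of_nat k * (1 - \<zeta>))) 0"
        using L by (intro zcong_lambda2_of_dvd w Zz_mult) auto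
      then have "zcong ?m (of_int (x + y) + (-1) * (of_int (int w * (x + y) + int u * y) * (of_nat k * (1 - \<zeta>)))) (of_int (x + y) + (-1) * 0)"
        using Zz_of_int[of "-1"] by (intro zcong_add zcong_refl zcong_mult_const) auto
      then show ?thesis by simp
    qed
    ultimately show ?thesis using zcong_trans by blast
  qed
  define S where "S = (x + y) ^ card ?T"
  have cP: "zcong ?m P (of_int S)"
  proof -
    have "zcong ?m P (\<Prod>t\<in>?T. of_int (x + y))"
      unfolding P_def
      by (intro zcong_prod fac Zz_mult Zz_add Zz_zeta_pow Zz_of_int)
    then show ?thesis by (simp add: S_def)
  qed
  \<comment> \<open>The Frobenius congruence for l = p sends \<zeta> to \<zeta>^p = 1, so a
    \<open>p\<close>-th power is an integer modulo \<open>p\<close>. Since p > 2, this is also true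
    modulo (1 - \<zeta>)^2.\<close>
  obtain c where c: "zcong ?m (\<delta> ^ p) (of_int c)"
  proof -
    obtain f where f: "\<delta> = ieval f \<zeta>" using dZ by (auto simp: Zz_def)
    have "zcong (of_nat p) (\<delta> ^ p) (ieval f 1)"
      using frobenius_ieval[OF p_prime, of f 1] f zeta_p by simp
    moreover have "ieval f 1 = of_int (poly f 1)" by (metis of_int_1 of_int_poly_hom.poly_map_poly_eval_poly of_int_hom.poly_map_poly)
    moreover obtain U where "U \<in> Zz" "of_nat p = ?m * U" using p_lambda2 by blast
    ultimately have "zcong ?m (\<delta> ^ p) (of_int (poly f 1))" using zcong_mod_trans by metis
    then show ?thesis using that by blast
  qed
  have key: "zcong ?m (of_int S) ((1 - of_nat j * (1 - \<zeta>)) * of_int c)"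
  proof -
    have "zcong ?m (\<zeta> ^ j * \<delta> ^ p) ((1 - of_nat j * (1 - \<zeta>)) * of_int c)"
      using dZ by (intro zcong_mult zeta_pow_lambda2 c Zz_power Zz_diff Zz_mult Zz_1 Zz_of_nat Zz_zeta)
    then show ?thesis using cP zcong_sym zcong_trans unfolding PP by blast
  qed
  then obtain v where v: "v \<in> Zz" "of_int S - (1 - of_nat j * (1 - \<zeta>)) * of_int c = ?m * v"
    by (auto simp: zcong_def)
  \<comment> \<open>Modulo 1 - \<zeta> the two integers agree, hence modulo \<open>p\<close> and
    modulo (1 - \<zeta>)^2. What remains at first order is j c (1 - \<zeta>), which forces
    \<open>p\<close> to divide \<open>j\<close>.\<close>
  have "of_int (S - c) = (1 - \<zeta>) * ((1 - \<zeta>) * v - of_nat j * of_int c)"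
    using v(2) by (simp add: power2_eq_square algebra_simps)
  moreover have "algebraic_int ((1 - \<zeta>) * v - of_nat j * of_int c)"
    using v(1) by (intro Zz_algebraic_int Zz_intros) auto
  ultimately have pSc: "int p dvd S - c" by (rule p_dvd_of_lambda)
  then obtain v' where v': "v' \<in> Zz" "of_int (S - c) * 1 - 0 = ?m * v'"
    using zcong_lambda2_of_dvd[OF Zz_1, of "S - c"] by (auto simp: zcong_def)
  have "(1 - \<zeta>) * of_int (int j * c) = (of_int S - (1 - of_nat j * (1 - \<zeta>)) * of_int c) - (of_int (S - c) * 1 - 0)"
    by (simp add: algebra_simps)
  also have "\<dots> = (1 - \<zeta>) * ((1 - \<zeta>) * (v - v'))"
    unfolding v(2) v'(2) by (simp add: power2_eq_square algebra_simps)
  finally have "(1 - \<zeta>) * of_int (int j * c) = (1 - \<zeta>) * ((1 - \<zeta>) * (v - v'))" .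
  then have "of_int (int j * c) = (1 - \<zeta>) * (v - v')" using zeta_ne_1 by simp
  moreover have "algebraic_int (v - v')" using v v' by (intro Zz_algebraic_int Zz_diff)
  ultimately have "int p dvd int j * c" by (rule p_dvd_of_lambda)
  moreover have pp: "prime (int p)" using p_prime by simp
  ultimately have "int p dvd int j \<or> int p dvd c" using prime_dvd_mult_iff by blast
  moreover have "\<not> int p dvd c"
  proof
    assume "int p dvd c"
    then have "int p dvd S" using pSc by (metis dvd_add diff_add_cancel)
    then show False using pxy prime_dvd_power[OF pp] by (auto simp: S_def)
  qed
  ultimately have "\<zeta> ^ j = 1" unfolding zeta_pow_1_iff by simp
  then show ?thesis using PP dZ unfolding P_def by (intro bexI[of _ \<delta>]) auto
qed

end

subsection \<open>Primes of \<open>\<int>[\<zeta>]\<close> and their residue fields\<close>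

abbreviation sub_ring :: "complex set \<Rightarrow> complex ring" where
  "sub_ring S \<equiv> complex_ring\<lparr>carrier := S\<rparr>"

lemma sub_ring_simps [simp]:
  "mult (sub_ring S) = (*)" "add (sub_ring S) = (+)" "one (sub_ring S) = 1" "zero (sub_ring S) = 0"
  by (auto simp: ring_of_type_algebra_def)

lemma cring_sub_ring:
  assumes S: "is_sub S"
  shows "cring (sub_ring S)"
proof (rule cringI)
  show "abelian_group (sub_ring S)"
  proof (rule abelian_groupI)
    fix x assume "x \<in> carrier (sub_ring S)"
    then show "\<exists>y\<in>carrier (sub_ring S). y \<oplus>\<^bsub>sub_ring S\<^esub> x = \<zero>\<^bsub>sub_ring S\<^esub>"
      using S by (intro bexI[of _ "- x"]) (auto simp: is_sub_def)
  qed (use S in \<open>auto simp: is_sub_def\<close>)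
  show "Group.comm_monoid (sub_ring S)"
    by (rule comm_monoidI) (use S in \<open>auto simp: is_sub_def\<close>)
qed (auto simp: algebra_simps)

lemma ideal_sub_ring_iff:
  assumes S: "is_sub S"
  shows "ideal I (sub_ring S) \<longleftrightarrow> is_idl S I"
proof
  interpret cring "sub_ring S" by (rule cring_sub_ring[OF S])
  assume I: "ideal I (sub_ring S)"
  interpret ideal I "sub_ring S" by (rule I)
  show "is_idl S I"
    unfolding is_idl_def using a_subset zero_closed a_closed I_l_closed by auto
next
  interpret cring "sub_ring S" by (rule cring_sub_ring[OF S])
  assume I: "is_idl S I"
  show "ideal I (sub_ring S)"
  proof (rule idealI)
    show "ring (sub_ring S)" by (rule ring_axioms)
    show "subgroup I (add_monoid (sub_ring S))"
    proof (rule group.subgroupI[OF a_group])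
      show "I \<subseteq> carrier (add_monoid (sub_ring S))" "I \<noteq> {}" using I by (auto simp: is_idl_def)
      fix a assume a: "a \<in> I"
      then have aS: "a \<in> S" "- a \<in> S" using is_idl_sub[OF I] S by (auto simp: is_sub_def)
      have "\<ominus>\<^bsub>sub_ring S\<^esub> a = - a" by (rule minus_equality) (use aS in auto)
      then show "inv\<^bsub>add_monoid (sub_ring S)\<^esub> a \<in> I"
        using is_idl_uminus[OF S I a] by (simp add: a_inv_def)
      fix b assume "b \<in> I"
      then show "a \<otimes>\<^bsub>add_monoid (sub_ring S)\<^esub> b \<in> I" using is_idl_add[OF I a] by simp
    qed
  qed (use is_idl_mult[OF I] is_idl_mult_right[OF I] in auto)
qed

lemma primeideal_sub_ring_iff:
  assumes S: "is_sub S"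
  shows "primeideal P (sub_ring S) \<longleftrightarrow> is_prm S P"
proof
  assume P: "primeideal P (sub_ring S)"
  interpret primeideal P "sub_ring S" by (rule P)
  have idl: "is_idl S P" using ideal_axioms ideal_sub_ring_iff[OF S] by simp
  have "1 \<notin> P"
  proof
    assume "1 \<in> P"
    then have "\<one>\<^bsub>sub_ring S\<^esub> \<in> P" by simp
    then show False using one_imp_carrier I_notcarr by blast
  qed
  then show "is_prm S P" using idl I_prime by (auto simp: is_prm_def)
next
  assume P: "is_prm S P"
  show "primeideal P (sub_ring S)"
  proof (rule primeidealI)
    show "ideal P (sub_ring S)" using ideal_sub_ring_iff[OF S] is_prm_idl[OF P] by simp
    show "carrier (sub_ring S) \<noteq> P" using is_prm_one[OF P] S by (auto simp: is_sub_def)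
  qed (use P cring_sub_ring[OF S] in \<open>auto simp: is_prm_def\<close>)
qed

text \<open>The hypotheses make the quotient a finite field. Its multiplicative group is cyclic, so
  every common exponent of the units is at least q - 1; this determines \<open>q\<close> without
  residue degrees.\<close>

theorem quotient_by_prime:
  assumes S: "is_sub S" and P: "is_prm S P" and l: "prime l" "of_nat l \<in> P"
    and fin: "finite R0" "R0 \<subseteq> S" "\<forall>z\<in>S. \<exists>w\<in>R0. z - w \<in> P"
    and mx: "\<forall>v\<in>S. v \<notin> P \<longrightarrow> (\<exists>w\<in>S. v * w - 1 \<in> P)"
  defines "q \<equiv> card (carrier (sub_ring S Quot P))"
  shows "\<exists>e. e > 0 \<and> q = l ^ e"
    and "\<And>z. z \<in> S \<Longrightarrow> z \<notin> P \<Longrightarrow> z ^ (q - 1) - 1 \<in> P"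
    and "\<And>N. N > 0 \<Longrightarrow> \<forall>z\<in>S. z \<notin> P \<longrightarrow> z ^ N - 1 \<in> P \<Longrightarrow> q - 1 \<le> N"
proof -
  let ?R = "sub_ring S"
  let ?F = "?R Quot P"
  have idl: "is_idl S P" by (rule is_prm_idl[OF P])
  have cr: "cring ?R" by (rule cring_sub_ring[OF S])
  interpret cring ?R by (rule cr)
  have pi: "ideal P ?R" using ideal_sub_ring_iff[OF S] idl by simp
  interpret I: ideal P ?R by (rule pi)
  define \<phi> where "\<phi> = (\<lambda>z. P +>\<^bsub>?R\<^esub> z)"
  have phi: "\<phi> z = (\<lambda>h. h + z) ` P" for z
    by (auto simp: \<phi>_def a_r_coset_def')
  have carF: "carrier ?F = \<phi> ` S"
    by (auto simp: FactRing_def A_RCOSETS_def' \<phi>_def)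
  have phi_eq: "\<phi> z = \<phi> w \<longleftrightarrow> z - w \<in> P" for z w
  proof
    assume "\<phi> z = \<phi> w"
    moreover have "z \<in> \<phi> z" unfolding phi using is_idl_zero[OF idl] by (intro image_eqI[of _ _ 0]) auto
    ultimately obtain h where "h \<in> P" "z = h + w" unfolding phi by auto
    then show "z - w \<in> P" by simp
  next
    assume d: "z - w \<in> P"
    show "\<phi> z = \<phi> w" unfolding phi
    proof (intro equalityI image_subsetI)
      fix h assume h: "h \<in> P"
      have "h + z = (h + (z - w)) + w" by simp
      then show "h + z \<in> (\<lambda>h. h + w) ` P" using is_idl_add[OF idl h d] by blast
      have "h + w = (h - (z - w)) + z" by simp
      then show "h + w \<in> (\<lambda>h. h + z) ` P" using is_idl_diff[OF S idl h d] by blast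
    qed
  qed
  note hom = I.rcos_ring_hom[folded \<phi>_def]
  have phi_mult: "\<phi> z \<otimes>\<^bsub>?F\<^esub> \<phi> w = \<phi> (z * w)" if "z \<in> S" "w \<in> S" for z w
    using ring_hom_mult[OF hom, of z w] that by simp
  have phi_add: "\<phi> z \<oplus>\<^bsub>?F\<^esub> \<phi> w = \<phi> (z + w)" if "z \<in> S" "w \<in> S" for z w
    using ring_hom_add[OF hom, of z w] that by simp
  have phi_one: "\<one>\<^bsub>?F\<^esub> = \<phi> 1" using ring_hom_one[OF hom] by simp
  have phi_zero: "\<zero>\<^bsub>?F\<^esub> = \<phi> 0" by (simp add: FactRing_def phi)
  have S1: "1 \<in> S" "0 \<in> S" and Smult: "\<And>a b. a \<in> S \<Longrightarrow> b \<in> S \<Longrightarrow> a * b \<in> S"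
    and Sadd: "\<And>a b. a \<in> S \<Longrightarrow> b \<in> S \<Longrightarrow> a + b \<in> S" using S by (auto simp: is_sub_def)
  have Spow: "z ^ n \<in> S" if "z \<in> S" for z n using is_sub_power[OF S that] .
  have Snat: "of_nat n \<in> S" for n by (induction n) (auto intro: S1 Sadd)
  have phi_pow: "\<phi> z [^]\<^bsub>?F\<^esub> n = \<phi> (z ^ n)" if z: "z \<in> S" for z and n :: nat
  proof (induction n)
    case (Suc n)
    then show ?case using phi_mult[OF Spow[OF z] z, of n] by (simp add: nat_pow_def mult.commute)
  qed (simp add: nat_pow_def phi_one)
  have phi_nat: "\<phi> z [^]\<^bsub>add_monoid ?F\<^esub> n = \<phi> (of_nat n * z)" if z: "z \<in> S" for z and n :: nat
  proof (induction n)
    case (Suc n)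
    then show ?case using phi_add[OF Smult[OF Snat z] z, of n]
      by (simp add: nat_pow_def distrib_right add.commute)
  qed (simp add: nat_pow_def phi_zero)
  have finF: "finite (carrier ?F)"
  proof -
    have "carrier ?F \<subseteq> \<phi> ` R0"
      unfolding carF
    proof (rule image_subsetI)
      fix z assume "z \<in> S"
      then obtain w where w: "w \<in> R0" "z - w \<in> P" using fin(3) by blast
      then have "\<phi> z = \<phi> w" by (simp only: phi_eq)
      then show "\<phi> z \<in> \<phi> ` R0" using w(1) by simp
    qed
    then show ?thesis using fin(1) finite_surj by blast
  qed
  have q_gt1: "q > 1"
  proof -
    have "\<phi> 1 \<noteq> \<phi> 0" using phi_eq is_prm_one[OF P] by simp
    then have "card {\<phi> 0, \<phi> 1} = 2" by simp
    moreover have "card {\<phi> 0, \<phi> 1} \<le> q" unfolding q_def using S1 by (intro card_mono finF) (auto simp: carF)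
    ultimately show ?thesis by simp
  qed
  have "maximalideal P ?R"
  proof (rule maximalidealI[OF pi])
    show "carrier ?R \<noteq> P" using is_prm_one[OF P] S1 by auto
    fix J assume J: "ideal J ?R" "P \<subseteq> J" "J \<subseteq> carrier ?R"
    have jd: "is_idl S J" using J(1) ideal_sub_ring_iff[OF S] by simp
    show "J = P \<or> J = carrier ?R"
    proof (cases "J = P")
      case False
      then obtain v where v: "v \<in> J" "v \<notin> P" using J(2) by blast
      then have vS: "v \<in> S" using is_idl_sub[OF jd] by blast
      obtain w where w: "w \<in> S" "v * w - 1 \<in> P" using mx vS v(2) by blast
      have "v * w \<in> J" by (rule is_idl_mult_right[OF jd w(1) v(1)])
      moreover have "v * w - 1 \<in> J" using J(2) w(2) by blast
      ultimately have "v * w - (v * w - 1) \<in> J" by (rule is_idl_diff[OF S jd])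
      then have "1 \<in> J" by simp
      then have "S \<subseteq> J" using is_idl_mult[OF jd, of _ 1] by auto
      then show ?thesis using J(3) by auto
    qed simp
  qed
  then have fF: "field ?F" using cr by (rule maximalideal.quotient_is_field)
  interpret F: field ?F by (rule fF)
  interpret M: Group.group "Multiplicative_Group.mult_of ?F" by (rule F.field_mult_group)
  have ordM: "Coset.order (Multiplicative_Group.mult_of ?F) = q - 1"
    unfolding q_def using F.order_mult_of[OF finF] by (simp add: Coset.order_def)
  have carM: "\<phi> z \<in> carrier (Multiplicative_Group.mult_of ?F)" if "z \<in> S" "z \<notin> P" for z
    using that phi_eq[of z 0] phi_zero by (auto simp: Multiplicative_Group.carrier_mult_of carF)
  show "z ^ (q - 1) - 1 \<in> P" if z: "z \<in> S" "z \<notin> P" for z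
  proof -
    have "\<phi> z [^]\<^bsub>Multiplicative_Group.mult_of ?F\<^esub> Coset.order (Multiplicative_Group.mult_of ?F) = \<one>\<^bsub>Multiplicative_Group.mult_of ?F\<^esub>"
      by (rule M.pow_order_eq_1[OF carM[OF z]])
    then have "\<phi> (z ^ (q - 1)) = \<phi> 1"
      using phi_pow[OF z(1)] by (simp add: ordM Multiplicative_Group.nat_pow_mult_of Multiplicative_Group.one_mult_of phi_one)
    then show ?thesis using phi_eq by simp
  qed
  show "q - 1 \<le> N" if N: "N > 0" "\<forall>z\<in>S. z \<notin> P \<longrightarrow> z ^ N - 1 \<in> P" for N
  proof -
    \<comment> \<open>The powers of a generator repeat with period \<open>N\<close>, so the
      multiplicative group has at most \<open>N\<close> elements.\<close>
    obtain a where a: "a \<in> carrier (Multiplicative_Group.mult_of ?F)" "carrier (Multiplicative_Group.mult_of ?F) = {a [^]\<^bsub>?F\<^esub> i | i::nat. i \<in> UNIV}"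
      using F.finite_field_mult_group_has_gen[OF finF] by blast
    then obtain z where z: "z \<in> S" "a = \<phi> z" by (auto simp: Multiplicative_Group.carrier_mult_of carF)
    have zP: "z \<notin> P" using a(1) z(2) phi_eq[of z 0] phi_zero by (auto simp: Multiplicative_Group.carrier_mult_of)
    have zmod: "\<phi> (z ^ i) = \<phi> (z ^ (i mod N))" for i
    proof -
      have "(z ^ N) ^ k - 1 \<in> P" for k
      proof (induction k)
        case (Suc k)
        have "(z ^ N) ^ Suc k - 1 = z ^ N * ((z ^ N) ^ k - 1) + (z ^ N - 1)" by (simp add: algebra_simps)
        then show ?case using Suc bspec[OF N(2) z(1)] zP Spow[OF z(1)]
          by (simp only: simp_thms) (intro is_idl_add[OF idl] is_idl_mult[OF idl])
      qed (use is_idl_zero[OF idl] in simp)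
      then have "z ^ (i mod N) * ((z ^ N) ^ (i div N) - 1) \<in> P"
        by (intro is_idl_mult[OF idl] Spow z(1))
      moreover have "z ^ i = z ^ (i mod N) * (z ^ N) ^ (i div N)"
        by (simp flip: power_mult power_add)
      ultimately show ?thesis unfolding phi_eq by (simp add: right_diff_distrib)
    qed
    have "carrier (Multiplicative_Group.mult_of ?F) \<subseteq> (\<lambda>i. \<phi> (z ^ i)) ` {..<N}"
    proof
      fix y assume "y \<in> carrier (Multiplicative_Group.mult_of ?F)"
      then obtain i :: nat where "y = \<phi> (z ^ i)" unfolding a(2) z(2) phi_pow[OF z(1)] by blast
      then have "y = \<phi> (z ^ (i mod N))" using zmod by simp
      then show "y \<in> (\<lambda>i. \<phi> (z ^ i)) ` {..<N}" using N(1) by simp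
    qed
    then have "card (carrier (Multiplicative_Group.mult_of ?F)) \<le> card ((\<lambda>i. \<phi> (z ^ i)) ` {..<N})" by (intro card_mono) auto
    also have "\<dots> \<le> N" using card_image_le[of "{..<N}" "\<lambda>i. \<phi> (z ^ i)"] by simp
    finally show ?thesis using ordM by (simp add: Coset.order_def)
  qed
  \<comment> \<open>A Sylow subgroup of the additive group for another prime \<open>r\<close> would
    contain a nonzero element killed by a power of \<open>r\<close> and also by
    \<open>l\<close>.\<close>
  have only_l: "r = l" if r: "prime r" "r dvd q" for r
  proof (rule ccontr)
    assume rl: "r \<noteq> l"
    have q0: "q \<noteq> 0" using q_gt1 by simp
    define a where "a = multiplicity r q"
    have a0: "a > 0" using r q0 by (simp add: a_def prime_multiplicity_gt_zero_iff)
    interpret A: Group.group "add_monoid ?F" by (rule F.a_group)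
    have ordA: "Coset.order (add_monoid ?F) = r ^ a * (q div r ^ a)"
      using multiplicity_dvd[of r q] by (simp add: Coset.order_def q_def a_def)
    have "\<exists>H. subgroup H (add_monoid ?F) \<and> card H = r ^ a"
      using sylow_thm[of r "add_monoid ?F" a "q div r ^ a"] r(1) F.a_group ordA finF by simp
    then obtain H where H: "subgroup H (add_monoid ?F)" "card H = r ^ a" by blast
    have "H \<noteq> {\<zero>\<^bsub>?F\<^esub>}"
    proof
      assume "H = {\<zero>\<^bsub>?F\<^esub>}"
      then have "r ^ a = 1" using H(2) by simp
      then show False using a0 prime_gt_1_nat[OF r(1)] by simp
    qed
    moreover have "\<zero>\<^bsub>?F\<^esub> \<in> H" using subgroup.one_closed[OF H(1)] by simp
    ultimately obtain x where x: "x \<in> H" "x \<noteq> \<zero>\<^bsub>?F\<^esub>" by blast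
    then obtain z where z: "z \<in> S" "x = \<phi> z" using subgroup.subset[OF H(1)] by (auto simp: carF)
    interpret HG: Group.group "(add_monoid ?F)\<lparr>carrier := H\<rparr>" by (rule subgroup.subgroup_is_group[OF H(1) F.a_group])
    have "x [^]\<^bsub>(add_monoid ?F)\<lparr>carrier := H\<rparr>\<^esub> Coset.order ((add_monoid ?F)\<lparr>carrier := H\<rparr>) =
        \<one>\<^bsub>(add_monoid ?F)\<lparr>carrier := H\<rparr>\<^esub>"
      using x(1) by (intro HG.pow_order_eq_1) simp
    then have "x [^]\<^bsub>add_monoid ?F\<^esub> (r ^ a) = \<zero>\<^bsub>?F\<^esub>"
      using H(2) by (simp add: Coset.order_def nat_pow_def)
    then have "\<phi> (of_nat (r ^ a) * z) = \<zero>\<^bsub>?F\<^esub>" unfolding z(2) phi_nat[OF z(1)] .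
    then have "\<phi> (of_nat (r ^ a) * z) = \<phi> 0" by (simp only: phi_zero)
    then have rz: "of_nat (r ^ a) * z \<in> P" by (simp only: phi_eq diff_zero)
    have "coprime (r ^ a) l" using primes_coprime[OF r(1) l(1) rl] by simp
    then have "gcd (int (r ^ a)) (int l) = 1" by (simp only: coprime_int_iff flip: coprime_iff_gcd_eq_1)
    then obtain u v where uv: "u * int (r ^ a) + v * int l = 1"
      using bezout_int[of "int (r ^ a)" "int l"] by auto
    have Sint: "of_int k \<in> S" for k :: int
    proof (cases "k \<ge> 0")
      case True
      then show ?thesis using Snat[of "nat k"] by simp
    next
      case False
      have "- of_nat (nat (- k)) \<in> S" using Snat[of "nat (- k)"] S by (simp only: is_sub_def)
      then show ?thesis using False by simp
    qed
    have "z = of_int (u * int (r ^ a) + v * int l) * z" unfolding uv by simp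
    also have "\<dots> = of_int u * (of_nat (r ^ a) * z) + (of_int v * z) * of_nat l" by (simp add: algebra_simps)
    also have "\<dots> \<in> P" by (intro is_idl_add[OF idl] is_idl_mult[OF idl] rz l(2) Sint Smult z(1))
    finally have "\<phi> z = \<phi> 0" using phi_eq by simp
    then show False using x z phi_zero by simp
  qed
  show "\<exists>e. e > 0 \<and> q = l ^ e"
  proof -
    have q0: "q \<noteq> 0" using q_gt1 by simp
    have sub: "prime_factors q \<subseteq> {l}"
    proof
      fix r assume "r \<in> prime_factors q"
      then have "prime r" "r dvd q" by auto
      then show "r \<in> {l}" using only_l by simp
    qed
    obtain r where "prime r" "r dvd q" using prime_factor_nat[of q] q_gt1 by auto
    then have "r \<in> prime_factors q" using q0 by (simp add: in_prime_factors_iff)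
    then have pf: "prime_factors q = {l}" using subset_singletonD[OF sub] by auto
    have "q = (\<Prod>r\<in>prime_factors q. r ^ multiplicity r q)" using q0 by (simp add: prod_prime_factors)
    then have "q = l ^ multiplicity l q" by (simp add: pf)
    moreover have "multiplicity l q > 0" using pf by (auto simp: prime_factors_multiplicity)
    ultimately show ?thesis by blast
  qed
qed

section \<open>Generated subfields and their rings of integers\<close>

definition is_fld :: "complex set \<Rightarrow> bool" where
  "is_fld E \<longleftrightarrow> is_sub E \<and> (\<forall>a\<in>E. inverse a \<in> E)"

lemma complex_ring_eq: "complex_ring = sub_ring UNIV"
  by (simp add: ring_of_type_algebra_def)

lemma complex_ring_simps [simp]:
  "mult complex_ring = (*)" "add complex_ring = (+)" "one complex_ring = 1" "zero complex_ring = 0"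
  "carrier complex_ring = UNIV"
  by (auto simp: ring_of_type_algebra_def)

lemma complex_ring_a_inv: "\<ominus>\<^bsub>complex_ring\<^esub> h = - h"
proof -
  interpret cring complex_ring
    by (subst complex_ring_eq, rule cring_sub_ring) (simp add: is_sub_def)
  show ?thesis by (rule minus_equality) auto
qed

lemma complex_ring_m_inv: "h \<noteq> 0 \<Longrightarrow> inv\<^bsub>complex_ring\<^esub> h = inverse h"
proof -
  assume h: "h \<noteq> 0"
  interpret cring complex_ring
    by (subst complex_ring_eq, rule cring_sub_ring) (simp add: is_sub_def)
  show ?thesis by (rule comm_inv_char) (use h in auto)
qed

lemma is_fld_generate_field: "is_fld (generate_field complex_ring H)"
proof -
  let ?G = "generate_field complex_ring H"
  have one: "1 \<in> ?G" using generate_field.one[of complex_ring H] by simp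
  have neg: "- a \<in> ?G" if "a \<in> ?G" for a
    using generate_field.a_inv[OF that] by (simp add: complex_ring_a_inv)
  have add: "a + b \<in> ?G" if "a \<in> ?G" "b \<in> ?G" for a b
    using generate_field.eng_add[OF that] by simp
  have mul: "a * b \<in> ?G" if "a \<in> ?G" "b \<in> ?G" for a b
    using generate_field.eng_mult[OF that] by simp
  have zero: "0 \<in> ?G" using add[OF one neg[OF one]] by simp
  have inv: "inverse a \<in> ?G" if "a \<in> ?G" for a
  proof (cases "a = 0")
    case False
    then have "inv\<^bsub>complex_ring\<^esub> a \<in> ?G" using that by (intro generate_field.m_inv) auto
    then show ?thesis using complex_ring_m_inv[OF False] by simp
  qed (simp add: zero)
  show ?thesis by (simp add: is_fld_def is_sub_def zero one neg add mul inv)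
qed

lemma generate_field_least:
  assumes E: "is_fld E" and H: "H \<subseteq> E"
  shows "generate_field complex_ring H \<subseteq> E"
proof
  fix z assume "z \<in> generate_field complex_ring H"
  then show "z \<in> E"
  proof (induction rule: generate_field.induct)
    case (m_inv h)
    then show ?case using E complex_ring_m_inv[of h] by (auto simp: is_fld_def)
  qed (use E H in \<open>auto simp: is_fld_def is_sub_def complex_ring_a_inv\<close>)
qed

lemma generate_field_incl_set: "H \<subseteq> generate_field complex_ring H"
  by (auto intro: generate_field.incl)

lemma is_fld_of_int: "is_fld E \<Longrightarrow> of_int k \<in> E"
proof -
  assume E: "is_fld E"
  have n: "of_nat n \<in> E" for n by (induction n) (use E in \<open>auto simp: is_fld_def is_sub_def\<close>)
  show ?thesis
  proof (cases "k \<ge> 0")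
    case True
    then show ?thesis using n[of "nat k"] by simp
  next
    case False
    have "- of_nat (nat (- k)) \<in> E" using n[of "nat (- k)"] E unfolding is_fld_def is_sub_def by blast
    then show ?thesis using False by simp
  qed
qed

lemma is_fld_ieval: "is_fld E \<Longrightarrow> z \<in> E \<Longrightarrow> ieval f z \<in> E"
  by (induction f) (auto simp: ieval_simps is_fld_of_int is_fld_def is_sub_def)

lemma ring_of_integers_sub_ring: "ring_of_integers F = sub_ring {z \<in> F. algebraic_int z}"
  by (simp add: ring_of_integers_def)

lemma is_sub_integers: "is_sub F \<Longrightarrow> is_sub {z \<in> F. algebraic_int z}"
  unfolding is_sub_def by (auto intro: algebraic_int_add algebraic_int_mult)

context cyclo
begin

lemma is_fld_QK: "is_fld QK"
  by (simp add: is_fld_def is_sub_def QK_Zz QK_uminus QK_add QK_mult QK_inverse)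

lemma cyclotomic_field_eq: "cyclotomic_field \<zeta> = QK"
proof
  show "cyclotomic_field \<zeta> \<subseteq> QK"
    unfolding cyclotomic_field_def
    by (rule generate_field_least[OF is_fld_QK]) (simp add: QK_Zz Zz_zeta)
  show "QK \<subseteq> cyclotomic_field \<zeta>"
  proof
    let ?G = "generate_field complex_ring {\<zeta>}"
    have G: "is_fld ?G" by (rule is_fld_generate_field)
    fix z assume "z \<in> QK"
    then obtain n f where n: "n > 0" "of_nat n * z = ieval f \<zeta>" using QK_repr by blast
    have "ieval f \<zeta> \<in> ?G" using G generate_field_incl_set[of "{\<zeta>}"] by (intro is_fld_ieval) auto
    moreover have "inverse (of_nat n) \<in> ?G" using is_fld_of_int[OF G, of "int n"] G by (auto simp: is_fld_def)
    ultimately have "inverse (of_nat n) * ieval f \<zeta> \<in> ?G" using G by (auto simp: is_fld_def is_sub_def)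
    moreover have "inverse (of_nat n) * ieval f \<zeta> = z" unfolding n(2)[symmetric] using n(1) by simp
    ultimately show "z \<in> cyclotomic_field \<zeta>" by (simp add: cyclotomic_field_def)
  qed
qed

lemma ring_of_integers_eq: "ring_of_integers (cyclotomic_field \<zeta>) = sub_ring Zz"
  by (simp add: ring_of_integers_sub_ring cyclotomic_field_eq QK_algebraic_int_iff)

lemma Zz_idl_int:
  assumes Q: "is_idl Zz Q" "1 \<notin> Q" and l: "prime l" "of_nat l \<in> Q"
  shows "of_int k \<in> Q \<longleftrightarrow> int l dvd k"
proof
  assume "int l dvd k"
  then obtain m where "k = int l * m" by (auto elim: dvdE)
  then show "of_int k \<in> Q" using is_idl_mult_right[OF Q(1) Zz_of_int l(2), of m] by simp
next
  assume k: "of_int k \<in> Q"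
  show "int l dvd k"
  proof (rule ccontr)
    assume "\<not> int l dvd k"
    moreover have "prime (int l)" using l(1) by simp
    ultimately have "coprime (int l) k" by (intro prime_imp_coprime)
    then have "gcd (int l) k = 1" by simp
    then obtain u v where "u * int l + v * k = 1" using bezout_int[of "int l" k] by auto
    then have "complex_of_int (u * int l + v * k) = 1" by simp
    then have "1 = of_int u * of_nat l + of_int v * (of_int k :: complex)" by simp
    also have "\<dots> \<in> Q" by (intro is_idl_add[OF Q(1)] is_idl_mult[OF Q(1)] l(2) k Zz_of_int)
    finally show False using Q(2) by simp
  qed
qed

lemma idl_zcong: "is_idl Zz Q \<Longrightarrow> m \<in> Q \<Longrightarrow> zcong m a b \<Longrightarrow> b \<in> Q \<Longrightarrow> a \<in> Q"
proof -
  assume Q: "is_idl Zz Q" and m: "m \<in> Q" and "zcong m a b" and b: "b \<in> Q"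
  then obtain w where w: "w \<in> Zz" "a - b = m * w" by (auto simp: zcong_def)
  have "m * w + b \<in> Q" by (intro is_idl_add[OF Q] is_idl_mult_right[OF Q] w m b)
  then have "a - b + b \<in> Q" unfolding w(2) .
  then show ?thesis by simp
qed

lemma finite_residues:
  assumes l: "l > 0"
  shows "\<exists>R\<subseteq>Zz. finite R \<and> (\<forall>z\<in>Zz. \<exists>w\<in>R. zcong (of_nat l) z w)"
proof -
  define R where "R = (\<lambda>a. \<Sum>j<p. of_nat (a j) * \<zeta> ^ j) ` (PiE {..<p} (\<lambda>_. {..<l}))"
  have "finite R" unfolding R_def by (intro finite_imageI finite_PiE) auto
  moreover have "R \<subseteq> Zz"
    unfolding R_def by (rule image_subsetI) (intro Zz_sum Zz_mult Zz_of_nat Zz_zeta_pow)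
  moreover have "\<exists>w\<in>R. zcong (of_nat l) z w" if zZ: "z \<in> Zz" for z
  proof -
    obtain f where f: "degree f < p - 1" "z = ieval f \<zeta>" using Zz_repr[OF zZ] by blast
    define a where "a = restrict (\<lambda>j. nat (coeff f j mod int l)) {..<p}"
    define w where "w = (\<Sum>j<p. of_nat (a j) * \<zeta> ^ j)"
    have "a j < l" if "j < p" for j
    proof -
      have "coeff f j mod int l < int l" using l by simp
      then show ?thesis using that l by (simp add: a_def nat_less_iff)
    qed
    then have "a \<in> PiE {..<p} (\<lambda>_. {..<l})" by (auto simp: a_def)
    then have wR: "w \<in> R" unfolding R_def w_def by (rule imageI)
    have aj: "(of_nat (a j) :: complex) = of_int (coeff f j mod int l)" if "j < p" for j
      using that l by (simp add: a_def of_nat_nat)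
    have "z - w = (\<Sum>j<p. of_int (coeff f j) * \<zeta> ^ j) - (\<Sum>j<p. of_int (coeff f j mod int l) * \<zeta> ^ j)"
      unfolding w_def f(2) using ieval_sum_coeff[of f p \<zeta>] f(1) aj by simp
    also have "\<dots> = (\<Sum>j<p. of_int (coeff f j - coeff f j mod int l) * \<zeta> ^ j)"
      by (simp add: sum_subtractf left_diff_distrib)
    also have "\<dots> = (\<Sum>j<p. of_int (int l * (coeff f j div int l)) * \<zeta> ^ j)"
      by (simp only: minus_mod_eq_mult_div)
    also have "\<dots> = of_nat l * (\<Sum>j<p. of_int (coeff f j div int l) * \<zeta> ^ j)"
      by (simp add: sum_distrib_left mult.assoc)
    finally have "z - w = of_nat l * (\<Sum>j<p. of_int (coeff f j div int l) * \<zeta> ^ j)" .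
    moreover have "(\<Sum>j<p. of_int (coeff f j div int l) * \<zeta> ^ j) \<in> Zz" by (intro Zz_sum Zz_mult) auto
    ultimately show ?thesis unfolding zcong_def using wR by blast
  qed
  ultimately show ?thesis by blast
qed

end

section \<open>The primes of Z[\<zeta>] above a prime number different from \<open>p\<close>\<close>

locale cyclo_prime = cyclo +
  fixes l :: nat
  assumes l_prime: "prime l" and l_ne_p: "l \<noteq> p"
begin

definition above :: "complex set \<Rightarrow> bool" where
  "above Q \<longleftrightarrow> is_prm Zz Q \<and> of_nat l \<in> Q"

lemma above_prm: "above Q \<Longrightarrow> is_prm Zz Q" and above_l: "above Q \<Longrightarrow> of_nat l \<in> Q"
  and above_idl: "above Q \<Longrightarrow> is_idl Zz Q" and above_one: "above Q \<Longrightarrow> 1 \<notin> Q"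
  and above_sub: "above Q \<Longrightarrow> z \<in> Q \<Longrightarrow> z \<in> Zz"
  by (auto simp: above_def is_prm_def is_idl_def)

lemma above_int: "above Q \<Longrightarrow> of_int k \<in> Q \<longleftrightarrow> int l dvd k"
  using Zz_idl_int above_idl above_one above_l l_prime by blast

lemma above_zcong: "above Q \<Longrightarrow> zcong (of_nat l) a b \<Longrightarrow> b \<in> Q \<Longrightarrow> a \<in> Q"
  using idl_zcong above_idl above_l by blast

lemma above_p: "above Q \<Longrightarrow> of_nat p \<notin> Q"
  using above_int[of Q "int p"] l_ne_p l_prime p_prime primes_dvd_imp_eq by auto

lemma coprime_l_p: "coprime l p"
  using primes_coprime l_prime p_prime l_ne_p by blast

lemma l_pow_p: "[l ^ (p - 1) = 1] (mod p)"
proof (rule fermat_theorem[OF p_prime])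
  show "\<not> p dvd l" using l_prime p_prime l_ne_p primes_dvd_imp_eq by blast
qed

lemma ex_above: "\<exists>Q. above Q"
proof -
  define I where "I = {of_nat l * z | z. z \<in> Zz}"
  have "is_idl Zz I"
    unfolding is_idl_def
  proof (intro conjI ballI)
    show "I \<subseteq> Zz" by (auto simp: I_def intro: Zz_mult)
    show "0 \<in> I" unfolding I_def by (intro CollectI exI[of _ 0]) auto
    fix a b assume "a \<in> I" "b \<in> I"
    then obtain u v where "u \<in> Zz" "v \<in> Zz" "a = of_nat l * u" "b = of_nat l * v" by (auto simp: I_def)
    then show "a + b \<in> I" unfolding I_def
      by (intro CollectI exI[of _ "u + v"]) (auto simp: distrib_left intro: Zz_add)
  next
    fix r a assume "r \<in> Zz" "a \<in> I"
    then obtain u where "u \<in> Zz" "a = of_nat l * u" by (auto simp: I_def)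
    then show "r * a \<in> I" unfolding I_def using \<open>r \<in> Zz\<close>
      by (intro CollectI exI[of _ "r * u"]) (auto intro: Zz_mult)
  qed
  moreover have "1 \<notin> I"
  proof
    assume "1 \<in> I"
    then obtain z where z: "z \<in> Zz" "of_nat l * z = of_int 1" by (auto simp: I_def)
    then have "int l dvd 1" using rational_algebraic_int_dvd[OF Zz_algebraic_int[OF z(1)] z(2)] prime_gt_0_nat[OF l_prime] by simp
    then show False using prime_gt_1_nat[OF l_prime] by simp
  qed
  ultimately obtain Q where Q: "is_prm Zz Q" "I \<subseteq> Q" using ex_is_prm[OF is_sub_Zz] by blast
  have "of_nat l \<in> I" unfolding I_def by (intro CollectI exI[of _ 1]) auto
  then show ?thesis using Q unfolding above_def by blast
qed

text \<open>If two distinct powers of \<zeta> agreed modulo \<open>Q\<close>, some factor of p = (1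
  - \<zeta>) ... (1 - \<zeta>^(p-1)) would lie in \<open>Q\<close>, and hence \<open>p\<close>
  itself.\<close>

lemma above_zeta_inj:
  assumes Q: "above Q" and d: "\<zeta> ^ i - \<zeta> ^ j \<in> Q"
  shows "\<zeta> ^ i = \<zeta> ^ j"
proof (rule ccontr)
  assume ne: "\<zeta> ^ i \<noteq> \<zeta> ^ j"
  define k where "k = (p - 1) * i + j"
  have inv: "\<zeta> ^ ((p - 1) * i) * \<zeta> ^ i = 1"
  proof -
    have "(p - 1) * i + i = p * i" using p_pos by (simp add: algebra_simps)
    then have "\<zeta> ^ ((p - 1) * i) * \<zeta> ^ i = \<zeta> ^ (p * i)" by (simp only: power_add[symmetric])
    then show ?thesis by (simp only: power_mult zeta_p power_one)
  qed
  have "\<zeta> ^ ((p - 1) * i) * (\<zeta> ^ i - \<zeta> ^ j) = 1 - \<zeta> ^ k"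
    using inv by (simp add: right_diff_distrib k_def power_add)
  then have kQ: "1 - \<zeta> ^ k \<in> Q" using is_idl_mult[OF above_idl[OF Q] Zz_zeta_pow d, of "(p - 1) * i"] by simp
  have "\<zeta> ^ k \<noteq> 1"
  proof
    assume "\<zeta> ^ k = 1"
    then have "\<zeta> ^ ((p - 1) * i) * \<zeta> ^ j = 1" by (simp only: k_def power_add)
    then have e1: "\<zeta> ^ i = \<zeta> ^ i * (\<zeta> ^ ((p - 1) * i) * \<zeta> ^ j)" by (simp only: mult_1_right)
    have "\<zeta> ^ i * (\<zeta> ^ ((p - 1) * i) * \<zeta> ^ j) = \<zeta> ^ ((p - 1) * i) * \<zeta> ^ i * \<zeta> ^ j"
      by (simp only: mult_ac)
    then have "\<zeta> ^ i = \<zeta> ^ j" using e1 by (simp only: inv mult_1_left)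
    then show False using ne by contradiction
  qed
  then have "\<not> p dvd k" using zeta_pow_1_iff by simp
  then have km: "k mod p \<in> {1..<p}" using p_pos by (simp add: dvd_eq_mod_eq_0)
  have "of_nat p = (\<Prod>j\<in>{1..<p}. 1 - \<zeta> ^ j)" by (rule p_eq_prod)
  also have "\<dots> = (1 - \<zeta> ^ (k mod p)) * (\<Prod>j\<in>{1..<p} - {k mod p}. 1 - \<zeta> ^ j)"
    using km by (intro prod.remove) auto
  also have "\<dots> \<in> Q" unfolding zeta_pow_mod
    by (rule is_idl_mult_right[OF above_idl[OF Q]]) (auto intro!: kQ Zz_prod Zz_diff)
  finally show False using above_p[OF Q] by simp
qed

text \<open>\<open>v\<close> is fixed modulo \<open>l\<close> by \<open>frobenius_fixed\<close>;
  being outside the prime \<open>Q\<close> it can be cancelled.\<close>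

lemma above_fermat:
  assumes Q: "above Q" and k: "[l ^ k = 1] (mod p)" and v: "v \<in> Zz" "v \<notin> Q"
  shows "v ^ (l ^ k - 1) - 1 \<in> Q"
proof -
  have z: "zcong (of_nat l) (v ^ (l ^ k)) v" by (rule frobenius_fixed[OF l_prime k v(1)])
  then obtain w where w: "w \<in> Zz" "v ^ (l ^ k) - v = of_nat l * w" by (auto simp: zcong_def)
  have "l ^ k > 0" using prime_gt_0_nat[OF l_prime] by simp
  then have "Suc (l ^ k - 1) = l ^ k" by simp
  then have "v ^ (l ^ k) = v * v ^ (l ^ k - 1)" by (simp only: power_Suc[symmetric])
  then have "v * (v ^ (l ^ k - 1) - 1) = of_nat l * w" using w(2) by (simp add: right_diff_distrib)
  then have "v * (v ^ (l ^ k - 1) - 1) \<in> Q"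
    using is_idl_mult_right[OF above_idl[OF Q] w(1) above_l[OF Q]] by simp
  moreover have "v ^ (l ^ k - 1) - 1 \<in> Zz" by (intro Zz_diff Zz_power v(1) Zz_1)
  ultimately show ?thesis using is_prm_mult[OF above_prm[OF Q] v(1)] v(2) by blast
qed

lemma above_maximal:
  assumes Q: "above Q" and J: "is_idl Zz J" "Q \<subseteq> J" "1 \<notin> J"
  shows "J = Q"
proof (rule ccontr)
  assume "J \<noteq> Q"
  then obtain v where v: "v \<in> J" "v \<notin> Q" using J(2) by blast
  have vZ: "v \<in> Zz" using is_idl_sub[OF J(1) v(1)] .
  have m1: "v ^ (l ^ (p - 1) - 1) - 1 \<in> J" using above_fermat[OF Q l_pow_p vZ v(2)] J(2) by blast
  have m2: "v ^ (l ^ (p - 1) - 1) \<in> J"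
  proof -
    have "l ^ (p - 1) > 1" using prime_gt_1_nat[OF l_prime] p_gt2 by (intro one_less_power) auto
    then have "l ^ (p - 1) - 1 = Suc (l ^ (p - 1) - 2)" by simp
    then have "v ^ (l ^ (p - 1) - 1) = v ^ (l ^ (p - 1) - 2) * v" by (simp only: power_Suc2)
    then show ?thesis using is_idl_mult[OF J(1) Zz_power[OF vZ] v(1)] by simp
  qed
  have "1 \<in> J" using is_idl_diff[OF is_sub_Zz J(1) m2 m1] by simp
  then show False using J(3) by simp
qed

text \<open>An element \<open>h \<notin> Q\<close> with \<open>h Q \<subseteq> l \<int>[\<zeta>]\<close>: the product of \<open>1 - w\<^sup>N\<close> over representatives \<open>w\<close> of
  \<open>Q\<close> modulo \<open>l\<close>, where \<open>N + 1 = l\<^sup>p\<^sup>-\<^sup>1\<close>. It replaces the unique factorisation of \<open>l\<close> into prime ideals.\<close>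

lemma above_annihilator:
  assumes Q: "above Q"
  shows "\<exists>h\<in>Zz. h \<notin> Q \<and> (\<forall>z\<in>Q. \<exists>w\<in>Zz. h * z = of_nat l * w)"
proof -
  define N where "N = l ^ (p - 1) - 1"
  have lp1: "l ^ (p - 1) > 1" using prime_gt_1_nat[OF l_prime] p_gt2 by (intro one_less_power) auto
  have N0: "N > 0" and NL: "Suc N = l ^ (p - 1)" using lp1 by (auto simp: N_def)
  obtain R where R: "R \<subseteq> Zz" "finite R" "\<And>z. z \<in> Zz \<Longrightarrow> \<exists>w\<in>R. zcong (of_nat l) z w"
    using finite_residues[OF prime_gt_0_nat[OF l_prime]] by blast
  define h where "h = (\<Prod>w\<in>R \<inter> Q. 1 - w ^ N)"
  have fZ: "1 - w ^ N \<in> Zz" if "w \<in> R \<inter> Q" for w using that R(1) by (intro Zz_diff Zz_power Zz_1) auto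
  have hZ: "h \<in> Zz" unfolding h_def by (intro Zz_prod fZ)
  have "h \<notin> Q"
  proof
    assume "h \<in> Q"
    then obtain w where w: "w \<in> R \<inter> Q" "1 - w ^ N \<in> Q"
      using is_prm_prod[OF is_sub_Zz above_prm[OF Q], of "R \<inter> Q" "\<lambda>w. 1 - w ^ N"] R(2) fZ
      unfolding h_def by blast
    have wZ: "w \<in> Zz" using w(1) R(1) by blast
    have "w ^ N = w ^ (N - 1) * w" using N0 by (metis power_minus_mult)
    then have "w ^ N \<in> Q" using is_idl_mult[OF above_idl[OF Q] Zz_power[OF wZ, of "N - 1"], of w] w(1) by simp
    then have "(1 - w ^ N) + w ^ N \<in> Q" using w(2) by (intro is_idl_add[OF above_idl[OF Q]])
    then show False using above_one[OF Q] by simp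
  qed
  moreover have "\<exists>w\<in>Zz. h * z = of_nat l * w" if z: "z \<in> Q" for z
  proof -
    have zZ: "z \<in> Zz" by (rule above_sub[OF Q z])
    obtain w where w: "w \<in> R" "zcong (of_nat l) z w" using R(3)[OF zZ] by blast
    have wQ: "w \<in> R \<inter> Q" using w above_zcong[OF Q zcong_sym[OF w(2)] z] by simp
    have wZ: "w \<in> Zz" using w(1) R(1) by blast
    have "zcong (of_nat l) (w ^ Suc N) w"
      unfolding NL by (rule frobenius_fixed[OF l_prime l_pow_p wZ])
    then have "zcong (of_nat l) w (w ^ Suc N)" by (rule zcong_sym)
    then obtain u where u: "u \<in> Zz" "w - w ^ Suc N = of_nat l * u" by (auto simp: zcong_def)
    obtain v where v: "v \<in> Zz" "z - w = of_nat l * v" using w(2) by (auto simp: zcong_def)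
    define h' where "h' = (\<Prod>w\<in>R \<inter> Q - {w}. 1 - w ^ N)"
    have h'Z: "h' \<in> Zz" unfolding h'_def by (intro Zz_prod fZ) auto
    have h: "h = (1 - w ^ N) * h'" unfolding h_def h'_def using wQ R(2) by (intro prod.remove) auto
    \<comment> \<open>\<open>w\<close> is the representative of \<open>z\<close>. Both summands are
      multiples of \<open>l\<close>, the first because \<open>z\<close> and \<open>w\<close> agree
      modulo \<open>l\<close>, the second because w^(N+1) and \<open>w\<close> do.\<close>
    have "h * z = h * (z - w) + h' * (w - w ^ Suc N)" unfolding h by (simp add: algebra_simps)
    also have "\<dots> = of_nat l * (h * v + h' * u)" unfolding u(2) v(2) by (simp add: algebra_simps)
    finally show ?thesis using hZ h'Z u v by (blast intro: Zz_add Zz_mult)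
  qed
  ultimately show ?thesis using hZ by blast
qed

lemma sg_image_above:
  assumes Q: "above Q" and t: "\<not> p dvd t"
  shows "above (sg t ` Q)"
proof -
  obtain s where s: "[t * s = 1] (mod p)" using ex_inverse[OF t] by blast
  then have s': "[s * t = 1] (mod p)" by (simp add: mult.commute)
  have ns: "\<not> p dvd s" using cong_1_not_dvd(2)[OF s] .
  have mem: "a \<in> sg t ` Q \<longleftrightarrow> sg s a \<in> Q" if a: "a \<in> Zz" for a
  proof
    assume "a \<in> sg t ` Q"
    then obtain z where z: "z \<in> Q" "a = sg t z" by blast
    then have "sg s a = z" using sg_inverse_index[OF QK_Zz[OF above_sub[OF Q z(1)]] s'] by simp
    then show "sg s a \<in> Q" using z by simp
  next
    assume "sg s a \<in> Q"
    moreover have "a = sg t (sg s a)" using sg_inverse_index[OF QK_Zz[OF a] s] by simp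
    ultimately show "a \<in> sg t ` Q" by blast
  qed
  have sub: "sg t ` Q \<subseteq> Zz" using sg_Zz[OF above_sub[OF Q] t] by blast
  have idl: "is_idl Zz (sg t ` Q)"
    unfolding is_idl_def
  proof (intro conjI ballI)
    show "sg t ` Q \<subseteq> Zz" by (rule sub)
    show "0 \<in> sg t ` Q" using mem[OF Zz_0] sg_0[OF ns] is_idl_zero[OF above_idl[OF Q]] by simp
    fix a b assume ab: "a \<in> sg t ` Q" "b \<in> sg t ` Q"
    then have Z: "a \<in> Zz" "b \<in> Zz" using sub by auto
    have "sg s (a + b) \<in> Q" unfolding sg_add[OF QK_Zz[OF Z(1)] QK_Zz[OF Z(2)] ns]
      using ab mem Z by (intro is_idl_add[OF above_idl[OF Q]]) auto
    then show "a + b \<in> sg t ` Q" using mem[OF Zz_add[OF Z]] by simp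
  next
    fix r a assume r: "r \<in> Zz" and a: "a \<in> sg t ` Q"
    then have Z: "a \<in> Zz" using sub by auto
    have "sg s (r * a) \<in> Q" unfolding sg_mult[OF QK_Zz[OF r] QK_Zz[OF Z] ns]
      using a mem[OF Z] sg_Zz[OF r ns] by (intro is_idl_mult[OF above_idl[OF Q]]) auto
    then show "r * a \<in> sg t ` Q" using mem[OF Zz_mult[OF r Z]] by simp
  qed
  have "1 \<notin> sg t ` Q" using mem[OF Zz_1] sg_1[OF ns] above_one[OF Q] by simp
  moreover have "a \<in> sg t ` Q \<or> b \<in> sg t ` Q" if ab: "a \<in> Zz" "b \<in> Zz" "a * b \<in> sg t ` Q" for a b
  proof -
    have "sg s a * sg s b \<in> Q"
      using mem[OF Zz_mult[OF ab(1,2)]] ab(3) sg_mult[OF QK_Zz[OF ab(1)] QK_Zz[OF ab(2)] ns] by simp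
    then have "sg s a \<in> Q \<or> sg s b \<in> Q"
      using is_prm_mult[OF above_prm[OF Q] sg_Zz[OF ab(1) ns] sg_Zz[OF ab(2) ns]] by simp
    then show ?thesis using mem ab by blast
  qed
  moreover have "of_nat l \<in> sg t ` Q" using mem[OF Zz_of_nat] sg_of_nat[OF ns] above_l[OF Q] by simp
  ultimately show ?thesis using idl unfolding above_def is_prm_def by blast
qed

lemma sg_image_image:
  assumes Q: "above Q" and st: "[s * t = 1] (mod p)"
  shows "sg s ` sg t ` Q = Q"
proof -
  have "sg s (sg t z) = z" if "z \<in> Q" for z
    by (rule sg_inverse_index[OF QK_Zz[OF above_sub[OF Q that]] st])
  then show ?thesis by force
qed

text \<open>The usual norm argument: an element of Q' outside all conjugates of \<open>Q\<close>
  would have a norm divisible by \<open>l\<close>, hence in \<open>Q\<close>. The element 1 - h^N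
  plays the part of the Chinese remainder theorem: the annihilator \<open>h\<close> of Q' is a unit
  at Q' and lies in every other prime above \<open>l\<close>.\<close>

lemma above_transitive:
  assumes Q: "above Q" and Q': "above Q'"
  shows "\<exists>t\<in>{1..<p}. Q' = sg t ` Q"
proof (rule ccontr)
  assume "\<not> ?thesis"
  then have ne: "\<And>t. t \<in> {1..<p} \<Longrightarrow> sg t ` Q \<noteq> Q'" by blast
  obtain h where h: "h \<in> Zz" "h \<notin> Q'" "\<And>z. z \<in> Q' \<Longrightarrow> \<exists>w\<in>Zz. h * z = of_nat l * w"
    using above_annihilator[OF Q'] by blast
  define N where "N = l ^ (p - 1) - 1"
  have lp1: "l ^ (p - 1) > 1" using prime_gt_1_nat[OF l_prime] p_gt2 by (intro one_less_power) auto
  then have N0: "N > 0" by (simp add: N_def)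
  define z where "z = 1 - h ^ N"
  have zZ: "z \<in> Zz" unfolding z_def using h(1) by (intro Zz_diff Zz_power) auto
  have "h ^ N - 1 \<in> Q'" unfolding N_def by (rule above_fermat[OF Q' l_pow_p h(1,2)])
  then have "- (h ^ N - 1) \<in> Q'" by (rule is_idl_uminus[OF is_sub_Zz above_idl[OF Q']])
  then have zQ': "z \<in> Q'" by (simp add: z_def)
  have znot: "z \<notin> sg t ` Q" if t: "t \<in> {1..<p}" for t
  proof
    assume zQ: "z \<in> sg t ` Q"
    have O: "above (sg t ` Q)" by (rule sg_image_above[OF Q unit_index[OF t]])
    have "\<not> Q' \<subseteq> sg t ` Q" using above_maximal[OF Q' above_idl[OF O] _ above_one[OF O]] ne[OF t] by blast
    then obtain u where u: "u \<in> Q'" "u \<notin> sg t ` Q" by blast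
    obtain w where w: "w \<in> Zz" "h * u = of_nat l * w" using h(3)[OF u(1)] by blast
    have "h * u \<in> sg t ` Q" unfolding w(2) by (rule is_idl_mult_right[OF above_idl[OF O] w(1) above_l[OF O]])
    then have hQ: "h \<in> sg t ` Q" using is_prm_mult[OF above_prm[OF O] h(1) above_sub[OF Q' u(1)]] u(2) by blast
    have "h ^ N = h ^ (N - 1) * h" using N0 by (metis power_minus_mult)
    then have "h ^ N \<in> sg t ` Q" using is_idl_mult[OF above_idl[OF O] Zz_power[OF h(1)] hQ] by simp
    then have "z + h ^ N \<in> sg t ` Q" using zQ by (intro is_idl_add[OF above_idl[OF O]])
    then show False using above_one[OF O] by (simp add: z_def)
  qed
  obtain k where k: "Nm z = of_int k" using Nm_int[OF zZ] by blast
  obtain w where w: "w \<in> Zz" "Nm z = z * w" using Nm_factor[OF zZ] by blast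
  have "of_int k \<in> Q'" unfolding k[symmetric] w(2) by (rule is_idl_mult_right[OF above_idl[OF Q'] w(1) zQ'])
  then have "of_int k \<in> Q" using above_int[OF Q] above_int[OF Q'] by simp
  then have "(\<Prod>t\<in>{1..<p}. sg t z) \<in> Q" unfolding k[symmetric] Nm_def .
  then obtain t where t: "t \<in> {1..<p}" "sg t z \<in> Q"
    using is_prm_prod[OF is_sub_Zz above_prm[OF Q], of "{1..<p}" "\<lambda>t. sg t z"] sg_Zz[OF zZ unit_index] by auto
  have c: "[inv_mod p t * t = 1] (mod p)" using inv_mod[OF unit_index[OF t(1)]] by (simp add: mult.commute)
  define t' where "t' = inv_mod p t mod p"
  have t': "t' \<in> {1..<p}" using bij_inv_mod t(1) unfolding t'_def bij_betw_def by blast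
  have "[t' * t = 1] (mod p)" using c unfolding t'_def by (simp add: cong_def mod_simps)
  then have "sg t' (sg t z) = z" by (rule sg_inverse_index[OF QK_Zz[OF zZ]])
  then have "z \<in> sg t' ` Q" using t(2) by (metis imageI)
  then show False using znot[OF t'] by simp
qed

text \<open>The powers of \<zeta> stay distinct modulo \<open>Q\<close>, so the cardinality is 1
  modulo \<open>p\<close> and the exponent is a multiple of the order of \<open>l\<close>.
  Conversely l^(ord p l) - 1 is an exponent of the unit group, which bounds the cardinality.\<close>

lemma residue_card:
  assumes Q: "above Q"
  shows "card (carrier (ring_of_integers (cyclotomic_field \<zeta>) Quot Q)) = l ^ ord p l"
proof -
  define q where "q = card (carrier (sub_ring Zz Quot Q))"
  obtain R where R: "R \<subseteq> Zz" "finite R" "\<And>z. z \<in> Zz \<Longrightarrow> \<exists>w\<in>R. zcong (of_nat l) z w"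
    using finite_residues[OF prime_gt_0_nat[OF l_prime]] by blast
  have rep: "\<forall>z\<in>Zz. \<exists>w\<in>R. z - w \<in> Q"
  proof
    fix z assume z: "z \<in> Zz"
    obtain w where "w \<in> R" "zcong (of_nat l) z w" using R(3)[OF z] by blast
    then obtain u where "u \<in> Zz" "z - w = of_nat l * u" by (auto simp: zcong_def)
    then have "z - w \<in> Q" using is_idl_mult_right[OF above_idl[OF Q] _ above_l[OF Q], of u] by simp
    then show "\<exists>w\<in>R. z - w \<in> Q" using \<open>w \<in> R\<close> by blast
  qed
  have inv: "\<forall>v\<in>Zz. v \<notin> Q \<longrightarrow> (\<exists>w\<in>Zz. v * w - 1 \<in> Q)"
  proof (intro ballI impI)
    fix v assume v: "v \<in> Zz" "v \<notin> Q"
    have lp1: "l ^ (p - 1) > 1" using prime_gt_1_nat[OF l_prime] p_gt2 by (intro one_less_power) auto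
    then have "l ^ (p - 1) - 1 = Suc (l ^ (p - 1) - 2)" by simp
    then have "v * v ^ (l ^ (p - 1) - 2) - 1 \<in> Q" using above_fermat[OF Q l_pow_p v] by (simp only: power_Suc)
    then show "\<exists>w\<in>Zz. v * w - 1 \<in> Q" using Zz_power[OF v(1)] by blast
  qed
  note qp = quotient_by_prime[OF is_sub_Zz above_prm[OF Q] l_prime above_l[OF Q] R(2,1) rep inv, folded q_def]
  obtain e where e: "e > 0" "q = l ^ e" using qp(1) by blast
  have zQ: "\<zeta> \<notin> Q"
  proof
    assume z: "\<zeta> \<in> Q"
    have "\<zeta> ^ (p - 1) * \<zeta> \<in> Q" by (rule is_idl_mult[OF above_idl[OF Q] Zz_zeta_pow z])
    moreover have "\<zeta> ^ (p - 1) * \<zeta> = 1" using zeta_p p_pos by (metis power_minus_mult)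
    ultimately show False using above_one[OF Q] by simp
  qed
  have "\<zeta> ^ (q - 1) - \<zeta> ^ 0 \<in> Q" using qp(2)[OF Zz_zeta zQ] by simp
  then have "\<zeta> ^ (q - 1) = 1" using above_zeta_inj[OF Q] by fastforce
  then have "p dvd q - 1" by (simp add: zeta_pow_1_iff)
  moreover have "q \<ge> 1" using e prime_gt_0_nat[OF l_prime] by simp
  ultimately have "[q = 1] (mod p)" using cong_altdef_nat[of 1 q p] by simp
  then have "ord p l dvd e" unfolding e(2) by (simp only: ord_divides)
  then have "ord p l \<le> e" using e(1) by (rule dvd_imp_le)
  moreover have "e \<le> ord p l"
  proof -
    have o: "[l ^ ord p l = 1] (mod p)" using ord_works by blast
    have "ord p l > 0" using ord_eq_0[of p l] coprime_l_p by (simp add: coprime_commute)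
    then have "l ^ ord p l > 1" using prime_gt_1_nat[OF l_prime] by (intro one_less_power) auto
    then have N: "l ^ ord p l - 1 > 0" by simp
    have "\<forall>z\<in>Zz. z \<notin> Q \<longrightarrow> z ^ (l ^ ord p l - 1) - 1 \<in> Q"
      using above_fermat[OF Q o] by simp
    then have "q - 1 \<le> l ^ ord p l - 1" by (rule qp(3)[OF N])
    then have "l ^ e \<le> l ^ ord p l" using e N by simp
    then show ?thesis by (rule power_le_imp_le_exp[OF prime_gt_1_nat[OF l_prime]])
  qed
  ultimately have "e = ord p l" by simp
  then show ?thesis using e unfolding ring_of_integers_eq q_def by simp
qed

end

subsection \<open>Kummer extensions and the residue symbol\<close>

lemma monic_division_coeffs:
  fixes f m :: "complex poly"
  assumes E: "is_sub E" and m: "lead_coeff m = 1" "\<And>i. coeff m i \<in> E" and f: "\<And>i. coeff f i \<in> E"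
  shows "\<exists>q r. f = m * q + r \<and> (r = 0 \<or> degree r < degree m) \<and> (\<forall>i. coeff r i \<in> E)"
  using f
proof (induction "degree f" arbitrary: f rule: less_induct)
  case (less f)
  show ?case
  proof (cases "degree f < degree m")
    case True
    then show ?thesis using less.prems by (intro exI[of _ 0] exI[of _ f]) simp
  next
    case False
    define t where "t = monom (lead_coeff f) (degree f - degree m)"
    define g where "g = f - t * m"
    have cg: "coeff g i \<in> E" for i
    proof -
      have "coeff (t * m) i = (if degree f - degree m \<le> i then lead_coeff f * coeff m (i - (degree f - degree m)) else 0)"
        unfolding t_def by (rule coeff_monom_mult)
      moreover have "0 \<in> E" "\<And>x y. x \<in> E \<Longrightarrow> y \<in> E \<Longrightarrow> x * y \<in> E" "\<And>x y. x \<in> E \<Longrightarrow> y \<in> E \<Longrightarrow> x - y \<in> E"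
      proof -
        show "0 \<in> E" "\<And>x y. x \<in> E \<Longrightarrow> y \<in> E \<Longrightarrow> x * y \<in> E" using E by (auto simp: is_sub_def)
        fix x y assume "x \<in> E" "y \<in> E"
        then have "x + - y \<in> E" using E unfolding is_sub_def by blast
        then show "x - y \<in> E" by simp
      qed
      ultimately show ?thesis using less.prems m(2) by (simp add: g_def)
    qed
    have "degree (t * m) \<le> (degree f - degree m) + degree m"
      by (rule order.trans[OF degree_mult_le]) (simp add: t_def degree_monom_le)
    then have dg: "degree g \<le> degree f" unfolding g_def using False by (intro degree_diff_le) auto
    have "coeff (t * m) (degree f) = lead_coeff f"
      unfolding t_def coeff_monom_mult using False m(1) by simp
    then have "coeff g (degree f) = 0" by (simp add: g_def)
    then consider "g = 0" | "degree g < degree f" using eq_zero_or_degree_less[OF dg] by blast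
    then show ?thesis
    proof cases
      case 1
      then have "f = m * t + 0" by (simp add: g_def mult.commute)
      then show ?thesis using E by (intro exI[of _ t] exI[of _ 0]) (auto simp: is_sub_def)
    next
      case 2
      then obtain q r where qr: "g = m * q + r" "r = 0 \<or> degree r < degree m" "\<forall>i. coeff r i \<in> E"
        using less.hyps[OF 2 cg] by blast
      have "f = m * (t + q) + r" using qr(1) by (simp add: g_def algebra_simps)
      then show ?thesis using qr by blast
    qed
  qed
qed

text \<open>The constant coefficient is the product of the roots up to sign, and each root is
  \<open>b\<close> times a power of \<zeta>.\<close>

lemma monic_const_coeff:
  fixes m :: "complex poly"
  assumes "lead_coeff m = 1" "\<And>w. poly m w = 0 \<Longrightarrow> \<exists>j. w = \<zeta> ^ j * b"
  shows "\<exists>s i. s \<in> {1, -1} \<and> coeff m 0 = s * \<zeta> ^ (i::nat) * b ^ degree m"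
  using assms
proof (induction "degree m" arbitrary: m)
  case 0
  then show ?case by (intro exI[of _ 1] exI[of _ 0]) (simp flip: 0(1))
next
  case (Suc n)
  then have "\<not> constant (poly m)" by (simp add: constant_degree)
  then obtain w where w: "poly m w = 0" using fundamental_theorem_of_algebra by blast
  then obtain m' where m': "m = [:- w, 1:] * m'" by (auto simp: poly_eq_0_iff_dvd elim: dvdE)
  have nz: "m' \<noteq> 0" using m' Suc.prems(1) by auto
  have "degree m = 1 + degree m'" unfolding m' by (subst degree_mult_eq) (use nz in auto)
  then have d: "n = degree m'" using Suc.hyps(2) by simp
  have lc: "lead_coeff m' = 1" using Suc.prems(1) unfolding m' lead_coeff_mult by simp
  have "\<exists>j. v = \<zeta> ^ j * b" if "poly m' v = 0" for v using Suc.prems(2)[of v] that m' by simp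
  then obtain s i where s: "s \<in> {1, -1}" "coeff m' 0 = s * \<zeta> ^ (i::nat) * b ^ degree m'"
    using Suc.hyps(1)[OF d lc] by blast
  obtain j where j: "w = \<zeta> ^ j * b" using Suc.prems(2)[OF w] by blast
  have "coeff m 0 = - w * coeff m' 0" unfolding m' by simp
  also have "\<dots> = (- s) * \<zeta> ^ (j + i) * b ^ degree m"
    unfolding j s(2) using d Suc.hyps(2) by (simp add: power_add flip: d Suc.hyps(2))
  finally show ?case using s(1) by (intro exI[of _ "- s"] exI[of _ "j + i"]) auto
qed

text \<open>Only elements prime to \<open>Q\<close> are treated here;
  \<open>power_residue_symbol_eq\<close> reduces to them. The root \<open>b\<close> may lie in the
  base field, so the extension may be trivial.\<close>

locale kummer = cyclo_prime +
  fixes Q :: "complex set" and a b :: complex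
  assumes Q: "above Q" and a: "a \<in> Zz" "a \<notin> Q" and bp: "b ^ p = a"
begin

lemma a_ne_0: "a \<noteq> 0" using a is_idl_zero[OF above_idl[OF Q]] by auto
lemma b_pow: "b ^ n = a ^ (n div p) * b ^ (n mod p)"
proof -
  have "b ^ n = b ^ (p * (n div p) + n mod p)" by simp
  then show ?thesis by (simp only: power_add power_mult bp)
qed

lemma zb_pow: "(\<zeta> ^ k * b) ^ n = a ^ (n div p) * (\<zeta> ^ k * b) ^ (n mod p)"
proof -
  have "(\<zeta> ^ k * b) ^ p = a" by (simp add: power_mult_distrib bp)
  moreover have "(\<zeta> ^ k * b) ^ n = (\<zeta> ^ k * b) ^ (p * (n div p) + n mod p)" by simp
  ultimately show ?thesis by (simp only: power_add power_mult)
qed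

lemma b_algebraic_int: "algebraic_int b"
proof (rule algebraic_int_root)
  show "algebraic_int a" by (rule Zz_algebraic_int[OF a(1)])
  show "poly (monom (1::complex) p) b = a" by (simp add: poly_monom bp)
  show "\<forall>i. coeff (monom (1::complex) p) i \<in> \<int>" by (simp add: coeff_monom)
  show "lead_coeff (monom (1::complex) p) = 1" by (simp add: degree_monom_eq)
  show "0 < degree (monom (1::complex) p)" using p_pos by (simp add: degree_monom_eq)
qed

text \<open>The field Q(\<zeta>, b), described by polynomials in \<open>b\<close> of degree below
  \<open>p\<close>. The coefficients are unique only if \<open>b\<close> is outside the base
  field.\<close>

definition LS :: "complex set" where
  "LS = {z. \<exists>c. (\<forall>j. c j \<in> QK) \<and> z = (\<Sum>j<p. c j * b ^ j)}"

lemma LS_repr: "z \<in> LS \<Longrightarrow> \<exists>c. (\<forall>j. c j \<in> QK) \<and> z = (\<Sum>j<p. c j * b ^ j)"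
  by (simp add: LS_def)

lemma LS_term: "k \<in> QK \<Longrightarrow> k * b ^ n \<in> LS"
proof -
  assume k: "k \<in> QK"
  define c where "c = (\<lambda>j. if j = n mod p then k * a ^ (n div p) else 0)"
  have "\<forall>j. c j \<in> QK" using k a(1) by (auto simp: c_def intro: QK_mult QK_power QK_Zz)
  moreover have "k * b ^ n = (\<Sum>j<p. c j * b ^ j)"
  proof -
    have "(\<Sum>j<p. c j * b ^ j) = (\<Sum>j<p. if j = n mod p then k * a ^ (n div p) * b ^ j else 0)"
      by (intro sum.cong) (auto simp: c_def)
    also have "\<dots> = k * a ^ (n div p) * b ^ (n mod p)" using p_pos by simp
    finally show ?thesis using b_pow[of n] by (simp add: mult.assoc)
  qed
  ultimately show ?thesis unfolding LS_def by blast
qed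

lemma LS_add: "z \<in> LS \<Longrightarrow> w \<in> LS \<Longrightarrow> z + w \<in> LS"
proof -
  assume "z \<in> LS" "w \<in> LS"
  then obtain c d where "\<forall>j. c j \<in> QK" "z = (\<Sum>j<p. c j * b ^ j)" "\<forall>j. d j \<in> QK" "w = (\<Sum>j<p. d j * b ^ j)"
    using LS_repr by meson
  then show ?thesis unfolding LS_def
    by (intro CollectI exI[of _ "\<lambda>j. c j + d j"]) (auto simp: sum.distrib distrib_right intro: QK_add)
qed

lemma LS_QK: "k \<in> QK \<Longrightarrow> k \<in> LS" using LS_term[of k 0] by simp

lemma LS_sum: "(\<And>i. i \<in> I \<Longrightarrow> f i \<in> LS) \<Longrightarrow> sum f I \<in> LS"
  by (induction I rule: infinite_finite_induct) (auto intro: LS_add LS_QK[OF QK_Zz[OF Zz_0]])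

lemma LS_mult: "z \<in> LS \<Longrightarrow> w \<in> LS \<Longrightarrow> z * w \<in> LS"
proof -
  assume "z \<in> LS" "w \<in> LS"
  then obtain c d where c: "\<forall>j. c j \<in> QK" "z = (\<Sum>j<p. c j * b ^ j)" and d: "\<forall>j. d j \<in> QK" "w = (\<Sum>j<p. d j * b ^ j)"
    using LS_repr by meson
  have "z * w = (\<Sum>i<p. \<Sum>j<p. (c i * d j) * b ^ (i + j))"
    unfolding c(2) d(2) sum_product by (intro sum.cong refl) (simp only: power_add mult_ac)
  also have "\<dots> \<in> LS" using c(1) d(1) by (intro LS_sum LS_term QK_mult) auto
  finally show ?thesis .
qed

lemma b_LS: "b \<in> LS" using LS_term[of 1 1] by (simp add: QK_Zz)

lemma is_sub_LS: "is_sub LS"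
proof -
  have "- z \<in> LS" if "z \<in> LS" for z
    using LS_mult[OF LS_QK[OF QK_uminus[OF QK_Zz[OF Zz_1]]] that] by simp
  then show ?thesis by (simp add: is_sub_def LS_add LS_mult LS_QK QK_Zz)
qed

lemma is_fld_LS: "is_fld LS"
  unfolding is_fld_def
proof (intro conjI ballI)
  show "is_sub LS" by (rule is_sub_LS)
  fix z assume z: "z \<in> LS"
  show "inverse z \<in> LS"
  proof (cases "z = 0")
    case False
    obtain c where c: "\<forall>j. c j \<in> QK" "z = (\<Sum>j<p. c j * b ^ j)" using LS_repr[OF z] by blast
    have "\<forall>j. \<exists>n::nat. n > 0 \<and> of_nat n * c j \<in> Zz" using c(1) by (simp add: QK_def)
    then obtain n :: "nat \<Rightarrow> nat" where n: "\<And>j. n j > 0" "\<And>j. of_nat (n j) * c j \<in> Zz" by metis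
    define N where "N = (\<Prod>j<p. n j)"
    have N0: "N > 0" unfolding N_def using n(1) by (simp add: prod_pos)
    have alg: "algebraic_int (of_nat N * z)"
    proof -
      have "algebraic_int (of_nat N * (c j * b ^ j))" if j: "j < p" for j
      proof -
        have "N = n j * (\<Prod>i\<in>{..<p} - {j}. n i)" unfolding N_def using j by (intro prod.remove) auto
        then have "of_nat N * (c j * b ^ j) = (of_nat (n j) * c j) * (of_nat (\<Prod>i\<in>{..<p} - {j}. n i) * b ^ j)"
          by simp
        also have "algebraic_int \<dots>"
          by (rule algebraic_int_mult[OF Zz_algebraic_int[OF n(2)]])
             (rule algebraic_int_mult[OF algebraic_int_of_nat algebraic_int_power[OF b_algebraic_int]])
        finally show ?thesis .
      qed
      then show ?thesis unfolding c(2) sum_distrib_left by (intro algebraic_int_sum) auto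
    qed
    obtain g where "ieval g (of_nat N * z) = 0" "lead_coeff g = 1"
      using alg algebraic_int_altdef_ipoly by blast
    then obtain h k where k: "k \<noteq> 0" "(of_nat N * z) * ieval h (of_nat N * z) = of_int k"
      using ieval_invertible[of g "of_nat N * z"] False N0 by fastforce
    have wL: "of_nat N * z \<in> LS" by (intro LS_mult z LS_QK QK_Zz Zz_of_nat)
    have hL: "ieval h w \<in> LS" if "w \<in> LS" for w
      by (induction h) (auto simp: ieval_simps that LS_QK QK_Zz intro!: LS_add LS_mult)
    have "inverse z = (of_nat N / of_int k) * ieval h (of_nat N * z)"
      using k False by (simp add: field_simps)
    also have "\<dots> \<in> LS" by (intro LS_mult hL wL LS_QK QK_divide QK_Zz) auto
    finally show ?thesis .
  qed (simp add: LS_QK QK_Zz)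
qed

text \<open>The symbol is defined with any root \<beta> of the given element, while \<open>b\<close>
  is a root after multiplication by the \<open>p\<close>-th power of \<kappa>; both generate the
  same field.\<close>

lemma generate_field_eq_LS:
  assumes k: "\<kappa> \<in> QK" "\<kappa> \<noteq> 0" "b = \<kappa> * \<beta>"
  shows "generate_field complex_ring {\<zeta>, \<beta>} = LS"
proof
  have "\<beta> = inverse \<kappa> * b" using k by simp
  also have "\<dots> \<in> LS" by (intro LS_mult LS_QK QK_inverse k b_LS)
  finally show "generate_field complex_ring {\<zeta>, \<beta>} \<subseteq> LS"
    by (intro generate_field_least is_fld_LS) (auto intro: LS_QK QK_Zz Zz_zeta)
  let ?G = "generate_field complex_ring {\<zeta>, \<beta>}"
  have G: "is_fld ?G" by (rule is_fld_generate_field)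
  have "generate_field complex_ring {\<zeta>} \<subseteq> ?G"
    using generate_field_incl_set[of "{\<zeta>, \<beta>}"] by (intro generate_field_least G) auto
  then have KG: "QK \<subseteq> ?G" using cyclotomic_field_eq by (simp add: cyclotomic_field_def)
  have mulG: "\<And>x y. x \<in> ?G \<Longrightarrow> y \<in> ?G \<Longrightarrow> x * y \<in> ?G" using G by (simp add: is_fld_def is_sub_def)
  have subG: "is_sub ?G" using G by (simp add: is_fld_def)
  have bG: "b \<in> ?G" unfolding k(3) using KG k(1) generate_field_incl_set[of "{\<zeta>, \<beta>}"] by (intro mulG) auto
  show "LS \<subseteq> ?G"
  proof
    fix z assume "z \<in> LS"
    then obtain c where c: "\<forall>j. c j \<in> QK" "z = (\<Sum>j<p. c j * b ^ j)" using LS_repr by blast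
    show "z \<in> ?G" unfolding c(2)
      using KG c(1) by (intro is_sub_sum[OF subG] mulG is_sub_power[OF subG bG]) auto
  qed
qed

definition OL :: "complex set" where "OL = {z \<in> LS. algebraic_int z}"

lemma ring_of_integers_LS: "ring_of_integers LS = sub_ring OL"
  by (simp add: ring_of_integers_sub_ring OL_def)

lemma is_sub_OL: "is_sub OL"
  unfolding OL_def by (rule is_sub_integers[OF is_sub_LS])

lemma Zz_OL: "z \<in> Zz \<Longrightarrow> z \<in> OL"
  by (simp add: OL_def LS_QK QK_Zz Zz_algebraic_int)

lemma OL_QK: "z \<in> OL \<Longrightarrow> z \<in> QK \<Longrightarrow> z \<in> Zz"
  using QK_algebraic_int by (simp add: OL_def)

lemma b_OL: "b \<in> OL" by (simp add: OL_def b_LS b_algebraic_int)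

lemma OL_add: "x \<in> OL \<Longrightarrow> y \<in> OL \<Longrightarrow> x + y \<in> OL"
  and OL_mult: "x \<in> OL \<Longrightarrow> y \<in> OL \<Longrightarrow> x * y \<in> OL"
  using is_sub_OL by (simp_all add: is_sub_def)

lemma OL_power: "x \<in> OL \<Longrightarrow> x ^ n \<in> OL" by (rule is_sub_power[OF is_sub_OL])

lemma OL_diff: "x \<in> OL \<Longrightarrow> y \<in> OL \<Longrightarrow> x - y \<in> OL"
  using OL_add[of x "- y"] is_sub_OL by (simp add: is_sub_def)

text \<open>The minimal polynomial of \<open>b\<close> divides \<open>X\<^sup>p - a\<close>, so its constant coefficient is \<open>\<plusminus> \<zeta>\<^sup>i b\<^sup>d\<close>; if
  \<open>0 < d < p\<close> this puts \<open>b\<close> into the base field.\<close>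

lemma independent_powers:
  assumes nb: "b \<notin> QK" and c: "\<forall>j. c j \<in> QK" and z: "(\<Sum>j<p. c j * b ^ j) = 0" and j: "j < p"
  shows "c j = 0"
proof (rule ccontr)
  assume cj: "c j \<noteq> 0"
  define good where "good = (\<lambda>f::complex poly. f \<noteq> 0 \<and> (\<forall>i. coeff f i \<in> QK) \<and> poly f b = 0)"
  define f0 where "f0 = (\<Sum>j<p. monom (c j) j)"
  have cf0: "coeff f0 i = (if i < p then c i else 0)" for i by (simp add: f0_def coeff_sum coeff_monom)
  have "coeff f0 j \<noteq> 0" using cf0 cj j by simp
  then have "f0 \<noteq> 0" by auto
  moreover have "poly f0 b = 0" using z by (simp add: f0_def poly_sum poly_monom)
  ultimately have g0: "good f0" using c by (auto simp: good_def cf0 QK_Zz)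
  have df0: "degree f0 < p"
  proof -
    have "degree f0 \<le> p - 1" by (rule degree_le) (auto simp: cf0)
    then show ?thesis using p_pos by simp
  qed
  obtain m0 where m0: "good m0" "\<And>g. good g \<Longrightarrow> degree m0 \<le> degree g"
    using ex_has_least_nat[of good f0 degree] g0 by blast
  define m where "m = smult (inverse (lead_coeff m0)) m0"
  have lc0: "lead_coeff m0 \<noteq> 0" using m0(1) by (simp add: good_def)
  have mlc: "lead_coeff m = 1" using lc0 by (simp add: m_def)
  have mc: "coeff m i \<in> QK" for i using m0(1) by (auto simp: m_def good_def intro: QK_mult QK_inverse)
  have mb: "poly m b = 0" using m0(1) by (simp add: m_def good_def)
  have dm: "degree m = degree m0" using lc0 by (simp add: m_def)
  have dp: "degree m < p" using dm m0(2)[OF g0] df0 by simp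
  have d0: "degree m > 0"
  proof (rule ccontr)
    assume "\<not> degree m > 0"
    then obtain k where "m = [:k:]" by (auto elim: degree_eq_zeroE)
    then show False using mlc mb by simp
  qed
  have "is_sub QK" using is_fld_QK by (simp add: is_fld_def)
  moreover have "coeff (monom 1 p - [:a:]) i \<in> QK" for i
  proof -
    have "coeff (monom 1 p - [:a:]) i = (if i = p then 1 else 0) - (if i = 0 then a else 0)"
      by (auto simp: coeff_monom coeff_pCons split: nat.splits)
    then show ?thesis using QK_Zz[OF a(1)] QK_Zz[OF Zz_0] QK_Zz[OF Zz_1] by (auto intro: QK_diff QK_uminus)
  qed
  ultimately obtain q r where qr: "monom 1 p - [:a:] = m * q + r" "r = 0 \<or> degree r < degree m" "\<forall>i. coeff r i \<in> QK"
    using monic_division_coeffs[of QK m "monom 1 p - [:a:]"] mlc mc by blast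
  have "poly r b = 0" using arg_cong[OF qr(1), of "\<lambda>f. poly f b"] mb bp by (simp add: poly_monom)
  have "r = 0"
  proof (rule ccontr)
    assume "r \<noteq> 0"
    then have "good r" using \<open>poly r b = 0\<close> qr(3) by (simp add: good_def)
    then show False using m0(2)[of r] qr(2) dm \<open>r \<noteq> 0\<close> by simp
  qed
  then have dv: "monom 1 p - [:a:] = m * q" using qr(1) by simp
  have "\<exists>j. w = \<zeta> ^ j * b" if w: "poly m w = 0" for w
  proof -
    have "w ^ p = a" using arg_cong[OF dv, of "\<lambda>f. poly f w"] w by (simp add: poly_monom)
    then have "(\<Prod>k<p. w - \<zeta> ^ k * b) = 0" using prod_diff[of w b] bp by simp
    then obtain k where "w - \<zeta> ^ k * b = 0" by (auto simp: prod_zero_iff)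
    then show ?thesis by (intro exI[of _ k]) simp
  qed
  then obtain s i where s: "s \<in> {1, -1}" "coeff m 0 = s * \<zeta> ^ i * b ^ degree m"
    using monic_const_coeff[OF mlc] by blast
  have "s * \<zeta> ^ i \<noteq> 0" using s(1) zeta_ne_0 by auto
  then have "b ^ degree m = coeff m 0 / (s * \<zeta> ^ i)" using s(2) by simp
  moreover have "s \<in> QK" using s(1) QK_Zz[OF Zz_1] QK_uminus[OF QK_Zz[OF Zz_1]] by auto
  ultimately have bd: "b ^ degree m \<in> QK" using mc[of 0] by (auto intro!: QK_divide QK_mult QK_Zz[OF Zz_zeta_pow])
  have "\<not> p dvd degree m" using d0 dp by (auto dest: dvd_imp_le)
  then obtain u where u: "[degree m * u = 1] (mod p)" using ex_inverse by blast
  then have "degree m * u mod p = 1" using p_gt2 by (simp add: cong_def)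
  then have "b ^ (degree m * u) = a ^ (degree m * u div p) * b" using b_pow[of "degree m * u"] by simp
  then have "b = (b ^ degree m) ^ u / a ^ (degree m * u div p)" using a_ne_0 by (simp add: power_mult)
  also have "\<dots> \<in> QK" by (intro QK_divide QK_power QK_Zz[OF a(1)] bd)
  finally show False using nb by simp
qed

definition coords :: "complex \<Rightarrow> nat \<Rightarrow> complex" where
  "coords z = (SOME c. (\<forall>j. c j \<in> QK) \<and> z = (\<Sum>j<p. c j * b ^ j))"

text \<open>The automorphism over Q(\<zeta>) with b going to \<zeta>^k b, if \<open>b\<close> is not
  in the base field; otherwise it depends on the chosen coordinates.\<close>

definition tw :: "nat \<Rightarrow> complex \<Rightarrow> complex" where
  "tw k z = (\<Sum>j<p. coords z j * (\<zeta> ^ k * b) ^ j)"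

context
  assumes nb: "b \<notin> QK"
begin

lemma tw_eq:
  assumes c: "\<forall>j. c j \<in> QK"
  shows "tw k (\<Sum>j<p. c j * b ^ j) = (\<Sum>j<p. c j * (\<zeta> ^ k * b) ^ j)"
proof -
  define z where "z = (\<Sum>j<p. c j * b ^ j)"
  have "\<exists>c. (\<forall>j. c j \<in> QK) \<and> z = (\<Sum>j<p. c j * b ^ j)" using c z_def by blast
  then have d: "(\<forall>j. coords z j \<in> QK) \<and> z = (\<Sum>j<p. coords z j * b ^ j)"
    unfolding coords_def by (rule someI_ex)
  have "(\<Sum>j<p. (coords z j - c j) * b ^ j) = 0"
    using d z_def by (simp add: left_diff_distrib sum_subtractf)
  moreover have "\<forall>j. coords z j - c j \<in> QK" using c d by (auto intro: QK_diff QK_uminus)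
  ultimately have "coords z j - c j = 0" if "j < p" for j
    using independent_powers[OF nb, of "\<lambda>j. coords z j - c j"] that by blast
  then show ?thesis unfolding tw_def z_def[symmetric] by (intro sum.cong) auto
qed

lemma tw_term:
  assumes k: "x \<in> QK"
  shows "tw k (x * b ^ n) = x * (\<zeta> ^ k * b) ^ n"
proof -
  define c where "c = (\<lambda>j. if j = n mod p then x * a ^ (n div p) else 0)"
  have c: "\<forall>j. c j \<in> QK" using k a(1) by (auto simp: c_def intro: QK_mult QK_power QK_Zz)
  have s: "(\<Sum>j<p. c j * y ^ j) = x * (a ^ (n div p) * y ^ (n mod p))" for y
  proof -
    have "(\<Sum>j<p. c j * y ^ j) = (\<Sum>j<p. if j = n mod p then x * a ^ (n div p) * y ^ j else 0)"
      by (intro sum.cong) (auto simp: c_def)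
    then show ?thesis using p_pos by (simp add: mult.assoc)
  qed
  show ?thesis using tw_eq[OF c, of k] unfolding s b_pow[of n, symmetric] zb_pow[of k n, symmetric] .
qed

lemma tw_add:
  assumes "z \<in> LS" "w \<in> LS"
  shows "tw k (z + w) = tw k z + tw k w"
proof -
  obtain c d where c: "\<forall>j. c j \<in> QK" "z = (\<Sum>j<p. c j * b ^ j)" and d: "\<forall>j. d j \<in> QK" "w = (\<Sum>j<p. d j * b ^ j)"
    using LS_repr assms by meson
  have "z + w = (\<Sum>j<p. (c j + d j) * b ^ j)" unfolding c(2) d(2) by (simp add: sum.distrib distrib_right)
  moreover have "\<forall>j. c j + d j \<in> QK" using c d by (auto intro: QK_add)
  ultimately have "tw k (z + w) = (\<Sum>j<p. (c j + d j) * (\<zeta> ^ k * b) ^ j)" using tw_eq[of "\<lambda>j. c j + d j"] by simp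
  then show ?thesis unfolding c(2) d(2) tw_eq[OF c(1)] tw_eq[OF d(1)] by (simp add: sum.distrib distrib_right)
qed

lemma tw_zero: "tw k 0 = 0" using tw_term[OF QK_Zz[OF Zz_0], of k 0] by simp

lemma tw_sum: "(\<And>i. i \<in> I \<Longrightarrow> f i \<in> LS) \<Longrightarrow> tw k (sum f I) = (\<Sum>i\<in>I. tw k (f i))"
  by (induction I rule: infinite_finite_induct) (auto simp: tw_zero tw_add LS_sum)

lemma tw_mult:
  assumes "z \<in> LS" "w \<in> LS"
  shows "tw k (z * w) = tw k z * tw k w"
proof -
  obtain c d where c: "\<forall>j. c j \<in> QK" "z = (\<Sum>j<p. c j * b ^ j)" and d: "\<forall>j. d j \<in> QK" "w = (\<Sum>j<p. d j * b ^ j)"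
    using LS_repr assms by meson
  have pr: "(\<Sum>j<p. c j * y ^ j) * (\<Sum>j<p. d j * y ^ j) = (\<Sum>i<p. \<Sum>j<p. (c i * d j) * y ^ (i + j))" for y
    unfolding sum_product by (intro sum.cong refl) (simp only: power_add mult_ac)
  have "tw k (z * w) = tw k (\<Sum>i<p. \<Sum>j<p. (c i * d j) * b ^ (i + j))" unfolding c(2) d(2) pr ..
  also have "\<dots> = (\<Sum>i<p. \<Sum>j<p. tw k ((c i * d j) * b ^ (i + j)))"
    using c(1) d(1) by (subst tw_sum; (intro LS_sum LS_term QK_mult sum.cong refl tw_sum)?; simp)
  also have "\<dots> = (\<Sum>i<p. \<Sum>j<p. (c i * d j) * (\<zeta> ^ k * b) ^ (i + j))"
    using c(1) d(1) by (intro sum.cong refl tw_term QK_mult) auto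
  finally show ?thesis unfolding pr[symmetric] c(2) d(2) tw_eq[OF c(1)] tw_eq[OF d(1)] .
qed

lemma tw_QK: "x \<in> QK \<Longrightarrow> tw k x = x" using tw_term[of x k 0] by simp

lemma tw_LS: "z \<in> LS \<Longrightarrow> tw k z \<in> LS"
proof -
  assume "z \<in> LS"
  then obtain c where c: "\<forall>j. c j \<in> QK" "z = (\<Sum>j<p. c j * b ^ j)" using LS_repr by blast
  have "tw k z = (\<Sum>j<p. (c j * (\<zeta> ^ k) ^ j) * b ^ j)"
    unfolding c(2) tw_eq[OF c(1)] by (simp add: power_mult_distrib mult.assoc)
  also have "\<dots> \<in> LS" using c(1) by (intro LS_sum LS_term QK_mult QK_power QK_Zz[OF Zz_zeta_pow]) auto
  finally show ?thesis .
qed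

lemma tw_tw: "z \<in> LS \<Longrightarrow> tw k (tw m z) = tw (k + m) z"
proof -
  assume "z \<in> LS"
  then obtain c where c: "\<forall>j. c j \<in> QK" "z = (\<Sum>j<p. c j * b ^ j)" using LS_repr by blast
  have c': "\<forall>j. c j * (\<zeta> ^ m) ^ j \<in> QK" using c(1) by (auto intro!: QK_mult QK_power QK_Zz[OF Zz_zeta_pow])
  have "tw m z = (\<Sum>j<p. (c j * (\<zeta> ^ m) ^ j) * b ^ j)"
    unfolding c(2) tw_eq[OF c(1)] by (simp add: power_mult_distrib mult.assoc)
  then have "tw k (tw m z) = (\<Sum>j<p. (c j * (\<zeta> ^ m) ^ j) * (\<zeta> ^ k * b) ^ j)" using tw_eq[OF c'] by simp
  also have "\<dots> = (\<Sum>j<p. c j * (\<zeta> ^ (k + m) * b) ^ j)"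
    by (intro sum.cong refl) (simp only: power_add power_mult_distrib mult_ac)
  finally show ?thesis unfolding c(2) tw_eq[OF c(1)] .
qed

lemma tw_p: "z \<in> LS \<Longrightarrow> p dvd k \<Longrightarrow> tw k z = z"
proof -
  assume "z \<in> LS" "p dvd k"
  then obtain c where c: "\<forall>j. c j \<in> QK" "z = (\<Sum>j<p. c j * b ^ j)" using LS_repr by blast
  have "\<zeta> ^ k = 1" using \<open>p dvd k\<close> zeta_pow_1_iff by simp
  then show ?thesis unfolding c(2) tw_eq[OF c(1)] by simp
qed

lemma tw_algebraic_int:
  assumes z: "z \<in> LS" "algebraic_int z"
  shows "algebraic_int (tw k z)"
proof -
  obtain h :: "int poly" where h: "ieval h z = 0" "lead_coeff h = 1"
    using z(2) algebraic_int_altdef_ipoly by blast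
  have "tw k (ieval g z) = ieval g (tw k z) \<and> ieval g z \<in> LS" for g
  proof (induction g)
    case (pCons i g)
    have i: "of_int i \<in> QK" by (simp add: QK_Zz)
    then show ?case using pCons z(1) by (simp add: ieval_simps tw_add tw_mult tw_QK LS_QK LS_add LS_mult)
  qed (simp add: tw_zero LS_QK QK_Zz)
  then have "ieval h (tw k z) = 0" using h(1) tw_zero by metis
  then show ?thesis using h(2) algebraic_int_altdef_ipoly by blast
qed

lemma tw_galois: "tw k \<in> galois_group QK LS"
  unfolding galois_group_def
proof (intro CollectI conjI ballI)
  show "tw k \<in> ring_iso (sub_ring LS) (sub_ring LS)"
  proof (rule ring_iso_memI)
    have inv: "tw (k * (p - 1)) (tw k z) = z" "tw k (tw (k * (p - 1)) z) = z" if "z \<in> LS" for z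
    proof -
      have "k * (p - 1) + k = p * k" using p_pos by (simp add: algebra_simps)
      then have "p dvd k * (p - 1) + k" "p dvd k + k * (p - 1)" by (simp_all add: add.commute)
      then show "tw (k * (p - 1)) (tw k z) = z" "tw k (tw (k * (p - 1)) z) = z"
        using tw_tw[OF that] tw_p[OF that] by simp_all
    qed
    show "bij_betw (tw k) (carrier (sub_ring LS)) (carrier (sub_ring LS))"
      by (rule bij_betw_byWitness[of _ "tw (k * (p - 1))"]) (use inv tw_LS in auto)
  qed (auto simp: tw_LS tw_mult tw_add tw_QK QK_Zz)
qed (auto simp: tw_QK)

end

text \<open>If z is the sum of c_j b^j, the trace of z b^(p-j) to the base field is p a c_j, so this
  lies in Z[\<zeta>]. As \<open>p a\<close> is prime to \<open>Q\<close>, the powers of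
  \<open>b\<close> behave like an integral basis locally at \<open>Q\<close>.\<close>

lemma integral_decomposition:
  assumes z: "z \<in> OL"
  shows "\<exists>c. (\<forall>j. c j \<in> Zz) \<and> of_nat p * a * z = (\<Sum>j<p. c j * b ^ j)"
proof (cases "b \<in> QK")
  case True
  obtain c where c: "\<forall>j. c j \<in> QK" "z = (\<Sum>j<p. c j * b ^ j)" using LS_repr z by (auto simp: OL_def)
  have "z \<in> QK" unfolding c(2) using c(1) True by (intro QK_sum QK_mult QK_power) auto
  then have zZ: "z \<in> Zz" using z OL_QK by blast
  define d where "d = (\<lambda>j::nat. if j = 0 then of_nat p * a * z else 0)"
  have "(\<Sum>j<p. d j * b ^ j) = (\<Sum>j<p. if j = 0 then of_nat p * a * z else 0)"
    by (intro sum.cong) (auto simp: d_def)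
  then have "of_nat p * a * z = (\<Sum>j<p. d j * b ^ j)" using p_pos by simp
  moreover have "\<forall>j. d j \<in> Zz" using zZ a(1) by (auto simp: d_def intro!: Zz_mult)
  ultimately show ?thesis by blast
next
  case False
  obtain c where c: "\<forall>j. c j \<in> QK" "z = (\<Sum>j<p. c j * b ^ j)" using LS_repr z by (auto simp: OL_def)
  have zL: "z \<in> LS" "algebraic_int z" using z by (auto simp: OL_def)
  define d where "d = (\<lambda>j. if j < p then of_nat p * a * c j else 0)"
  have "d j \<in> Zz" for j
  proof (cases "j < p")
    case True
    \<comment> \<open>The exponent p - j, in place of -j, keeps \<open>v\<close> integral and costs
      the factor a = b^p.\<close>
    define v where "v = (\<Sum>m<p. c m * b ^ (m + (p - j)))"
    have v: "v = z * b ^ (p - j)" unfolding v_def c(2) by (simp add: sum_distrib_right power_add mult.assoc)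
    have vL: "v \<in> LS" "algebraic_int v" unfolding v
      using zL b_LS b_algebraic_int
      by (auto intro!: LS_mult is_sub_power[OF is_sub_LS] algebraic_int_mult algebraic_int_power)
    have "(\<Sum>i<p. tw i v) = (\<Sum>i<p. \<Sum>m<p. c m * (\<zeta> ^ i * b) ^ (m + (p - j)))"
      unfolding v_def using c(1) False
      by (intro sum.cong refl) (subst tw_sum[OF False]; (intro sum.cong refl tw_term LS_term)?; simp)
    also have "\<dots> = (\<Sum>m<p. \<Sum>i<p. c m * (\<zeta> ^ i * b) ^ (m + (p - j)))" by (rule sum.swap)
    also have "\<dots> = (\<Sum>m<p. c m * b ^ (m + (p - j)) * (\<Sum>i<p. \<zeta> ^ (i * (m + (p - j)))))"
      unfolding sum_distrib_left by (intro sum.cong refl) (simp only: power_mult_distrib power_mult[symmetric] mult_ac)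
    also have "\<dots> = (\<Sum>m<p. if m = j then c j * a * of_nat p else 0)"
    proof (intro sum.cong refl)
      fix m assume m: "m \<in> {..<p}"
      have "p dvd m + (p - j) \<longleftrightarrow> m = j"
      proof
        assume "p dvd m + (p - j)"
        then obtain q where q: "m + (p - j) = p * q" by (auto elim: dvdE)
        have "0 < m + (p - j)" "m + (p - j) < p * 2" using m True by auto
        then have "0 < p * q" "p * q < p * 2" by (simp_all only: q)
        then have "q = 1" by auto
        then show "m = j" using q True by auto
      qed (use True in auto)
      then show "c m * b ^ (m + (p - j)) * (\<Sum>i<p. \<zeta> ^ (i * (m + (p - j)))) =
          (if m = j then c j * a * of_nat p else 0)"
        unfolding sum_zeta_pow using True by (auto simp: bp)
    qed
    also have "\<dots> = c j * a * of_nat p" using True by simp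
    finally have e: "d j = (\<Sum>i<p. tw i v)" using True by (simp add: d_def mult_ac)
    have "algebraic_int (d j)" unfolding e using tw_algebraic_int[OF False vL] by (intro algebraic_int_sum)
    moreover have "d j \<in> QK" using True c(1) a(1) by (auto simp: d_def intro!: QK_mult QK_Zz[OF a(1)] QK_Zz[OF Zz_of_nat])
    ultimately show ?thesis by (intro QK_algebraic_int)
  qed (simp add: d_def)
  moreover have "of_nat p * a * z = (\<Sum>j<p. d j * b ^ j)"
    unfolding c(2) sum_distrib_left by (intro sum.cong) (auto simp: d_def mult.assoc)
  ultimately show ?thesis by blast
qed

end

lemma idl_cong_mult:
  assumes R: "is_sub R" "is_idl R I" and x: "x - y \<in> I" "x' - y' \<in> I" "x' \<in> R" "y \<in> R"
  shows "x * x' - y * y' \<in> I"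
proof -
  have "(x - y) * x' + y * (x' - y') \<in> I"
    by (intro is_idl_add[OF R(2)] is_idl_mult[OF R(2)] is_idl_mult_right[OF R(2)] x)
  then show ?thesis by (simp add: algebra_simps)
qed

lemma idl_cong_power:
  assumes R: "is_sub R" "is_idl R I" and x: "x - y \<in> I" "x \<in> R" "y \<in> R"
  shows "x ^ n - y ^ n \<in> I"
proof (induction n)
  case (Suc n)
  then show ?case using idl_cong_mult[OF R x(1) Suc is_sub_power[OF R(1) x(2)] x(3)] by simp
qed (simp add: is_idl_zero[OF R(2)])

lemma idl_cong_trans:
  assumes R: "is_idl R I" and x: "x - y \<in> I" "y - z \<in> I"
  shows "x - z \<in> I"
  using is_idl_add[OF R x] by simp

lemma frobenius_power_sum:
  assumes S: "is_sub S" and I: "is_idl S I" and l: "prime l" "of_nat l \<in> I"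
    and f: "\<And>i. i \<in> A \<Longrightarrow> f i \<in> S"
  shows "sum f A ^ (l ^ e) - (\<Sum>i\<in>A. f i ^ (l ^ e)) \<in> I"
proof -
  have two: "(x + y) ^ (l ^ e) - (x ^ (l ^ e) + y ^ (l ^ e)) \<in> I" if xy: "x \<in> S" "y \<in> S" for x y
  proof (induction e)
    case 0
    then show ?case using is_idl_zero[OF I] by simp
  next
    case (Suc e)
    let ?u = "x ^ (l ^ e)" and ?v = "y ^ (l ^ e)"
    have uv: "?u \<in> S" "?v \<in> S" using xy is_sub_power[OF S] by blast+
    have S2: "x + y \<in> S" "?u + ?v \<in> S" using xy uv S by (auto simp: is_sub_def)
    obtain w where w: "w \<in> S" "(?u + ?v) ^ l - (?u ^ l + ?v ^ l) = of_nat l * w"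
      using frobenius_sub[OF S l(1) uv] by blast
    have 1: "((x + y) ^ (l ^ e)) ^ l - (?u + ?v) ^ l \<in> I"
      by (rule idl_cong_power[OF S I Suc is_sub_power[OF S S2(1)] S2(2)])
    have 2: "(?u + ?v) ^ l - (?u ^ l + ?v ^ l) \<in> I" unfolding w(2) by (rule is_idl_mult_right[OF I w(1) l(2)])
    have p: "(z ^ (l ^ e)) ^ l = z ^ (l ^ Suc e)" for z :: complex
      by (simp add: power_mult[symmetric] mult.commute)
    show ?case using idl_cong_trans[OF I 1 2] unfolding p .
  qed
  show ?thesis
    using f
  proof (induction A rule: infinite_finite_induct)
    case (insert i A)
    have s: "sum f A \<in> S" using insert.prems by (intro is_sub_sum[OF S]) auto
    have 1: "(f i + sum f A) ^ (l ^ e) - (f i ^ (l ^ e) + sum f A ^ (l ^ e)) \<in> I"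
      by (rule two) (use insert.prems s in auto)
    have 2: "sum f A ^ (l ^ e) - (\<Sum>i\<in>A. f i ^ (l ^ e)) \<in> I" using insert.IH insert.prems by auto
    show ?case using is_idl_add[OF I 1 2] insert.hyps by (simp add: algebra_simps)
  qed (use l in \<open>auto simp: is_idl_zero[OF I] prime_gt_0_nat zero_power\<close>)
qed

lemma galois_group_mult:
  assumes "\<sigma> \<in> galois_group F L" "x \<in> L" "y \<in> L"
  shows "\<sigma> (x * y) = \<sigma> x * \<sigma> y"
proof -
  have "\<sigma> \<in> Ring.ring_hom (sub_ring L) (sub_ring L)" using assms(1) by (simp add: galois_group_def ring_iso_def)
  then show ?thesis using ring_hom_mult[of \<sigma> "sub_ring L" "sub_ring L" x y] assms by simp
qed

context cyclo_prime
begin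

abbreviation (input) lq :: nat where "lq \<equiv> l ^ ord p l"

lemma lq_cong: "[lq = 1] (mod p)" using ord_works by blast

lemma lq_gt_1: "lq > 1"
proof -
  have "ord p l > 0" using ord_eq_0[of p l] coprime_l_p by (simp add: coprime_commute)
  then show ?thesis using prime_gt_1_nat[OF l_prime] by (intro one_less_power) auto
qed

lemma lq_pos: "lq > 0" using lq_gt_1 by linarith

lemma p_dvd_lq: "p dvd lq - 1"
proof -
  have "1 \<le> lq" using lq_gt_1 by linarith
  then show ?thesis using lq_cong cong_altdef_nat[of 1 lq p] by blast
qed

lemma zeta_pow_lq: "(\<zeta> ^ k) ^ lq = \<zeta> ^ k"
proof -
  have "[k * lq = k * 1] (mod p)" by (intro cong_mult cong_refl lq_cong)
  then show ?thesis using zeta_pow_cong[of "k * lq" k] by (simp add: power_mult)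
qed

lemma above_inverse:
  assumes Q: "above Q" and v: "v \<in> Zz" "v \<notin> Q"
  shows "\<exists>w\<in>Zz. v * w - 1 \<in> Q"
proof -
  have "l ^ (p - 1) > 1" using prime_gt_1_nat[OF l_prime] p_gt2 by (intro one_less_power) auto
  then have "l ^ (p - 1) - 1 = Suc (l ^ (p - 1) - 2)" by simp
  then have "v * v ^ (l ^ (p - 1) - 2) - 1 \<in> Q" using above_fermat[OF Q l_pow_p v] by (simp only: power_Suc)
  then show ?thesis using Zz_power[OF v(1)] by blast
qed

lemma above_fermat_lq:
  assumes Q: "above Q" and v: "v \<in> Zz"
  shows "v ^ lq - v \<in> Q"
proof -
  have "zcong (of_nat l) (v ^ lq) v" by (rule frobenius_fixed[OF l_prime lq_cong v])
  then obtain w where "w \<in> Zz" "v ^ lq - v = of_nat l * w" by (auto simp: zcong_def)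
  then show ?thesis using is_idl_mult_right[OF above_idl[OF Q] _ above_l[OF Q]] by simp
qed

end

section \<open>Unramifiedness and Frobenius in the Kummer extension\<close>

locale kummer_symbol = kummer +
  fixes k :: nat
  assumes sym: "\<zeta> ^ k - a ^ ((l ^ ord p l - 1) div p) \<in> Q"
begin

text \<open>The ideal \<open>M\<close> is the extension \<open>Q O\<^sub>L\<close> to the ring of integers \<open>O\<^sub>L\<close> of the Kummer extension, and
  \<open>T d i\<close> is the image of \<open>\<Sum>j<p. d j * b ^ j\<close> under \<open>b \<mapsto> \<zeta>\<^sup>k\<^sup>i b\<close>.\<close>

definition M :: "complex set" where "M = \<Inter>{I. is_idl OL I \<and> Q \<subseteq> I}"

lemma M_least: "is_idl OL I \<Longrightarrow> Q \<subseteq> I \<Longrightarrow> M \<subseteq> I" by (auto simp: M_def)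

lemma Q_M: "Q \<subseteq> M" by (auto simp: M_def)

lemma M_idl: "is_idl OL M"
proof -
  have "is_idl OL OL" using is_sub_OL by (auto simp: is_idl_def is_sub_def)
  moreover have "Q \<subseteq> OL" using above_sub[OF Q] Zz_OL by blast
  ultimately have "M \<subseteq> OL" by (rule M_least)
  then show ?thesis unfolding is_idl_def by (auto simp: M_def is_idl_def)
qed

text \<open>The integers that \<open>h\<close> maps into l O_L form an ideal containing
  \<open>Q\<close>, so the annihilator of \<open>Q\<close> modulo \<open>l\<close> works for the
  extended ideal as well.\<close>

lemma M_annihilator:
  "\<exists>h\<in>Zz. h \<notin> Q \<and> (\<forall>z\<in>M. \<exists>w\<in>OL. h * z = of_nat l * w)"
proof -
  obtain h where h: "h \<in> Zz" "h \<notin> Q" "\<And>z. z \<in> Q \<Longrightarrow> \<exists>w\<in>Zz. h * z = of_nat l * w"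
    using above_annihilator[OF Q] by blast
  define I where "I = {z \<in> OL. \<exists>w\<in>OL. h * z = of_nat l * w}"
  have "is_idl OL I"
    unfolding is_idl_def
  proof (intro conjI ballI)
    show "I \<subseteq> OL" by (auto simp: I_def)
    have "0 \<in> OL" using is_sub_OL by (simp add: is_sub_def)
    then show "0 \<in> I" by (auto simp: I_def)
  next
    fix x y assume "x \<in> I" "y \<in> I"
    then obtain u v where u: "u \<in> OL" "h * x = of_nat l * u" "x \<in> OL" "v \<in> OL" "h * y = of_nat l * v" "y \<in> OL"
      by (auto simp: I_def)
    have "h * (x + y) = of_nat l * (u + v)" unfolding distrib_left u(2,5) ..
    then show "x + y \<in> I" unfolding I_def using OL_add u by blast
  next
    fix r x assume r: "r \<in> OL" and "x \<in> I"
    then obtain u where u: "u \<in> OL" "h * x = of_nat l * u" "x \<in> OL" by (auto simp: I_def)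
    have "h * (r * x) = r * (h * x)" by (simp only: mult_ac)
    also have "\<dots> = of_nat l * (r * u)" unfolding u(2) by (simp only: mult_ac)
    finally show "r * x \<in> I" unfolding I_def using OL_mult r u by blast
  qed
  moreover have "Q \<subseteq> I" unfolding I_def using h(3) Zz_OL above_sub[OF Q] by blast
  ultimately have "M \<subseteq> I" by (rule M_least)
  then have "\<forall>z\<in>M. \<exists>w\<in>OL. h * z = of_nat l * w" unfolding I_def by blast
  then show ?thesis using h(1,2) by blast
qed

text \<open>This takes the place of lying over. In h z = l w the element \<open>w\<close> is an
  algebraic integer of the base field, hence in Z[\<zeta>]; so h z is in \<open>Q\<close> and
  \<open>h\<close> is not.\<close>

lemma M_QK: "z \<in> M \<Longrightarrow> z \<in> QK \<Longrightarrow> z \<in> Q"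
proof -
  assume z: "z \<in> M" "z \<in> QK"
  obtain h where h: "h \<in> Zz" "h \<notin> Q" "\<And>z. z \<in> M \<Longrightarrow> \<exists>w\<in>OL. h * z = of_nat l * w"
    using M_annihilator by metis
  have zZ: "z \<in> Zz" using OL_QK[OF is_idl_sub[OF M_idl z(1)] z(2)] .
  obtain w where w: "w \<in> OL" "h * z = of_nat l * w" using h(3)[OF z(1)] by blast
  have l0: "(of_nat l :: complex) \<noteq> 0" using prime_gt_0_nat[OF l_prime] by simp
  have "w = (h * z) / of_nat l" using w(2) l0 by simp
  also have "\<dots> \<in> QK" by (intro QK_divide QK_mult QK_Zz[OF h(1)] z(2) QK_Zz[OF Zz_of_nat])
  finally have "w \<in> Zz" by (rule OL_QK[OF w(1)])
  then have "h * z \<in> Q" unfolding w(2) by (rule is_idl_mult_right[OF above_idl[OF Q] _ above_l[OF Q]])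
  then show "z \<in> Q" using is_prm_mult[OF above_prm[OF Q] h(1) zZ] h(2) by blast
qed

lemma one_M: "1 \<notin> M" using M_QK[OF _ QK_Zz[OF Zz_1]] above_one[OF Q] by blast

lemma prime_over:
  assumes P: "is_prm OL P" "P \<inter> QK = Q"
  shows "M \<subseteq> P"
  using M_least[OF is_prm_idl[OF P(1)]] P(2) by blast

lemma ex_prime_over: "\<exists>P. is_prm OL P \<and> P \<inter> QK = Q"
proof -
  obtain P where P: "is_prm OL P" "M \<subseteq> P" using ex_is_prm[OF is_sub_OL M_idl one_M] by blast
  have idl: "is_idl OL P" by (rule is_prm_idl[OF P(1)])
  have e: "P \<inter> QK = P \<inter> Zz" using OL_QK is_idl_sub[OF idl] QK_Zz by blast
  have "is_idl Zz (P \<inter> Zz)" using idl Zz_OL by (auto simp: is_idl_def Zz_add Zz_mult)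
  moreover have "Q \<subseteq> P \<inter> Zz" using P(2) Q_M above_sub[OF Q] by blast
  ultimately have "P \<inter> Zz = Q" using above_maximal[OF Q] is_prm_one[OF P(1)] by blast
  then show ?thesis using P(1) e by blast
qed

lemma b_pow_lq: "b ^ (lq - 1) = a ^ ((lq - 1) div p)"
proof -
  have "b ^ (lq - 1) = b ^ (p * ((lq - 1) div p))" using p_dvd_lq by simp
  then show ?thesis by (simp only: power_mult bp)
qed

lemma b_pow_lq': "b ^ lq = b * a ^ ((lq - 1) div p)"
proof -
  have "b ^ lq = b * b ^ (lq - 1)" using lq_pos by (metis Suc_diff_1 power_Suc)
  then show ?thesis by (simp only: b_pow_lq)
qed

definition T :: "(nat \<Rightarrow> complex) \<Rightarrow> nat \<Rightarrow> complex" where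
  "T d i = (\<Sum>j<p. d j * ((\<zeta> ^ k) ^ i * b) ^ j)"

lemma T_OL: "(\<And>j. d j \<in> Zz) \<Longrightarrow> T d i \<in> OL"
  unfolding T_def
  by (intro is_sub_sum[OF is_sub_OL] OL_mult OL_power b_OL Zz_OL[OF Zz_zeta_pow]) (auto intro: Zz_OL)

text \<open>Modulo \<open>M\<close> the Frobenius power is additive and fixes the coefficients, and
  it sends \<open>b\<close> to b a^((lq-1)/p), which \<open>sym\<close> identifies with \<zeta>^k
  b.\<close>

lemma T_frobenius:
  assumes d: "\<And>j. d j \<in> Zz"
  shows "T d i ^ lq - T d (Suc i) \<in> M"
proof -
  let ?f = "\<lambda>j. d j * ((\<zeta> ^ k) ^ i * b) ^ j"
  have fOL: "?f j \<in> OL" for j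
    by (intro OL_mult OL_power b_OL Zz_OL[OF Zz_zeta_pow] Zz_OL[OF d])
  have lM: "of_nat l \<in> M" using Q_M above_l[OF Q] by blast
  have 1: "T d i ^ lq - (\<Sum>j<p. ?f j ^ lq) \<in> M"
    unfolding T_def by (rule frobenius_power_sum[OF is_sub_OL M_idl l_prime lM fOL])
  have s: "((\<zeta> ^ k) ^ i * b) ^ lq - (\<zeta> ^ k) ^ Suc i * b \<in> M"
  proof -
    have "((\<zeta> ^ k) ^ i * b) ^ lq = (\<zeta> ^ k) ^ i * (b * a ^ ((lq - 1) div p))"
      unfolding power_mult_distrib b_pow_lq' using zeta_pow_lq[of "k * i"] by (simp add: power_mult)
    then have "((\<zeta> ^ k) ^ i * b) ^ lq - (\<zeta> ^ k) ^ Suc i * b =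
        ((\<zeta> ^ k) ^ i * b) * - (\<zeta> ^ k - a ^ ((lq - 1) div p))" by (simp add: algebra_simps)
    also have "\<dots> \<in> M"
      by (intro is_idl_mult[OF M_idl] is_idl_uminus[OF is_sub_OL M_idl] OL_mult OL_power b_OL
            Zz_OL[OF Zz_zeta_pow] subsetD[OF Q_M sym])
    finally show ?thesis .
  qed
  have 2: "?f j ^ lq - d j * ((\<zeta> ^ k) ^ Suc i * b) ^ j \<in> M" for j
  proof -
    have OLs: "(\<zeta> ^ k) ^ n * b \<in> OL" for n by (intro OL_mult OL_power b_OL Zz_OL[OF Zz_zeta_pow])
    have a1: "d j ^ lq - d j \<in> M" using above_fermat_lq[OF Q d] Q_M by blast
    have a2: "(((\<zeta> ^ k) ^ i * b) ^ lq) ^ j - ((\<zeta> ^ k) ^ Suc i * b) ^ j \<in> M"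
      by (rule idl_cong_power[OF is_sub_OL M_idl s OL_power[OF OLs] OLs])
    have "?f j ^ lq = d j ^ lq * (((\<zeta> ^ k) ^ i * b) ^ lq) ^ j"
    proof -
      have "(y ^ j) ^ lq = (y ^ lq) ^ j" for y :: complex by (simp only: power_mult[symmetric] mult.commute)
      then show ?thesis by (simp only: power_mult_distrib[of "d j"])
    qed
    then show ?thesis
      using idl_cong_mult[OF is_sub_OL M_idl a1 a2 OL_power[OF OL_power[OF OLs]] Zz_OL[OF d]] by simp
  qed
  have "(\<Sum>j<p. ?f j ^ lq) - T d (Suc i) \<in> M"
    unfolding T_def sum_subtractf[symmetric] by (intro is_idl_sum[OF M_idl] 2)
  then show ?thesis using idl_cong_trans[OF M_idl 1] by blast
qed

lemma T_frobenius_iter: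
  assumes d: "\<And>j. d j \<in> Zz"
  shows "T d 0 ^ (lq ^ n) - T d n \<in> M"
proof (induction n)
  case 0
  then show ?case using is_idl_zero[OF M_idl] by simp
next
  case (Suc n)
  have "(T d 0 ^ (lq ^ n)) ^ lq - T d n ^ lq \<in> M"
    by (rule idl_cong_power[OF is_sub_OL M_idl Suc OL_power[OF T_OL[OF d]] T_OL[OF d]])
  then have "(T d 0 ^ (lq ^ n)) ^ lq - T d (Suc n) \<in> M"
    using T_frobenius[OF d] by (rule idl_cong_trans[OF M_idl])
  moreover have "(T d 0 ^ (lq ^ n)) ^ lq = T d 0 ^ (lq ^ Suc n)"
    by (simp only: power_mult[symmetric] power_Suc2)
  ultimately show ?case by simp
qed

lemma pa_not_Q: "of_nat p * a \<in> Zz" "of_nat p * a \<notin> Q"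
  using is_prm_mult[OF above_prm[OF Q] Zz_of_nat a(1), of p] above_p[OF Q] a
  by (auto intro: Zz_mult)

text \<open>After \<open>p\<close> Frobenius steps \<open>p a z\<close> returns to itself modulo
  \<open>M\<close>, but it has then been raised to a power that is a multiple of z^2.\<close>

lemma M_radical:
  assumes z: "z \<in> OL" "z ^ 2 \<in> M"
  shows "z \<in> M"
proof -
  obtain d where d: "\<forall>j. d j \<in> Zz" "of_nat p * a * z = (\<Sum>j<p. d j * b ^ j)"
    using integral_decomposition[OF z(1)] by blast
  let ?v = "of_nat p * a"
  have v: "?v \<in> OL" using Zz_OL pa_not_Q by blast
  have T0: "T d 0 = ?v * z" unfolding d(2) T_def by simp
  have Tp: "T d p = T d 0"
  proof -
    have "(\<zeta> ^ k) ^ p = 1" by (metis power_mult mult.commute zeta_p power_one)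
    then show ?thesis unfolding T_def by simp
  qed
  have "lq ^ p \<ge> 2"
  proof -
    have "lq ^ p > 1" by (rule one_less_power[OF lq_gt_1 p_pos(1)])
    then show ?thesis by simp
  qed
  then have e: "(?v * z) ^ (lq ^ p) = (?v ^ (lq ^ p) * z ^ (lq ^ p - 2)) * z ^ 2"
    by (simp only: power_mult_distrib mult.assoc power_add[symmetric] le_add_diff_inverse2)
  have "(?v * z) ^ (lq ^ p) \<in> M" unfolding e
    by (intro is_idl_mult[OF M_idl] OL_mult OL_power v z)
  moreover have "(?v * z) ^ (lq ^ p) - ?v * z \<in> M"
    using T_frobenius_iter[of d p] d(1) unfolding Tp T0 by blast
  ultimately have "(?v * z) ^ (lq ^ p) - ((?v * z) ^ (lq ^ p) - ?v * z) \<in> M"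
    by (rule is_idl_diff[OF is_sub_OL M_idl])
  then have vz: "?v * z \<in> M" by simp
  obtain w where w: "w \<in> Zz" "?v * w - 1 \<in> Q" using above_inverse[OF Q pa_not_Q] by blast
  have "w * (?v * z) - z * (?v * w - 1) \<in> M"
    by (rule is_idl_diff[OF is_sub_OL M_idl is_idl_mult[OF M_idl Zz_OL[OF w(1)] vz]
          is_idl_mult[OF M_idl z(1) subsetD[OF Q_M w(2)]]])
  then show ?thesis by (simp add: algebra_simps)
qed

text \<open>Some iterate of the Frobenius power is the identity modulo \<open>M\<close>, up to the factor \<open>p a\<close> prime to \<open>Q\<close>;
  so \<open>M\<close> is radical, and \<open>M = P\<^sup>2 J\<close> would give \<open>P J \<subseteq> M\<close>. The annihilator \<open>h\<close> of \<open>M\<close> modulo \<open>l\<close> would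
  then lie in \<open>P\<close>.\<close>

lemma unramified: "unramified_in LS Q"
  unfolding unramified_in_def ring_of_integers_LS
proof
  let ?R = "sub_ring OL"
  assume "\<exists>P J. primeideal P ?R \<and> ideal J ?R \<and> Idl\<^bsub>?R\<^esub> Q = P \<cdot>\<^bsub>?R\<^esub> P \<cdot>\<^bsub>?R\<^esub> J"
  then obtain P J where "primeideal P ?R" "ideal J ?R" and e: "Idl\<^bsub>?R\<^esub> Q = P \<cdot>\<^bsub>?R\<^esub> P \<cdot>\<^bsub>?R\<^esub> J" by blast
  then have P: "is_prm OL P" and J: "is_idl OL J"
    using primeideal_sub_ring_iff[OF is_sub_OL] ideal_sub_ring_iff[OF is_sub_OL] by blast+
  have Pi: "is_idl OL P" by (rule is_prm_idl[OF P])
  have M: "M = P \<cdot>\<^bsub>?R\<^esub> P \<cdot>\<^bsub>?R\<^esub> J"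
    unfolding e[symmetric] genideal_def M_def ideal_sub_ring_iff[OF is_sub_OL] ..
  have PJ: "u * v \<in> M" if u: "u \<in> P" and v: "v \<in> J" for u v
  proof -
    have uO: "u \<in> OL" "v \<in> OL" using u v is_idl_sub Pi J by blast+
    have "u * u \<in> P \<cdot>\<^bsub>?R\<^esub> P" using ideal_prod.prod[OF u u, of ?R] by simp
    then have "(u * u) * v \<in> M" unfolding M using ideal_prod.prod[OF _ v, of "u * u" "P \<cdot>\<^bsub>?R\<^esub> P" ?R] by simp
    then have "((u * u) * v) * v \<in> M" by (rule is_idl_mult_right[OF M_idl uO(2)])
    moreover have "((u * u) * v) * v = (u * v) ^ 2" unfolding power2_eq_square by (simp only: mult_ac)
    ultimately have "(u * v) ^ 2 \<in> M" by (simp only:)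
    then show ?thesis by (rule M_radical[OF OL_mult[OF uO]])
  qed
  obtain h where h: "h \<in> Zz" "h \<notin> Q" "\<And>z. z \<in> M \<Longrightarrow> \<exists>w\<in>OL. h * z = of_nat l * w"
    using M_annihilator by metis
  have PP: "u \<in> P \<and> (\<forall>v\<in>J. \<exists>w\<in>P. h * (u * v) = of_nat l * w)" if "u \<in> P \<cdot>\<^bsub>?R\<^esub> P" for u
    using that
  proof (induction u rule: ideal_prod.induct)
    case (prod i j)
    have ij: "i \<in> OL" "j \<in> OL" using prod is_idl_sub[OF Pi] by blast+
    have "\<exists>w\<in>P. h * (i * j * v) = of_nat l * w" if v: "v \<in> J" for v
    proof -
      obtain w where w: "w \<in> OL" "h * (j * v) = of_nat l * w" using h(3)[OF PJ[OF prod(2) v]] by blast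
      have "h * (i * j * v) = i * (h * (j * v))" by (simp only: mult_ac)
      also have "\<dots> = of_nat l * (i * w)" unfolding w(2) by (simp only: mult_ac)
      finally show ?thesis using is_idl_mult_right[OF Pi w(1) prod(1)] by blast
    qed
    then show ?case using is_idl_mult[OF Pi ij(1) prod(2)] by simp
  next
    case (sum s1 s2)
    have "\<exists>w\<in>P. h * ((s1 + s2) * v) = of_nat l * w" if v: "v \<in> J" for v
    proof -
      obtain w1 w2 where w: "w1 \<in> P" "h * (s1 * v) = of_nat l * w1" "w2 \<in> P" "h * (s2 * v) = of_nat l * w2"
        using sum v by meson
      have "h * ((s1 + s2) * v) = of_nat l * (w1 + w2)" unfolding distrib_right distrib_left w(2,4) ..
      then show ?thesis using is_idl_add[OF Pi w(1,3)] by blast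
    qed
    then show ?case using sum is_idl_add[OF Pi] by simp
  qed
  have MP: "u \<in> P \<and> (\<exists>w\<in>P. h * u = of_nat l * w)" if "u \<in> M" for u
    using that unfolding M
  proof (induction u rule: ideal_prod.induct)
    case (prod i j)
    then show ?case using PP[of i] is_idl_mult_right[OF Pi is_idl_sub[OF J]] by simp
  next
    case (sum s1 s2)
    then obtain w1 w2 where w: "w1 \<in> P" "h * s1 = of_nat l * w1" "w2 \<in> P" "h * s2 = of_nat l * w2" by meson
    have "h * (s1 + s2) = of_nat l * (w1 + w2)" unfolding distrib_left w(2,4) ..
    then show ?case using is_idl_add[OF Pi] w(1,3) sum by fastforce
  qed
  obtain w where w: "w \<in> P" "h * of_nat l = of_nat l * w" using MP[of "of_nat l"] Q_M above_l[OF Q] by blast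
  have "(of_nat l :: complex) \<noteq> 0" using prime_gt_0_nat[OF l_prime] by simp
  then have "h \<in> P" using w by (simp add: mult.commute)
  obtain g where g: "g \<in> Zz" "h * g - 1 \<in> Q" using above_inverse[OF Q h(1,2)] by blast
  have "h * g - 1 \<in> P" using MP Q_M g(2) by blast
  then have "h * g - (h * g - 1) \<in> P"
    by (rule is_idl_diff[OF is_sub_OL Pi is_idl_mult_right[OF Pi Zz_OL[OF g(1)] \<open>h \<in> P\<close>]])
  then show False using is_prm_one[OF P] by simp
qed

text \<open>If \<open>b\<close> is in the base field, only the identity is available; then
  a^((lq-1)/p) = b^(lq-1) is 1 modulo \<open>Q\<close>, and this forces \<zeta>^k = 1.\<close>

lemma ex_galois:
  "\<exists>\<sigma>\<in>galois_group QK LS. \<sigma> b = \<zeta> ^ k * b \<and> (\<forall>z\<in>OL. \<sigma> z \<in> OL) \<and>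
     (\<forall>c. (\<forall>j. c j \<in> QK) \<longrightarrow> \<sigma> (\<Sum>j<p. c j * b ^ j) = (\<Sum>j<p. c j * (\<zeta> ^ k * b) ^ j))"
proof (cases "b \<in> QK")
  case True
  have bZ: "b \<in> Zz" using QK_algebraic_int True b_algebraic_int by blast
  have bQ: "b \<notin> Q"
  proof
    assume "b \<in> Q"
    then have "b ^ (p - 1) * b \<in> Q" by (intro is_idl_mult[OF above_idl[OF Q]] Zz_power bZ)
    then have "a \<in> Q" by (simp only: power_minus_mult[OF p_pos(1)] bp)
    then show False using a(2) by contradiction
  qed
  have "a ^ ((lq - 1) div p) - 1 \<in> Q" using above_fermat[OF Q lq_cong bZ bQ] unfolding b_pow_lq .
  then have "\<zeta> ^ k - \<zeta> ^ 0 \<in> Q" using idl_cong_trans[OF above_idl[OF Q] sym] by simp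
  then have "\<zeta> ^ k = 1" using above_zeta_inj[OF Q] by fastforce
  moreover have "(\<lambda>z. z) \<in> galois_group QK LS"
    unfolding galois_group_def by (auto intro!: ring_iso_memI bij_betw_id[unfolded id_def])
  ultimately show ?thesis by (intro bexI[of _ "\<lambda>z. z"]) auto
next
  case False
  have "tw k b = \<zeta> ^ k * b" using tw_term[OF False QK_Zz[OF Zz_1], of k 1] by simp
  moreover have "tw k z \<in> OL" if "z \<in> OL" for z
    using that tw_LS[OF False] tw_algebraic_int[OF False] by (auto simp: OL_def)
  ultimately show ?thesis using tw_galois[OF False] tw_eq[OF False] by blast
qed

text \<open>The Frobenius congruence is verified for \<open>p a z\<close>, where it is
  \<open>T_frobenius\<close>. The factor \<open>p a\<close> is fixed by \<sigma>, satisfies its own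
  congruence modulo \<open>Q\<close>, and lies outside \<open>P\<close>, so it can be
  cancelled.\<close>

lemma ex_frobenius: "\<exists>\<sigma>. is_frobenius QK LS Q \<sigma> \<and> \<sigma> b = \<zeta> ^ k * b"
proof -
  obtain \<sigma> where s: "\<sigma> \<in> galois_group QK LS" "\<sigma> b = \<zeta> ^ k * b" "\<And>z. z \<in> OL \<Longrightarrow> \<sigma> z \<in> OL"
    "\<And>c. (\<forall>j. c j \<in> QK) \<Longrightarrow> \<sigma> (\<Sum>j<p. c j * b ^ j) = (\<Sum>j<p. c j * (\<zeta> ^ k * b) ^ j)"
    using ex_galois by blast
  have "\<sigma> z - z ^ lq \<in> P" if P: "is_prm OL P" "P \<inter> QK = Q" and z: "z \<in> OL" for P z
  proof -
    have Pi: "is_idl OL P" by (rule is_prm_idl[OF P(1)])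
    let ?v = "of_nat p * a"
    have v: "?v \<in> Zz" "?v \<in> OL" "?v \<notin> P"
      using pa_not_Q Zz_OL P(2) QK_Zz by blast+
    obtain d where d: "\<forall>j. d j \<in> Zz" "?v * z = (\<Sum>j<p. d j * b ^ j)"
      using integral_decomposition[OF z] by blast
    have T0: "T d 0 = ?v * z" unfolding d(2) T_def by simp
    have "\<sigma> (?v * z) = T d 1" unfolding d(2) T_def using s(4)[of d] d(1) QK_Zz by simp
    moreover have "\<sigma> (?v * z) = \<sigma> ?v * \<sigma> z"
      by (rule galois_group_mult[OF s(1)]) (use v(2) z in \<open>simp_all add: OL_def\<close>)
    moreover have "\<sigma> ?v = ?v" using s(1) QK_Zz[OF v(1)] by (simp add: galois_group_def)
    ultimately have sv: "?v * \<sigma> z = T d 1" by simp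
    have 1: "T d 0 ^ lq - T d 1 \<in> P" using T_frobenius[of d 0] d(1) prime_over[OF P] by auto
    have 2: "?v ^ lq - ?v \<in> P" using above_fermat_lq[OF Q v(1)] P(2) by blast
    have "(?v ^ lq - ?v) * z ^ lq - (T d 0 ^ lq - T d 1) \<in> P"
      by (rule is_idl_diff[OF is_sub_OL Pi is_idl_mult_right[OF Pi OL_power[OF z] 2] 1])
    moreover have "(V - v) * Z - (V * Z - v * S) = v * (S - Z)" for V v Z S :: complex
      by (simp add: algebra_simps)
    ultimately have "?v * (\<sigma> z - z ^ lq) \<in> P"
      by (simp only: sv[symmetric] T0 power_mult_distrib[of ?v z])
    then show ?thesis
      using is_prm_mult[OF P(1) v(2) OL_diff[OF s(3)[OF z] OL_power[OF z]]] v(3) by blast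
  qed
  then have "is_frobenius QK LS Q \<sigma>"
    unfolding is_frobenius_def ring_of_integers_LS residue_card[OF Q, unfolded cyclotomic_field_eq]
    using s(1) primeideal_sub_ring_iff[OF is_sub_OL] by auto
  then show ?thesis using s(2) by blast
qed

text \<open>One prime \<open>P\<close> over \<open>Q\<close> suffices: it does not contain
  \<open>b\<close>, so the congruence for \<open>b\<close> gives \<zeta>^j modulo \<open>P\<close>,
  and both sides of that lie in the base ring.\<close>

lemma frobenius_unique:
  assumes f: "is_frobenius QK LS Q \<sigma>" "\<sigma> b = \<zeta> ^ j * b"
  shows "\<zeta> ^ j = \<zeta> ^ k"
proof -
  obtain P where P: "is_prm OL P" "P \<inter> QK = Q" using ex_prime_over by blast
  have pr: "primeideal P (ring_of_integers LS)"
    unfolding ring_of_integers_LS using P primeideal_sub_ring_iff[OF is_sub_OL] by blast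
  have "\<sigma> b - b ^ lq \<in> P"
    using f(1) pr P(2) b_OL
    unfolding is_frobenius_def residue_card[OF Q, unfolded cyclotomic_field_eq]
    by (auto simp: ring_of_integers_LS)
  then have "b * (\<zeta> ^ j - a ^ ((lq - 1) div p)) \<in> P"
    unfolding f(2) b_pow_lq' by (simp add: algebra_simps)
  moreover have "b \<notin> P"
  proof
    assume "b \<in> P"
    then have "b ^ (p - 1) * b \<in> P" by (intro is_idl_mult[OF is_prm_idl[OF P(1)]] OL_power b_OL)
    then have "a \<in> P" by (simp only: power_minus_mult[OF p_pos(1)] bp)
    then show False using a P(2) QK_Zz by blast
  qed
  moreover have dZ: "\<zeta> ^ j - a ^ ((lq - 1) div p) \<in> Zz" by (intro Zz_diff Zz_zeta_pow Zz_power a)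
  ultimately have "\<zeta> ^ j - a ^ ((lq - 1) div p) \<in> P"
    using is_prm_mult[OF P(1) b_OL Zz_OL[OF dZ]] by blast
  then have "\<zeta> ^ j - a ^ ((lq - 1) div p) \<in> Q" using P(2) QK_Zz[OF dZ] by blast
  then have "(\<zeta> ^ j - a ^ ((lq - 1) div p)) - (\<zeta> ^ k - a ^ ((lq - 1) div p)) \<in> Q"
    using sym by (rule is_idl_diff[OF is_sub_Zz above_idl[OF Q]])
  then have "\<zeta> ^ j - \<zeta> ^ k \<in> Q" by simp
  then show ?thesis by (rule above_zeta_inj[OF Q])
qed

end

context cyclo_prime
begin

text \<open>Euler's criterion for the Frobenius symbol. The factor \<kappa>^p lets \<open>Q\<close>
  divide \<alpha>: it changes the root by \<kappa>, which every automorphism over the base field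
  fixes.\<close>

theorem power_residue_symbol_eq:
  assumes Q: "above Q" and k: "\<kappa> \<in> QK" "\<kappa> \<noteq> 0" and a: "\<alpha> * \<kappa> ^ p \<in> Zz" "\<alpha> * \<kappa> ^ p \<notin> Q"
    and s: "\<zeta> ^ k - (\<alpha> * \<kappa> ^ p) ^ ((lq - 1) div p) \<in> Q"
  shows "power_residue_symbol p \<zeta> \<alpha> Q = \<zeta> ^ k"
proof -
  have loc: "kummer_symbol p \<zeta> l Q (\<alpha> * \<kappa> ^ p) (\<kappa> * \<beta>) k" if "\<beta> ^ p = \<alpha>" for \<beta>
    by unfold_locales (use Q a s that in \<open>auto simp: power_mult_distrib mult.commute\<close>)
  show ?thesis
    unfolding power_residue_symbol_def
  proof (rule the_equality)
    \<comment> \<open>Some complex \<open>p\<close>-th root must exist for the symbol to have a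
      value; polar coordinates provide it.\<close>
    obtain \<beta> where b: "\<beta> ^ p = \<alpha>"
    proof
      show "rcis (root p (cmod \<alpha>)) (Arg \<alpha> / real p) ^ p = \<alpha>"
        using p_pos by (simp add: DeMoivre2 real_root_pow_pos2 rcis_cmod_Arg)
    qed
    interpret kummer_symbol p \<zeta> l Q "\<alpha> * \<kappa> ^ p" "\<kappa> * \<beta>" k by (rule loc[OF b])
    have g: "generate_field complex_ring {\<zeta>, \<beta>} = LS" by (rule generate_field_eq_LS[OF k refl])
    obtain \<sigma> where f: "is_frobenius QK LS Q \<sigma>" "\<sigma> (\<kappa> * \<beta>) = \<zeta> ^ k * (\<kappa> * \<beta>)" using ex_frobenius by blast
    have bL: "\<beta> \<in> LS" using generate_field_incl_set[of "{\<zeta>, \<beta>}"] unfolding g by simp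
    have "\<sigma> (\<kappa> * \<beta>) = \<sigma> \<kappa> * \<sigma> \<beta>"
      using f(1) galois_group_mult[of \<sigma> QK LS, OF _ LS_QK[OF k(1)] bL] by (simp only: is_frobenius_def)
    moreover have "\<sigma> \<kappa> = \<kappa>" using f(1) k(1) by (simp add: is_frobenius_def galois_group_def)
    ultimately have "\<sigma> \<beta> = \<zeta> ^ k * \<beta>" using f(2) k(2) by simp
    then show "\<zeta> ^ k \<in> range (\<lambda>j. \<zeta> ^ j) \<and> (\<exists>\<beta> \<sigma>. \<beta> ^ p = \<alpha> \<and>
        unramified_in (generate_field complex_ring {\<zeta>, \<beta>}) Q \<and>
        is_frobenius (cyclotomic_field \<zeta>) (generate_field complex_ring {\<zeta>, \<beta>}) Q \<sigma> \<and>
        \<sigma> \<beta> = \<zeta> ^ k * \<beta>)"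
      by (intro conjI exI[of _ \<beta>] exI[of _ \<sigma>]) (simp_all add: g cyclotomic_field_eq b unramified f(1))
  next
    fix s' assume s': "s' \<in> range (\<lambda>j. \<zeta> ^ j) \<and> (\<exists>\<beta> \<sigma>. \<beta> ^ p = \<alpha> \<and>
        unramified_in (generate_field complex_ring {\<zeta>, \<beta>}) Q \<and>
        is_frobenius (cyclotomic_field \<zeta>) (generate_field complex_ring {\<zeta>, \<beta>}) Q \<sigma> \<and>
        \<sigma> \<beta> = s' * \<beta>)"
    from s' obtain j where j: "s' = \<zeta> ^ j" by (elim conjE rangeE)
    from s' obtain \<beta> \<sigma> where b: "\<beta> ^ p = \<alpha>"
      and fr: "is_frobenius QK (generate_field complex_ring {\<zeta>, \<beta>}) Q \<sigma>" "\<sigma> \<beta> = \<zeta> ^ j * \<beta>"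
      unfolding cyclotomic_field_eq j by (elim conjE exE)
    interpret kummer_symbol p \<zeta> l Q "\<alpha> * \<kappa> ^ p" "\<kappa> * \<beta>" k by (rule loc[OF b])
    have g: "generate_field complex_ring {\<zeta>, \<beta>} = LS" by (rule generate_field_eq_LS[OF k refl])
    note f = fr[unfolded g]
    have bL: "\<beta> \<in> LS" using generate_field_incl_set[of "{\<zeta>, \<beta>}"] unfolding g by simp
    have "\<sigma> (\<kappa> * \<beta>) = \<sigma> \<kappa> * \<sigma> \<beta>"
      using f(1) galois_group_mult[of \<sigma> QK LS, OF _ LS_QK[OF k(1)] bL] by (simp only: is_frobenius_def)
    moreover have "\<sigma> \<kappa> = \<kappa>" using f(1) k(1) by (simp add: is_frobenius_def galois_group_def)
    ultimately have "\<sigma> (\<kappa> * \<beta>) = \<zeta> ^ j * (\<kappa> * \<beta>)" using f(2) by simp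
    then show "s' = \<zeta> ^ k" unfolding j by (rule frobenius_unique[OF f(1)])
  qed
qed

lemma ex_residue_symbol:
  assumes Q: "above Q" and v: "v \<in> Zz" "v \<notin> Q"
  shows "\<exists>k<p. \<zeta> ^ k - v ^ ((lq - 1) div p) \<in> Q"
proof -
  let ?w = "v ^ ((lq - 1) div p)"
  have "?w ^ p = v ^ (lq - 1)" using p_dvd_lq by (simp add: power_mult[symmetric])
  then have "?w ^ p - 1 ^ p \<in> Q" using above_fermat[OF Q lq_cong v] by simp
  then have "(\<Prod>k<p. ?w - \<zeta> ^ k) \<in> Q" using prod_diff[of ?w 1] by simp
  moreover have "?w - \<zeta> ^ k \<in> Zz" for k by (intro Zz_diff Zz_power v(1) Zz_zeta_pow)
  ultimately have "\<exists>k\<in>{..<p}. ?w - \<zeta> ^ k \<in> Q"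
    by (intro is_prm_prod[OF is_sub_Zz above_prm[OF Q]]) auto
  then obtain k where "k < p" "?w - \<zeta> ^ k \<in> Q" by blast
  then have "- (?w - \<zeta> ^ k) \<in> Q" using is_idl_uminus[OF is_sub_Zz above_idl[OF Q]] by blast
  then show ?thesis using \<open>k < p\<close> by auto
qed

end

subsection \<open>Pseudo-units\<close>

lemma multiplicity_int_prime:
  assumes "prime q" "k > 0"
  shows "multiplicity (int q) (int k) = multiplicity q k"
proof -
  have "\<not> is_unit q" using prime_gt_1_nat[OF assms(1)] by simp
  then obtain m where m: "k = q ^ multiplicity q k * m" "\<not> q dvd m"
    using multiplicity_decompose'[of k q] assms(2) by blast
  have "int k = int (q ^ multiplicity q k * m)" using m(1) by (rule arg_cong)
  then show ?thesis using m(2) assms by (intro multiplicity_decomposeI[of _ _ _ "int m"]) auto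
qed

context cyclo
begin

text \<open>What is needed of the ideal \<open>I\<close> with I^p = (\<alpha>), free of ideal
  arithmetic. The clause about \<open>W\<close> says that I^p goes into step e p of any
  multiplicative filtration with \<open>I\<close> in step \<open>e\<close>; it will be used for the
  powers of a prime.\<close>

lemma pseudo_unit_ideal:
  assumes "pseudo_unit p \<zeta> \<alpha>"
  shows "\<exists>I. is_idl Zz I \<and> (\<exists>i\<in>I. \<exists>w\<in>Zz. i + w * (1 - \<zeta>) = 1) \<and> (\<forall>i\<in>I. \<exists>w\<in>Zz. i ^ p = w * \<alpha>) \<and>
    (\<forall>W e. W 0 = Zz \<longrightarrow> (\<forall>k. \<forall>a\<in>W k. \<forall>b\<in>W k. a + b \<in> W k) \<longrightarrow>
       (\<forall>j k. \<forall>a\<in>W j. \<forall>b\<in>W k. a * b \<in> W (j + k)) \<longrightarrow> I \<subseteq> W e \<longrightarrow> \<alpha> \<in> W (e * p))"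
proof -
  let ?R = "sub_ring Zz"
  obtain I where I: "ideal I ?R" "I <+>\<^bsub>?R\<^esub> (PIdl\<^bsub>?R\<^esub> (1 - \<zeta>)) = carrier ?R"
    and pw: "PIdl\<^bsub>?R\<^esub> \<alpha> = I [^]\<^bsub>ideals_set ?R\<^esub> p"
    using assms unfolding pseudo_unit_def ring_of_integers_eq Let_def by blast
  have P: "PIdl\<^bsub>?R\<^esub> z = {x * z | x. x \<in> Zz}" for z by (simp add: cgenideal_def)
  have p0: "I [^]\<^bsub>ideals_set ?R\<^esub> (0::nat) = Zz" by (simp add: nat_pow_def ideals_set_def)
  have pS: "I [^]\<^bsub>ideals_set ?R\<^esub> Suc n = (I [^]\<^bsub>ideals_set ?R\<^esub> n) \<cdot>\<^bsub>?R\<^esub> I" for n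
    by (simp add: nat_pow_def ideals_set_def)
  have "is_idl Zz I" using I(1) ideal_sub_ring_iff[OF is_sub_Zz] by blast
  moreover have "\<exists>i\<in>I. \<exists>w\<in>Zz. i + w * (1 - \<zeta>) = 1"
  proof -
    have "1 \<in> I <+>\<^bsub>?R\<^esub> (PIdl\<^bsub>?R\<^esub> (1 - \<zeta>))" unfolding I(2) by simp
    then show ?thesis unfolding P set_add_def' by fastforce
  qed
  moreover have "\<exists>w\<in>Zz. i ^ p = w * \<alpha>" if i: "i \<in> I" for i
  proof -
    have "i ^ n \<in> I [^]\<^bsub>ideals_set ?R\<^esub> n" for n
    proof (induction n)
      case 0
      then show ?case by (simp only: p0) simp
    next
      case (Suc n)
      then show ?case unfolding pS using ideal_prod.prod[OF Suc i, of ?R] by (simp add: mult.commute)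
    qed
    from this[of p] show ?thesis unfolding pw[symmetric] P by blast
  qed
  moreover have "\<alpha> \<in> W (e * p)"
    if W: "W 0 = Zz" "\<forall>k. \<forall>a\<in>W k. \<forall>b\<in>W k. a + b \<in> W k"
      "\<forall>j k. \<forall>a\<in>W j. \<forall>b\<in>W k. a * b \<in> W (j + k)" "I \<subseteq> W e" for W :: "nat \<Rightarrow> complex set" and e
  proof -
    have "I [^]\<^bsub>ideals_set ?R\<^esub> n \<subseteq> W (e * n)" for n
    proof (induction n)
      case 0
      then show ?case using W(1) p0 by simp
    next
      case (Suc n)
      show ?case unfolding pS
      proof
        fix z assume "z \<in> (I [^]\<^bsub>ideals_set ?R\<^esub> n) \<cdot>\<^bsub>?R\<^esub> I"
        then show "z \<in> W (e * Suc n)"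
        proof (induction z rule: ideal_prod.induct)
          case (prod i j)
          then have "i * j \<in> W (e * n + e)" using W(3,4) Suc by blast
          then show ?case by (simp add: add.commute)
        qed (use W(2) in auto)
      qed
    qed
    moreover have "\<alpha> \<in> PIdl\<^bsub>?R\<^esub> \<alpha>" unfolding P by (intro CollectI exI[of _ 1]) auto
    ultimately show ?thesis using pw by blast
  qed
  ultimately show ?thesis by blast
qed

text \<open>Comaximality gives \<open>i\<close> in \<open>I\<close> congruent to 1 modulo 1 -
  \<zeta>, and i^p is a multiple of the element, which is x + y modulo 1 - \<zeta>. If
  \<open>p\<close> divided x + y, then 1 would be a multiple of 1 - \<zeta>.\<close>

lemma pseudo_unit_not_dvd:
  assumes "pseudo_unit p \<zeta> (of_int x + of_int y * \<zeta>)"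
  shows "\<not> int p dvd x + y"
proof
  assume "int p dvd x + y"
  then obtain m where m: "x + y = int p * m" by (auto elim: dvdE)
  obtain I where I0: "is_idl Zz I" "\<exists>i\<in>I. \<exists>w\<in>Zz. i + w * (1 - \<zeta>) = 1"
    "\<forall>i\<in>I. \<exists>w\<in>Zz. i ^ p = w * (of_int x + of_int y * \<zeta>)"
    using pseudo_unit_ideal[OF assms] by (elim exE conjE)
  obtain i w where I: "i \<in> I" "w \<in> Zz" "i + w * (1 - \<zeta>) = 1" using I0(2) by blast
  obtain v where v: "v \<in> Zz" "i ^ p = v * (of_int x + of_int y * \<zeta>)" using I0(3) I(1) by blast
  have iZ: "i \<in> Zz" by (rule is_idl_sub[OF I0(1) I(1)])
  obtain U where U: "U \<in> Zz" "of_nat p = (1 - \<zeta>) ^ (p - 1) * U" using p_lambda_pow by blast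
  have e1: "(1 - \<zeta>) ^ (p - 1) = (1 - \<zeta>) * (1 - \<zeta>) ^ (p - 2)"
  proof -
    have "p - 1 = Suc (p - 2)" using p_gt2 by simp
    then show ?thesis by (simp only: power_Suc)
  qed
  have "of_int (x + y) = (1 - \<zeta>) * ((1 - \<zeta>) ^ (p - 2) * U * of_int m)"
    unfolding m of_int_mult of_int_of_nat_eq U(2) e1 by (simp only: mult_ac)
  then have a: "of_int x + of_int y * \<zeta> = (1 - \<zeta>) * ((1 - \<zeta>) ^ (p - 2) * U * of_int m - of_int y)"
    by (simp add: algebra_simps)
  let ?c = "(1 - \<zeta>) ^ (p - 2) * U * of_int m - of_int y"
  have "1 - i ^ p = (1 - i) * (\<Sum>j<p. i ^ j)" by (rule one_diff_power_eq)
  moreover have "1 - i = w * (1 - \<zeta>)" by (metis I(3) add_diff_cancel_left')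
  ultimately have i1: "1 - i ^ p = w * (1 - \<zeta>) * (\<Sum>j<p. i ^ j)" by (simp only:)
  have i2: "i ^ p = v * ((1 - \<zeta>) * ?c)" unfolding v(2) a ..
  have "1 = (1 - i ^ p) + i ^ p" by simp
  also have "\<dots> = w * (1 - \<zeta>) * (\<Sum>j<p. i ^ j) + v * ((1 - \<zeta>) * ?c)"
    by (rule arg_cong2[where f = "(+)", OF i1 i2])
  also have "\<dots> = (1 - \<zeta>) * (v * ?c + w * (\<Sum>j<p. i ^ j))" by (simp add: algebra_simps)
  finally have "of_int 1 = (1 - \<zeta>) * (v * ?c + w * (\<Sum>j<p. i ^ j))" by simp
  moreover have "v * ?c + w * (\<Sum>j<p. i ^ j) \<in> Zz"
    by (intro Zz_intros Zz_of_int Zz_1 v(1) U(1) I(2) iZ)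
  ultimately have "int p dvd 1" using p_dvd_of_lambda Zz_algebraic_int by blast
  then show False using p_gt2 by simp
qed

text \<open>The product (x + y) N = x^p - (- y)^p has the sign of x + y, because odd powers are
  monotone; N is nonzero since it is 1 modulo \<open>p\<close>.\<close>

lemma norm_form_pos:
  assumes "\<not> int p dvd x + y"
  shows "(\<Sum>i<p. (- x) ^ i * y ^ (p - 1 - i)) > 0"
proof -
  let ?N = "\<Sum>i<p. (- x) ^ i * y ^ (p - 1 - i)"
  have "(- x) ^ Suc (p - 1) - y ^ Suc (p - 1) = (- x - y) * (\<Sum>i<Suc (p - 1). (- x) ^ i * y ^ (p - 1 - i))"
    by (rule diff_power_eq_sum)
  then have "(- x) ^ p - y ^ p = (- x - y) * ?N" using p_pos by simp
  moreover have "(- z) ^ p = - (z ^ p)" for z :: int using odd_p by simp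
  ultimately have e: "(x + y) * ?N = x ^ p - (- y) ^ p" by (simp add: algebra_simps)
  have "x + y \<noteq> 0" using assms by auto
  then consider "x + y > 0" | "x + y < 0" by linarith
  then have "?N \<ge> 0"
  proof cases
    case 1
    then have "- y \<le> x" by simp
    then have "(- y) ^ p \<le> x ^ p" by (rule power_mono_odd[OF odd_p])
    then have "0 \<le> (x + y) * ?N" unfolding e by simp
    then show ?thesis using 1 by (simp add: zero_le_mult_iff)
  next
    case 2
    then have "x \<le> - y" by simp
    then have "x ^ p \<le> (- y) ^ p" by (rule power_mono_odd[OF odd_p])
    then have "(x + y) * ?N \<le> 0" unfolding e by simp
    then show ?thesis using 2 by (simp add: mult_le_0_iff)
  qed
  moreover have "?N \<noteq> 0"
  proof
    assume "?N = 0"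
    then have "[0 = 1] (mod int p)" using norm_form_mod_p[OF assms] by simp
    then show False using p_gt2 by (simp add: cong_def)
  qed
  ultimately show ?thesis by simp
qed

lemma sg_form: "\<not> p dvd t \<Longrightarrow> sg t (of_int x + of_int y * \<zeta> ^ u) = of_int x + of_int y * \<zeta> ^ (t * u)"
  by (simp add: sg_add sg_mult sg_of_int sg_zeta_pow QK_Zz[OF Zz_of_int] QK_Zz[OF Zz_zeta_pow] QK_mult)

end

section \<open>Valuations at the primes above \<open>l\<close>\<close>

context cyclo_prime
begin

text \<open>In terms of the \<open>Q\<close>-adic valuation \<open>v\<close>, \<open>val Q z k\<close> says \<open>v z = k\<close> and \<open>z \<in> fil Q k\<close> says \<open>v z \<ge> k\<close>.\<close>

definition val :: "complex set \<Rightarrow> complex \<Rightarrow> nat \<Rightarrow> bool" where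
  "val Q z k \<longleftrightarrow> (\<exists>u\<in>Zz - Q. \<exists>w\<in>Zz - Q. u * z = of_nat l ^ k * w)"

definition fil :: "complex set \<Rightarrow> nat \<Rightarrow> complex set" where
  "fil Q k = {z \<in> Zz. \<exists>u\<in>Zz - Q. \<exists>w\<in>Zz. u * z = of_nat l ^ k * w}"

lemma above_compl_mult: "above Q \<Longrightarrow> u \<in> Zz - Q \<Longrightarrow> w \<in> Zz - Q \<Longrightarrow> u * w \<in> Zz - Q"
  using is_prm_mult[OF above_prm] Zz_mult by blast

lemma l_nz: "(of_nat l :: complex) \<noteq> 0" using prime_gt_0_nat[OF l_prime] by simp

lemma val_fil_le:
  assumes Q: "above Q" and v: "val Q z v" and k: "z \<in> fil Q k"
  shows "k \<le> v"
proof (rule ccontr)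
  assume "\<not> k \<le> v"
  then obtain j where j: "k = v + Suc j" by (metis less_imp_Suc_add not_le add_Suc_right)
  obtain u w where u: "u \<in> Zz - Q" "w \<in> Zz - Q" "u * z = of_nat l ^ v * w" using v by (auto simp: val_def)
  obtain u' w' where u': "u' \<in> Zz - Q" "w' \<in> Zz" "u' * z = of_nat l ^ k * w'" using k by (auto simp: fil_def)
  have "of_nat l ^ v * (u' * w) = u' * (u * z)" unfolding u(3) by (simp only: mult_ac)
  also have "\<dots> = u * (u' * z)" by (simp only: mult_ac)
  also have "\<dots> = of_nat l ^ v * (of_nat l * (of_nat l ^ j * (u * w')))" unfolding u'(3) j power_add power_Suc
    by (simp only: mult_ac)
  finally have "u' * w = of_nat l * (of_nat l ^ j * (u * w'))" using l_nz by simp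
  also have "\<dots> \<in> Q" using u u'
    by (intro is_idl_mult_right[OF above_idl[OF Q] _ above_l[OF Q]] Zz_mult Zz_power Zz_of_nat) auto
  finally show False using above_compl_mult[OF Q u'(1) u(2)] by blast
qed

lemma val_fil: "z \<in> Zz \<Longrightarrow> val Q z v \<Longrightarrow> k \<le> v \<Longrightarrow> z \<in> fil Q k"
proof -
  assume z: "z \<in> Zz" "val Q z v" and "k \<le> v"
  then obtain j where j: "v = k + j" using le_Suc_ex by blast
  obtain u w where u: "u \<in> Zz - Q" "w \<in> Zz - Q" "u * z = of_nat l ^ v * w" using z by (auto simp: val_def)
  have "u * z = of_nat l ^ k * (of_nat l ^ j * w)" unfolding u(3) j power_add by (simp only: mult_ac)
  moreover have "of_nat l ^ j * w \<in> Zz" using u(2) by (intro Zz_mult Zz_power Zz_of_nat) simp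
  ultimately show ?thesis unfolding fil_def using z(1) u(1) by blast
qed

lemma val_unique: "above Q \<Longrightarrow> z \<in> Zz \<Longrightarrow> val Q z v \<Longrightarrow> val Q z v' \<Longrightarrow> v = v'"
  using val_fil_le val_fil by (meson order_antisym order_refl)

lemma val_mult:
  assumes Q: "above Q" and v: "val Q z v" "val Q z' v'"
  shows "val Q (z * z') (v + v')"
proof -
  obtain u w where u: "u \<in> Zz - Q" "w \<in> Zz - Q" "u * z = of_nat l ^ v * w" using v(1) by (auto simp: val_def)
  obtain u' w' where u': "u' \<in> Zz - Q" "w' \<in> Zz - Q" "u' * z' = of_nat l ^ v' * w'" using v(2) by (auto simp: val_def)
  have "(u * u') * (z * z') = (u * z) * (u' * z')" by (simp only: mult_ac)
  also have "\<dots> = of_nat l ^ (v + v') * (w * w')" unfolding u(3) u'(3) power_add by (simp only: mult_ac)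
  finally show ?thesis unfolding val_def using above_compl_mult[OF Q] u u' by blast
qed

lemma val_unit: "above Q \<Longrightarrow> z \<in> Zz - Q \<Longrightarrow> val Q z 0"
  unfolding val_def using above_one by (intro bexI[of _ 1] bexI[of _ z]) auto

lemma val_power: "above Q \<Longrightarrow> val Q z v \<Longrightarrow> val Q (z ^ n) (v * n)"
proof (induction n)
  case 0
  then show ?case using val_unit above_one by simp
next
  case (Suc n)
  then show ?case using val_mult[of Q z v "z ^ n" "v * n"] by simp
qed

lemma val_int:
  assumes Q: "above Q" and k: "k \<noteq> 0"
  shows "val Q (of_int k) (multiplicity (int l) k)"
proof -
  have "\<not> is_unit (int l)" using prime_gt_1_nat[OF l_prime] by simp
  then obtain m where m: "k = int l ^ multiplicity (int l) k * m" "\<not> int l dvd m"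
    using multiplicity_decompose'[of k "int l"] k by blast
  have "(of_int k :: complex) = of_int (int l ^ multiplicity (int l) k * m)" using m(1) by (rule arg_cong)
  then have "1 * of_int k = of_nat l ^ multiplicity (int l) k * (of_int m :: complex)" by simp
  moreover have "of_int m \<in> Zz - Q" using above_int[OF Q] m(2) by simp
  moreover have "1 \<in> Zz - Q" using above_one[OF Q] by simp
  ultimately show ?thesis unfolding val_def by blast
qed

lemma fil_0: "above Q \<Longrightarrow> fil Q 0 = Zz"
  unfolding fil_def using above_one by (auto intro!: bexI[of _ 1])

lemma fil_add:
  assumes Q: "above Q" and a: "a \<in> fil Q k" "b \<in> fil Q k"
  shows "a + b \<in> fil Q k"
proof -
  obtain u w where u: "u \<in> Zz - Q" "w \<in> Zz" "u * a = of_nat l ^ k * w" "a \<in> Zz" using a(1) by (auto simp: fil_def)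
  obtain u' w' where u': "u' \<in> Zz - Q" "w' \<in> Zz" "u' * b = of_nat l ^ k * w'" "b \<in> Zz" using a(2) by (auto simp: fil_def)
  have "(u * u') * (a + b) = u' * (u * a) + u * (u' * b)" by (simp add: algebra_simps)
  also have "\<dots> = of_nat l ^ k * (u' * w + u * w')" unfolding u(3) u'(3) by (simp add: algebra_simps)
  finally have "(u * u') * (a + b) = of_nat l ^ k * (u' * w + u * w')" .
  moreover have "u' * w + u * w' \<in> Zz" using u u' by (intro Zz_add Zz_mult) auto
  ultimately show ?thesis unfolding fil_def using above_compl_mult[OF Q u(1) u'(1)] Zz_add[OF u(4) u'(4)] by blast
qed

lemma fil_mult:
  assumes Q: "above Q" and a: "a \<in> fil Q j" "b \<in> fil Q k"
  shows "a * b \<in> fil Q (j + k)"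
proof -
  obtain u w where u: "u \<in> Zz - Q" "w \<in> Zz" "u * a = of_nat l ^ j * w" "a \<in> Zz" using a(1) by (auto simp: fil_def)
  obtain u' w' where u': "u' \<in> Zz - Q" "w' \<in> Zz" "u' * b = of_nat l ^ k * w'" "b \<in> Zz" using a(2) by (auto simp: fil_def)
  have "(u * u') * (a * b) = (u * a) * (u' * b)" by (simp only: mult_ac)
  also have "\<dots> = of_nat l ^ (j + k) * (w * w')" unfolding u(3) u'(3) power_add by (simp only: mult_ac)
  finally show ?thesis unfolding fil_def
    using above_compl_mult[OF Q u(1) u'(1)] Zz_mult[OF u(4) u'(4)] Zz_mult[OF u(2) u'(2)] by blast
qed

text \<open>The norm is a nonzero integer multiple of \<open>z\<close>, so the steps of the
  filtration containing \<open>z\<close> are bounded. At the last step the cofactor is outside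
  \<open>Q\<close>: otherwise the annihilator of \<open>Q\<close> would give one more factor
  \<open>l\<close>.\<close>

lemma ex_val:
  assumes Q: "above Q" and z: "z \<in> Zz" "z \<noteq> 0"
  shows "\<exists>v. val Q z v"
proof -
  obtain N where N: "Nm z = of_int N" using Nm_int[OF z(1)] by blast
  obtain c where c: "c \<in> Zz" "Nm z = z * c" using Nm_factor[OF z(1)] by blast
  have "Nm z \<noteq> 0" unfolding Nm_def using sg_eq_0_iff[OF QK_Zz[OF z(1)] unit_index] z(2) by simp
  then have N0: "N \<noteq> 0" using N by auto
  have bd: "k \<le> multiplicity (int l) N" if k: "z \<in> fil Q k" for k
  proof -
    have "z * c \<in> fil Q (k + 0)" using fil_mult[OF Q k, of c 0] c(1) fil_0[OF Q] by blast
    then show ?thesis using val_fil_le[OF Q val_int[OF Q N0]] c(2) N by simp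
  qed
  define S where "S = {k. z \<in> fil Q k}"
  have S: "finite S" "S \<noteq> {}"
    using bd z(1) fil_0[OF Q] by (auto simp: S_def intro: finite_subset[of _ "{..multiplicity (int l) N}"])
  define v where "v = Max S"
  have "v \<in> S" unfolding v_def by (rule Max_in[OF S])
  then obtain u w where u: "u \<in> Zz - Q" "w \<in> Zz" "u * z = of_nat l ^ v * w" by (auto simp: S_def fil_def)
  have "w \<notin> Q"
  proof
    assume w: "w \<in> Q"
    obtain h where h: "h \<in> Zz" "h \<notin> Q" "\<And>z. z \<in> Q \<Longrightarrow> \<exists>w\<in>Zz. h * z = of_nat l * w"
      using above_annihilator[OF Q] by blast
    obtain w' where w': "w' \<in> Zz" "h * w = of_nat l * w'" using h(3)[OF w] by blast
    have "(h * u) * z = h * (u * z)" by (simp only: mult_ac)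
    also have "\<dots> = of_nat l ^ v * (h * w)" unfolding u(3) by (simp only: mult_ac)
    also have "\<dots> = of_nat l ^ Suc v * w'" unfolding w'(2) power_Suc by (simp only: mult_ac)
    finally have "(h * u) * z = of_nat l ^ Suc v * w'" .
    moreover have "h * u \<in> Zz - Q" using above_compl_mult[OF Q _ u(1), of h] h by blast
    ultimately have "Suc v \<in> S" unfolding S_def fil_def using z(1) w'(1) by blast
    then have "Suc v \<le> v" unfolding v_def by (rule Max_ge[OF S(1)])
    then show False by simp
  qed
  then show ?thesis unfolding val_def using u by blast
qed

text \<open>The valuation is e p for the last step \<open>e\<close> of the filtration containing
  \<open>I\<close>: at least e p since \<alpha> is in I^p, and at most since an \<open>i\<close> in
  \<open>I\<close> outside step e + 1 has a \<open>p\<close>-th power divisible by \<alpha>.\<close>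

lemma pseudo_unit_val:
  assumes Q: "above Q" and pu: "pseudo_unit p \<zeta> \<alpha>" and a: "\<alpha> \<in> Zz" "\<alpha> \<noteq> 0" "val Q \<alpha> v"
  shows "p dvd v"
proof -
  obtain I where I: "is_idl Zz I" "\<forall>i\<in>I. \<exists>w\<in>Zz. i ^ p = w * \<alpha>"
    and flt: "\<forall>W e. W 0 = Zz \<longrightarrow> (\<forall>k. \<forall>a\<in>W k. \<forall>b\<in>W k. a + b \<in> W k) \<longrightarrow>
       (\<forall>j k. \<forall>a\<in>W j. \<forall>b\<in>W k. a * b \<in> W (j + k)) \<longrightarrow> I \<subseteq> W e \<longrightarrow> \<alpha> \<in> W (e * p)"
    using pseudo_unit_ideal[OF pu] by (elim exE conjE)
  define S where "S = {e. I \<subseteq> fil Q e}"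
  have le: "e * p \<le> v" if "e \<in> S" for e
  proof -
    have "\<alpha> \<in> fil Q (e * p)"
      by (rule flt[rule_format]) (use that fil_0[OF Q] fil_add[OF Q] fil_mult[OF Q] in \<open>auto simp: S_def\<close>)
    then show ?thesis by (rule val_fil_le[OF Q a(3)])
  qed
  have "e \<le> v" if "e \<in> S" for e
  proof -
    have "e * 1 \<le> e * p" using p_pos by (intro mult_le_mono) auto
    then show ?thesis using le[OF that] by linarith
  qed
  then have "S \<subseteq> {..v}" by blast
  then have S: "finite S" by (rule finite_subset) simp
  have "0 \<in> S" using fil_0[OF Q] is_idl_sub[OF I(1)] by (auto simp: S_def)
  then have e: "Max S \<in> S" by (intro Max_in[OF S]) auto
  define e where "e = Max S"
  have "Suc e \<notin> S" using Max_ge[OF S, of "Suc e"] by (auto simp: e_def)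
  then obtain i where i: "i \<in> I" "i \<notin> fil Q (Suc e)" by (auto simp: S_def)
  have iZ: "i \<in> Zz" using is_idl_sub[OF I(1) i(1)] .
  have "0 \<in> fil Q (Suc e)" 
    unfolding fil_def using above_one[OF Q] by (intro CollectI conjI bexI[of _ 1] bexI[of _ 0]) auto
  then have i0: "i \<noteq> 0" using i(2) by blast
  obtain m where m: "val Q i m" using ex_val[OF Q iZ i0] by blast
  have "m \<le> e" using val_fil[OF iZ m, of "Suc e"] i(2) by (meson not_less_eq_eq)
  obtain w where w: "w \<in> Zz" "i ^ p = w * \<alpha>" using I(2) i(1) by blast
  have "w \<noteq> 0" using w(2) i0 by auto
  then obtain m' where m': "val Q w m'" using ex_val[OF Q w(1)] by blast
  have "val Q (i ^ p) (m' + v)" unfolding w(2) by (rule val_mult[OF Q m' a(3)])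
  then have "m * p = m' + v" using val_unique[OF Q Zz_power[OF iZ] val_power[OF Q m]] by blast
  moreover have "m * p \<le> e * p" using \<open>m \<le> e\<close> by simp
  ultimately have "v = e * p" using le[OF e] by (simp add: e_def)
  then show ?thesis by simp
qed

text \<open>Subtracting two conjugates in \<open>Q\<close> leaves \<open>y\<close> times a
  difference of roots of unity. If those differ, \<open>y\<close> and then \<open>x\<close> are
  divisible by \<open>l\<close>.\<close>

lemma conjugates_inj:
  assumes Q: "above Q" and xy: "coprime x y"
    and b: "of_int x + of_int y * \<zeta> ^ i \<in> Q" "of_int x + of_int y * \<zeta> ^ j \<in> Q"
  shows "[i = j] (mod p)"
proof (rule ccontr)
  assume n: "\<not> [i = j] (mod p)"
  have "(of_int x + of_int y * \<zeta> ^ i) - (of_int x + of_int y * \<zeta> ^ j) \<in> Q"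
    by (rule is_idl_diff[OF is_sub_Zz above_idl[OF Q] b])
  then have "of_int y * (\<zeta> ^ i - \<zeta> ^ j) \<in> Q" by (simp add: algebra_simps)
  moreover have "\<zeta> ^ i - \<zeta> ^ j \<in> Zz" by (intro Zz_diff Zz_zeta_pow)
  moreover have "\<zeta> ^ i - \<zeta> ^ j \<notin> Q"
    using above_zeta_inj[OF Q, of i j] n by (auto simp only: zeta_pow_eq_iff)
  ultimately have y: "of_int y \<in> Q" using is_prm_mult[OF above_prm[OF Q] Zz_of_int] by blast
  have "of_int y * \<zeta> ^ i \<in> Q" by (rule is_idl_mult_right[OF above_idl[OF Q] Zz_zeta_pow y])
  then have "of_int x + of_int y * \<zeta> ^ i - of_int y * \<zeta> ^ i \<in> Q"
    by (rule is_idl_diff[OF is_sub_Zz above_idl[OF Q] b(1)])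
  then have "int l dvd x" "int l dvd y" using y above_int[OF Q] by simp_all
  then have "int l dvd 1" using xy by (meson coprime_common_divisor)
  then show False using prime_gt_1_nat[OF l_prime] by simp
qed

lemma conjugate_notin:
  assumes "above Q" "coprime x y" "of_int x + of_int y * \<zeta> \<in> Q" "t \<in> {2..<p}"
  shows "of_int x + of_int y * \<zeta> ^ t \<notin> Q"
  using conjugates_inj[of Q x y 1 t] assms by (auto simp: cong_def)

text \<open>Two primes above \<open>l\<close> are used. At one not containing the form, the
  valuation of the pseudo-unit is that of \<open>g\<close>. At one containing it, no other conjugate
  is in the prime, so the valuation of the form is that of its norm.\<close>

lemma pseudo_unit_multiplicity:
  assumes pu: "pseudo_unit p \<zeta> (of_int g * (of_int x + of_int y * \<zeta>))" and xy: "coprime x y"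
    and g: "g \<noteq> 0" and b0: "of_int x + of_int y * \<zeta> \<noteq> 0"
    and N: "(\<Sum>i<p. (- x) ^ i * y ^ (p - 1 - i)) = N" "N \<noteq> 0"
  shows "p dvd multiplicity (int l) g" "p dvd multiplicity (int l) N"
proof -
  let ?b = "of_int x + of_int y * \<zeta>"
  have bZ: "?b \<in> Zz" by (intro Zz_add Zz_mult Zz_of_int Zz_zeta)
  have aZ: "of_int g * ?b \<in> Zz" by (intro Zz_mult bZ Zz_of_int)
  have a0: "of_int g * ?b \<noteq> 0" using g b0 by simp
  have sgb: "sg t ?b = of_int x + of_int y * \<zeta> ^ t" if "\<not> p dvd t" for t
    using sg_form[OF that, of x y 1] by simp
  have "\<exists>Q. above Q \<and> ?b \<notin> Q"
  proof (rule ccontr)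
    assume "\<not> ?thesis"
    then have al: "\<And>Q. above Q \<Longrightarrow> ?b \<in> Q" by blast
    obtain Q where Q: "above Q" using ex_above by blast
    \<comment> \<open>If every prime above \<open>l\<close> contained the form, then by conjugation
      each would contain its second conjugate too, against \<open>conjugate_notin\<close>.\<close>
    have n2: "\<not> p dvd 2" using p_gt2 by (auto dest: dvd_imp_le)
    then obtain s where s: "[2 * s = 1] (mod p)" using ex_inverse by blast
    have ns: "\<not> p dvd s" using cong_1_not_dvd[OF s] by blast
    have "?b \<in> sg s ` Q" by (rule al[OF sg_image_above[OF Q ns]])
    then have "sg 2 ?b \<in> sg 2 ` sg s ` Q" by (rule imageI)
    then have "of_int x + of_int y * \<zeta> ^ 2 \<in> Q" unfolding sg_image_image[OF Q s] sgb[OF n2] .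
    then show False using conjugate_notin[OF Q xy al[OF Q], of 2] p_gt2 by simp
  qed
  then obtain Q where Q: "above Q" "?b \<in> Zz - Q" using bZ by blast
  have "val Q (of_int g * ?b) (multiplicity (int l) g + 0)"
    by (rule val_mult[OF Q(1) val_int[OF Q(1) g] val_unit[OF Q]])
  then show pg: "p dvd multiplicity (int l) g" using pseudo_unit_val[OF Q(1) pu aZ a0] by simp
  show "p dvd multiplicity (int l) N"
  proof (cases "int l dvd N")
    case False
    then show ?thesis by (simp add: not_dvd_imp_multiplicity_0)
  next
    case True
    have Np: "of_int N = (\<Prod>k\<in>{1..<p}. of_int x + of_int y * \<zeta> ^ k)" unfolding N(1)[symmetric] by (rule norm_form_int[symmetric])
    have BZ: "of_int x + of_int y * \<zeta> ^ k \<in> Zz" for k by (intro Zz_add Zz_mult Zz_of_int Zz_zeta_pow)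
    obtain Q0 where Q0: "above Q0" using ex_above by blast
    have "of_int N \<in> Q0" using above_int[OF Q0] True by simp
    then have "\<exists>k\<in>{1..<p}. of_int x + of_int y * \<zeta> ^ k \<in> Q0"
      unfolding Np by (intro is_prm_prod[OF is_sub_Zz above_prm[OF Q0]] BZ) auto
    then obtain k where k: "k \<in> {1..<p}" "of_int x + of_int y * \<zeta> ^ k \<in> Q0" by (rule bexE)
    obtain s where s: "[k * s = 1] (mod p)" using ex_inverse[OF unit_index[OF k(1)]] by blast
    then have s': "[s * k = 1] (mod p)" by (simp add: mult.commute)
    define Q where "Q = sg s ` Q0"
    have Q: "above Q" unfolding Q_def using sg_image_above[OF Q0] cong_1_not_dvd[OF s] by blast
    have "sg s (sg k ?b) = ?b" by (rule sg_inverse_index[OF QK_Zz[OF bZ] s'])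
    then have bQ: "?b \<in> Q" unfolding Q_def using k(2) sgb[OF unit_index[OF k(1)]] by (metis imageI)
    let ?B = "\<Prod>k\<in>{2..<p}. of_int x + of_int y * \<zeta> ^ k"
    have "?B \<notin> Q"
      using is_prm_prod[OF is_sub_Zz above_prm[OF Q], of "{2..<p}" "\<lambda>k. of_int x + of_int y * \<zeta> ^ k"]
        conjugate_notin[OF Q xy bQ] BZ by blast
    then have B: "?B \<in> Zz - Q" using BZ by (blast intro: Zz_prod)
    obtain v where v: "val Q ?b v" using ex_val[OF Q bZ b0] by blast
    have "{1..<p} = insert 1 {2..<p}" using p_gt2 by auto
    then have e: "of_int N = ?b * ?B" unfolding Np by simp
    have "val Q (of_int N) (v + 0)" unfolding e by (rule val_mult[OF Q v val_unit[OF Q B]])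
    then have mv: "multiplicity (int l) N = v"
      using val_unique[OF Q Zz_of_int val_int[OF Q N(2)]] by simp
    have "p dvd multiplicity (int l) g + v"
      by (rule pseudo_unit_val[OF Q pu aZ a0 val_mult[OF Q val_int[OF Q g] v]])
    then show ?thesis using pg mv by (simp add: dvd_add_right_iff)
  qed
qed

end

context cyclo
begin

theorem pseudo_unit_data:
  assumes pu: "pseudo_unit p \<zeta> (of_int x + of_int y * \<zeta>)"
  shows "\<exists>d n x' y'. d > 0 \<and> n > 0 \<and> x = int d ^ p * x' \<and> y = int d ^ p * y' \<and> coprime x' y' \<and>
    \<not> int p dvd x' + y' \<and> (\<Sum>i<p. (- x') ^ i * y' ^ (p - 1 - i)) = int n ^ p"
proof -
  define g where "g = gcd x y"
  have pxy: "\<not> int p dvd x + y" by (rule pseudo_unit_not_dvd[OF pu])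
  then have "x \<noteq> 0 \<or> y \<noteq> 0" by auto
  then have g0: "g > 0" by (simp add: g_def)
  obtain x' y' where xy: "x = g * x'" "y = g * y'" "coprime x' y'"
    using gcd_coprime_exists[of x y] g0 unfolding g_def by (auto simp: mult.commute)
  have pxy': "\<not> int p dvd x' + y'" and pg: "\<not> int p dvd g"
    using pxy unfolding xy by (auto simp: distrib_left[symmetric])
  define N where "N = (\<Sum>i<p. (- x') ^ i * y' ^ (p - 1 - i))"
  have N0: "N > 0" unfolding N_def by (rule norm_form_pos[OF pxy'])
  have pN: "\<not> int p dvd N"
  proof
    assume "int p dvd N"
    then have "[N = 0] (mod int p)" by (simp add: cong_0_iff)
    then have "[0 = 1] (mod int p)" using norm_form_mod_p[OF pxy'] unfolding N_def by (metis cong_sym cong_trans)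
    then show False using p_gt2 by (simp add: cong_def)
  qed
  have b0: "of_int x' + of_int y' * \<zeta> \<noteq> 0"
  proof
    assume "of_int x' + of_int y' * \<zeta> = 0"
    then have "of_int (x' + y') = (1 - \<zeta>) * of_int y'" by (simp add: algebra_simps)
    then have "int p dvd x' + y'" by (rule p_dvd_of_lambda) simp
    then show False using pxy' by contradiction
  qed
  have pu': "pseudo_unit p \<zeta> (of_int g * (of_int x' + of_int y' * \<zeta>))"
    using pu unfolding xy by (simp add: distrib_left mult.assoc)
  have m: "p dvd multiplicity (int q) g \<and> p dvd multiplicity (int q) N" if q: "prime q" for q
  proof (cases "q = p")
    \<comment> \<open>The prime \<open>p\<close>, where no valuation was constructed, divides
      neither \<open>g\<close> nor the norm.\<close>
    case True
    then show ?thesis using pg pN by (simp add: not_dvd_imp_multiplicity_0)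
  next
    case False
    interpret cyclo_prime p \<zeta> q by unfold_locales (rule q, rule False)
    have "g \<noteq> 0" "N \<noteq> 0" using g0 N0 by linarith+
    then show ?thesis using pseudo_unit_multiplicity[OF pu' xy(3) _ b0 N_def[symmetric]] by blast
  qed
  have pow: "\<exists>d>0. k = int d ^ p" if k: "k > 0" "\<And>q. prime q \<Longrightarrow> p dvd multiplicity (int q) k" for k
  proof -
    have "\<forall>q. prime q \<longrightarrow> p dvd multiplicity q (nat k)"
      using k multiplicity_int_prime[of _ "nat k"] by auto
    then have "is_nth_power p (nat k)" using is_nth_power_conv_multiplicity_nat[OF p_pos(1)] by blast
    then obtain d where d: "nat k = d ^ p" by (auto elim: is_nth_powerE)
    then have "k = int d ^ p" using k(1) by (metis int_nat_eq of_nat_power less_imp_le)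
    moreover from this have "d > 0" using k(1) p_pos by (cases "d = 0") (auto simp: zero_power)
    ultimately show ?thesis by blast
  qed
  obtain d where d: "d > 0" "g = int d ^ p" using pow[of g] g0 m by blast
  obtain n where n: "n > 0" "N = int n ^ p" using pow[of N] N0 m by blast
  have "x = int d ^ p * x'" "y = int d ^ p * y'" "(\<Sum>i<p. (- x') ^ i * y' ^ (p - 1 - i)) = int n ^ p"
    using xy(1,2) d(2) n(2) N_def by (simp_all only:)
  then show ?thesis using d(1) n(1) xy(3) pxy' by blast
qed

end

subsection \<open>The product of the residue symbols above \<open>l\<close>\<close>

context cyclo_prime
begin

abbreviation (input) rexp :: nat where "rexp \<equiv> (l ^ ord p l - 1) div p"

text \<open>The symbol by Euler's criterion, for \<open>v\<close> prime to \<open>Q\<close>. Its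
  link to the Frobenius definition is \<open>power_residue_symbol_eq\<close>.\<close>

definition chi :: "complex set \<Rightarrow> complex \<Rightarrow> complex" where
  "chi Q v = (SOME s. \<exists>k. s = \<zeta> ^ k \<and> \<zeta> ^ k - v ^ rexp \<in> Q)"

lemma chi_eqI:
  assumes Q: "above Q" and k: "\<zeta> ^ k - v ^ rexp \<in> Q"
  shows "chi Q v = \<zeta> ^ k"
proof -
  have "\<exists>s k. s = \<zeta> ^ k \<and> \<zeta> ^ k - v ^ rexp \<in> Q" using k by blast
  then have "\<exists>k. chi Q v = \<zeta> ^ k \<and> \<zeta> ^ k - v ^ rexp \<in> Q" unfolding chi_def by (rule someI_ex)
  then obtain j where j: "chi Q v = \<zeta> ^ j" "\<zeta> ^ j - v ^ rexp \<in> Q" by blast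
  have "\<zeta> ^ j - v ^ rexp - (\<zeta> ^ k - v ^ rexp) \<in> Q" by (rule is_idl_diff[OF is_sub_Zz above_idl[OF Q] j(2) k])
  then have "\<zeta> ^ j - \<zeta> ^ k \<in> Q" by simp
  then show ?thesis using above_zeta_inj[OF Q] j(1) by simp
qed

lemma ex_chi:
  assumes Q: "above Q" and v: "v \<in> Zz - Q"
  shows "\<exists>k. chi Q v = \<zeta> ^ k \<and> \<zeta> ^ k - v ^ rexp \<in> Q"
proof -
  obtain k where "\<zeta> ^ k - v ^ rexp \<in> Q" using ex_residue_symbol[OF Q, of v] v by blast
  then show ?thesis using chi_eqI[OF Q] by blast
qed

lemma chi_mult:
  assumes Q: "above Q" and v: "v \<in> Zz - Q" "w \<in> Zz - Q"
  shows "chi Q (v * w) = chi Q v * chi Q w"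
proof -
  obtain j k where j: "chi Q v = \<zeta> ^ j" "\<zeta> ^ j - v ^ rexp \<in> Q" and k: "chi Q w = \<zeta> ^ k" "\<zeta> ^ k - w ^ rexp \<in> Q"
    using ex_chi[OF Q v(1)] ex_chi[OF Q v(2)] by blast
  have "v ^ rexp \<in> Zz" using v(1) by (intro Zz_power) blast
  then have "\<zeta> ^ j * \<zeta> ^ k - v ^ rexp * w ^ rexp \<in> Q"
    by (rule idl_cong_mult[OF is_sub_Zz above_idl[OF Q] j(2) k(2) Zz_zeta_pow])
  then have "\<zeta> ^ (j + k) - (v * w) ^ rexp \<in> Q" by (simp only: power_add power_mult_distrib)
  then have "chi Q (v * w) = \<zeta> ^ (j + k)" by (rule chi_eqI[OF Q])
  then show ?thesis by (simp only: j(1) k(1) power_add)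
qed

lemma chi_1: "above Q \<Longrightarrow> chi Q 1 = 1"
  using chi_eqI[of Q 0 1] is_idl_zero[OF above_idl] by simp

lemma above_compl_prod:
  assumes "above Q" "\<And>i. i \<in> A \<Longrightarrow> v i \<in> Zz - Q"
  shows "prod v A \<in> Zz - Q"
  using assms by (induction A rule: infinite_finite_induct) (simp_all add: above_one above_compl_mult del: Diff_iff, simp_all add: above_one)

lemma chi_prod:
  assumes "above Q" "\<And>i. i \<in> A \<Longrightarrow> v i \<in> Zz - Q"
  shows "chi Q (prod v A) = (\<Prod>i\<in>A. chi Q (v i))"
  using assms(2)
proof (induction A rule: infinite_finite_induct)
  case (insert i A)
  then have "chi Q (v i * prod v A) = chi Q (v i) * chi Q (prod v A)"
    by (intro chi_mult above_compl_prod assms(1)) auto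
  then show ?case using insert by simp
qed (simp_all add: chi_1[OF assms(1)])

lemma chi_cong:
  assumes Q: "above Q" and v: "v \<in> Zz - Q" "w \<in> Zz" "v - w \<in> Q"
  shows "chi Q w = chi Q v"
proof -
  obtain k where k: "chi Q v = \<zeta> ^ k" "\<zeta> ^ k - v ^ rexp \<in> Q" using ex_chi[OF Q v(1)] by blast
  have "v ^ rexp - w ^ rexp \<in> Q"
    using v by (intro idl_cong_power[OF is_sub_Zz above_idl[OF Q]]) auto
  then have "\<zeta> ^ k - w ^ rexp \<in> Q" by (rule idl_cong_trans[OF above_idl[OF Q] k(2)])
  then show ?thesis using chi_eqI[OF Q] k(1) by simp
qed

lemma chi_pow_p:
  assumes Q: "above Q" and v: "v \<in> Zz - Q"
  shows "chi Q (v ^ p) = 1"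
proof -
  have "(v ^ p) ^ rexp = v ^ (lq - 1)" using p_dvd_lq by (simp add: power_mult[symmetric])
  moreover have "v ^ (lq - 1) - 1 \<in> Q" using above_fermat[OF Q lq_cong] v by blast
  ultimately have "- ((v ^ p) ^ rexp - 1) \<in> Q" using is_idl_uminus[OF is_sub_Zz above_idl[OF Q]] by metis
  then have "\<zeta> ^ 0 - (v ^ p) ^ rexp \<in> Q" by simp
  then have "chi Q (v ^ p) = \<zeta> ^ 0" by (rule chi_eqI[OF Q])
  then show ?thesis by simp
qed

text \<open>The automorphism carries the defining congruence modulo \<open>Q\<close> to one modulo
  the conjugate prime and raises the root of unity to the power \<open>t\<close>.\<close>

lemma chi_sg:
  assumes Q: "above Q" and v: "v \<in> Zz - Q" and t: "\<not> p dvd t"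
  shows "chi (sg t ` Q) (sg t v) = chi Q v ^ t" "sg t v \<in> Zz - sg t ` Q"
proof -
  have tQ: "above (sg t ` Q)" by (rule sg_image_above[OF Q t])
  obtain k where k: "chi Q v = \<zeta> ^ k" "\<zeta> ^ k - v ^ rexp \<in> Q" using ex_chi[OF Q v] by blast
  have vZ: "v \<in> Zz" using v by blast
  have "sg t (\<zeta> ^ k - v ^ rexp) \<in> sg t ` Q" using k(2) by (rule imageI)
  moreover have "sg t (\<zeta> ^ k - v ^ rexp) = \<zeta> ^ (t * k) - sg t v ^ rexp"
    unfolding sg_diff[OF QK_Zz[OF Zz_zeta_pow] QK_power[OF QK_Zz[OF vZ]] t] sg_zeta_pow[OF t]
      sg_power[OF QK_Zz[OF vZ] t] ..
  ultimately have "\<zeta> ^ (t * k) - sg t v ^ rexp \<in> sg t ` Q" by (simp only:)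
  then have "chi (sg t ` Q) (sg t v) = \<zeta> ^ (t * k)" by (rule chi_eqI[OF tQ])
  then show "chi (sg t ` Q) (sg t v) = chi Q v ^ t" unfolding k(1) by (simp only: power_mult[symmetric] mult.commute)
  obtain s where ts: "[t * s = 1] (mod p)" using ex_inverse[OF t] by blast
  have s: "[s * t = 1] (mod p)" using ts by (subst mult.commute)
  have "sg t v \<notin> sg t ` Q"
  proof
    assume "sg t v \<in> sg t ` Q"
    then obtain z where z: "sg t v = sg t z" "z \<in> Q" by (rule imageE)
    have "v = sg s (sg t v)" by (rule sg_inverse_index[OF QK_Zz[OF vZ] s, symmetric])
    also have "\<dots> = z" unfolding z(1) by (rule sg_inverse_index[OF QK_Zz[OF above_sub[OF Q z(2)]] s])
    finally show False using z(2) v by blast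
  qed
  then show "sg t v \<in> Zz - sg t ` Q" using sg_Zz[OF vZ t] by blast
qed

lemma bij_sg_above:
  assumes t: "\<not> p dvd t"
  shows "bij_betw (\<lambda>Q. sg t ` Q) {Q. above Q} {Q. above Q}"
proof -
  obtain s where s: "[t * s = 1] (mod p)" using ex_inverse[OF t] by blast
  then have s': "[s * t = 1] (mod p)" by (simp only: mult.commute)
  have ns: "\<not> p dvd s" using cong_1_not_dvd[OF s] by blast
  show ?thesis
    by (rule bij_betw_byWitness[of _ "\<lambda>Q. sg s ` Q"])
       (use sg_image_image s s' sg_image_above t ns in auto)
qed

text \<open>Transitivity bounds the number of primes by p - 1, so this number is prime to
  \<open>p\<close>.\<close>

lemma finite_above:
  assumes Q: "above Q"
  shows "finite {Q. above Q}" "card {Q. above Q} < p" "card {Q. above Q} > 0"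
proof -
  have sub: "{Q. above Q} \<subseteq> (\<lambda>t. sg t ` Q) ` {1..<p}" using above_transitive[OF Q] by blast
  then show f: "finite {Q. above Q}" by (rule finite_subset) simp
  have "card {Q. above Q} \<le> card {1..<p}" by (rule surj_card_le[OF _ sub]) simp
  then show "card {Q. above Q} < p" using p_pos by simp
  show "card {Q. above Q} > 0" using f Q by (auto simp: card_gt_0_iff)
qed

lemma zeta_notin: "above Q \<Longrightarrow> \<zeta> ^ k \<in> Zz - Q"
proof -
  assume Q: "above Q"
  have "\<zeta> ^ k \<notin> Q"
  proof
    assume "\<zeta> ^ k \<in> Q"
    then have "(\<zeta> ^ k) ^ (p - 1) * \<zeta> ^ k \<in> Q" by (intro is_idl_mult[OF above_idl[OF Q]] Zz_power Zz_zeta_pow)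
    then have "(\<zeta> ^ k) ^ p \<in> Q" by (simp only: power_minus_mult[OF p_pos(1)])
    moreover have "(\<zeta> ^ k) ^ p = 1" by (metis power_mult mult.commute zeta_p power_one)
    ultimately show False using above_one[OF Q] by simp
  qed
  then show ?thesis by simp
qed

text \<open>If \<open>c\<close> lies in \<open>Q\<close>, the product \<open>B\<close> of the other conjugates does not, and dividing \<open>c B\<^sup>p\<close> by the
  \<open>p\<close>-th power of the norm leaves a root of unity times \<open>B\<^sup>p\<^sup>-\<^sup>1\<close>.\<close>

lemma symbol_local:
  fixes w :: nat
  assumes Q: "above Q" and d: "d > 0" and u: "u \<in> {1..<p}" and xy: "coprime x y"
    and N: "(\<Sum>i<p. (- x) ^ i * y ^ (p - 1 - i)) = int n ^ p" "n > 0"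
  defines "c \<equiv> \<zeta> ^ w * (of_int x + of_int y * \<zeta> ^ u)"
  shows "\<exists>\<eta>\<in>QK. \<eta> \<noteq> 0 \<and> c * \<eta> ^ p \<in> Zz - Q \<and>
    power_residue_symbol p \<zeta> (of_nat d ^ p * c) Q = chi Q (c * \<eta> ^ p)"
proof -
  let ?f = "\<lambda>k. of_int x + of_int y * \<zeta> ^ k"
  have fZ: "?f k \<in> Zz" for k by (intro Zz_add Zz_mult Zz_of_int Zz_zeta_pow)
  have cZ: "c \<in> Zz" unfolding c_def by (intro Zz_mult fZ Zz_zeta_pow)
  have d0: "(of_nat d :: complex) \<noteq> 0" using d by simp
  have main: "power_residue_symbol p \<zeta> (of_nat d ^ p * c) Q = chi Q (c * \<eta> ^ p)"
    if e: "\<eta> \<in> QK" "\<eta> \<noteq> 0" "c * \<eta> ^ p \<in> Zz - Q" for \<eta>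
  proof -
    obtain k where k: "chi Q (c * \<eta> ^ p) = \<zeta> ^ k" "\<zeta> ^ k - (c * \<eta> ^ p) ^ rexp \<in> Q"
      using ex_chi[OF Q e(3)] by blast
    \<comment> \<open>Dividing \<eta> by \<open>d\<close> absorbs the content d^p of the original
      coordinates.\<close>
    have eq: "of_nat d ^ p * c * (\<eta> / of_nat d) ^ p = c * \<eta> ^ p" using d0 by (simp add: power_divide)
    show ?thesis unfolding k(1)
    proof (rule power_residue_symbol_eq[OF Q, of "\<eta> / of_nat d"])
      show "\<eta> / of_nat d \<in> QK" by (intro QK_divide e QK_Zz[OF Zz_of_nat])
      show "\<eta> / of_nat d \<noteq> 0" using e(2) d0 by simp
    qed (use e(3) k(2) in \<open>simp_all only: eq Diff_iff not_False_eq_True\<close>)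
  qed
  show ?thesis
  proof (cases "c \<in> Q")
    case False
    then show ?thesis using main[of 1] cZ QK_Zz[OF Zz_1] by (intro bexI[of _ 1]) auto
  next
    case True
    define B where "B = (\<Prod>k\<in>{1..<p} - {u}. ?f k)"
    have fu: "?f u \<in> Q"
      using is_prm_mult[OF above_prm[OF Q] Zz_zeta_pow fZ, of w u] True zeta_notin[OF Q] unfolding c_def by blast
    have "?f k \<notin> Q" if "k \<in> {1..<p} - {u}" for k
    proof
      assume "?f k \<in> Q"
      then have "[u = k] (mod p)" using conjugates_inj[OF Q xy fu] by blast
      then show False using that u by (simp add: cong_def)
    qed
    then have B: "B \<in> Zz - Q" unfolding B_def using fZ by (intro above_compl_prod[OF Q]) blast
    have fB: "?f u * B = of_nat n ^ p"
    proof -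
      have "?f u * B = (\<Prod>k\<in>{1..<p}. ?f k)" unfolding B_def using u by (intro prod.remove[symmetric]) auto
      then show ?thesis unfolding norm_form_int N(1) by simp
    qed
    have n0: "(of_nat n :: complex) \<noteq> 0" using N(2) by simp
    have "p = Suc (p - 1)" using p_pos by simp
    then have "B ^ p = B * B ^ (p - 1)" by (metis power_Suc)
    then have "c * (B / of_nat n) ^ p = \<zeta> ^ w * (?f u * B) * B ^ (p - 1) / of_nat n ^ p"
      unfolding c_def by (simp add: power_divide)
    also have "\<dots> = \<zeta> ^ w * B ^ (p - 1)" unfolding fB using n0 by simp
    finally have e: "c * (B / of_nat n) ^ p = \<zeta> ^ w * B ^ (p - 1)" .
    have "B ^ m \<in> Zz - Q" for m using above_compl_prod[OF Q, of "{..<m}" "\<lambda>_. B"] B by simp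
    then have "c * (B / of_nat n) ^ p \<in> Zz - Q" unfolding e by (intro above_compl_mult[OF Q zeta_notin[OF Q]])
    moreover have "B / of_nat n \<in> QK" using B by (intro QK_divide QK_Zz[OF Zz_of_nat] QK_Zz) blast
    moreover have "B / of_nat n \<noteq> 0" using B n0 is_idl_zero[OF above_idl[OF Q]] by auto
    ultimately show ?thesis using main[of "B / of_nat n"] by blast
  qed
qed

text \<open>The symbol at the conjugate of \<open>Q\<close> by \<open>t\<close>, raised to the
  inverse of \<open>t\<close>, equals the symbol at \<open>Q\<close> of the conjugate by that
  inverse. The product of these conjugates is a \<open>p\<close>-th power by
  \<open>stickelberger_primary\<close>, so its symbol is 1.\<close>

lemma stick_symbol_relation:
  assumes Q: "above Q" and d: "d > 0" and u: "u \<in> {1..<p}" and xy: "coprime x y" "\<not> int p dvd x + y"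
    and N: "(\<Sum>i<p. (- x) ^ i * y ^ (p - 1 - i)) = int n ^ p" "n > 0"
    and w: "int p dvd int w * (x + y) + int u * y" and b: "1 \<le> b" "b \<le> p - 2"
  defines "\<alpha> \<equiv> of_nat d ^ p * (\<zeta> ^ w * (of_int x + of_int y * \<zeta> ^ u))"
  shows "(\<Prod>t\<in>stick_set p b. power_residue_symbol p \<zeta> \<alpha> (sg t ` Q) ^ inv_mod p t) = 1"
proof -
  define c where "c = \<zeta> ^ w * (of_int x + of_int y * \<zeta> ^ u)"
  let ?T = "stick_set p b"
  have T: "t \<in> {1..<p}" "\<not> p dvd t" "above (sg t ` Q)" if "t \<in> ?T" for t
  proof -
    show t: "t \<in> {1..<p}" using that by (simp add: stick_set_def)
    show n: "\<not> p dvd t" by (rule unit_index[OF t])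
    show "above (sg t ` Q)" by (rule sg_image_above[OF Q n])
  qed
  have "\<forall>t\<in>?T. \<exists>\<eta>. \<eta> \<in> QK \<and> \<eta> \<noteq> 0 \<and> c * \<eta> ^ p \<in> Zz - sg t ` Q \<and>
      power_residue_symbol p \<zeta> \<alpha> (sg t ` Q) = chi (sg t ` Q) (c * \<eta> ^ p)"
    using symbol_local[OF T(3) d u xy(1) N, of _ w] unfolding \<alpha>_def c_def by blast
  then obtain \<eta> where e: "\<And>t. t \<in> ?T \<Longrightarrow> \<eta> t \<in> QK \<and> \<eta> t \<noteq> 0 \<and> c * \<eta> t ^ p \<in> Zz - sg t ` Q \<and>
      power_residue_symbol p \<zeta> \<alpha> (sg t ` Q) = chi (sg t ` Q) (c * \<eta> t ^ p)"
    by (metis (no_types))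
  define v where "v = (\<lambda>t. sg (inv_mod p t) (c * \<eta> t ^ p))"
  have cQ: "c \<in> QK" unfolding c_def
    by (intro QK_mult QK_add QK_Zz[OF Zz_zeta_pow] QK_Zz[OF Zz_of_int])
  have v: "v t \<in> Zz - Q" "chi Q (v t) = power_residue_symbol p \<zeta> \<alpha> (sg t ` Q) ^ inv_mod p t"
    "v t = \<zeta> ^ (w * inv_mod p t) * (of_int x + of_int y * \<zeta> ^ (u * inv_mod p t)) * sg (inv_mod p t) (\<eta> t) ^ p"
    "sg (inv_mod p t) (\<eta> t) \<in> QK"
    if t: "t \<in> ?T" for t
  proof -
    let ?s = "inv_mod p t"
    have ns: "\<not> p dvd ?s" by (rule inv_mod_unit[OF T(2)[OF t]])
    have "[?s * t = 1] (mod p)" using inv_mod[OF T(2)[OF t]] by (simp add: mult.commute)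
    then have im: "sg ?s ` sg t ` Q = Q" by (rule sg_image_image[OF Q])
    have ct: "c * \<eta> t ^ p \<in> Zz - sg t ` Q" using e[OF t] by blast
    show "v t \<in> Zz - Q" "chi Q (v t) = power_residue_symbol p \<zeta> \<alpha> (sg t ` Q) ^ ?s"
      using chi_sg[OF T(3)[OF t] ct ns] e[OF t] unfolding im v_def by simp_all
    have eQ: "\<eta> t \<in> QK" using e[OF t] by blast
    show "sg ?s (\<eta> t) \<in> QK" by (rule sg_QK[OF eQ ns])
    have "sg ?s c = \<zeta> ^ (w * ?s) * (of_int x + of_int y * \<zeta> ^ (u * ?s))"
      unfolding c_def
      by (simp add: sg_mult[OF QK_Zz[OF Zz_zeta_pow] _ ns] sg_form[OF ns] sg_zeta_pow[OF ns] QK_add QK_mult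
          QK_Zz[OF Zz_of_int] QK_Zz[OF Zz_zeta_pow] mult.commute)
    then show "v t = \<zeta> ^ (w * ?s) * (of_int x + of_int y * \<zeta> ^ (u * ?s)) * sg ?s (\<eta> t) ^ p"
      unfolding v_def by (simp add: sg_mult[OF cQ QK_power[OF eQ] ns] sg_power[OF eQ ns])
  qed
  obtain \<gamma> where g: "\<gamma> \<in> Zz"
    "(\<Prod>t\<in>?T. \<zeta> ^ (w * inv_mod p t) * (of_int x + of_int y * \<zeta> ^ (u * inv_mod p t))) = \<gamma> ^ p"
    using stickelberger_primary[OF xy N b unit_index[OF u] w] by blast
  define \<delta> where "\<delta> = \<gamma> * (\<Prod>t\<in>?T. sg (inv_mod p t) (\<eta> t))"
  have vd: "prod v ?T = \<delta> ^ p"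
  proof -
    have "prod v ?T = (\<Prod>t\<in>?T. \<zeta> ^ (w * inv_mod p t) * (of_int x + of_int y * \<zeta> ^ (u * inv_mod p t)) *
        sg (inv_mod p t) (\<eta> t) ^ p)"
      by (intro prod.cong refl v(3))
    also have "\<dots> = \<delta> ^ p"
      unfolding \<delta>_def power_mult_distrib prod_power_distrib g(2)[symmetric] by (rule prod.distrib)
    finally show ?thesis .
  qed
  have vQ: "\<delta> ^ p \<in> Zz - Q" unfolding vd[symmetric] by (rule above_compl_prod[OF Q v(1)])
  have "\<delta> \<in> QK" unfolding \<delta>_def by (intro QK_mult QK_Zz[OF g(1)] QK_prod v(4))
  \<comment> \<open>The elements \<eta> may have denominators, but the \<open>p\<close>-th power of
    \<delta> is a product of elements of Z[\<zeta>], so \<delta> is integral.\<close>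
  moreover have "algebraic_int \<delta>"
  proof (rule algebraic_int_root)
    show "algebraic_int (\<delta> ^ p)" using vQ Zz_algebraic_int by blast
    show "poly (monom (1::complex) p) \<delta> = \<delta> ^ p" by (simp add: poly_monom)
    show "\<forall>i. coeff (monom (1::complex) p) i \<in> \<int>" by (simp add: coeff_monom)
    show "lead_coeff (monom (1::complex) p) = 1" by (simp add: degree_monom_eq)
    show "0 < degree (monom (1::complex) p)" using p_pos by (simp add: degree_monom_eq)
  qed
  ultimately have dZ: "\<delta> \<in> Zz" by (rule QK_algebraic_int)
  have "\<delta> \<notin> Q"
  proof
    assume "\<delta> \<in> Q"
    then have "\<delta> ^ (p - 1) * \<delta> \<in> Q" by (intro is_idl_mult[OF above_idl[OF Q]] Zz_power dZ)
    then show False using vQ by (simp only: power_minus_mult[OF p_pos(1)]) blast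
  qed
  then have "chi Q (prod v ?T) = 1" unfolding vd using dZ by (intro chi_pow_p[OF Q]) blast
  moreover have "chi Q (prod v ?T) = (\<Prod>t\<in>?T. chi Q (v t))" by (rule chi_prod[OF Q v(1)])
  moreover have "(\<Prod>t\<in>?T. chi Q (v t)) = (\<Prod>t\<in>?T. power_residue_symbol p \<zeta> \<alpha> (sg t ` Q) ^ inv_mod p t)"
    by (intro prod.cong refl v(2))
  ultimately show ?thesis by simp
qed

end

section \<open>The sum of the Stickelberger exponents\<close>

context cyclo
begin

text \<open>For fixed \<open>t\<close> the residues of b t run through all units, and the t - 1
  largest exceed p - t. The value b = p - 1, outside the range, has residue exactly p - t and is not
  counted.\<close>

lemma card_stick_index:
  assumes t: "t \<in> {1..<p}"
  shows "card {b\<in>{1..p - 2}. t \<in> stick_set p b} = t - 1"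
proof -
  have "{b\<in>{1..p - 2}. t \<in> stick_set p b} = {b\<in>{1..<p}. p - t < t * b mod p}"
  proof (intro equalityI subsetI)
    fix b assume "b \<in> {b\<in>{1..p - 2}. t \<in> stick_set p b}"
    then show "b \<in> {b\<in>{1..<p}. p - t < t * b mod p}" using p_gt2 by (auto simp: stick_set_def mult.commute)
  next
    fix b assume b: "b \<in> {b\<in>{1..<p}. p - t < t * b mod p}"
    have "b \<noteq> p - 1"
    proof
      assume bp: "b = p - 1"
      obtain s where s: "t = Suc s" using t by (cases t) auto
      obtain q where q: "p = t + q" using t le_Suc_ex[of t p] by auto
      have bs: "b = s + q" using bp q s by linarith
      have ps: "p = Suc s + q" using q s by linarith
      have "t * b = q + s * p" unfolding s bs ps by (simp only: algebra_simps mult_Suc mult_Suc_right)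
      then have "t * b mod p = q mod p" by (simp only: mod_mult_self1)
      moreover have "q < p" "p - t = q" using q s by linarith+
      ultimately show False using b by simp
    qed
    then show "b \<in> {b\<in>{1..p - 2}. t \<in> stick_set p b}" using b t by (auto simp: stick_set_def mult.commute)
  qed
  also have "card \<dots> = card {r\<in>{1..<p}. p - t < r}" (is "card ?A = card ?B")
  proof (rule bij_betw_same_card)
    have bij: "bij_betw (\<lambda>b. t * b mod p) {1..<p} {1..<p}" by (rule unit_perm[OF unit_index[OF t]])
    show "bij_betw (\<lambda>b. t * b mod p) {b\<in>{1..<p}. p - t < t * b mod p} {r\<in>{1..<p}. p - t < r}"
      unfolding bij_betw_def
    proof
      show "inj_on (\<lambda>b. t * b mod p) {b\<in>{1..<p}. p - t < t * b mod p}"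
        using bij by (auto simp: bij_betw_def intro: inj_on_subset)
      have im: "(\<lambda>b. t * b mod p) ` {1..<p} = {1..<p}" using bij by (simp only: bij_betw_def)
      have "f ` {b \<in> A. P (f b)} = {r \<in> f ` A. P r}" for f :: "nat \<Rightarrow> nat" and A P by blast
      from this[of "\<lambda>b. t * b mod p" "{1..<p}" "\<lambda>r. p - t < r"]
      show "(\<lambda>b. t * b mod p) ` ?A = ?B" unfolding im .
    qed
  qed
  also have "{r\<in>{1..<p}. p - t < r} = {p - t<..<p}" using t by auto
  also have "card \<dots> = t - 1" using t by simp
  finally show ?thesis .
qed

text \<open>By \<open>card_stick_index\<close> the sum is that of (t - 1) / t, hence p - 1 minus the
  sum of all inverses, which vanishes modulo the odd prime \<open>p\<close>.\<close>

lemma stick_index_sum: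
  "[(\<Sum>b\<in>{1..p - 2}. \<Sum>t\<in>stick_set p b. inv_mod p t) = p - 1] (mod p)"
proof -
  let ?E = "\<Sum>b\<in>{1..p - 2}. \<Sum>t\<in>stick_set p b. inv_mod p t"
  have "?E = (\<Sum>b\<in>{1..p - 2}. \<Sum>t\<in>{1..<p}. if t \<in> stick_set p b then inv_mod p t else 0)"
    by (intro sum.cong refl sum.mono_neutral_cong_left) (auto simp: stick_set_def)
  also have "\<dots> = (\<Sum>t\<in>{1..<p}. \<Sum>b\<in>{1..p - 2}. if t \<in> stick_set p b then inv_mod p t else 0)" by (rule sum.swap)
  also have "\<dots> = (\<Sum>t\<in>{1..<p}. (t - 1) * inv_mod p t)"
  proof (intro sum.cong refl)
    fix t assume t: "t \<in> {1..<p}"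
    have "(\<Sum>b\<in>{1..p - 2}. if t \<in> stick_set p b then inv_mod p t else 0) =
        (\<Sum>b\<in>{b\<in>{1..p - 2}. t \<in> stick_set p b}. inv_mod p t)"
      by (intro sum.inter_filter[symmetric]) simp
    then show "(\<Sum>b\<in>{1..p - 2}. if t \<in> stick_set p b then inv_mod p t else 0) = (t - 1) * inv_mod p t"
      by (simp only: sum_constant card_stick_index[OF t] of_nat_id)
  qed
  finally have E: "?E = (\<Sum>t\<in>{1..<p}. (t - 1) * inv_mod p t)" .
  have "(\<Sum>t\<in>{1..<p}. (t - 1) * inv_mod p t) + (\<Sum>t\<in>{1..<p}. inv_mod p t) = (\<Sum>t\<in>{1..<p}. t * inv_mod p t)"
    unfolding sum.distrib[symmetric] by (intro sum.cong refl) (auto simp: algebra_simps)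
  moreover have "[(\<Sum>t\<in>{1..<p}. t * inv_mod p t) = (\<Sum>t\<in>{1..<p}. 1)] (mod p)"
    by (intro cong_sum inv_mod unit_index)
  ultimately have 1: "[?E + (\<Sum>t\<in>{1..<p}. inv_mod p t) = p - 1] (mod p)" unfolding E by simp
  have "[(\<Sum>t\<in>{1..<p}. inv_mod p t) = (\<Sum>t\<in>{1..<p}. inv_mod p t mod p)] (mod p)"
    by (intro cong_sum) (simp add: cong_def)
  also have "(\<Sum>t\<in>{1..<p}. inv_mod p t mod p) = (\<Sum>t\<in>{1..<p}. t)"
    by (rule sum.reindex_bij_betw[OF bij_inv_mod])
  also have "\<dots> = p * ((p - 1) div 2)"
  proof -
    have "even (p - 1)" using odd_p by simp
    have "(\<Sum>t\<in>{1..<p}. t) = p * (p - 1) div 2" by (simp add: Sum_Ico_nat)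
    also have "\<dots> = p * ((p - 1) div 2)" using \<open>even (p - 1)\<close> by (simp add: div_mult_swap)
    finally show ?thesis .
  qed
  finally have "[(\<Sum>t\<in>{1..<p}. inv_mod p t) = 0] (mod p)" by (simp add: cong_def)
  then have "[?E + (\<Sum>t\<in>{1..<p}. inv_mod p t) = ?E + 0] (mod p)" by (intro cong_add cong_refl)
  from cong_trans[OF cong_sym[OF this] 1] show ?thesis by (simp only: add_0_right)
qed

lemma zeta_powi: "\<zeta> powi m = \<zeta> ^ nat (m mod int p)"
proof -
  have "\<zeta> powi m = \<zeta> powi (int p * (m div int p) + m mod int p)" by simp
  also have "\<dots> = (\<zeta> powi int p) powi (m div int p) * \<zeta> powi (m mod int p)"
    unfolding power_int_mult[symmetric] by (rule power_int_add) (simp add: zeta_ne_0)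
  also have "\<zeta> powi int p = 1" using zeta_p by simp
  also have "\<zeta> powi (m mod int p) = \<zeta> ^ nat (m mod int p)" using p_pos by (simp add: power_int_def)
  finally show ?thesis by simp
qed

end

section \<open>The symbol at \<open>l\<close> and the congruence for \<open>l\<close>\<close>

context cyclo_prime
begin

lemma symbol_nat_eq:
  "power_residue_symbol_nat p \<zeta> \<alpha> l = (\<Prod>Q\<in>{Q. above Q}. power_residue_symbol p \<zeta> \<alpha> Q)"
  unfolding power_residue_symbol_nat_def ring_of_integers_eq primeideal_sub_ring_iff[OF is_sub_Zz] above_def ..

theorem symbol_nat_eq_1:
  assumes d: "d > 0" and u: "u \<in> {1..<p}" and xy: "coprime x y" "\<not> int p dvd x + y"
    and N: "(\<Sum>i<p. (- x) ^ i * y ^ (p - 1 - i)) = int n ^ p" "n > 0"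
    and w: "int p dvd int w * (x + y) + int u * y"
  defines "\<alpha> \<equiv> of_nat d ^ p * (\<zeta> ^ w * (of_int x + of_int y * \<zeta> ^ u))"
  shows "power_residue_symbol_nat p \<zeta> \<alpha> l = 1"
proof -
  let ?S = "power_residue_symbol p \<zeta> \<alpha>"
  define V where "V = (\<Prod>Q\<in>{Q. above Q}. ?S Q)"
  have Sp: "?S Q ^ p = 1" if Q: "above Q" for Q
  proof -
    obtain \<eta> where "\<zeta> ^ w * (of_int x + of_int y * \<zeta> ^ u) * \<eta> ^ p \<in> Zz - Q"
        "?S Q = chi Q (\<zeta> ^ w * (of_int x + of_int y * \<zeta> ^ u) * \<eta> ^ p)"
      using symbol_local[OF Q d u xy(1) N, of w] unfolding \<alpha>_def by blast
    then obtain k where "?S Q = \<zeta> ^ k" using ex_chi[OF Q] by metis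
    then show ?thesis by (metis power_mult mult.commute zeta_p power_one)
  qed
  have Vp: "V ^ p = 1" unfolding V_def prod_power_distrib by (intro prod.neutral ballI Sp) simp
  \<comment> \<open>Conjugation permutes the primes above \<open>l\<close>, so in each factor
    \<open>V\<close> may be written over conjugate primes; regrouping by \<open>Q\<close> gives the
    Stickelberger relations.\<close>
  have Vb: "V ^ (\<Sum>t\<in>stick_set p b. inv_mod p t) = 1" if b: "b \<in> {1..p - 2}" for b
  proof -
    have "V ^ (\<Sum>t\<in>stick_set p b. inv_mod p t) = (\<Prod>t\<in>stick_set p b. V ^ inv_mod p t)" by (rule power_sum)
    also have "\<dots> = (\<Prod>t\<in>stick_set p b. \<Prod>Q\<in>{Q. above Q}. ?S (sg t ` Q) ^ inv_mod p t)"
    proof (intro prod.cong refl)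
      fix t assume "t \<in> stick_set p b"
      then have "\<not> p dvd t" by (intro unit_index) (simp add: stick_set_def)
      then show "V ^ inv_mod p t = (\<Prod>Q\<in>{Q. above Q}. ?S (sg t ` Q) ^ inv_mod p t)"
        unfolding V_def prod_power_distrib
        by (intro prod.reindex_bij_betw[OF bij_sg_above, symmetric])
    qed
    also have "\<dots> = (\<Prod>Q\<in>{Q. above Q}. \<Prod>t\<in>stick_set p b. ?S (sg t ` Q) ^ inv_mod p t)" by (rule prod.swap)
    also have "\<dots> = 1"
    proof (rule prod.neutral, intro ballI)
      fix Q assume "Q \<in> {Q. above Q}"
      then have "above Q" by simp
      moreover have "1 \<le> b" "b \<le> p - 2" using b by simp_all
      ultimately show "(\<Prod>t\<in>stick_set p b. ?S (sg t ` Q) ^ inv_mod p t) = 1"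
        unfolding \<alpha>_def by (rule stick_symbol_relation[OF _ d u xy N w])
    qed
    finally show ?thesis .
  qed
  have VE: "V ^ (\<Sum>b\<in>{1..p - 2}. \<Sum>t\<in>stick_set p b. inv_mod p t) = 1"
    unfolding power_sum by (intro prod.neutral ballI Vb[unfolded power_sum])
  define E where "E = (\<Sum>b\<in>{1..p - 2}. \<Sum>t\<in>stick_set p b. inv_mod p t)"
  \<comment> \<open>The total exponent is -1 modulo \<open>p\<close>, so \<open>V\<close> itself is
    trivial, being a \<open>p\<close>-th root of unity.\<close>
  have "[E + 1 = p - 1 + 1] (mod p)" unfolding E_def by (intro cong_add cong_refl stick_index_sum)
  then have "p dvd E + 1" using p_pos by (simp add: cong_def dvd_eq_mod_eq_0)
  then obtain m where "E + 1 = p * m" by (auto elim: dvdE)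
  then have "V ^ (E + 1) = 1" using Vp by (simp only: power_mult power_one)
  then have "V = 1" using VE by (simp add: E_def)
  then show ?thesis unfolding symbol_nat_eq V_def .
qed

theorem symbol_nat_divisor:
  assumes y: "int l dvd y" and x: "\<not> int l dvd x" and w: "\<not> p dvd w"
    and one: "power_residue_symbol_nat p \<zeta> (\<zeta> ^ w * (of_int x + of_int y * \<zeta> ^ u)) l = 1"
  shows "[l ^ (p - 1) = 1] (mod p ^ 2)"
proof -
  let ?a = "\<zeta> ^ w * (of_int x + of_int y * \<zeta> ^ u)"
  have aZ: "?a \<in> Zz" by (intro Zz_add Zz_mult Zz_of_int Zz_zeta_pow)
  define g where "g = card {Q. above Q}"
  define Y where "Y = (\<Prod>Q\<in>{Q. above Q}. chi Q (of_int x))"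
  have xQ: "of_int x \<in> Zz - Q" if "above Q" for Q using above_int[OF that] x by simp
  have S: "power_residue_symbol p \<zeta> ?a Q = \<zeta> ^ (w * rexp) * chi Q (of_int x)" if Q: "above Q" for Q
  proof -
    have wx: "\<zeta> ^ w * of_int x \<in> Zz - Q" by (rule above_compl_mult[OF Q zeta_notin[OF Q] xQ[OF Q]])
    have "of_int y * (\<zeta> ^ w * \<zeta> ^ u) \<in> Q"
      using above_int[OF Q] y by (intro is_idl_mult_right[OF above_idl[OF Q]] Zz_mult Zz_zeta_pow) simp
    then have "- (of_int y * (\<zeta> ^ w * \<zeta> ^ u)) \<in> Q" by (rule is_idl_uminus[OF is_sub_Zz above_idl[OF Q]])
    then have ca: "\<zeta> ^ w * of_int x - ?a \<in> Q" by (simp add: algebra_simps)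
    have "?a \<notin> Q"
    proof
      assume "?a \<in> Q"
      then have "(\<zeta> ^ w * of_int x - ?a) + ?a \<in> Q" by (rule is_idl_add[OF above_idl[OF Q] ca])
      then show False using wx by simp
    qed
    then have aQ: "?a \<in> Zz - Q" using aZ by blast
    obtain k where k: "chi Q ?a = \<zeta> ^ k" "\<zeta> ^ k - ?a ^ rexp \<in> Q" using ex_chi[OF Q aQ] by blast
    have "power_residue_symbol p \<zeta> ?a Q = \<zeta> ^ k"
      using aQ k(2) by (intro power_residue_symbol_eq[OF Q QK_Zz[OF Zz_1]]) simp_all
    also have "\<dots> = chi Q (\<zeta> ^ w * of_int x)"
      using chi_cong[OF Q wx aZ ca] k(1) by simp
    also have "\<dots> = chi Q (\<zeta> ^ w) * chi Q (of_int x)" by (rule chi_mult[OF Q zeta_notin[OF Q] xQ[OF Q]])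
    also have "chi Q (\<zeta> ^ w) = \<zeta> ^ (w * rexp)"
      by (rule chi_eqI[OF Q]) (simp add: power_mult is_idl_zero[OF above_idl[OF Q]])
    finally show ?thesis .
  qed
  \<comment> \<open>Conjugation by the index 2 fixes \<open>x\<close> and permutes the primes, while
    it squares every symbol.\<close>
  have "Y ^ 2 = Y"
  proof -
    have n2: "\<not> p dvd 2" using p_gt2 by (auto dest: dvd_imp_le)
    have "Y = (\<Prod>Q\<in>{Q. above Q}. chi (sg 2 ` Q) (of_int x))"
      unfolding Y_def by (intro prod.reindex_bij_betw[OF bij_sg_above[OF n2], symmetric])
    also have "\<dots> = (\<Prod>Q\<in>{Q. above Q}. chi Q (of_int x) ^ 2)"
      using chi_sg(1)[OF _ xQ n2] sg_of_int[OF n2] by (intro prod.cong refl) auto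
    finally show ?thesis unfolding Y_def prod_power_distrib by simp
  qed
  moreover have "chi Q (of_int x) \<noteq> 0" if "above Q" for Q using ex_chi[OF that xQ[OF that]] zeta_ne_0 by auto
  then have "Y \<noteq> 0" unfolding Y_def
    by (cases "finite {Q. above Q}") (auto simp: prod_zero_iff)
  ultimately have Y: "Y = 1" by (simp add: power2_eq_square)
  have "1 = (\<Prod>Q\<in>{Q. above Q}. \<zeta> ^ (w * rexp) * chi Q (of_int x))"
    unfolding one[symmetric] symbol_nat_eq by (intro prod.cong refl S) simp
  also have "\<dots> = (\<zeta> ^ (w * rexp)) ^ g" unfolding prod.distrib Y_def[symmetric] Y g_def by simp
  finally have "\<zeta> ^ (w * rexp * g) = 1" by (simp only: power_mult)
  then have "p dvd w * rexp * g" by (simp only: zeta_pow_1_iff)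
  moreover obtain Q where Q: "above Q" using ex_above by blast
  \<comment> \<open>The same root of unity occurs once for each prime above \<open>l\<close>, and
    their number is positive and below \<open>p\<close>.\<close>
  have "\<not> p dvd g" using finite_above(2,3)[OF Q] unfolding g_def by (auto dest: dvd_imp_le)
  ultimately have "p dvd rexp" using w p_prime by (simp add: prime_dvd_mult_iff)
  then have "p * p dvd p * rexp" by simp
  also have "p * rexp = lq - 1" using p_dvd_lq by simp
  finally have "p ^ 2 dvd lq - 1" by (simp add: power2_eq_square)
  moreover have "1 \<le> lq" using lq_pos by linarith
  ultimately have c: "[lq = 1] (mod p ^ 2)" using cong_altdef_nat[of 1 lq "p ^ 2"] by blast
  \<comment> \<open>The congruence holds for \<open>l\<close> raised to its order modulo
    \<open>p\<close>, and that order divides p - 1.\<close>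
  have "ord p l dvd p - 1" using l_pow_p by (simp only: ord_divides)
  then obtain m where m: "p - 1 = ord p l * m" by (auto elim: dvdE)
  have "[lq ^ m = 1 ^ m] (mod p ^ 2)" by (rule cong_pow[OF c])
  then show ?thesis unfolding m by (simp add: power_mult)
qed

end

lemma cyclo_primitive_root:
  assumes "prime p" "p > 2" "primitive_root_of_unity p \<zeta>"
  shows "cyclo p \<zeta>"
proof
  show "\<zeta> ^ p = 1" using assms by (simp add: primitive_root_of_unity_def)
  have "\<zeta> ^ 1 \<noteq> 1" using assms unfolding primitive_root_of_unity_def by (metis One_nat_def less_one less_trans one_less_numeral_iff prime_gt_1_nat semiring_norm(76) zero_less_one)
  then show "\<zeta> \<noteq> 1" by simp
qed (use assms in auto)

theorem theorem3p20:
  fixes p l :: nat and x y :: int and \<zeta> :: complex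
  assumes "prime p" and "p > 2"
    and "primitive_root_of_unity p \<zeta>"
    and "prime l" and "l \<noteq> p"
    and "pseudo_unit p \<zeta> (of_int x + of_int y * \<zeta>)"
  shows "power_residue_symbol_nat p \<zeta>
           (\<zeta> powi x * of_int y + \<zeta> powi (- y) * of_int x) l = 1 \<and>
         (\<forall>z::int.
            int l dvd y \<and> \<not> int p dvd y \<and>
            x \<noteq> 0 \<and> y \<noteq> 0 \<and> z \<noteq> 0 \<and>
            coprime x y \<and> coprime y z \<and> coprime x z \<and>
            x ^ p + y ^ p + z ^ p = 0 \<longrightarrow>
            [l ^ (p - 1) = 1] (mod p ^ 2))"
proof -
  interpret cyclo p \<zeta> by (rule cyclo_primitive_root) (use assms in auto)
  interpret cyclo_prime p \<zeta> l by unfold_locales (rule assms(4), rule assms(5))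
  let ?a = "\<zeta> powi x * of_int y + \<zeta> powi (- y) * of_int x"
  obtain d n x' y' where d: "d > 0" "n > 0" "x = int d ^ p * x'" "y = int d ^ p * y'" "coprime x' y'"
    and N: "\<not> int p dvd x' + y'" "(\<Sum>i<p. (- x') ^ i * y' ^ (p - 1 - i)) = int n ^ p"
    using pseudo_unit_data[OF assms(6)] by blast
  \<comment> \<open>Factoring out \<zeta>^(-y) leaves x + y \<zeta>^(x+y). So \<open>u\<close> and
    \<open>w\<close> are the residues of x + y and -y, for which w (x + y) + u y vanishes: the given
    twist is the primary one.\<close>
  define u where "u = nat ((x + y) mod int p)"
  define w where "w = nat (- y mod int p)"
  have u: "int u = (x + y) mod int p" and w: "int w = - y mod int p" using p_pos by (simp_all add: u_def w_def)
  have pxy: "\<not> int p dvd x + y" by (rule pseudo_unit_not_dvd[OF assms(6)])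
  then have "0 < int u" "int u < int p" unfolding u using p_pos by (simp_all add: dvd_eq_mod_eq_0 order.not_eq_order_implies_strict)
  then have up: "u \<in> {1..<p}" by auto
  have a: "?a = \<zeta> ^ w * (of_int x + of_int y * \<zeta> ^ u)"
  proof -
    have "\<zeta> powi x = \<zeta> powi (- y + (x + y))" by simp
    also have "\<dots> = \<zeta> powi (- y) * \<zeta> powi (x + y)" using zeta_ne_0 by (intro power_int_add) simp
    finally have "\<zeta> powi x = \<zeta> ^ w * \<zeta> ^ u" unfolding zeta_powi[of "- y"] zeta_powi[of "x + y"] u_def w_def .
    then show ?thesis unfolding zeta_powi[of "- y"] w_def[symmetric] by (simp add: algebra_simps)
  qed
  have a': "?a = of_nat d ^ p * (\<zeta> ^ w * (of_int x' + of_int y' * \<zeta> ^ u))"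
    unfolding a by (simp add: d(3,4) algebra_simps)
  \<comment> \<open>The exponents come from the original coordinates and the form from the reduced
    ones; the two terms still cancel because both pairs are proportional.\<close>
  have "[int w * (x' + y') + int u * y' = (- y) * (x' + y') + (x + y) * y'] (mod int p)"
    unfolding u w by (intro cong_add cong_mult cong_refl) (simp_all add: cong_def)
  also have "(- y) * (x' + y') + (x + y) * y' = 0" unfolding d(3,4) by (simp add: algebra_simps)
  finally have wu: "int p dvd int w * (x' + y') + int u * y'" by (simp only: cong_0_iff)
  have 1: "power_residue_symbol_nat p \<zeta> ?a l = 1"
    unfolding a' by (rule symbol_nat_eq_1[OF d(1) up d(5) N d(2) wu])
  moreover have "[l ^ (p - 1) = 1] (mod p ^ 2)" if "int l dvd y" "\<not> int p dvd y" "coprime x y"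
  proof (rule symbol_nat_divisor[OF that(1) _ _ 1[unfolded a]])
    show "\<not> int l dvd x"
    proof
      assume "int l dvd x"
      then have "int l dvd 1" using that(1,3) by (meson coprime_common_divisor)
      then show False using prime_gt_1_nat[OF l_prime] by simp
    qed
    show "\<not> p dvd w"
    proof
      assume "p dvd w"
      then have "int p dvd - y mod int p" unfolding w[symmetric] by (simp only: int_dvd_int_iff)
      then have "int p dvd - y" by (simp only: dvd_mod_iff dvd_refl)
      then show False using that(2) by simp
    qed
  qed
  ultimately show ?thesis by blast
qed

end
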